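(* There exist constants $c>0$ and $C>0$ (independent of $\nu,\mu,\eta$, of the initial data, and of $k,t$) such that the following holds. Let $0<\nu=\mu\le\eta\le 1$ and let $(w,j,\theta)$ be the solution on $\Omega=\mathbb{T}\times\mathbb{R}$ of the linear system $$\begin{cases}\partial_t w+y\partial_x w-\partial_x j-\nu\Delta w-\partial_x\theta=0,\\ \partial_t j+y\partial_x j-\partial_x w-\mu\Delta j-2\partial_x b^1=0,\\ \partial_t\theta+y\partial_x\theta-\eta\Delta\theta=0,\end{cases}\qquad \mathbf{b}=(b^1,b^2)=-\nabla^{\perp}(-\Delta)^{-1}j,$$ with initial data $(w(0),j(0),\theta(0))$. Then for every $k\in\mathbb{Z}$ and $t>0$, $$\|\theta_k(t)\|_{L^2_y}\le C\|\theta_k(0)\|_{L^2_y}\,e^{-c\,\eta^{1/3}|k|^{2/3}t},$$ $$\|(w_k(t),j_k(t))\|_{L^2_y}\le C\Big(\nu^{-2}\|(w_k(0),j_k(0))\|_{L^2_y}+\nu^{-6}(\nu^{-1}|k|)^{1/3}\|\theta_k(0)\|_{L^2_y}\Big)e^{-c\,\nu^{13/3}|k|^{2/3}t}.$$ Moreover, for every integer $N>0$ there exist constants $c_N>0$ and $C_N>0$ (depending only on $N$) such that, for all such $\nu=\mu,\eta$ and $(w,j,\theta)$ and for every $k\in\mathbb{Z}$ and $t>0$, $$\|D_y^N\theta_k(t)\|_{L^2_y}\le C_N e^{-c_N\eta^{1/3}|k|^{2/3}t}\Big(\|D_y^N\theta_k(0)\|_{L^2_y}+(\eta^{-1}|k|)^{N/3}\|\theta_k(0)\|_{L^2_y}\Big),$$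 $$\begin{aligned}\|(D_y^Nw_k(t),D_y^Nj_k(t))\|_{L^2_y}\le C_N e^{-c_N\nu^{13/3}|k|^{2/3}t}\Big(&\nu^{-2}\|(D_y^Nw_k(0),D_y^Nj_k(0))\|_{L^2_y}+\nu^{-6}(\nu^{-1}|k|)^{1/3}\|D_y^N\theta_k(0)\|_{L^2_y}\\&+\nu^{-6N}(\nu^{-1}|k|)^{N/3}\big(\nu^{-2}\|(w_k(0),j_k(0))\|_{L^2_y}+\nu^{-6}(\nu^{-1}|k|)^{1/3}\|\theta_k(0)\|_{L^2_y}\big)\Big).\end{aligned}$$
   Context: The spatial domain is $\Omega=\mathbb{T}\times\mathbb{R}$ with $\mathbb{T}=[0,2\pi]$ periodic in $x$, and $y\in\mathbb{R}$. For $f=f(x,y)$ and $k\in\mathbb{Z}$, $f_k(y):=\frac1{2\pi}\int_{\mathbb{T}}f(x,y)e^{-ikx}\,dx$. $D_y=-i\partial_y$. For a pair, $\|(f,g)\|_X=\sqrt{\|f\|_X^2+\|g\|_X^2}$. Here $\nabla^\perp=(-\partial_y,\partial_x)$, so $b^1=\partial_y(-\Delta)^{-1}j$ and $b^2=-\partial_x(-\Delta)^{-1}j$. Thus $\partial_xb^1=\partial_x\partial_y(-\Delta)^{-1}j$, which has zero $k=0$ mode. The system is the vorticity/current-density form of the 2D Boussinesq-MHD equations linearized around the Couette flow $\mathbf{u}_{sh}=(y,0)$, $\mathbf{b}_{sh}=(1,0)$, $p_{sh}=0$, $\theta_{sh}=0$. The unknowns are the perturbed vorticity $w$, current density $j$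 and temperature $\theta$. The constants $\nu,\mu,\eta$ are the viscosity, magnetic diffusivity and thermal diffusivity. *)

theory Defs
  imports "HOL-Analysis.Analysis"
begin

section \<open>Square-integrable functions, Fourier modes, weak derivatives\<close>

text \<open>
  Functions on \<open>\<Omega> = \<bbbT> \<times> \<real>\<close> are curried functions of \<open>x\<close> and \<open>y\<close> on the
  whole plane that are \<open>2\<pi>\<close>-periodic in \<open>x\<close>; time-dependent ones take \<open>t\<close> first.
\<close>

definition torus :: "real measure" where
  "torus = restrict_space lborel {0..2 * pi}"

definition Omega :: "(real \<times> real) measure" where
  "Omega = torus \<Otimes>\<^sub>M lborel"

definition L2 :: "'a measure \<Rightarrow> ('a \<Rightarrow> 'b::{banach, second_countable_topology}) \<Rightarrow> bool" where
  "L2 M f \<longleftrightarrow> f \<in> borel_measurable M \<and> integrable M (\<lambda>z. (norm (f z))\<^sup>2)"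

text \<open>Meaningful for \<open>f\<close> with \<open>L2 M f\<close> only: the Bochner integral of a non-integrable
  function is \<open>0\<close>.\<close>

definition L2norm :: "'a measure \<Rightarrow> ('a \<Rightarrow> 'b::{banach, second_countable_topology}) \<Rightarrow> real" where
  "L2norm M f = sqrt (\<integral>z. (norm (f z))\<^sup>2 \<partial>M)"

definition L2norm_pair ::
  "'a measure \<Rightarrow> ('a \<Rightarrow> 'b::{banach, second_countable_topology}) \<Rightarrow> ('a \<Rightarrow> 'b) \<Rightarrow> real" where
  "L2norm_pair M f g = sqrt ((L2norm M f)\<^sup>2 + (L2norm M g)\<^sup>2)"

definition mode :: "int \<Rightarrow> (real \<Rightarrow> real \<Rightarrow> real) \<Rightarrow> real \<Rightarrow> complex" where
  "mode k f y = 1 / (2 * pi) * (\<integral>x. f x y * exp (- \<i> * of_int k * of_real x) \<partial>torus)"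

definition test_function :: "(real \<Rightarrow> real) \<Rightarrow> bool" where
  "test_function \<phi> \<longleftrightarrow>
     (\<forall>n x. (deriv ^^ n) \<phi> differentiable (at x)) \<and> compact (closure {x. \<phi> x \<noteq> 0})"

text \<open>
  \<open>has_Dy N f g\<close>: \<open>f\<close> and \<open>g\<close> are square-integrable and \<open>g = D\<^sub>y\<^sup>N f\<close> in the sense of
  distributions, where \<open>D\<^sub>y = - \<i> \<partial>\<^sub>y\<close>. The factor is \<open>(- \<i>)\<^sup>N (- 1)\<^sup>N = \<i>\<^sup>N\<close>. Such a
  \<open>g\<close> is unique up to null sets, and agrees with the classical derivative when that
  exists, is continuous and is square-integrable.
\<close>

definition has_Dy :: "nat \<Rightarrow> (real \<Rightarrow> complex) \<Rightarrow> (real \<Rightarrow> complex) \<Rightarrow> bool" where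
  "has_Dy N f g \<longleftrightarrow> L2 lborel f \<and> L2 lborel g \<and>
     (\<forall>\<phi>. test_function \<phi> \<longrightarrow>
        (\<integral>y. g y * of_real (\<phi> y) \<partial>lborel) =
        \<i> ^ N * (\<integral>y. f y * of_real ((deriv ^^ N) \<phi> y) \<partial>lborel))"


section \<open>Differential operators in space\<close>

definition dx :: "(real \<Rightarrow> real \<Rightarrow> real) \<Rightarrow> real \<Rightarrow> real \<Rightarrow> real" where
  "dx f x y = deriv (\<lambda>x'. f x' y) x"

definition dy :: "(real \<Rightarrow> real \<Rightarrow> real) \<Rightarrow> real \<Rightarrow> real \<Rightarrow> real" where
  "dy f x y = deriv (\<lambda>y'. f x y') y"

definition laplacian :: "(real \<Rightarrow> real \<Rightarrow> real) \<Rightarrow> real \<Rightarrow> real \<Rightarrow> real" where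
  "laplacian f x y = dx (dx f) x y + dy (dy f) x y"

definition perp_grad :: "(real \<Rightarrow> real \<Rightarrow> real) \<Rightarrow> real \<Rightarrow> real \<Rightarrow> real \<times> real" where
  "perp_grad f x y = (- dy f x y, dx f x y)"

definition periodic_x :: "(real \<Rightarrow> real \<Rightarrow> real) \<Rightarrow> bool" where
  "periodic_x f \<longleftrightarrow> (\<forall>x y. f (x + 2 * pi) y = f x y)"

definition C1_plane :: "(real \<Rightarrow> real \<Rightarrow> real) \<Rightarrow> bool" where
  "C1_plane f \<longleftrightarrow>
     (\<forall>x y. (\<lambda>x'. f x' y) differentiable (at x) \<and> (\<lambda>y'. f x y') differentiable (at y)) \<and>
     continuous_on UNIV (\<lambda>(x, y). dx f x y) \<and> continuous_on UNIV (\<lambda>(x, y). dy f x y)"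

definition C2_plane :: "(real \<Rightarrow> real \<Rightarrow> real) \<Rightarrow> bool" where
  "C2_plane f \<longleftrightarrow> C1_plane f \<and> C1_plane (dx f) \<and> C1_plane (dy f)"

text \<open>
  \<open>inv_neg_laplacian f \<psi>\<close>: \<open>\<psi> = (-\<Delta>)\<^sup>-\<^sup>1 f\<close>. On the mode \<open>k \<noteq> 0\<close>, square-integrability
  singles out the solution of \<open>(k\<^sup>2 - \<partial>\<^sub>y\<^sup>2) \<psi>\<^sub>k = f\<^sub>k\<close>. The mode \<open>k = 0\<close> is determined
  only up to an affine function of \<open>y\<close>, so that \<open>\<partial>\<^sub>y \<psi>\<close> is determined up to a constant
  and \<open>\<partial>\<^sub>x \<partial>\<^sub>y \<psi>\<close>, the only quantity entering the equations, is unique.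
\<close>

definition inv_neg_laplacian :: "(real \<Rightarrow> real \<Rightarrow> real) \<Rightarrow> (real \<Rightarrow> real \<Rightarrow> real) \<Rightarrow> bool" where
  "inv_neg_laplacian f \<psi> \<longleftrightarrow> periodic_x \<psi> \<and> C2_plane \<psi> \<and>
     (\<forall>x y. - laplacian \<psi> x y = f x y) \<and> (\<forall>k. k \<noteq> 0 \<longrightarrow> L2 lborel (mode k \<psi>))"

definition magnetic_field ::
  "(real \<Rightarrow> real \<Rightarrow> real) \<Rightarrow> (real \<Rightarrow> real \<Rightarrow> real \<times> real) \<Rightarrow> bool" where
  "magnetic_field j b \<longleftrightarrow>
     (\<exists>\<psi>. inv_neg_laplacian j \<psi> \<and> (\<forall>x y. b x y = - perp_grad \<psi> x y))"


section \<open>Solutions of the linearized system\<close>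

text \<open>
  Solutions are classical for \<open>t > 0\<close> and attain their initial data in \<open>L\<^sup>2(\<Omega>)\<close>.
  By parabolic smoothing this covers arbitrary initial data in \<open>L\<^sup>2(\<Omega>)\<close>.
\<close>

definition L2_continuous :: "(real \<Rightarrow> real \<Rightarrow> real \<Rightarrow> real) \<Rightarrow> bool" where
  "L2_continuous u \<longleftrightarrow>
     (\<forall>t\<ge>0. L2 Omega (\<lambda>(x, y). u t x y)) \<and>
     (\<forall>t\<ge>0. ((\<lambda>s. L2norm Omega (\<lambda>(x, y). u s x y - u t x y)) \<longlongrightarrow> 0) (at t within {0..}))"

definition dt :: "(real \<Rightarrow> real \<Rightarrow> real \<Rightarrow> real) \<Rightarrow> real \<Rightarrow> real \<Rightarrow> real \<Rightarrow> real" where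
  "dt u t x y = deriv (\<lambda>s. u s x y) t"

definition regular :: "(real \<Rightarrow> real \<Rightarrow> real \<Rightarrow> real) \<Rightarrow> bool" where
  "regular u \<longleftrightarrow>
     (\<forall>t\<ge>0. periodic_x (u t)) \<and> L2_continuous u \<and>
     (\<forall>t>0. C2_plane (u t)) \<and>
     (\<forall>t>0. \<forall>x y. (\<lambda>s. u s x y) differentiable (at t)) \<and>
     continuous_on ({0<..} \<times> UNIV) (\<lambda>(t, x, y). dt u t x y)"

definition solution ::
  "real \<Rightarrow> real \<Rightarrow> real \<Rightarrow> (real \<Rightarrow> real \<Rightarrow> real \<Rightarrow> real) \<Rightarrow>
   (real \<Rightarrow> real \<Rightarrow> real \<Rightarrow> real) \<Rightarrow> (real \<Rightarrow> real \<Rightarrow> real \<Rightarrow> real) \<Rightarrow> bool" where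
  "solution \<nu> \<mu> \<eta> w j \<theta> \<longleftrightarrow>
     regular w \<and> regular j \<and> regular \<theta> \<and>
     (\<exists>b. \<forall>t>0. magnetic_field (j t) (b t) \<and>
        (\<forall>x y.
           dt w t x y + y * dx (w t) x y - dx (j t) x y
             - \<nu> * laplacian (w t) x y - dx (\<theta> t) x y = 0 \<and>
           dt j t x y + y * dx (j t) x y - dx (w t) x y
             - \<mu> * laplacian (j t) x y - 2 * dx (\<lambda>x y. fst (b t x y)) x y = 0 \<and>
           dt \<theta> t x y + y * dx (\<theta> t) x y - \<eta> * laplacian (\<theta> t) x y = 0))"

end

theory Submission
  imports Defs "HOL-Probability.Characteristic_Functions" "HOL-Computational_Algebra.Polynomial"
begin

text \<open>
  On the mode \<open>k\<close>, the Fourier transform in \<open>y\<close> followed along the characteristics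
  \<open>\<xi> - k t\<close> of the shear turns the system into a family of ordinary differential equations
  in \<open>t\<close>, one for each frequency \<open>\<xi>\<close>. With \<open>p = k\<^sup>2 + (\<xi> - k t)\<^sup>2\<close>, the temperature decays like
  \<open>exp (- \<eta> \<integral> p)\<close>, and \<open>\<integral>\<^sub>0\<^sup>t p \<ge> k\<^sup>2 t\<^sup>3 / 12\<close> gives the enhanced dissipation rate. In the pair
  \<open>(w, j)\<close> the coupling \<open>\<i> k\<close> cancels in the energy, and the nonlocal term contributes the growth rate
  \<open>p' / p\<close> to \<open>j\<close>; this exceeds the viscous damping on a bounded range of
  \<open>t - \<xi> / k\<close> only, which costs a factor \<open>O(\<nu>\<^sup>-\<^sup>2)\<close>, while damping at the rate \<open>\<nu> k\<^sup>2\<close>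
  survives. Since \<open>k\<close> is an integer and \<open>\<nu> \<le> 1\<close>, this dominates the rate \<open>\<nu>\<^sup>1\<^sup>3\<^sup>/\<^sup>3 \<bar>k\<bar>\<^sup>2\<^sup>/\<^sup>3\<close>. Derivatives
  are weights: \<open>\<bar>\<xi> - k t\<bar>\<^sup>N \<le> 2\<^sup>N (\<bar>\<xi>\<bar>\<^sup>N + \<bar>k t\<bar>\<^sup>N)\<close>, and the powers of \<open>k t\<close> are absorbed by half of the decay.

  As the solutions are classical without any assumed decay of derivatives at infinity, the
  equations are first multiplied by a compactly supported window of width \<open>n\<close>. The commutators are
  \<open>O(n\<^sup>-\<^sup>1\<^sup>/\<^sup>2)\<close> for each fixed frequency, and the estimates pass to the limit almost everywhere
  along a subsequence, by Plancherel's theorem.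
\<close>

section \<open>Square-integrable functions\<close>

text \<open>The obstacle is that \<open>regular\<close> controls no derivative at infinity, so the
  equations, and even \<open>y * U\<close>, have no Fourier transform as they stand. Once the window
  is in place every derivative is moved onto it, and the errors involve only the L2 norm of the
  solution itself. The stream function is given separately at each time; its norm is bounded by that
  of \<open>j\<close>, which keeps its errors uniform in time. Existence of the derivatives at time
  t is part of the claim, so weak derivatives are characterised in both directions by the weight
  \<xi>^N. The forcing by \<theta> is paid for by adding 4/\<nu>^2 times the energy of \<theta> to
  that of \<open>(w, j)\<close>. For k \<noteq> 0 the norms are shown to decay like exp(-\<nu> k^2 t
  / 8), with factors of order \<nu>^-2 on the data of \<open>(w, j)\<close> and \<nu>^-3 on those of
  \<theta>. Half of this rate yields c = 1/16, the other half absorbs the powers of k t. The mode k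
  = 0 is separate: there \<open>w\<close> and \<open>j\<close> solve two uncoupled heat equations
  and every stated exponential equals 1.\<close>

lemma L2D:
  assumes "L2 M f"
  shows "f \<in> borel_measurable M" "integrable M (\<lambda>z. (norm (f z))\<^sup>2)"
  using assms by (auto simp: L2_def)

lemma L2norm_nonneg [simp]: "0 \<le> L2norm M f"
  by (simp add: L2norm_def)

lemma L2norm_power2: "(L2norm M f)\<^sup>2 = (\<integral>z. (norm (f z))\<^sup>2 \<partial>M)"
  by (simp add: L2norm_def)

lemma L2_zero [simp]: "L2 M (\<lambda>x. 0)"
  by (simp add: L2_def)

lemma L2norm_zero [simp]: "L2norm M (\<lambda>x. 0) = 0"
  by (simp add: L2norm_def)

lemma
  assumes g: "L2 M g" and f: "f \<in> borel_measurable M"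
    and le: "AE x in M. norm (f x) \<le> norm (g x)"
  shows L2_bound: "L2 M f" and L2norm_mono: "L2norm M f \<le> L2norm M g"
proof -
  note [measurable] = f L2D(1)[OF g]
  have le2: "AE x in M. (norm (f x))\<^sup>2 \<le> (norm (g x))\<^sup>2"
    using le by eventually_elim (simp add: power_mono)
  have int: "integrable M (\<lambda>z. (norm (f z))\<^sup>2)"
  proof (rule Bochner_Integration.integrable_bound[OF L2D(2)[OF g]])
    show "AE x in M. norm ((norm (f x))\<^sup>2) \<le> norm ((norm (g x))\<^sup>2)"
      using le2 by eventually_elim simp
  qed measurable
  then show "L2 M f" using f by (simp add: L2_def)
  show "L2norm M f \<le> L2norm M g"
    unfolding L2norm_def
    by (intro real_sqrt_le_mono integral_mono_AE int L2D(2)[OF g] le2)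
qed

text \<open>Meant for majorants known through their squares, such as the slice norms in
  \<open>mode_L2\<close>, where Fubini yields integrability of \<open>(g x)\<^sup>2\<close>.\<close>

lemma L2_of_norm_bound:
  fixes g :: "'a \<Rightarrow> real"
  assumes "integrable M (\<lambda>x. (g x)\<^sup>2)" "f \<in> borel_measurable M" "AE x in M. norm (f x) \<le> g x"
  shows "L2 M f" "(L2norm M f)\<^sup>2 \<le> (\<integral>x. (g x)\<^sup>2 \<partial>M)"
proof -
  have le2: "AE x in M. (norm (f x))\<^sup>2 \<le> (g x)\<^sup>2"
    using assms(3) by eventually_elim (simp add: power_mono)
  have int: "integrable M (\<lambda>z. (norm (f z))\<^sup>2)"
  proof (rule Bochner_Integration.integrable_bound[OF assms(1)])
    show "AE x in M. norm ((norm (f x))\<^sup>2) \<le> norm ((g x)\<^sup>2)"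
      using le2 by eventually_elim simp
  qed (use assms(2) in measurable)
  then show "L2 M f" using assms(2) by (simp add: L2_def)
  show "(L2norm M f)\<^sup>2 \<le> (\<integral>x. (g x)\<^sup>2 \<partial>M)"
    unfolding L2norm_power2
    by (intro integral_mono_AE int assms(1) le2)
qed

lemma L2norm_AE_eq:
  assumes f: "f \<in> borel_measurable M" and g: "L2 M g" and eq: "AE x in M. f x = g x"
  shows "L2norm M f = L2norm M g"
proof -
  have L: "L2 M f"
    by (rule L2_bound[OF g f]) (use eq in \<open>eventually_elim, simp\<close>)
  show "L2norm M f = L2norm M g"
    by (intro antisym L2norm_mono g L f L2D(1)[OF g]) (use eq in \<open>eventually_elim, simp\<close>)+
qed

lemma L2_cmult:
  fixes f :: "'a \<Rightarrow> 'b::{real_normed_field, banach, second_countable_topology}"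
  shows "L2 M f \<Longrightarrow> L2 M (\<lambda>x. c * f x)"
  by (auto simp: L2_def norm_mult power_mult_distrib)

lemma L2_add:
  assumes f: "L2 M f" and g: "L2 M g"
  shows "L2 M (\<lambda>x. f x + g x)"
proof -
  note [measurable] = L2D(1)[OF f] L2D(1)[OF g]
  have "integrable M (\<lambda>x. 2 * (norm (f x))\<^sup>2 + 2 * (norm (g x))\<^sup>2)"
    using L2D(2)[OF f] L2D(2)[OF g] by auto
  then have "integrable M (\<lambda>x. (norm (f x + g x))\<^sup>2)"
  proof (rule Bochner_Integration.integrable_bound)
    show "AE x in M. norm ((norm (f x + g x))\<^sup>2) \<le> norm (2 * (norm (f x))\<^sup>2 + 2 * (norm (g x))\<^sup>2)"
    proof (rule AE_I2)
      fix x
      have "(norm (f x + g x))\<^sup>2 \<le> (norm (f x) + norm (g x))\<^sup>2"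
        by (intro power_mono norm_triangle_ineq) simp
      also have "\<dots> \<le> 2 * (norm (f x))\<^sup>2 + 2 * (norm (g x))\<^sup>2"
        using sum_squares_bound[of "norm (f x)" "norm (g x)"] by (simp add: power2_sum)
      finally show "norm ((norm (f x + g x))\<^sup>2) \<le> norm (2 * (norm (f x))\<^sup>2 + 2 * (norm (g x))\<^sup>2)"
        by simp
    qed
  qed measurable
  then show ?thesis by (simp add: L2_def)
qed

lemma L2_uminus: "L2 M f \<Longrightarrow> L2 M (\<lambda>x. - f x)"
  by (auto simp: L2_def)

lemma L2_diff:
  assumes f: "L2 M f" and g: "L2 M g"
  shows "L2 M (\<lambda>x. f x - g x)"
  using L2_add[OF f L2_uminus[OF g]] by simp

lemma L2_mult_norm_integrable:
  assumes f: "L2 M f" and g: "L2 M g"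
  shows "integrable M (\<lambda>x. norm (f x) * norm (g x))"
proof -
  note [measurable] = L2D(1)[OF f] L2D(1)[OF g]
  have "integrable M (\<lambda>x. (norm (f x))\<^sup>2 + (norm (g x))\<^sup>2)"
    using L2D(2)[OF f] L2D(2)[OF g] by auto
  then show ?thesis
  proof (rule Bochner_Integration.integrable_bound)
    show "AE x in M. norm (norm (f x) * norm (g x)) \<le> norm ((norm (f x))\<^sup>2 + (norm (g x))\<^sup>2)"
    proof (rule AE_I2)
      fix x
      have "0 \<le> norm (f x) * norm (g x)" by simp
      then show "norm (norm (f x) * norm (g x)) \<le> norm ((norm (f x))\<^sup>2 + (norm (g x))\<^sup>2)"
        using sum_squares_bound[of "norm (f x)" "norm (g x)"] unfolding real_norm_def by linarith
    qed
  qed measurable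
qed

text \<open>Integrating \<open>0 \<le> (norm (f x) - s * norm (g x))\<^sup>2\<close> gives
  \<open>quad\<close> for every real s. The optimal s is the quotient of the two norms; when one of
  the norms is 0, another choice of s contradicts a positive integral.\<close>

lemma L2_Cauchy_Schwarz:
  assumes f: "L2 M f" and g: "L2 M g"
  shows "(\<integral>x. norm (f x) * norm (g x) \<partial>M) \<le> L2norm M f * L2norm M g"
proof -
  let ?I = "\<integral>x. norm (f x) * norm (g x) \<partial>M"
  let ?F = "L2norm M f" let ?G = "L2norm M g"
  have quad: "2 * s * ?I \<le> ?F\<^sup>2 + s\<^sup>2 * ?G\<^sup>2" for s :: real
  proof -
    have "2 * s * ?I = (\<integral>x. 2 * s * (norm (f x) * norm (g x)) \<partial>M)" by simp
    also have "\<dots> \<le> (\<integral>x. (norm (f x))\<^sup>2 + s\<^sup>2 * (norm (g x))\<^sup>2 \<partial>M)"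
    proof (rule integral_mono)
      show "integrable M (\<lambda>x. 2 * s * (norm (f x) * norm (g x)))"
        using L2_mult_norm_integrable[OF f g] by simp
      show "integrable M (\<lambda>x. (norm (f x))\<^sup>2 + s\<^sup>2 * (norm (g x))\<^sup>2)"
        using L2D(2)[OF f] L2D(2)[OF g] by simp
      show "2 * s * (norm (f x) * norm (g x)) \<le> (norm (f x))\<^sup>2 + s\<^sup>2 * (norm (g x))\<^sup>2" for x
        using sum_squares_bound[of "norm (f x)" "s * norm (g x)"]
        by (simp add: power_mult_distrib algebra_simps)
    qed
    also have "\<dots> = ?F\<^sup>2 + s\<^sup>2 * ?G\<^sup>2"
      using L2D(2)[OF f] L2D(2)[OF g] by (simp add: L2norm_power2)
    finally show ?thesis .
  qed
  show ?thesis
  proof (cases "?G = 0")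
    case True
    show ?thesis
    proof (rule ccontr)
      assume "\<not> ?thesis"
      then have I: "?I > 0" using True by simp
      have "2 * ((?F\<^sup>2 + 1) / (2 * ?I)) * ?I \<le> ?F\<^sup>2"
        using quad[of "(?F\<^sup>2 + 1) / (2 * ?I)"] True by simp
      then show False using I by simp
    qed
  next
    case False
    then have G: "?G > 0" using L2norm_nonneg[of M g] by linarith
    have "2 * (?F / ?G) * ?I \<le> 2 * ?F\<^sup>2"
      using quad[of "?F / ?G"] False by (simp add: power_divide)
    then have *: "?F * ?I \<le> ?F * (?F * ?G)" using G by (simp add: field_simps power2_eq_square)
    show ?thesis
    proof (cases "?F = 0")
      case True
      show ?thesis
      proof (rule ccontr)
        assume "\<not> ?thesis"
        then have I: "?I > 0" using True by simp
        have "2 * (?I / ?G\<^sup>2) * ?I \<le> (?I / ?G\<^sup>2)\<^sup>2 * ?G\<^sup>2" using quad[of "?I / ?G\<^sup>2"] True by simp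
        also have "\<dots> = ?I\<^sup>2 / ?G\<^sup>2" using G by (simp add: power2_eq_square field_simps)
        finally have "2 * ?I\<^sup>2 \<le> ?I\<^sup>2" using G by (simp add: field_simps power2_eq_square)
        then show False using I by simp
      qed
    next
      case F: False
      then have "?F > 0" using L2norm_nonneg[of M f] by linarith
      then show ?thesis using * by simp
    qed
  qed
qed

lemma
  fixes f g :: "'a \<Rightarrow> 'b::{real_normed_field, banach, second_countable_topology}"
  assumes f: "L2 M f" and g: "L2 M g"
  shows L2_mult_integrable: "integrable M (\<lambda>x. f x * g x)"
    and L2_mult_bound: "norm (\<integral>x. f x * g x \<partial>M) \<le> L2norm M f * L2norm M g"
proof -
  note [measurable] = L2D(1)[OF f] L2D(1)[OF g]
  show "integrable M (\<lambda>x. f x * g x)"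
    by (rule Bochner_Integration.integrable_bound[OF L2_mult_norm_integrable[OF f g]])
      (auto simp: norm_mult)
  have "norm (\<integral>x. f x * g x \<partial>M) \<le> (\<integral>x. norm (f x * g x) \<partial>M)"
    by (rule integral_norm_bound)
  also have "\<dots> \<le> L2norm M f * L2norm M g"
    using L2_Cauchy_Schwarz[OF f g] by (simp add: norm_mult)
  finally show "norm (\<integral>x. f x * g x \<partial>M) \<le> L2norm M f * L2norm M g" .
qed

lemma L2norm_triangle:
  assumes f: "L2 M f" and g: "L2 M g"
  shows "L2norm M (\<lambda>x. f x + g x) \<le> L2norm M f + L2norm M g"
proof (rule power2_le_imp_le)
  have "(L2norm M (\<lambda>x. f x + g x))\<^sup>2 \<le>
      (\<integral>x. (norm (f x))\<^sup>2 + 2 * (norm (f x) * norm (g x)) + (norm (g x))\<^sup>2 \<partial>M)"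
    unfolding L2norm_power2
  proof (rule integral_mono)
    show "integrable M (\<lambda>x. (norm (f x + g x))\<^sup>2)" using L2_add[OF f g] by (simp add: L2_def)
    show "integrable M (\<lambda>x. (norm (f x))\<^sup>2 + 2 * (norm (f x) * norm (g x)) + (norm (g x))\<^sup>2)"
      using L2D(2)[OF f] L2D(2)[OF g] L2_mult_norm_integrable[OF f g] by simp
    fix x
    have "(norm (f x + g x))\<^sup>2 \<le> (norm (f x) + norm (g x))\<^sup>2"
      by (intro power_mono norm_triangle_ineq) simp
    then show "(norm (f x + g x))\<^sup>2 \<le> (norm (f x))\<^sup>2 + 2 * (norm (f x) * norm (g x)) + (norm (g x))\<^sup>2"
      by (simp add: power2_sum)
  qed
  also have "\<dots> = (L2norm M f)\<^sup>2 + 2 * (\<integral>x. norm (f x) * norm (g x) \<partial>M) + (L2norm M g)\<^sup>2"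
    using L2D(2)[OF f] L2D(2)[OF g] L2_mult_norm_integrable[OF f g] by (simp add: L2norm_power2)
  also have "\<dots> \<le> (L2norm M f + L2norm M g)\<^sup>2"
    using L2_Cauchy_Schwarz[OF f g] by (simp add: power2_sum)
  finally show "(L2norm M (\<lambda>x. f x + g x))\<^sup>2 \<le> (L2norm M f + L2norm M g)\<^sup>2" .
qed simp

lemma L2norm_minus_commute: "L2norm M (\<lambda>x. f x - g x) = L2norm M (\<lambda>x. g x - f x)"
  by (simp add: L2norm_def norm_minus_commute)

lemma L2norm_triangle_diff:
  assumes "L2 M f" "L2 M g" "L2 M h"
  shows "L2norm M (\<lambda>x. f x - h x) \<le> L2norm M (\<lambda>x. f x - g x) + L2norm M (\<lambda>x. g x - h x)"
  using L2norm_triangle[OF L2_diff[OF assms(1,2)] L2_diff[OF assms(2,3)]] by simp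

lemma L2norm_triangle3:
  assumes "L2 M f" "L2 M g"
  shows "\<bar>L2norm M f - L2norm M g\<bar> \<le> L2norm M (\<lambda>x. f x - g x)"
  using L2norm_triangle[OF L2_diff[OF assms] assms(2)]
    L2norm_triangle[OF L2_diff[OF assms(2,1)] assms(1)]
  by (simp add: L2norm_minus_commute[of M f g] abs_le_iff)

lemma L2norm_eq_0_AE:
  assumes "L2 M f" "L2norm M f = 0"
  shows "AE x in M. f x = 0"
proof -
  have "(\<integral>x. (norm (f x))\<^sup>2 \<partial>M) = 0" using assms(2) by (simp add: L2norm_def)
  then have "AE x in M. (norm (f x))\<^sup>2 = 0"
    by (subst (asm) integral_nonneg_eq_0_iff_AE) (use L2D[OF assms(1)] in auto)
  then show ?thesis by eventually_elim simp
qed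

text \<open>Fatou's lemma for the squared norms. It carries norm bounds through almost-everywhere
  limits, both for completeness and for Plancherel's theorem.\<close>

lemma L2_limit:
  fixes f :: "nat \<Rightarrow> 'a \<Rightarrow> 'b::{banach, second_countable_topology}"
  assumes f: "\<And>n. L2 M (f n)" and g: "g \<in> borel_measurable M"
    and lim: "AE x in M. (\<lambda>n. f n x) \<longlonglongrightarrow> g x"
    and B: "eventually (\<lambda>n. L2norm M (f n) \<le> B) sequentially"
  shows "L2 M g" "L2norm M g \<le> B"
proof -
  note [measurable] = L2D(1)[OF f] g
  obtain n0 where n0: "L2norm M (f n0) \<le> B" using B by (auto simp: eventually_sequentially)
  have B0: "0 \<le> B" by (rule order_trans[OF L2norm_nonneg n0])
  have nn: "(\<integral>\<^sup>+x. ennreal ((norm (f n x))\<^sup>2) \<partial>M) = ennreal ((L2norm M (f n))\<^sup>2)" for n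
    unfolding L2norm_power2 by (rule nn_integral_eq_integral) (use L2D(2)[OF f] in auto)
  have "(\<integral>\<^sup>+x. ennreal ((norm (g x))\<^sup>2) \<partial>M) = (\<integral>\<^sup>+x. liminf (\<lambda>n. ennreal ((norm (f n x))\<^sup>2)) \<partial>M)"
  proof (rule nn_integral_cong_AE, use lim in eventually_elim)
    case (elim x)
    have "(\<lambda>n. ennreal ((norm (f n x))\<^sup>2)) \<longlonglongrightarrow> ennreal ((norm (g x))\<^sup>2)"
      by (intro tendsto_ennrealI tendsto_intros elim)
    then show ?case by (rule lim_imp_Liminf[OF trivial_limit_sequentially, symmetric])
  qed
  also have "\<dots> \<le> liminf (\<lambda>n. \<integral>\<^sup>+x. ennreal ((norm (f n x))\<^sup>2) \<partial>M)"
    by (rule nn_integral_liminf) measurable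
  also have "\<dots> \<le> ennreal (B\<^sup>2)"
  proof -
    have "liminf (\<lambda>n. \<integral>\<^sup>+x. ennreal ((norm (f n x))\<^sup>2) \<partial>M) \<le> liminf (\<lambda>n::nat. ennreal (B\<^sup>2))"
      by (rule Liminf_mono, use B in eventually_elim) (auto simp: nn intro!: ennreal_leI power_mono)
    then show ?thesis by (simp add: Liminf_const)
  qed
  finally have fin: "(\<integral>\<^sup>+x. ennreal ((norm (g x))\<^sup>2) \<partial>M) \<le> ennreal (B\<^sup>2)" .
  have int: "integrable M (\<lambda>x. (norm (g x))\<^sup>2)"
    by (rule integrableI_bounded) (use fin in \<open>auto simp: top.extremum_unique intro: le_less_trans\<close>)
  then show "L2 M g" by (simp add: L2_def)
  have "ennreal ((L2norm M g)\<^sup>2) \<le> ennreal (B\<^sup>2)"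
    using fin unfolding L2norm_power2 by (subst (asm) nn_integral_eq_integral[OF int]) auto
  then have "(L2norm M g)\<^sup>2 \<le> B\<^sup>2" by (simp add: ennreal_le_iff)
  then show "L2norm M g \<le> B" using B0 by (rule power2_le_imp_le)
qed

lemma L2_AE_subseq:
  fixes f :: "nat \<Rightarrow> 'a \<Rightarrow> 'b::{banach, second_countable_topology}"
  assumes f: "\<And>n. L2 M (f n)" and lim: "(\<lambda>n. L2norm M (f n)) \<longlonglongrightarrow> 0"
  shows "\<exists>r::nat\<Rightarrow>nat. strict_mono r \<and> (AE x in M. (\<lambda>n. f (r n) x) \<longlonglongrightarrow> 0)"
proof -
  have "(\<lambda>n. (L2norm M (f n))\<^sup>2) \<longlonglongrightarrow> 0\<^sup>2" by (intro tendsto_intros lim)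
  then have "(\<lambda>n. \<integral>x. norm ((norm (f n x))\<^sup>2) \<partial>M) \<longlonglongrightarrow> 0" by (simp add: L2norm_power2)
  from tendsto_L1_AE_subseq[OF L2D(2)[OF f] this]
  obtain r :: "nat \<Rightarrow> nat" where r: "strict_mono r" "AE x in M. (\<lambda>n. (norm (f (r n) x))\<^sup>2) \<longlonglongrightarrow> 0"
    by auto
  have "AE x in M. (\<lambda>n. f (r n) x) \<longlonglongrightarrow> 0"
    using r(2)
  proof eventually_elim
    case (elim x)
    have "(\<lambda>n. sqrt ((norm (f (r n) x))\<^sup>2)) \<longlonglongrightarrow> sqrt 0" by (intro tendsto_intros elim)
    then show ?case by (simp add: tendsto_norm_zero_iff)
  qed
  with r(1) show ?thesis by blast
qed

text \<open>Riesz-Fischer. Along a subsequence with increments of norm at most 4^-k, the sum of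
  \<open>4^k * (norm (d k x))\<^sup>2\<close> has a finite integral and is therefore finite almost
  everywhere. So the increments are eventually at most 2^-k at almost every point, and the
  telescoping series converges.\<close>

lemma L2_complete:
  fixes f :: "nat \<Rightarrow> 'a \<Rightarrow> 'b::{banach, second_countable_topology}"
  assumes f: "\<And>n. L2 M (f n)"
    and cauchy: "\<And>e. e > 0 \<Longrightarrow> \<exists>N. \<forall>m\<ge>N. \<forall>n\<ge>N. L2norm M (\<lambda>x. f m x - f n x) \<le> e"
  shows "\<exists>g. L2 M g \<and> (\<lambda>n. L2norm M (\<lambda>x. f n x - g x)) \<longlonglongrightarrow> 0"
proof -
  note [measurable] = L2D(1)[OF f]
  have "\<exists>N. \<forall>k. \<forall>m\<ge>N k. \<forall>n\<ge>N k. L2norm M (\<lambda>x. f m x - f n x) \<le> (1/4)^k"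
    using cauchy by (intro choice) auto
  then obtain N0 where N0: "\<And>k m n. m \<ge> N0 k \<Longrightarrow> n \<ge> N0 k \<Longrightarrow> L2norm M (\<lambda>x. f m x - f n x) \<le> (1/4)^k"
    by blast
  \<comment> \<open>Partial sums make the thresholds monotone, so that consecutive indices can be
    compared in \<open>dn\<close>.\<close>
  define N where "N k = (\<Sum>i\<le>k. N0 i)" for k
  have NN0: "N k \<ge> N0 k" for k unfolding N_def by (rule member_le_sum) auto
  have Nmono: "N k \<le> N (Suc k)" for k unfolding N_def by simp
  define d where "d k x = f (N (Suc k)) x - f (N k) x" for k x
  have d: "L2 M (d k)" for k unfolding d_def by (intro L2_diff f)
  have dn: "(L2norm M (d k))\<^sup>2 \<le> (1/16)^k" for k
  proof -
    have "L2norm M (d k) \<le> (1/4)^k" unfolding d_def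
      by (rule N0) (use NN0[of k] Nmono[of k] in auto)
    then have "(L2norm M (d k))\<^sup>2 \<le> ((1/4)^k)\<^sup>2" by (intro power_mono) auto
    also have "\<dots> = (1/16)^k" by (simp add: power2_eq_square flip: power_mult_distrib)
    finally show ?thesis .
  qed
  note [measurable] = L2D(1)[OF d]
  have "(\<integral>\<^sup>+x. (\<Sum>k. ennreal (4^k * (norm (d k x))\<^sup>2)) \<partial>M) = (\<Sum>k. \<integral>\<^sup>+x. ennreal (4^k * (norm (d k x))\<^sup>2) \<partial>M)"
    by (rule nn_integral_suminf) measurable
  also have "\<dots> = (\<Sum>k. ennreal (4^k * (L2norm M (d k))\<^sup>2))"
  proof (rule suminf_cong)
    fix k
    have "(\<integral>\<^sup>+x. ennreal (4^k * (norm (d k x))\<^sup>2) \<partial>M) = ennreal (\<integral>x. 4^k * (norm (d k x))\<^sup>2 \<partial>M)"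
      by (rule nn_integral_eq_integral) (use L2D(2)[OF d] in auto)
    then show "(\<integral>\<^sup>+x. ennreal (4^k * (norm (d k x))\<^sup>2) \<partial>M) = ennreal (4^k * (L2norm M (d k))\<^sup>2)"
      by (simp add: L2norm_power2)
  qed
  also have "\<dots> \<le> (\<Sum>k. ennreal ((1/4)^k))"
  proof (rule suminf_le)
    fix k
    have "4^k * (L2norm M (d k))\<^sup>2 \<le> 4^k * (1/16)^k" by (intro mult_left_mono dn) simp
    also have "\<dots> = (1/4::real)^k" by (simp flip: power_mult_distrib)
    finally show "ennreal (4^k * (L2norm M (d k))\<^sup>2) \<le> ennreal ((1/4)^k)" by (rule ennreal_leI)
  qed auto
  also have "\<dots> = ennreal (\<Sum>k. (1/4)^k)"
    by (rule suminf_ennreal2) (auto intro: summable_geometric)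
  finally have "(\<integral>\<^sup>+x. (\<Sum>k. ennreal (4^k * (norm (d k x))\<^sup>2)) \<partial>M) \<noteq> \<infinity>"
    by (auto simp: top_unique)
  then have "AE x in M. (\<Sum>k. ennreal (4^k * (norm (d k x))\<^sup>2)) \<noteq> \<infinity>"
    by (intro nn_integral_PInf_AE) measurable
  then have conv: "AE x in M. convergent (\<lambda>k. f (N k) x)"
  proof eventually_elim
    case (elim x)
    have "summable (\<lambda>k. 4^k * (norm (d k x))\<^sup>2)"
      by (rule summable_suminf_not_top) (use elim in auto)
    then have "(\<lambda>k. 4^k * (norm (d k x))\<^sup>2) \<longlonglongrightarrow> 0" by (rule summable_LIMSEQ_zero)
    then have "eventually (\<lambda>k. 4^k * (norm (d k x))\<^sup>2 < 1) sequentially"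
      by (rule order_tendstoD) simp
    then have ev: "eventually (\<lambda>k. norm (d k x) \<le> (1/2)^k) sequentially"
    proof eventually_elim
      case (elim k)
      have "(2^k * norm (d k x))\<^sup>2 = 4^k * (norm (d k x))\<^sup>2"
        using power_mult_distrib[of "2::real" 2 k] by (simp add: power_mult_distrib power2_eq_square)
      then have "(2^k * norm (d k x))\<^sup>2 \<le> 1\<^sup>2" using elim by simp
      then have "2^k * norm (d k x) \<le> 1" by (rule power2_le_imp_le) simp
      then show ?case by (simp add: field_simps power_one_over)
    qed
    have "summable (\<lambda>k. d k x)"
    proof (rule summable_comparison_test_ev[OF ev])
      show "summable (\<lambda>k. (1/2)^k :: real)" by (rule summable_geometric) simp
    qed
    then have "convergent (\<lambda>n. f (N 0) x + (\<Sum>k<n. d k x))"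
      by (intro convergent_add convergent_const) (simp add: summable_iff_convergent)
    moreover have "f (N 0) x + (\<Sum>k<n. d k x) = f (N n) x" for n
      by (induction n) (simp, simp add: d_def algebra_simps)
    ultimately show ?case by (simp only:)
  qed
  define g where "g x = lim (\<lambda>k. f (N k) x)" for x
  have g[measurable]: "g \<in> borel_measurable M"
    unfolding g_def by measurable
  have lim: "AE x in M. (\<lambda>k. f (N k) x) \<longlonglongrightarrow> g x"
    using conv by eventually_elim (simp add: g_def convergent_LIMSEQ_iff)
  \<comment> \<open>Fatou in the second index turns the Cauchy estimate into a distance to the
    limit.\<close>
  have key: "L2 M (\<lambda>x. f m x - g x) \<and> L2norm M (\<lambda>x. f m x - g x) \<le> (1/4)^j" if "m \<ge> N0 j" for m j
  proof -
    have ev: "eventually (\<lambda>k. L2norm M (\<lambda>x. f m x - f (N k) x) \<le> (1/4)^j) sequentially"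
    proof (rule eventually_sequentiallyI)
      fix k assume "k \<ge> j"
      then have "N k \<ge> N j" unfolding N_def by (intro sum_mono2) auto
      then show "L2norm M (\<lambda>x. f m x - f (N k) x) \<le> (1/4)^j"
        using N0[OF that, of "N k"] NN0[of j] by simp
    qed
    have l: "AE x in M. (\<lambda>k. f m x - f (N k) x) \<longlonglongrightarrow> f m x - g x"
      using lim by eventually_elim (intro tendsto_intros)
    show ?thesis
      using L2_limit[OF L2_diff[OF f f] _ l ev] by simp
  qed
  have "L2 M (\<lambda>x. f (N0 0) x - (f (N0 0) x - g x))"
    by (intro L2_diff f conjunct1[OF key[of 0]]) simp
  then have "L2 M g" by simp
  moreover have "(\<lambda>n. L2norm M (\<lambda>x. f n x - g x)) \<longlonglongrightarrow> 0"
  proof (rule LIMSEQ_I)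
    fix e :: real assume "e > 0"
    then obtain j where j: "(1/4::real)^j < e" using real_arch_pow_inv[of e "1/4"] by auto
    then show "\<exists>n0. \<forall>n\<ge>n0. norm (L2norm M (\<lambda>x. f n x - g x) - 0) < e"
      using key[of j] by (intro exI[of _ "N0 j"]) (auto intro: le_less_trans)
  qed
  ultimately show ?thesis by blast
qed

lemma L2_conv:
  assumes "L2 M f" "\<And>n. L2 M (g n)" "(\<lambda>n. L2norm M (\<lambda>x. g n x - f x)) \<longlonglongrightarrow> 0"
  shows "(\<lambda>n. L2norm M (g n)) \<longlonglongrightarrow> L2norm M f"
proof (rule LIM_zero_cancel, rule Lim_null_comparison[OF _ assms(3)])
  show "\<forall>\<^sub>F n in sequentially. norm (L2norm M (g n) - L2norm M f) \<le> L2norm M (\<lambda>x. g n x - f x)"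
    using L2norm_triangle3[OF assms(2,1)] by simp
qed

lemma L2_mult_conv:
  fixes f g :: "'a \<Rightarrow> 'b::{real_normed_field, banach, second_countable_topology}"
  assumes f: "L2 M f" "\<And>n. L2 M (F n)" "(\<lambda>n. L2norm M (\<lambda>x. F n x - f x)) \<longlonglongrightarrow> 0"
    and g: "L2 M g"
  shows "(\<lambda>n. \<integral>x. F n x * g x \<partial>M) \<longlonglongrightarrow> (\<integral>x. f x * g x \<partial>M)"
proof (rule LIM_zero_cancel, rule Lim_null_comparison)
  show "(\<lambda>n. L2norm M (\<lambda>x. F n x - f x) * L2norm M g) \<longlonglongrightarrow> 0"
    by (rule tendsto_mult_left_zero[OF f(3)])
  have "(\<integral>x. F n x * g x \<partial>M) - (\<integral>x. f x * g x \<partial>M) = (\<integral>x. (F n x - f x) * g x \<partial>M)" for n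
    using L2_mult_integrable[OF f(2) g] L2_mult_integrable[OF f(1) g]
    by (simp add: left_diff_distrib)
  then show "\<forall>\<^sub>F n in sequentially. norm ((\<integral>x. F n x * g x \<partial>M) - (\<integral>x. f x * g x \<partial>M))
      \<le> L2norm M (\<lambda>x. F n x - f x) * L2norm M g"
    using L2_mult_bound[OF L2_diff[OF f(2,1)] g] by simp
qed

section \<open>Density of continuous functions of bounded support, in L1 and L2 at once\<close>

definition Cc :: "(real \<Rightarrow> complex) \<Rightarrow> bool" where
  "Cc g \<longleftrightarrow> continuous_on UNIV g \<and> (\<exists>M. \<forall>x. M < \<bar>x\<bar> \<longrightarrow> g x = 0)"

lemma integrable_bounded_support:
  fixes g :: "real \<Rightarrow> 'b::{banach, second_countable_topology}"
  assumes [measurable]: "g \<in> borel_measurable lborel"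
    and "\<And>x. norm (g x) \<le> B" "\<And>x. M < \<bar>x\<bar> \<Longrightarrow> g x = 0"
  shows "integrable lborel g"
proof (rule integrableI_bounded_set[of "{-M..M}" _ _ B])
  show "emeasure lborel {-M..M} < \<infinity>" by (cases "0 \<le> M") auto
  show "AE x in lborel. x \<notin> {-M..M} \<longrightarrow> g x = 0"
    using assms(3) by (intro AE_I2) auto
qed (use assms in auto)

lemma Cc_bounded:
  assumes "Cc g" obtains B M where "\<And>x. norm (g x) \<le> B" "\<And>x. M < \<bar>x\<bar> \<Longrightarrow> g x = 0" "B \<ge> 0" "M \<ge> 0"
proof -
  obtain M where M: "\<And>x. M < \<bar>x\<bar> \<Longrightarrow> g x = 0" using assms by (auto simp: Cc_def)
  have "compact (g ` {-\<bar>M\<bar>..\<bar>M\<bar>})"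
    using assms by (intro compact_continuous_image) (auto simp: Cc_def intro: continuous_on_subset)
  then have "bounded (g ` {-\<bar>M\<bar>..\<bar>M\<bar>})" by (rule compact_imp_bounded)
  then obtain B where B: "B > 0" "\<And>x. x \<in> {-\<bar>M\<bar>..\<bar>M\<bar>} \<Longrightarrow> norm (g x) \<le> B"
    by (auto simp: bounded_pos)
  have "norm (g x) \<le> B" for x
    using B(2)[of x] M[of x] B(1) by (cases "\<bar>x\<bar> \<le> \<bar>M\<bar>") (auto simp: abs_le_iff)
  moreover have "g x = 0" if "\<bar>M\<bar> < \<bar>x\<bar>" for x using M[of x] that by auto
  ultimately show ?thesis using that[of B "\<bar>M\<bar>"] B(1) by auto
qed

lemma Cc_measurable: "Cc g \<Longrightarrow> g \<in> borel_measurable lborel"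
  by (auto simp: Cc_def intro: borel_measurable_continuous_onI)

lemma Cc_integrable:
  assumes "Cc g" shows "integrable lborel g"
proof -
  obtain B M where "\<And>x. norm (g x) \<le> B" "\<And>x. M < \<bar>x\<bar> \<Longrightarrow> g x = 0" using Cc_bounded[OF assms] by metis
  with Cc_measurable[OF assms] show ?thesis by (intro integrable_bounded_support[of g B M])
qed

lemma Cc_L2:
  assumes "Cc g" shows "L2 lborel g"
proof -
  obtain B M where "\<And>x. norm (g x) \<le> B" "\<And>x. M < \<bar>x\<bar> \<Longrightarrow> g x = 0" using Cc_bounded[OF assms] by metis
  with Cc_measurable[OF assms] have "integrable lborel (\<lambda>x. (norm (g x))\<^sup>2)"
    by (intro integrable_bounded_support[of _ "B\<^sup>2" M]) (auto intro: power_mono)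
  with Cc_measurable[OF assms] show ?thesis by (simp add: L2_def)
qed

text \<open>\<open>measurable_on\<close> is by definition approximation by continuous functions off
  a null set; only that null set has to be carried from Lebesgue measure over to
  \<open>lborel\<close>.\<close>

lemma AE_continuous_approx:
  fixes f :: "real \<Rightarrow> complex"
  assumes "f \<in> borel_measurable lborel"
  obtains g :: "nat \<Rightarrow> real \<Rightarrow> complex"
    where "\<And>n. continuous_on UNIV (g n)" "AE x in lborel. (\<lambda>n. g n x) \<longlonglongrightarrow> f x"
proof -
  have "f \<in> borel_measurable lebesgue" using assms by (intro measurable_completion) auto
  then have "f measurable_on UNIV" by (intro lebesgue_measurable_imp_measurable_on) auto
  then obtain N g where N: "negligible N" "\<And>n. continuous_on UNIV (g n)"
    "\<And>x. x \<notin> N \<Longrightarrow> (\<lambda>n. g n x) \<longlonglongrightarrow> f x" unfolding measurable_on_def by auto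
  have "AE x in lebesgue. x \<notin> N" using N(1) by (simp add: negligible_iff_null_sets AE_not_in)
  then have "AE x in lborel. x \<notin> N" by (simp add: AE_completion_iff)
  then have "AE x in lborel. (\<lambda>n. g n x) \<longlonglongrightarrow> f x" by eventually_elim (rule N(3))
  with N(2) show ?thesis by (rule that)
qed

text \<open>One integral for both distances, so that a single dominated convergence controls L1 and
  L2 together.\<close>

definition L12dist :: "(real \<Rightarrow> complex) \<Rightarrow> (real \<Rightarrow> complex) \<Rightarrow> real" where
  "L12dist f g = (\<integral>x. norm (f x - g x) + (norm (f x - g x))\<^sup>2 \<partial>lborel)"

lemma L12_small:
  assumes "integrable lborel f" "L2 lborel f" "integrable lborel g" "L2 lborel g"
    and "L12dist f g < e"
  shows "(\<integral>x. norm (f x - g x) \<partial>lborel) < e" "(L2norm lborel (\<lambda>x. f x - g x))\<^sup>2 < e"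
proof -
  have "L12dist f g = (\<integral>x. norm (f x - g x) \<partial>lborel) + (L2norm lborel (\<lambda>x. f x - g x))\<^sup>2"
    unfolding L12dist_def L2norm_power2
    by (rule Bochner_Integration.integral_add) (use assms L2D(2)[OF L2_diff[OF assms(2,4)]] in auto)
  moreover have "0 \<le> (\<integral>x. norm (f x - g x) \<partial>lborel)" by simp
  moreover have "0 \<le> (L2norm lborel (\<lambda>x. f x - g x))\<^sup>2" by simp
  ultimately show "(\<integral>x. norm (f x - g x) \<partial>lborel) < e" "(L2norm lborel (\<lambda>x. f x - g x))\<^sup>2 < e"
    using assms(5) by linarith+
qed

text \<open>Both norms matter: L1 convergence makes \<open>ft\<close> converge pointwise, L2
  convergence makes the norms converge. \<open>F m\<close> has bounded values and bounded support;
  replacing f inside it by continuous approximants gives \<open>G m n\<close>, which obeys the same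
  bounds, so dominated convergence applies to each replacement.\<close>

lemma Cc_dense:
  fixes f :: "real \<Rightarrow> complex"
  assumes f1: "integrable lborel f" and f2: "L2 lborel f"
  shows "\<exists>g :: nat \<Rightarrow> real \<Rightarrow> complex. (\<forall>n. Cc (g n)) \<and>
    (\<lambda>n. \<integral>x. norm (g n x - f x) \<partial>lborel) \<longlonglongrightarrow> 0 \<and>
    (\<lambda>n. L2norm lborel (\<lambda>x. g n x - f x)) \<longlonglongrightarrow> 0"
proof -
  note [measurable] = L2D(1)[OF f2, simplified]
  obtain g where g: "\<And>n. continuous_on UNIV (g n)" "AE x in lborel. (\<lambda>n. g n x) \<longlonglongrightarrow> f x"
    using AE_continuous_approx[OF L2D(1)[OF f2]] by blast
  have [measurable]: "g n \<in> borel_measurable borel" for n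
    by (intro borel_measurable_continuous_onI g)
  define c :: "nat \<Rightarrow> real \<Rightarrow> real" where "c m x = max 0 (min 1 (real m + 1 - \<bar>x\<bar>))" for m x
  \<comment> \<open>Radial clipping to the disc of radius m + 1: the identity inside it, and
    continuous because the denominator is at least m + 1.\<close>
  define cl :: "nat \<Rightarrow> complex \<Rightarrow> complex"
    where "cl m z = ((real m + 1) / max (real m + 1) (norm z)) *\<^sub>R z" for m z
  have c: "0 \<le> c m x" "c m x \<le> 1" for m x by (auto simp: c_def)
  have c0: "c m x = 0" if "real m + 1 < \<bar>x\<bar>" for m x using that by (auto simp: c_def)
  have c_cont: "continuous_on UNIV (c m)" for m unfolding c_def by (intro continuous_intros)
  then have [measurable]: "c m \<in> borel_measurable borel" for m
    by (intro borel_measurable_continuous_onI)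
  have cl_cont: "continuous_on UNIV (cl m)" for m
    unfolding cl_def by (intro continuous_intros) auto
  then have [measurable]: "cl m \<in> borel_measurable borel" for m
    by (intro borel_measurable_continuous_onI)
  have cl_le: "norm (cl m z) \<le> real m + 1" for m z
  proof -
    have "norm (cl m z) = (real m + 1) * (norm z / max (real m + 1) (norm z))"
      by (simp add: cl_def)
    also have "\<dots> \<le> (real m + 1) * 1"
      by (intro mult_left_mono) (auto simp: divide_le_eq_1)
    finally show ?thesis by simp
  qed
  define F where "F m x = c m x *\<^sub>R cl m (f x)" for m x
  define G where "G m n x = c m x *\<^sub>R cl m (g n x)" for m n x
  have [measurable]: "F m \<in> borel_measurable borel" "G m n \<in> borel_measurable borel" for m n
    unfolding F_def G_def by measurable
  have F_diff: "norm (f x - F m x) \<le> norm (f x)" for m x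
  proof -
    let ?t = "c m x * ((real m + 1) / max (real m + 1) (norm (f x)))"
    have t: "0 \<le> ?t" "?t \<le> 1"
      using c[of m x] by (auto intro!: mult_nonneg_nonneg mult_le_one divide_nonneg_pos
          simp: divide_le_eq_1 simp del: times_divide_eq_right)
    have "f x - F m x = (1 - ?t) *\<^sub>R f x" by (simp add: F_def cl_def algebra_simps)
    then have "norm (f x - F m x) = (1 - ?t) * norm (f x)" using t by simp
    also have "\<dots> \<le> 1 * norm (f x)" using t by (intro mult_right_mono) auto
    finally show ?thesis by simp
  qed
  have F_lim: "(\<lambda>m. L12dist f (F m)) \<longlonglongrightarrow> (\<integral>x. 0 \<partial>(lborel::real measure))"
    unfolding L12dist_def
  proof (rule integral_dominated_convergence[where w="\<lambda>x. norm (f x) + (norm (f x))\<^sup>2"])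
    show "integrable lborel (\<lambda>x. norm (f x) + (norm (f x))\<^sup>2)"
      using f1 L2D(2)[OF f2] by auto
    show "AE x in lborel. (\<lambda>m. norm (f x - F m x) + (norm (f x - F m x))\<^sup>2) \<longlonglongrightarrow> 0"
    proof (rule AE_I2, rule tendsto_eventually)
      fix x
      obtain m0 :: nat where m0: "real m0 \<ge> \<bar>x\<bar> + norm (f x)" using real_arch_simple by blast
      have "F m x = f x" if "m \<ge> m0" for m
      proof -
        have "real m \<ge> \<bar>x\<bar> + norm (f x)" using m0 that by linarith
        then have "real m \<ge> \<bar>x\<bar>" "real m \<ge> norm (f x)" using norm_ge_zero[of "f x"] by linarith+
        then show ?thesis by (simp add: F_def c_def cl_def max_def)
      qed
      then show "\<forall>\<^sub>F m in sequentially. norm (f x - F m x) + (norm (f x - F m x))\<^sup>2 = 0"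
        by (intro eventually_sequentiallyI[of m0]) simp
    qed
    show "AE x in lborel. norm (norm (f x - F m x) + (norm (f x - F m x))\<^sup>2) \<le> norm (f x) + (norm (f x))\<^sup>2" for m
      using F_diff by (intro AE_I2) (auto intro!: add_mono power_mono)
  qed measurable
  have G_lim: "(\<lambda>n. L12dist (F m) (G m n)) \<longlonglongrightarrow> (\<integral>x. 0 \<partial>(lborel::real measure))" for m
    unfolding L12dist_def
  proof (rule integral_dominated_convergence
      [where w="\<lambda>x. (2 * (real m + 1) + (2 * (real m + 1))\<^sup>2) * indicator {-(real m + 1)..real m + 1} x"])
    show "integrable lborel (\<lambda>x. (2 * (real m + 1) + (2 * (real m + 1))\<^sup>2) * indicator {-(real m + 1)..real m + 1} x)"
      by (intro integrable_mult_right integrable_real_indicator) (auto)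
    show "AE x in lborel. (\<lambda>n. norm (F m x - G m n x) + (norm (F m x - G m n x))\<^sup>2) \<longlonglongrightarrow> 0"
      using g(2)
    proof eventually_elim
      case (elim x)
      have "(\<lambda>n. G m n x) \<longlonglongrightarrow> F m x"
        unfolding G_def F_def
        by (intro tendsto_intros continuous_on_tendsto_compose[OF cl_cont elim]) auto
      then have "(\<lambda>n. norm (F m x - G m n x) + (norm (F m x - G m n x))\<^sup>2) \<longlonglongrightarrow>
          norm (F m x - F m x) + (norm (F m x - F m x))\<^sup>2"
        by (intro tendsto_intros)
      then show ?case by simp
    qed
    have FG: "norm (F m x - G m n x) \<le> 2 * (real m + 1) * indicator {-(real m + 1)..real m + 1} x" for n x
    proof (cases "\<bar>x\<bar> \<le> real m + 1")
      case True
      have "norm (F m x) \<le> 1 * (real m + 1)" "norm (G m n x) \<le> 1 * (real m + 1)"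
        unfolding F_def G_def norm_scaleR using c[of m x] by (intro mult_mono cl_le; simp)+
      then show ?thesis using norm_triangle_ineq4[of "F m x" "G m n x"] True by (auto simp: indicator_def)
    next
      case False
      then show ?thesis using c0[of m x] by (simp add: F_def G_def)
    qed
    show "AE x in lborel. norm (norm (F m x - G m n x) + (norm (F m x - G m n x))\<^sup>2) \<le>
        (2 * (real m + 1) + (2 * (real m + 1))\<^sup>2) * indicator {-(real m + 1)..real m + 1} x" for n
    proof (rule AE_I2)
      fix x
      have "(norm (F m x - G m n x))\<^sup>2 \<le> (2 * (real m + 1) * indicator {-(real m + 1)..real m + 1} x)\<^sup>2"
        by (intro power_mono FG) simp
      from add_mono[OF FG[of x n] this]
      show "norm (norm (F m x - G m n x) + (norm (F m x - G m n x))\<^sup>2) \<le>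
          (2 * (real m + 1) + (2 * (real m + 1))\<^sup>2) * indicator {-(real m + 1)..real m + 1} x"
        by (cases "x \<in> {-(real m + 1)..real m + 1}") simp_all
    qed
  qed measurable
  have Fint: "integrable lborel (F m)" "L2 lborel (F m)" for m
  proof -
    have b: "norm (F m x) \<le> real m + 1" for x
      unfolding F_def norm_scaleR using mult_mono[OF c(2)[of m x] cl_le[of m "f x"]] c[of m x] by simp
    show "integrable lborel (F m)"
      by (rule integrable_bounded_support[of _ "real m + 1" "real m + 1"]) (auto simp: b, auto simp: F_def c0)
    have "integrable lborel (\<lambda>x. (norm (F m x))\<^sup>2)"
      by (rule integrable_bounded_support[of _ "(real m + 1)\<^sup>2" "real m + 1"])
        (auto simp: power_mono b, auto simp: F_def c0)
    then show "L2 lborel (F m)" by (simp add: L2_def)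
  qed
  have Gc: "Cc (G m n)" for m n
    unfolding Cc_def
  proof (intro conjI exI[of _ "real m + 1"] allI impI)
    show "continuous_on UNIV (G m n)" unfolding G_def
      by (intro continuous_intros c_cont continuous_on_compose2[OF cl_cont g(1)]) auto
  qed (auto simp: G_def c0)
  have "\<exists>h. Cc h \<and> (\<integral>x. norm (h x - f x) \<partial>lborel) \<le> e \<and> L2norm lborel (\<lambda>x. h x - f x) \<le> e"
    if e: "e > 0" for e
  proof -
    \<comment> \<open>\<open>L12dist\<close> below d bounds the L1 distance by d but only the square
      of the L2 distance by d; the minimum makes both distances at most e / 2.\<close>
    define d where "d = min (e/2) ((e/2)\<^sup>2)"
    have d: "d > 0" "d \<le> e/2" "d \<le> (e/2)\<^sup>2" using e by (auto simp: d_def)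
    have "eventually (\<lambda>m. L12dist f (F m) < d) sequentially"
      using order_tendstoD(2)[OF F_lim] d(1) by simp
    then obtain m where m: "L12dist f (F m) < d" by (auto simp: eventually_sequentially)
    have "eventually (\<lambda>n. L12dist (F m) (G m n) < d) sequentially"
      using order_tendstoD(2)[OF G_lim] d(1) by simp
    then obtain n where n: "L12dist (F m) (G m n) < d" by (auto simp: eventually_sequentially)
    note A = L12_small[OF f1 f2 Fint m] and B = L12_small[OF Fint Cc_integrable[OF Gc] Cc_L2[OF Gc] n]
    have sq: "x \<le> e/2" if "x\<^sup>2 < d" for x :: real
      by (rule power2_le_imp_le) (use that d e in auto)
    have "L2norm lborel (\<lambda>x. f x - G m n x) \<le> e/2 + e/2"
      using L2norm_triangle_diff[OF f2 Fint(2) Cc_L2[OF Gc], of m n m] sq[OF A(2)] sq[OF B(2)] by linarith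
    moreover have "(\<integral>x. norm (f x - G m n x) \<partial>lborel) \<le>
        (\<integral>x. norm (f x - F m x) + norm (F m x - G m n x) \<partial>lborel)"
    proof (intro integral_mono)
      show "norm (f x - G m n x) \<le> norm (f x - F m x) + norm (F m x - G m n x)" for x
        using norm_triangle_ineq[of "f x - F m x" "F m x - G m n x"] by simp
    qed (use f1 Fint(1) Cc_integrable[OF Gc] in auto)
    moreover have "\<dots> = (\<integral>x. norm (f x - F m x) \<partial>lborel) + (\<integral>x. norm (F m x - G m n x) \<partial>lborel)"
      by (rule Bochner_Integration.integral_add) (use f1 Fint(1) Cc_integrable[OF Gc] in auto)
    ultimately show ?thesis
      using A(1) B(1) d Gc
      by (intro exI[of _ "G m n"]) (auto simp: L2norm_minus_commute[of _ _ f] norm_minus_commute[of "f x" for x])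
  qed
  then have "\<forall>n. \<exists>h. Cc h \<and> (\<integral>x. norm (h x - f x) \<partial>lborel) \<le> inverse (real (Suc n)) \<and>
      L2norm lborel (\<lambda>x. h x - f x) \<le> inverse (real (Suc n))"
    by (metis inverse_positive_iff_positive of_nat_0_less_iff zero_less_Suc)
  then obtain h where h: "\<And>n. Cc (h n)" "\<And>n. (\<integral>x. norm (h n x - f x) \<partial>lborel) \<le> inverse (real (Suc n))"
    "\<And>n. L2norm lborel (\<lambda>x. h n x - f x) \<le> inverse (real (Suc n))" by metis
  show ?thesis
  proof (intro exI[of _ h] conjI allI h(1))
    show "(\<lambda>n. \<integral>x. norm (h n x - f x) \<partial>lborel) \<longlonglongrightarrow> 0"
      by (rule Lim_null_comparison[OF _ LIMSEQ_inverse_real_of_nat]) (use h(2) in auto)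
    show "(\<lambda>n. L2norm lborel (\<lambda>x. h n x - f x)) \<longlonglongrightarrow> 0"
      by (rule Lim_null_comparison[OF _ LIMSEQ_inverse_real_of_nat]) (use h(3) in auto)
  qed
qed

section \<open>The Fourier transform on the real line\<close>

text \<open>Unitary normalisation, so that Plancherel's theorem carries no constant. Meant for
  integrable f; \<open>fourier\<close> is the extension to L2.\<close>

definition ft :: "(real \<Rightarrow> complex) \<Rightarrow> real \<Rightarrow> complex" where
  "ft f \<xi> = (\<integral>y. f y * cis (- (\<xi> * y)) \<partial>lborel) / sqrt (2 * pi)"

lemma cis_measurable [measurable]:
  "g \<in> borel_measurable M \<Longrightarrow> (\<lambda>x. cis (g x)) \<in> borel_measurable M"
  by (rule measurable_compose[where N=borel])
    (auto intro!: borel_measurable_continuous_onI continuous_intros)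

lemma cnj_measurable [measurable]:
  "g \<in> borel_measurable M \<Longrightarrow> (\<lambda>x. cnj (g x)) \<in> borel_measurable M"
  by (rule measurable_compose[where N=borel])
    (auto intro!: borel_measurable_continuous_onI continuous_intros)

lemma integrable_cis_mult:
  assumes "integrable lborel f"
  shows "integrable lborel (\<lambda>y. f y * cis (a * y + b))"
proof (rule Bochner_Integration.integrable_bound[OF assms])
  have [measurable]: "f \<in> borel_measurable borel" using assms by auto
  show "(\<lambda>y. f y * cis (a * y + b)) \<in> borel_measurable lborel" by measurable
qed (auto simp: norm_mult)

lemma integrable_cis_mult':
  assumes "integrable lborel f"
  shows "integrable lborel (\<lambda>y. f y * cis (- (\<xi> * y)))"
  using integrable_cis_mult[OF assms, of "-\<xi>" 0] by simp

lemma ft_diff: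
  assumes "integrable lborel f" "integrable lborel g"
  shows "ft (\<lambda>x. f x - g x) \<xi> = ft f \<xi> - ft g \<xi>"
  using integrable_cis_mult'[OF assms(1)] integrable_cis_mult'[OF assms(2)]
  by (simp add: ft_def left_diff_distrib diff_divide_distrib)

lemma norm_ft_le: "norm (ft f \<xi>) \<le> (\<integral>x. norm (f x) \<partial>lborel) / sqrt (2 * pi)"
proof -
  have "norm (\<integral>y. f y * cis (- (\<xi> * y)) \<partial>lborel) \<le> (\<integral>y. norm (f y * cis (- (\<xi> * y))) \<partial>lborel)"
    by (rule integral_norm_bound)
  then show ?thesis by (simp add: ft_def norm_divide norm_mult divide_right_mono)
qed

lemma ft_continuous:
  assumes f: "integrable lborel f"
  shows "continuous_on UNIV (ft f)"
proof -
  have [measurable]: "f \<in> borel_measurable borel" using f by auto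
  have "isCont (ft f) \<xi>" for \<xi>
    unfolding continuous_at_sequentially
  proof safe
    fix X :: "nat \<Rightarrow> real" assume X: "X \<longlonglongrightarrow> \<xi>"
    have "(\<lambda>n. \<integral>y. f y * cis (- (X n * y)) \<partial>lborel) \<longlonglongrightarrow> (\<integral>y. f y * cis (- (\<xi> * y)) \<partial>lborel)"
    proof (rule integral_dominated_convergence[where w="\<lambda>y. norm (f y)"])
      show "AE y in lborel. (\<lambda>n. f y * cis (- (X n * y))) \<longlonglongrightarrow> f y * cis (- (\<xi> * y))"
        by (intro AE_I2 tendsto_intros X continuous_on_tendsto_compose[OF continuous_on_cis[OF continuous_on_id]])
    qed (use f integrable_cis_mult'[OF f] in \<open>auto simp: norm_mult\<close>)
    then show "((ft f) \<circ> X) \<longlonglongrightarrow> ft f \<xi>"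
      unfolding ft_def comp_def by (intro tendsto_intros) auto
  qed
  then show ?thesis by (simp add: continuous_on_eq_continuous_at)
qed

lemma ft_measurable: "integrable lborel f \<Longrightarrow> ft f \<in> borel_measurable borel"
  by (intro borel_measurable_continuous_onI ft_continuous)

text \<open>Fubini with a symmetric kernel. It trades the transform of f for that of g, and g can be
  taken Gaussian.\<close>

lemma ft_mult_formula:
  assumes f: "integrable lborel f" and g: "integrable lborel g"
  shows "(\<integral>\<xi>. ft f \<xi> * g \<xi> \<partial>lborel) = (\<integral>y. f y * ft g y \<partial>lborel)"
proof -
  have [measurable]: "f \<in> borel_measurable borel" "g \<in> borel_measurable borel" using f g by auto
  have I: "integrable (lborel \<Otimes>\<^sub>M lborel) (\<lambda>(y, \<xi>). f y * cis (- (\<xi> * y)) * g \<xi>)"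
  proof (rule lborel_pair.Fubini_integrable)
    show "integrable lborel (\<lambda>y. \<integral>\<xi>. norm (case (y, \<xi>) of (y, \<xi>) \<Rightarrow> f y * cis (- (\<xi> * y)) * g \<xi>) \<partial>lborel)"
      using f by (simp add: norm_mult)
    show "AE y in lborel. integrable lborel (\<lambda>\<xi>. case (y, \<xi>) of (y, \<xi>) \<Rightarrow> f y * cis (- (\<xi> * y)) * g \<xi>)"
    proof (rule AE_I2)
      fix y
      have "integrable lborel (\<lambda>\<xi>. f y * (g \<xi> * cis (- y * \<xi> + 0)))"
        by (intro integrable_mult_right integrable_cis_mult g)
      then show "integrable lborel (\<lambda>\<xi>. case (y, \<xi>) of (y, \<xi>) \<Rightarrow> f y * cis (- (\<xi> * y)) * g \<xi>)"
        by (simp add: mult_ac)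
    qed
  qed measurable
  have "(\<integral>\<xi>. (\<integral>y. f y * cis (- (\<xi> * y)) * g \<xi> \<partial>lborel) \<partial>lborel)
      = (\<integral>y. (\<integral>\<xi>. f y * cis (- (\<xi> * y)) * g \<xi> \<partial>lborel) \<partial>lborel)"
    using lborel_pair.Fubini_integral[OF I] .
  moreover have "(\<integral>\<xi>. f y * cis (- (\<xi> * y)) * g \<xi> \<partial>lborel) = f y * ft g y * sqrt (2 * pi)" for y
  proof -
    have "(\<integral>\<xi>. f y * cis (- (\<xi> * y)) * g \<xi> \<partial>lborel) = (\<integral>\<xi>. f y * (g \<xi> * cis (- (y * \<xi>))) \<partial>lborel)"
      by (simp add: mult_ac)
    then show ?thesis by (simp add: ft_def)
  qed
  moreover have "(\<integral>y. f y * cis (- (\<xi> * y)) * g \<xi> \<partial>lborel) = ft f \<xi> * g \<xi> * sqrt (2 * pi)" for \<xi>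
    by (simp add: ft_def)
  ultimately have "(\<integral>\<xi>. ft f \<xi> * g \<xi> * sqrt (2 * pi) \<partial>lborel) = (\<integral>y. f y * ft g y * sqrt (2 * pi) \<partial>lborel)"
    by (simp only:)
  then show ?thesis by (simp only: integral_mult_left_zero) simp
qed

text \<open>Read off from the characteristic function of the standard normal distribution, at -u
  because \<open>char\<close> has the opposite sign in the exponent.\<close>

lemma ft_gaussian: "ft (\<lambda>\<xi>. of_real (exp (- (\<xi>\<^sup>2) / 2))) u = exp (- (u\<^sup>2) / 2)"
proof -
  have "complex_of_real (exp (- ((-u)\<^sup>2) / 2)) = char std_normal_distribution (-u)"
    by (simp add: char_std_normal_distribution)
  also have "\<dots> = (\<integral>x. std_normal_density x *\<^sub>R iexp (-u * x) \<partial>lborel)"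
    unfolding char_def by (subst integral_density) auto
  also have "\<dots> = (\<integral>x. of_real (exp (- (x\<^sup>2) / 2)) * cis (- (u * x)) / sqrt (2 * pi) \<partial>lborel)"
    by (intro Bochner_Integration.integral_cong) 
      (auto simp: std_normal_density_def cis_conv_exp scaleR_conv_of_real)
  also have "\<dots> = ft (\<lambda>\<xi>. of_real (exp (- (\<xi>\<^sup>2) / 2))) u"
    by (simp add: ft_def)
  finally show ?thesis by simp
qed

lemma gaussian_integrable: "integrable lborel (\<lambda>\<xi>::real. exp (- (\<xi>\<^sup>2) / 2))"
proof -
  have "integrable lborel (\<lambda>x. sqrt (2 * pi) * std_normal_density x)"
    by (intro integrable_mult_right) auto
  then show ?thesis by (simp add: std_normal_density_def)
qed

lemma gaussian_integral: "(\<integral>\<xi>. exp (- (\<xi>\<^sup>2) / 2 :: real) \<partial>lborel) = sqrt (2 * pi)"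
proof -
  have "(\<integral>x. sqrt (2 * pi) * std_normal_density x \<partial>lborel) = sqrt (2 * pi)" by simp
  then show ?thesis by (simp add: std_normal_density_def)
qed

lemma ft_gaussian_scaled:
  assumes "n > 0"
  shows "ft (\<lambda>\<xi>. of_real (exp (- ((\<xi> / n)\<^sup>2) / 2))) u = n * exp (- ((n * u)\<^sup>2) / 2)"
proof -
  have "(\<integral>\<xi>. of_real (exp (- ((\<xi> / n)\<^sup>2) / 2)) * cis (- (u * \<xi>)) \<partial>lborel) =
      \<bar>n\<bar> *\<^sub>R (\<integral>\<xi>. of_real (exp (- (((0 + n * \<xi>) / n)\<^sup>2) / 2)) * cis (- (u * (0 + n * \<xi>))) \<partial>lborel)"
    by (rule lborel_integral_real_affine) (use assms in auto)
  also have "\<dots> = n * (\<integral>\<xi>. of_real (exp (- (\<xi>\<^sup>2) / 2)) * cis (- ((n * u) * \<xi>)) \<partial>lborel)"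
    using assms by (simp add: scaleR_conv_of_real mult_ac)
  finally have "ft (\<lambda>\<xi>. of_real (exp (- ((\<xi> / n)\<^sup>2) / 2))) u = n * ft (\<lambda>\<xi>. of_real (exp (- (\<xi>\<^sup>2) / 2))) (n * u)"
    by (simp add: ft_def)
  then show ?thesis by (simp only: ft_gaussian of_real_mult)
qed

lemma gaussian_scaled_integrable:
  assumes "n > 0" shows "integrable lborel (\<lambda>\<xi>::real. exp (- ((\<xi> / n)\<^sup>2) / 2))"
  using lborel_integrable_real_affine[OF gaussian_integrable, of "1/n" 0] assms by simp

text \<open>h is the convolution of f with its conjugate reflection, which is why its transform is a
  nonnegative multiple of |ft f|^2. The factor \<open>sqrt (2 * pi)\<close> stems from the unitary
  normalisation.\<close>

lemma autocorrelation:
  fixes f :: "real \<Rightarrow> complex"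
  assumes f: "integrable lborel f"
  defines "h \<equiv> \<lambda>u. \<integral>x. f x * cnj (f (x - u)) \<partial>lborel"
  shows "integrable lborel h" "ft h \<xi> = sqrt (2 * pi) * (ft f \<xi> * cnj (ft f \<xi>))"
proof -
  have [measurable]: "f \<in> borel_measurable borel" using f by auto
  have fc: "integrable lborel (\<lambda>v. cnj (f v))" using f by simp
  have sh: "integrable lborel (\<lambda>u. cnj (f (x - u)) * cis (a * u))" for x a
    using integrable_cis_mult[OF lborel_integrable_real_affine[OF fc, of "-1" x], of a 0] by simp
  have nsh: "(\<integral>u. norm (f (x - u)) \<partial>lborel) = (\<integral>u. norm (f u) \<partial>lborel)" for x
    using lborel_integral_real_affine[of "-1" "\<lambda>u. norm (f u)" x] by simp
  have I: "integrable (lborel \<Otimes>\<^sub>M lborel) (\<lambda>(x, u). f x * cnj (f (x - u)) * cis (a * u))" for a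
  proof (rule lborel_pair.Fubini_integrable)
    show "integrable lborel (\<lambda>x. \<integral>u. norm (case (x, u) of (x, u) \<Rightarrow> f x * cnj (f (x - u)) * cis (a * u)) \<partial>lborel)"
      using f by (simp add: norm_mult nsh)
    show "AE x in lborel. integrable lborel (\<lambda>u. case (x, u) of (x, u) \<Rightarrow> f x * cnj (f (x - u)) * cis (a * u))"
      using sh[of _ a] by (intro AE_I2) (simp add: mult.assoc)
  qed measurable
  show "integrable lborel h"
    using lborel_pair.integrable_snd[OF I[of 0]] by (simp add: h_def)
  have "(\<integral>u. h u * cis (- (\<xi> * u)) \<partial>lborel) = (\<integral>u. (\<integral>x. f x * cnj (f (x - u)) * cis (-\<xi> * u) \<partial>lborel) \<partial>lborel)"
    by (simp add: h_def)
  also have "\<dots> = (\<integral>x. (\<integral>u. f x * cnj (f (x - u)) * cis (-\<xi> * u) \<partial>lborel) \<partial>lborel)"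
    by (rule lborel_pair.Fubini_integral[OF I])
  also have "\<dots> = (\<integral>x. f x * cis (- (\<xi> * x)) * cnj (\<integral>v. f v * cis (- (\<xi> * v)) \<partial>lborel) \<partial>lborel)"
  proof (rule Bochner_Integration.integral_cong[OF refl])
    fix x
    have "(\<integral>u. f x * cnj (f (x - u)) * cis (-\<xi> * u) \<partial>lborel) =
        \<bar>-1\<bar> *\<^sub>R (\<integral>v. f x * cnj (f (x - (x + -1 * v))) * cis (-\<xi> * (x + -1 * v)) \<partial>lborel)"
      by (rule lborel_integral_real_affine) simp
    also have "\<dots> = (\<integral>v. f x * cis (- (\<xi> * x)) * cnj (f v * cis (- (\<xi> * v))) \<partial>lborel)"
    proof -
      have "cis (-\<xi> * (x + -1 * v)) = cis (- (\<xi> * x)) * cis (\<xi> * v)" for v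
        by (simp add: cis_mult algebra_simps)
      then show ?thesis by (simp add: cis_cnj mult_ac)
    qed
    also have "\<dots> = f x * cis (- (\<xi> * x)) * cnj (\<integral>v. f v * cis (- (\<xi> * v)) \<partial>lborel)"
      by (simp only: integral_mult_right_zero Bochner_Integration.integral_cnj)
    finally show "(\<integral>u. f x * cnj (f (x - u)) * cis (-\<xi> * u) \<partial>lborel) = \<dots>" .
  qed
  also have "\<dots> = (\<integral>v. f v * cis (- (\<xi> * v)) \<partial>lborel) * cnj (\<integral>v. f v * cis (- (\<xi> * v)) \<partial>lborel)"
    by simp
  finally have *: "(\<integral>u. h u * cis (- (\<xi> * u)) \<partial>lborel) =
      (\<integral>v. f v * cis (- (\<xi> * v)) \<partial>lborel) * cnj (\<integral>v. f v * cis (- (\<xi> * v)) \<partial>lborel)" .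
  have s: "complex_of_real (sqrt (2 * pi)) * of_real (sqrt (2 * pi)) = 2 * pi"
    by (simp flip: of_real_mult)
  show "ft h \<xi> = sqrt (2 * pi) * (ft f \<xi> * cnj (ft f \<xi>))"
    unfolding ft_def * using s by (simp add: field_simps)
qed

lemma autocorrelation_tendsto:
  assumes f: "Cc f" and X: "X \<longlonglongrightarrow> 0"
  shows "(\<lambda>n. \<integral>x. f x * cnj (f (x - X n)) \<partial>lborel) \<longlonglongrightarrow> (\<integral>x. f x * cnj (f x) \<partial>lborel)"
proof -
  obtain B where B: "\<And>x. norm (f x) \<le> B" using Cc_bounded[OF f] by metis
  have [measurable]: "f \<in> borel_measurable borel" using Cc_measurable[OF f] by simp
  have fc: "continuous_on UNIV f" using f by (simp add: Cc_def)
  show ?thesis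
  proof (rule integral_dominated_convergence[where w="\<lambda>x. norm (f x) * B"])
    show "integrable lborel (\<lambda>x. norm (f x) * B)" using Cc_integrable[OF f] by simp
    show "AE x in lborel. (\<lambda>n. f x * cnj (f (x - X n))) \<longlonglongrightarrow> f x * cnj (f x)"
    proof (rule AE_I2)
      fix x
      have "(\<lambda>n. x - X n) \<longlonglongrightarrow> x - 0" by (intro tendsto_intros X)
      then have "(\<lambda>n. x - X n) \<longlonglongrightarrow> x" by simp
      then show "(\<lambda>n. f x * cnj (f (x - X n))) \<longlonglongrightarrow> f x * cnj (f x)"
        by (intro tendsto_intros continuous_on_tendsto_compose[OF fc]) auto
    qed
    show "AE x in lborel. norm (f x * cnj (f (x - X n))) \<le> norm (f x) * B" for n
      by (intro AE_I2) (simp add: norm_mult mult_left_mono B)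
  qed measurable
qed

text \<open>Integrating \<open>ft\<close> of the autocorrelation \<open>h\<close> of \<open>f\<close> against wider and wider Gaussians
  recovers \<open>h 0 = \<parallel>f\<parallel>\<^sup>2\<close>.\<close>

lemma Plancherel_Cc:
  assumes f: "Cc f"
  shows "L2 lborel (ft f)" "L2norm lborel (ft f) = L2norm lborel f"
proof -
  note fi = Cc_integrable[OF f]
  have [measurable]: "ft f \<in> borel_measurable borel" using ft_measurable[OF fi] .
  define h where "h u = (\<integral>x. f x * cnj (f (x - u)) \<partial>lborel)" for u
  have hi: "integrable lborel h" and fth: "\<And>\<xi>. ft h \<xi> = sqrt (2 * pi) * (ft f \<xi> * cnj (ft f \<xi>))"
    using autocorrelation[OF fi] unfolding h_def by auto
  have [measurable]: "h \<in> borel_measurable borel" using hi by auto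
  obtain B where B: "\<And>x. norm (f x) \<le> B" using Cc_bounded[OF f] by metis
  have [measurable]: "f \<in> borel_measurable borel" using Cc_measurable[OF f] by simp
  define K where "K = (\<integral>x. norm (f x) * B \<partial>lborel)"
  have hK: "norm (h u) \<le> K" for u
  proof -
    have "norm (h u) \<le> (\<integral>x. norm (f x * cnj (f (x - u))) \<partial>lborel)"
      unfolding h_def by (rule integral_norm_bound)
    also have "\<dots> \<le> K" unfolding K_def
    proof (rule integral_mono)
      have i: "integrable lborel (\<lambda>x. norm (f x) * B)" using fi by simp
      then show "integrable lborel (\<lambda>x. norm (f x * cnj (f (x - u))))"
        by (rule Bochner_Integration.integrable_bound)
          (auto intro!: AE_I2 simp: norm_mult intro: order_trans[OF mult_left_mono[OF B]])
      show "integrable lborel (\<lambda>x. norm (f x) * B)" by fact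
    qed (auto simp: norm_mult mult_left_mono B)
    finally show ?thesis .
  qed
  define G where "G n \<xi> = exp (- ((\<xi> / real (Suc n))\<^sup>2) / 2)" for n \<xi>
  have [measurable]: "G n \<in> borel_measurable borel" for n unfolding G_def by measurable
  have Gi: "integrable lborel (G n)" for n
    using gaussian_scaled_integrable[of "real (Suc n)"] unfolding G_def by simp
  have int: "integrable lborel (\<lambda>\<xi>. G n \<xi> * (norm (ft f \<xi>))\<^sup>2)" for n
  proof (rule Bochner_Integration.integrable_bound)
    let ?C = "((\<integral>x. norm (f x) \<partial>lborel) / sqrt (2 * pi))\<^sup>2"
    show "integrable lborel (\<lambda>\<xi>. G n \<xi> * ?C)" using Gi by simp
    show "AE x in lborel. norm (G n x * (cmod (ft f x))\<^sup>2) \<le> norm (G n x * ?C)"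
      by (intro AE_I2) (auto simp: norm_mult abs_mult intro!: mult_left_mono power_mono norm_ft_le)
  qed measurable
  \<comment> \<open>Multiplication formula against a wide Gaussian, whose transform concentrates at
    0. The substitution u = v / \<open>Suc n\<close> moves the dilation into h and leaves a fixed
    Gaussian weight, ready for dominated convergence.\<close>
  have eq: "complex_of_real (\<integral>\<xi>. G n \<xi> * (norm (ft f \<xi>))\<^sup>2 \<partial>lborel) =
     (\<integral>v. h (v / real (Suc n)) * of_real (exp (- (v\<^sup>2) / 2)) \<partial>lborel) / sqrt (2 * pi)" for n
  proof -
    let ?n = "real (Suc n)"
    have "complex_of_real (\<integral>\<xi>. G n \<xi> * (norm (ft f \<xi>))\<^sup>2 \<partial>lborel) =
        (\<integral>\<xi>. of_real (G n \<xi> * (norm (ft f \<xi>))\<^sup>2) \<partial>lborel)"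
      by (rule integral_complex_of_real[symmetric])
    also have "\<dots> = (\<integral>\<xi>. ft h \<xi> * of_real (G n \<xi>) / sqrt (2 * pi) \<partial>lborel)"
      by (simp add: fth complex_norm_square mult_ac del: of_real_power)
    also have "\<dots> = (\<integral>u. h u * ft (\<lambda>\<xi>. of_real (G n \<xi>)) u \<partial>lborel) / sqrt (2 * pi)"
      using ft_mult_formula[OF hi, of "\<lambda>\<xi>. of_real (G n \<xi>)"] Gi by simp
    also have "(\<integral>u. h u * ft (\<lambda>\<xi>. of_real (G n \<xi>)) u \<partial>lborel) =
        (\<integral>u. h u * of_real (?n * exp (- ((?n * u)\<^sup>2) / 2)) \<partial>lborel)"
      using ft_gaussian_scaled[of ?n] by (simp add: G_def)
    also have "\<dots> = \<bar>1/?n\<bar> *\<^sub>R (\<integral>v. h (0 + 1/?n * v) * of_real (?n * exp (- ((?n * (0 + 1/?n * v))\<^sup>2) / 2)) \<partial>lborel)"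
      by (rule lborel_integral_real_affine) simp
    also have "\<dots> = (\<integral>v. (1/?n) *\<^sub>R (h (0 + 1/?n * v) * of_real (?n * exp (- ((?n * (0 + 1/?n * v))\<^sup>2) / 2))) \<partial>lborel)"
      by simp
    also have "\<dots> = (\<integral>v. h (v / ?n) * of_real (exp (- (v\<^sup>2) / 2)) \<partial>lborel)"
      by (intro Bochner_Integration.integral_cong refl) (simp add: scaleR_conv_of_real field_simps del: of_nat_Suc)
    finally show ?thesis .
  qed
  have h0: "h 0 = of_real ((L2norm lborel f)\<^sup>2)"
    unfolding h_def L2norm_power2 by (simp add: complex_norm_square flip: integral_complex_of_real del: of_real_power)
  have "(\<lambda>n. \<integral>v. h (v / real (Suc n)) * of_real (exp (- (v\<^sup>2) / 2)) \<partial>lborel)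
      \<longlonglongrightarrow> (\<integral>v. h 0 * of_real (exp (- (v\<^sup>2) / 2)) \<partial>lborel)"
  proof (rule integral_dominated_convergence[where w="\<lambda>v. K * exp (- (v\<^sup>2) / 2)"])
    show "integrable lborel (\<lambda>v. K * exp (- (v\<^sup>2) / 2))" using gaussian_integrable by simp
    show "AE v in lborel. (\<lambda>n. h (v / real (Suc n)) * of_real (exp (- (v\<^sup>2) / 2)))
        \<longlonglongrightarrow> h 0 * of_real (exp (- (v\<^sup>2) / 2))"
    proof (intro AE_I2 tendsto_intros)
      fix v :: real
      have "(\<lambda>n. v * inverse (real (Suc n))) \<longlonglongrightarrow> v * 0"
        by (intro tendsto_intros LIMSEQ_inverse_real_of_nat)
      then show "(\<lambda>n. h (v / real (Suc n))) \<longlonglongrightarrow> h 0"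
        unfolding h_def using autocorrelation_tendsto[OF f, of "\<lambda>n. v / real (Suc n)"]
        by (simp add: divide_inverse)
    qed
    show "AE v in lborel. norm (h (v / real (Suc n)) * of_real (exp (- (v\<^sup>2) / 2))) \<le> K * exp (- (v\<^sup>2) / 2)" for n
      by (intro AE_I2) (simp add: norm_mult mult_right_mono hK)
  qed measurable
  also have "(\<integral>v. h 0 * of_real (exp (- (v\<^sup>2) / 2)) \<partial>lborel) = h 0 * sqrt (2 * pi)"
    by (simp only: integral_mult_right_zero integral_complex_of_real gaussian_integral)
  finally have "(\<lambda>n. (\<integral>v. h (v / real (Suc n)) * of_real (exp (- (v\<^sup>2) / 2)) \<partial>lborel) / sqrt (2 * pi))
      \<longlonglongrightarrow> h 0 * sqrt (2 * pi) / sqrt (2 * pi)" by (rule tendsto_divide) auto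
  then have "(\<lambda>n. complex_of_real (\<integral>\<xi>. G n \<xi> * (norm (ft f \<xi>))\<^sup>2 \<partial>lborel)) \<longlonglongrightarrow> of_real ((L2norm lborel f)\<^sup>2)"
    unfolding eq by (simp add: h0)
  then have ilim: "(\<lambda>n. \<integral>\<xi>. G n \<xi> * (norm (ft f \<xi>))\<^sup>2 \<partial>lborel) \<longlonglongrightarrow> (L2norm lborel f)\<^sup>2"
    by (simp only: tendsto_of_real_iff)
  \<comment> \<open>Integrability of |ft f|^2 is not known beforehand. The Gaussians increase to 1,
    so monotone convergence supplies it along with the value.\<close>
  have mono: "AE x in lborel. mono (\<lambda>n. G n x * (cmod (ft f x))\<^sup>2)"
  proof (intro AE_I2 monoI mult_right_mono)
    fix x :: real and m n :: nat assume "m \<le> n"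
    then have "\<bar>x / real (Suc n)\<bar> \<le> \<bar>x / real (Suc m)\<bar>"
      by (simp add: frac_le)
    then have "(x / real (Suc n))\<^sup>2 \<le> (x / real (Suc m))\<^sup>2" by (rule abs_le_square_iff[THEN iffD1])
    then show "G m x \<le> G n x" by (simp add: G_def)
  qed simp
  have lim: "AE x in lborel. (\<lambda>n. G n x * (cmod (ft f x))\<^sup>2) \<longlonglongrightarrow> (cmod (ft f x))\<^sup>2"
  proof (rule AE_I2)
    fix x :: real
    have "(\<lambda>n. x / real (Suc n)) \<longlonglongrightarrow> 0"
      using tendsto_mult[OF tendsto_const[of x] LIMSEQ_inverse_real_of_nat] by (simp only: divide_inverse mult_zero_right)
    then have "(\<lambda>n. exp (- ((x / real (Suc n))\<^sup>2) / 2) * (cmod (ft f x))\<^sup>2) \<longlonglongrightarrow> exp (- (0\<^sup>2) / 2) * (cmod (ft f x))\<^sup>2"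
      by (intro tendsto_intros) auto
    then show "(\<lambda>n. G n x * (cmod (ft f x))\<^sup>2) \<longlonglongrightarrow> (cmod (ft f x))\<^sup>2"
      unfolding G_def by (simp del: of_nat_Suc)
  qed
  have nn: "AE x in lborel. 0 \<le> G n x * (cmod (ft f x))\<^sup>2" for n by (intro AE_I2) (simp add: G_def)
  have m: "(\<lambda>x. (cmod (ft f x))\<^sup>2) \<in> borel_measurable lborel" by measurable
  note R = integral_monotone_convergence_nonneg[OF int mono nn lim ilim m]
  show "L2 lborel (ft f)" using R(1) by (simp add: L2_def)
  show "L2norm lborel (ft f) = L2norm lborel f" using R(2) unfolding L2norm_def[of _ "ft f"] by simp
qed

text \<open>Approximation by \<open>Cc\<close> functions and Fatou give only the inequality, but for
  every f. Applied to \<open>g n - f\<close>, this inequality makes the transforms converge in L2,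
  which upgrades it to an equality.\<close>

theorem Plancherel_L1_L2:
  assumes f1: "integrable lborel f" and f2: "L2 lborel f"
  shows "L2 lborel (ft f)" "L2norm lborel (ft f) = L2norm lborel f"
proof -
  have contr: "L2 lborel (ft f) \<and> L2norm lborel (ft f) \<le> L2norm lborel f"
    if f1: "integrable lborel f" and f2: "L2 lborel f" for f
  proof -
    obtain g where g: "\<And>n. Cc (g n)" "(\<lambda>n. \<integral>x. norm (g n x - f x) \<partial>lborel) \<longlonglongrightarrow> 0"
      "(\<lambda>n. L2norm lborel (\<lambda>x. g n x - f x)) \<longlonglongrightarrow> 0" using Cc_dense[OF f1 f2] by blast
    have lim: "(\<lambda>n. ft (g n) \<xi>) \<longlonglongrightarrow> ft f \<xi>" for \<xi>
    proof (rule LIM_zero_cancel, rule Lim_null_comparison)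
      show "(\<lambda>n. (\<integral>x. norm (g n x - f x) \<partial>lborel) / sqrt (2 * pi)) \<longlonglongrightarrow> 0"
        using tendsto_divide[OF g(2) tendsto_const[of "sqrt (2 * pi)"]] by simp
      show "\<forall>\<^sub>F n in sequentially. norm (ft (g n) \<xi> - ft f \<xi>) \<le> (\<integral>x. norm (g n x - f x) \<partial>lborel) / sqrt (2 * pi)"
        using norm_ft_le[of "\<lambda>x. g n x - f x" \<xi> for n] by (simp add: ft_diff Cc_integrable[OF g(1)] f1)
    qed
    have nl: "(\<lambda>n. L2norm lborel (ft (g n))) \<longlonglongrightarrow> L2norm lborel f"
      using L2_conv[OF f2 Cc_L2[OF g(1)] g(3)] Plancherel_Cc[OF g(1)] by simp
    have *: "L2 lborel (ft f) \<and> L2norm lborel (ft f) \<le> L2norm lborel f + e" if "e > 0" for e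
    proof -
      have "\<forall>\<^sub>F n in sequentially. L2norm lborel (ft (g n)) < L2norm lborel f + e"
        using order_tendstoD(2)[OF nl] that by simp
      then have ev: "\<forall>\<^sub>F n in sequentially. L2norm lborel (ft (g n)) \<le> L2norm lborel f + e"
        by eventually_elim simp
      have "ft f \<in> borel_measurable lborel" using ft_measurable[OF f1] by simp
      from L2_limit[OF Plancherel_Cc(1)[OF g(1)] this AE_I2[OF lim] ev] show ?thesis by blast
    qed
    show ?thesis
    proof
      show "L2 lborel (ft f)" by (rule conjunct1[OF *[OF zero_less_one]])
      show "L2norm lborel (ft f) \<le> L2norm lborel f" by (rule field_le_epsilon, rule conjunct2[OF *])
    qed
  qed
  show "L2 lborel (ft f)" using contr[OF f1 f2] by simp
  obtain g where "(\<forall>n. Cc (g n)) \<and> (\<lambda>n. \<integral>x. norm (g n x - f x) \<partial>lborel) \<longlonglongrightarrow> 0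
      \<and> (\<lambda>n. L2norm lborel (\<lambda>x. g n x - f x)) \<longlonglongrightarrow> 0"
    using Cc_dense[OF f1 f2] ..
  then have g: "\<And>n. Cc (g n)" "(\<lambda>n. L2norm lborel (\<lambda>x. g n x - f x)) \<longlonglongrightarrow> 0" by auto
  have "ft (\<lambda>x. g n x - f x) = (\<lambda>\<xi>. ft (g n) \<xi> - ft f \<xi>)" for n
    by (intro ext ft_diff Cc_integrable g f1)
  then have "L2norm lborel (\<lambda>\<xi>. ft (g n) \<xi> - ft f \<xi>) \<le> L2norm lborel (\<lambda>x. g n x - f x)" for n
    using contr[of "\<lambda>x. g n x - f x"] Cc_integrable[OF g(1)] L2_diff[OF Cc_L2[OF g(1)] f2] f1
    by auto
  then have "(\<lambda>n. L2norm lborel (\<lambda>\<xi>. ft (g n) \<xi> - ft f \<xi>)) \<longlonglongrightarrow> 0"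
    by (intro Lim_null_comparison[OF _ g(2)]) simp
  from L2_conv[OF conjunct1[OF contr[OF f1 f2]] Plancherel_Cc(1)[OF g(1)] this]
  have "(\<lambda>n. L2norm lborel (g n)) \<longlonglongrightarrow> L2norm lborel (ft f)"
    using Plancherel_Cc(2)[OF g(1)] by simp
  moreover have "(\<lambda>n. L2norm lborel (g n)) \<longlonglongrightarrow> L2norm lborel f"
    using L2_conv[OF f2 Cc_L2[OF g(1)] g(2)] .
  ultimately show "L2norm lborel (ft f) = L2norm lborel f" by (rule LIMSEQ_unique)
qed

section \<open>Extension of the Fourier transform to L2\<close>

definition trunc :: "nat \<Rightarrow> (real \<Rightarrow> complex) \<Rightarrow> real \<Rightarrow> complex" where
  "trunc n f x = indicator {-real n..real n} x *\<^sub>R f x"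

text \<open>Cauchy-Schwarz against the indicator function. The factor \<open>sqrt (b - a)\<close>
  later becomes \<open>sqrt (2 * n)\<close>, which turns commutators of size 1/n into errors of
  order n^(-1/2).\<close>

lemma L2_integrable_on_bounded:
  assumes "L2 lborel f"
  shows "integrable lborel (\<lambda>x. indicator {a..b} x *\<^sub>R f x)"
    and "a \<le> b \<Longrightarrow> (\<integral>x. indicator {a..b} x * norm (f x) \<partial>lborel) \<le> sqrt (b - a) * L2norm lborel f"
proof -
  note [measurable] = L2D(1)[OF assms, simplified]
  have I: "L2 lborel (\<lambda>x. indicator {a..b} x :: real)" for a b :: real
  proof -
    have "(norm (indicator {a..b} x :: real))\<^sup>2 = indicator {a..b} x" for x
      by (simp add: indicator_def)
    moreover have "integrable lborel (indicat_real {a..b})"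
      by (rule integrable_real_indicator) (auto simp: emeasure_lborel_Icc_eq)
    ultimately show ?thesis unfolding L2_def by simp
  qed
  show "integrable lborel (\<lambda>x. indicator {a..b} x *\<^sub>R f x)"
    by (rule Bochner_Integration.integrable_bound[OF L2_mult_norm_integrable[OF I[of a b] assms]]) auto
  show "(\<integral>x. indicator {a..b} x * norm (f x) \<partial>lborel) \<le> sqrt (b - a) * L2norm lborel f" if "a \<le> b"
  proof -
    have "L2norm lborel (\<lambda>x. indicator {a..b} x :: real) = sqrt (b - a)"
      using that unfolding L2norm_def by (simp add: power2_eq_square flip: indicator_inter_arith)
    then show ?thesis using L2_Cauchy_Schwarz[OF I[of a b] assms] by simp
  qed
qed

lemma trunc_integrable: "L2 lborel f \<Longrightarrow> integrable lborel (trunc n f)"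
  unfolding trunc_def[abs_def] by (rule L2_integrable_on_bounded)

lemma trunc_L2:
  assumes "L2 lborel f" shows "L2 lborel (trunc n f)"
proof (rule L2_bound[OF assms])
  note [measurable] = L2D(1)[OF assms, simplified]
  show "trunc n f \<in> borel_measurable lborel" unfolding trunc_def[abs_def] by measurable
qed (auto simp: trunc_def indicator_def)

lemma L2_dominated_conv:
  fixes f :: "'a \<Rightarrow> 'b::{banach, second_countable_topology}"
  assumes f: "L2 M f" and g: "\<And>n. g n \<in> borel_measurable M"
    and lim: "\<And>x. (\<lambda>n. g n x) \<longlonglongrightarrow> f x" and le: "\<And>n x. norm (g n x) \<le> norm (f x)"
  shows "(\<lambda>n. L2norm M (\<lambda>x. g n x - f x)) \<longlonglongrightarrow> 0"
proof -
  note [measurable] = L2D(1)[OF f] g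
  have "(\<lambda>n. \<integral>x. (norm (g n x - f x))\<^sup>2 \<partial>M) \<longlonglongrightarrow> (\<integral>x. 0 \<partial>M)"
  proof (rule integral_dominated_convergence[where w="\<lambda>x. 4 * (norm (f x))\<^sup>2"])
    show "integrable M (\<lambda>x. 4 * (norm (f x))\<^sup>2)" using L2D(2)[OF f] by simp
    show "AE x in M. (\<lambda>n. (norm (g n x - f x))\<^sup>2) \<longlonglongrightarrow> 0"
    proof (rule AE_I2)
      fix x
      have "(\<lambda>n. (norm (g n x - f x))\<^sup>2) \<longlonglongrightarrow> (norm (f x - f x))\<^sup>2" by (intro tendsto_intros lim)
      then show "(\<lambda>n. (norm (g n x - f x))\<^sup>2) \<longlonglongrightarrow> 0" by simp
    qed
    show "AE x in M. norm ((norm (g n x - f x))\<^sup>2) \<le> 4 * (norm (f x))\<^sup>2" for n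
    proof (rule AE_I2)
      fix x
      have "norm (g n x - f x) \<le> 2 * norm (f x)"
        using norm_triangle_ineq4[of "g n x" "f x"] le[of n x] by linarith
      then have "(norm (g n x - f x))\<^sup>2 \<le> (2 * norm (f x))\<^sup>2" by (intro power_mono) auto
      then show "norm ((norm (g n x - f x))\<^sup>2) \<le> 4 * (norm (f x))\<^sup>2" by (simp add: power_mult_distrib)
    qed
  qed measurable
  then have "(\<lambda>n. sqrt (\<integral>x. (norm (g n x - f x))\<^sup>2 \<partial>M)) \<longlonglongrightarrow> sqrt 0" by (intro tendsto_intros) simp
  then show ?thesis by (simp add: L2norm_def)
qed

lemma trunc_tendsto:
  assumes "L2 lborel f"
  shows "(\<lambda>n. L2norm lborel (\<lambda>x. trunc n f x - f x)) \<longlonglongrightarrow> 0"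
proof (rule L2_dominated_conv[OF assms])
  show "trunc n f \<in> borel_measurable lborel" for n using trunc_L2[OF assms] by (rule L2D)
  show "(\<lambda>n. trunc n f x) \<longlonglongrightarrow> f x" for x
  proof (rule tendsto_eventually)
    obtain m0 :: nat where m0: "real m0 \<ge> \<bar>x\<bar>" using real_arch_simple by blast
    show "\<forall>\<^sub>F n in sequentially. trunc n f x = f x"
    proof (rule eventually_sequentiallyI[of m0])
      fix n assume "m0 \<le> n"
      then have "real n \<ge> \<bar>x\<bar>" using m0 by linarith
      then show "trunc n f x = f x" by (auto simp: trunc_def indicator_def)
    qed
  qed
qed (auto simp: trunc_def indicator_def)

text \<open>An L2 limit of transforms of truncations, hence fixed only up to null sets: pointwise
  statements about \<open>fourier\<close> hold almost everywhere.\<close>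

definition fourier :: "(real \<Rightarrow> complex) \<Rightarrow> real \<Rightarrow> complex" where
  "fourier f = (SOME g. L2 lborel g \<and> (\<lambda>n. L2norm lborel (\<lambda>\<xi>. ft (trunc n f) \<xi> - g \<xi>)) \<longlonglongrightarrow> 0)"

lemma ft_L2norm_diff:
  assumes "integrable lborel f" "L2 lborel f" "integrable lborel g" "L2 lborel g"
  shows "L2norm lborel (\<lambda>\<xi>. ft f \<xi> - ft g \<xi>) = L2norm lborel (\<lambda>x. f x - g x)"
proof -
  have "(\<lambda>\<xi>. ft f \<xi> - ft g \<xi>) = ft (\<lambda>x. f x - g x)"
    by (intro ext ft_diff[symmetric] assms)
  then show ?thesis using Plancherel_L1_L2[of "\<lambda>x. f x - g x"] assms by (simp add: L2_diff)
qed

lemma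
  assumes f: "L2 lborel f"
  shows fourier_L2: "L2 lborel (fourier f)"
    and fourier_trunc: "(\<lambda>n. L2norm lborel (\<lambda>\<xi>. ft (trunc n f) \<xi> - fourier f \<xi>)) \<longlonglongrightarrow> 0"
proof -
  have "\<exists>g. L2 lborel g \<and> (\<lambda>n. L2norm lborel (\<lambda>\<xi>. ft (trunc n f) \<xi> - g \<xi>)) \<longlonglongrightarrow> 0"
  proof (rule L2_complete)
    show "L2 lborel (ft (trunc n f))" for n
      by (intro Plancherel_L1_L2 trunc_integrable trunc_L2 f)
    fix e :: real assume e: "e > 0"
    have "\<forall>\<^sub>F n in sequentially. L2norm lborel (\<lambda>x. trunc n f x - f x) < e/2"
      using order_tendstoD(2)[OF trunc_tendsto[OF f], of "e/2"] e by simp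
    then obtain N where N: "\<And>n. n \<ge> N \<Longrightarrow> L2norm lborel (\<lambda>x. trunc n f x - f x) < e/2"
      by (auto simp: eventually_sequentially)
    show "\<exists>N. \<forall>m\<ge>N. \<forall>n\<ge>N. L2norm lborel (\<lambda>x. ft (trunc m f) x - ft (trunc n f) x) \<le> e"
    proof (intro exI[of _ N] allI impI)
      fix m n assume mn: "m \<ge> N" "n \<ge> N"
      have "L2norm lborel (\<lambda>x. ft (trunc m f) x - ft (trunc n f) x) = L2norm lborel (\<lambda>x. trunc m f x - trunc n f x)"
        by (intro ft_L2norm_diff trunc_integrable trunc_L2 f)
      also have "\<dots> \<le> L2norm lborel (\<lambda>x. trunc m f x - f x) + L2norm lborel (\<lambda>x. f x - trunc n f x)"
        by (intro L2norm_triangle_diff trunc_L2 f)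
      also have "\<dots> \<le> e"
        using N[OF mn(1)] N[OF mn(2)] L2norm_minus_commute[of lborel f "trunc n f"] by linarith
      finally show "L2norm lborel (\<lambda>x. ft (trunc m f) x - ft (trunc n f) x) \<le> e" .
    qed
  qed
  from someI_ex[OF this]
  show "L2 lborel (fourier f)"
    "(\<lambda>n. L2norm lborel (\<lambda>\<xi>. ft (trunc n f) \<xi> - fourier f \<xi>)) \<longlonglongrightarrow> 0"
    unfolding fourier_def by blast+
qed

text \<open>The isometry that links both transforms. The case h = 0 is Plancherel's theorem, h = f
  shows that they agree almost everywhere, and \<open>h = cutoff n f\<close> will show that
  localized transforms converge to \<open>fourier f\<close>.\<close>

lemma fourier_dist:
  assumes h: "integrable lborel h" "L2 lborel h" and f: "L2 lborel f"
  shows "L2norm lborel (\<lambda>\<xi>. ft h \<xi> - fourier f \<xi>) = L2norm lborel (\<lambda>x. h x - f x)"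
proof (rule LIMSEQ_unique)
  have hL: "L2 lborel (ft h)" by (rule Plancherel_L1_L2[OF h])
  have tL: "L2 lborel (ft (trunc n f))" for n by (intro Plancherel_L1_L2 trunc_integrable trunc_L2 f)
  have "(\<lambda>n. L2norm lborel (\<lambda>\<xi>. ft h \<xi> - ft (trunc n f) \<xi>)) \<longlonglongrightarrow> L2norm lborel (\<lambda>\<xi>. ft h \<xi> - fourier f \<xi>)"
  proof (rule L2_conv[OF L2_diff[OF hL fourier_L2[OF f]] L2_diff[OF hL tL]])
    show "(\<lambda>n. L2norm lborel (\<lambda>x. ft h x - ft (trunc n f) x - (ft h x - fourier f x))) \<longlonglongrightarrow> 0"
      using fourier_trunc[OF f] by (subst (asm) L2norm_minus_commute) simp
  qed
  then show "(\<lambda>n. L2norm lborel (\<lambda>x. h x - trunc n f x)) \<longlonglongrightarrow> L2norm lborel (\<lambda>\<xi>. ft h \<xi> - fourier f \<xi>)"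
    by (simp add: ft_L2norm_diff[OF h trunc_integrable[OF f] trunc_L2[OF f]])
  show "(\<lambda>n. L2norm lborel (\<lambda>x. h x - trunc n f x)) \<longlonglongrightarrow> L2norm lborel (\<lambda>x. h x - f x)"
  proof (rule L2_conv[OF L2_diff[OF h(2) f] L2_diff[OF h(2) trunc_L2[OF f]]])
    show "(\<lambda>n. L2norm lborel (\<lambda>x. h x - trunc n f x - (h x - f x))) \<longlonglongrightarrow> 0"
      using trunc_tendsto[OF f] by (subst (asm) L2norm_minus_commute) simp
  qed
qed

theorem Plancherel:
  assumes "L2 lborel f" shows "L2norm lborel (fourier f) = L2norm lborel f"
  using fourier_dist[of "\<lambda>x. 0" f] assms by (simp add: ft_def L2norm_def)

lemma fourier_eq_ft:
  assumes "integrable lborel f" "L2 lborel f"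
  shows "AE \<xi> in lborel. fourier f \<xi> = ft f \<xi>"
proof -
  have "AE \<xi> in lborel. ft f \<xi> - fourier f \<xi> = 0"
    by (rule L2norm_eq_0_AE[OF L2_diff[OF Plancherel_L1_L2(1)[OF assms] fourier_L2[OF assms(2)]]])
      (simp add: fourier_dist assms)
  then show ?thesis by eventually_elim simp
qed

text \<open>The two truncations are removed one after the other, each time against a factor that
  stays fixed in L2.\<close>

lemma fourier_mult_formula:
  assumes f: "L2 lborel f" and g: "L2 lborel g"
  shows "(\<integral>\<xi>. fourier f \<xi> * g \<xi> \<partial>lborel) = (\<integral>y. f y * fourier g y \<partial>lborel)"
proof -
  have tL: "L2 lborel (ft (trunc n f))" if "L2 lborel f" for n f
    by (intro Plancherel_L1_L2 trunc_integrable trunc_L2 that)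
  have 1: "(\<integral>\<xi>. fourier f \<xi> * trunc m g \<xi> \<partial>lborel) = (\<integral>y. f y * ft (trunc m g) y \<partial>lborel)" for m
  proof (rule LIMSEQ_unique)
    show "(\<lambda>n. \<integral>\<xi>. ft (trunc n f) \<xi> * trunc m g \<xi> \<partial>lborel) \<longlonglongrightarrow> (\<integral>\<xi>. fourier f \<xi> * trunc m g \<xi> \<partial>lborel)"
      by (intro L2_mult_conv fourier_L2 fourier_trunc tL trunc_L2 f g)
    have "(\<lambda>n. \<integral>\<xi>. trunc n f \<xi> * ft (trunc m g) \<xi> \<partial>lborel) \<longlonglongrightarrow> (\<integral>y. f y * ft (trunc m g) y \<partial>lborel)"
      by (intro L2_mult_conv tL trunc_L2 f g trunc_tendsto)
    then show "(\<lambda>n. \<integral>\<xi>. ft (trunc n f) \<xi> * trunc m g \<xi> \<partial>lborel) \<longlonglongrightarrow> (\<integral>y. f y * ft (trunc m g) y \<partial>lborel)"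
      by (simp add: ft_mult_formula trunc_integrable f g)
  qed
  show ?thesis
  proof (rule LIMSEQ_unique)
    show "(\<lambda>m. \<integral>\<xi>. fourier f \<xi> * trunc m g \<xi> \<partial>lborel) \<longlonglongrightarrow> (\<integral>\<xi>. fourier f \<xi> * g \<xi> \<partial>lborel)"
      using L2_mult_conv[OF g trunc_L2[OF g] trunc_tendsto[OF g] fourier_L2[OF f]] by (simp add: mult.commute)
    have "(\<lambda>m. \<integral>y. f y * ft (trunc m g) y \<partial>lborel) \<longlonglongrightarrow> (\<integral>y. f y * fourier g y \<partial>lborel)"
      using L2_mult_conv[OF fourier_L2[OF g] tL[OF g] fourier_trunc[OF g] f] by (simp add: mult.commute)
    then show "(\<lambda>m. \<integral>\<xi>. fourier f \<xi> * trunc m g \<xi> \<partial>lborel) \<longlonglongrightarrow> (\<integral>y. f y * fourier g y \<partial>lborel)"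
      by (simp add: 1)
  qed
qed

lemma L2_cnj: "L2 M f \<Longrightarrow> L2 M (\<lambda>x. cnj (f x))"
  by (auto simp: L2_def)

lemma L2norm_cnj: "L2norm M (\<lambda>x. cnj (f x)) = L2norm M f"
  by (simp add: L2norm_def)

lemma L2norm_diff_power2:
  assumes u: "L2 M u" and v: "L2 M v"
  shows "(L2norm M (\<lambda>x. u x - v x))\<^sup>2 = (L2norm M u)\<^sup>2 + (L2norm M v)\<^sup>2 - 2 * Re (\<integral>x. u x * cnj (v x) \<partial>M)"
proof -
  have i: "integrable M (\<lambda>x. u x * cnj (v x))" by (intro L2_mult_integrable u L2_cnj v)
  have "(norm (a - b))\<^sup>2 = (norm a)\<^sup>2 + (norm b)\<^sup>2 - 2 * Re (a * cnj b)" for a b :: complex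
    unfolding cmod_power2 by (simp add: power2_eq_square algebra_simps)
  then have "(\<integral>x. (norm (u x - v x))\<^sup>2 \<partial>M) = (\<integral>x. (norm (u x))\<^sup>2 + (norm (v x))\<^sup>2 - 2 * Re (u x * cnj (v x)) \<partial>M)"
    by (simp only:)
  also have "\<dots> = (\<integral>x. (norm (u x))\<^sup>2 + (norm (v x))\<^sup>2 \<partial>M) - (\<integral>x. 2 * Re (u x * cnj (v x)) \<partial>M)"
    by (rule Bochner_Integration.integral_diff) (use L2D(2)[OF u] L2D(2)[OF v] integrable_Re[OF i] in \<open>auto simp del: times_complex.simps\<close>)
  also have "\<dots> = (L2norm M u)\<^sup>2 + (L2norm M v)\<^sup>2 - 2 * Re (\<integral>x. u x * cnj (v x) \<partial>M)"
    using L2D(2)[OF u] L2D(2)[OF v] by (simp add: L2norm_power2 integral_Re[OF i] del: times_complex.simps)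
  finally show ?thesis by (simp add: L2norm_power2)
qed

text \<open>Conjugating before and after makes \<open>fourier\<close> its own inverse, so no second
  transform is introduced. When the squared distance of the two sides is expanded, both squared
  norms and the mixed integral equal the squared norm of f, and the distance is 0.\<close>

theorem fourier_inversion:
  assumes f: "L2 lborel f"
  shows "AE y in lborel. fourier (\<lambda>\<xi>. cnj (fourier f \<xi>)) y = cnj (f y)"
proof -
  let ?u = "fourier (\<lambda>\<xi>. cnj (fourier f \<xi>))"
  note F = fourier_L2[OF f] and Fc = L2_cnj[OF fourier_L2[OF f]]
  note u = fourier_L2[OF Fc]
  have "(\<integral>y. ?u y * f y \<partial>lborel) = (\<integral>\<xi>. cnj (fourier f \<xi>) * fourier f \<xi> \<partial>lborel)"
    by (rule fourier_mult_formula[OF Fc f])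
  also have "\<dots> = (\<integral>\<xi>. complex_of_real ((norm (fourier f \<xi>))\<^sup>2) \<partial>lborel)"
    by (simp add: complex_norm_square mult.commute del: of_real_power)
  also have "\<dots> = of_real ((L2norm lborel f)\<^sup>2)"
    by (simp only: integral_complex_of_real flip: L2norm_power2) (simp add: Plancherel[OF f])
  finally have "(\<integral>y. ?u y * cnj (cnj (f y)) \<partial>lborel) = of_real ((L2norm lborel f)\<^sup>2)" by simp
  then have "(L2norm lborel (\<lambda>y. ?u y - cnj (f y)))\<^sup>2 = 0"
    unfolding L2norm_diff_power2[OF u L2_cnj[OF f]] Plancherel[OF Fc] L2norm_cnj Plancherel[OF f] by simp
  then have "AE y in lborel. ?u y - cnj (f y) = 0"
    by (intro L2norm_eq_0_AE L2_diff u L2_cnj f) simp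
  then show ?thesis by eventually_elim simp
qed

lemma Parseval:
  assumes f: "L2 lborel f" and h: "L2 lborel h"
  shows "(\<integral>\<xi>. fourier f \<xi> * cnj (fourier h \<xi>) \<partial>lborel) = (\<integral>y. f y * cnj (h y) \<partial>lborel)"
proof -
  note Fc = L2_cnj[OF fourier_L2[OF h]]
  have "(\<integral>\<xi>. fourier f \<xi> * cnj (fourier h \<xi>) \<partial>lborel) = (\<integral>y. f y * fourier (\<lambda>\<xi>. cnj (fourier h \<xi>)) y \<partial>lborel)"
    by (rule fourier_mult_formula[OF f Fc])
  also have "\<dots> = (\<integral>y. f y * cnj (h y) \<partial>lborel)"
  proof (rule integral_cong_AE)
    show "AE x in lborel. f x * fourier (\<lambda>\<xi>. cnj (fourier h \<xi>)) x = f x * cnj (h x)"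
      using fourier_inversion[OF h] by eventually_elim simp
  qed (use L2D(1)[OF f] L2D(1)[OF h] L2D(1)[OF fourier_L2[OF Fc]] in simp_all)
  finally show ?thesis .
qed

text \<open>Surjectivity of the transform, from which weak derivatives will be constructed.\<close>

lemma fourier_inverse_ex:
  assumes g: "L2 lborel g"
  shows "\<exists>f. L2 lborel f \<and> L2norm lborel f = L2norm lborel g \<and> (AE \<xi> in lborel. fourier f \<xi> = g \<xi>)"
proof (intro exI conjI)
  let ?f = "\<lambda>y. cnj (fourier (\<lambda>\<xi>. cnj (g \<xi>)) y)"
  note gc = L2_cnj[OF g]
  show "L2 lborel ?f" by (intro L2_cnj fourier_L2 g)
  show "L2norm lborel ?f = L2norm lborel g" by (simp add: L2norm_cnj Plancherel[OF gc])
  show "AE \<xi> in lborel. fourier ?f \<xi> = g \<xi>" using fourier_inversion[OF gc] by simp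
qed

section \<open>Test functions and weak derivatives\<close>

definition smooth :: "(real \<Rightarrow> real) \<Rightarrow> bool" where
  "smooth f \<longleftrightarrow> (\<forall>n x. (deriv ^^ n) f differentiable (at x))"

text \<open>A finite-order version of \<open>smooth\<close>, recursive in the derivative:
  differentiating a product once leaves products of functions that are differentiable one time less,
  so closure under products goes by induction without a formula for higher derivatives.\<close>

fun diff_times :: "nat \<Rightarrow> (real \<Rightarrow> real) \<Rightarrow> bool" where
  "diff_times 0 f \<longleftrightarrow> True"
| "diff_times (Suc n) f \<longleftrightarrow> (\<forall>x. f differentiable (at x)) \<and> diff_times n (deriv f)"

lemma diff_times_iff: "diff_times n f \<longleftrightarrow> (\<forall>m<n. \<forall>x. (deriv ^^ m) f differentiable (at x))"
proof (induction n arbitrary: f)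
  case (Suc n)
  have "(\<forall>m<Suc n. \<forall>x. (deriv ^^ m) f differentiable (at x)) \<longleftrightarrow>
      (\<forall>x. f differentiable (at x)) \<and> (\<forall>m<n. \<forall>x. (deriv ^^ Suc m) f differentiable (at x))"
    unfolding All_less_Suc2 by simp
  then show ?case by (simp add: Suc funpow_swap1)
qed simp

lemma smooth_iff_diff_times: "smooth f \<longleftrightarrow> (\<forall>n. diff_times n f)"
  unfolding smooth_def diff_times_iff by blast

lemma diff_times_SucD: "diff_times (Suc n) f \<Longrightarrow> diff_times n f"
  by (simp add: diff_times_iff)

lemma deriv_eqI: "(\<And>x. (f has_real_derivative f' x) (at x)) \<Longrightarrow> deriv f = f'"
  by (auto intro!: ext DERIV_imp_deriv)

lemma has_deriv: "f differentiable (at x) \<Longrightarrow> (f has_real_derivative deriv f x) (at x)" for x :: real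
  using DERIV_deriv_iff_real_differentiable by blast

lemma diff_times_add: "diff_times n f \<Longrightarrow> diff_times n g \<Longrightarrow> diff_times n (\<lambda>x. f x + g x)"
proof (induction n arbitrary: f g)
  case (Suc n)
  have "deriv (\<lambda>x. f x + g x) = (\<lambda>x. deriv f x + deriv g x)"
    using Suc.prems by (intro deriv_eqI DERIV_add has_deriv) auto
  then show ?case using Suc by simp
qed simp

lemma diff_times_mult: "diff_times n f \<Longrightarrow> diff_times n g \<Longrightarrow> diff_times n (\<lambda>x. f x * g x)"
proof (induction n arbitrary: f g)
  case (Suc n)
  have "deriv (\<lambda>x. f x * g x) = (\<lambda>x. deriv f x * g x + deriv g x * f x)"
    using Suc.prems by (intro deriv_eqI DERIV_mult has_deriv) auto
  moreover have "diff_times n (\<lambda>x. deriv f x * g x + deriv g x * f x)"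
    using Suc.prems diff_times_SucD[OF Suc.prems(1)] diff_times_SucD[OF Suc.prems(2)]
    by (intro diff_times_add Suc.IH) auto
  ultimately show ?case using Suc.prems by simp
qed simp

lemma smooth_mult: "smooth f \<Longrightarrow> smooth g \<Longrightarrow> smooth (\<lambda>x. f x * g x)"
  by (simp add: smooth_iff_diff_times diff_times_mult)

lemma deriv_funpow_affine:
  assumes "smooth f"
  shows "(deriv ^^ n) (\<lambda>x. f (c * x + d)) = (\<lambda>x. c ^ n * (deriv ^^ n) f (c * x + d))"
proof (induction n)
  case (Suc n)
  have "((\<lambda>x. c ^ n * (deriv ^^ n) f (c * x + d)) has_real_derivative
      c ^ n * (deriv ((deriv ^^ n) f) (c * x + d) * c)) (at x)" for x
    using assms unfolding smooth_def
    by (intro DERIV_cmult DERIV_chain'[where f="\<lambda>x. c * x + d"] has_deriv) (auto intro!: derivative_eq_intros)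
  from deriv_eqI[OF this] show ?case
    unfolding funpow.simps comp_apply Suc by (simp add: mult_ac)
qed simp

lemma smooth_affine:
  assumes "smooth f" shows "smooth (\<lambda>x. f (c * x + d))"
  unfolding smooth_def deriv_funpow_affine[OF assms]
proof (intro allI)
  fix n x
  have "((\<lambda>x. c ^ n * (deriv ^^ n) f (c * x + d)) has_real_derivative
      c ^ n * (deriv ((deriv ^^ n) f) (c * x + d) * c)) (at x)"
    using assms unfolding smooth_def
    by (intro DERIV_cmult DERIV_chain'[where f="\<lambda>x. c * x + d"] has_deriv) (auto intro!: derivative_eq_intros)
  then show "(\<lambda>x. c ^ n * (deriv ^^ n) f (c * x + d)) differentiable (at x)"
    unfolding real_differentiable_def by blast
qed

text \<open>The classical functions p(1/x) exp(-1/x) for x > 0, extended by 0. With p arbitrary the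
  family is closed under differentiation, so smoothness follows by induction on the order.\<close>

definition flat :: "real poly \<Rightarrow> real \<Rightarrow> real" where
  "flat p x = (if x > 0 then poly p (inverse x) * exp (- inverse x) else 0)"

lemma poly_times_exp_tendsto_0: "((\<lambda>z. z ^ k * poly p z * exp (- z)) \<longlongrightarrow> (0::real)) at_top"
proof (induction p arbitrary: k)
  case (pCons a p)
  have "((\<lambda>z. a * (z ^ k / exp z) + z ^ Suc k * poly p z * exp (- z)) \<longlongrightarrow> a * 0 + 0) at_top"
    by (intro tendsto_intros tendsto_power_div_exp_0 pCons.IH)
  then show ?case by (simp add: algebra_simps exp_minus divide_inverse)
qed simp

lemma flat_tendsto_0: "(flat p \<longlongrightarrow> 0) (at 0)"
proof (rule filterlim_split_at)
  have "eventually (\<lambda>x. flat p x = 0) (at_left 0)"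
    unfolding eventually_at_left_field by (intro exI[of _ "-1"]) (simp add: flat_def)
  then show "(flat p \<longlongrightarrow> 0) (at_left 0)" by (rule tendsto_eventually)
  have "((\<lambda>x. inverse x ^ 0 * poly p (inverse x) * exp (- inverse x)) \<longlongrightarrow> 0) (at_right 0)"
    by (rule filterlim_compose[OF poly_times_exp_tendsto_0 filterlim_inverse_at_top_right])
  moreover have "eventually (\<lambda>x. inverse x ^ 0 * poly p (inverse x) * exp (- inverse x) = flat p x) (at_right 0)"
    unfolding eventually_at_right_field by (intro exI[of _ 1]) (simp add: flat_def)
  ultimately show "(flat p \<longlongrightarrow> 0) (at_right 0)" by (rule Lim_transform_eventually)
qed

text \<open>With z = 1/x one has dz/dx = -z^2, hence p(z) exp(-z) differentiates to z^2 (p - p')(z)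
  exp(-z).\<close>

lemma flat_has_derivative:
  "(flat p has_real_derivative flat ([:0, 0, 1:] * (p - pderiv p)) x) (at x)"
proof -
  consider "x > 0" | "x < 0" | "x = 0" by linarith
  then show ?thesis
  proof cases
    case 1
    have "((\<lambda>x. poly p (inverse x) * exp (- inverse x)) has_real_derivative
        flat ([:0, 0, 1:] * (p - pderiv p)) x) (at x)"
    proof -
      have inv: "(inverse has_real_derivative - (inverse x ^ Suc (Suc 0))) (at x)"
        by (rule DERIV_inverse) (use 1 in simp)
      show ?thesis
        by (rule DERIV_cong[OF DERIV_mult[OF DERIV_chain2[OF poly_DERIV inv] DERIV_chain2[OF DERIV_exp DERIV_minus[OF inv]]]])
          (use 1 in \<open>simp add: flat_def algebra_simps\<close>)
    qed
    then show ?thesis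
    proof (rule DERIV_cong_ev[THEN iffD1, OF refl _ refl, rotated])
      show "\<forall>\<^sub>F x in nhds x. poly p (inverse x) * exp (- inverse x) = flat p x"
        using eventually_nhds_in_open[of "{0<..}" x] 1 by (auto simp: flat_def elim: eventually_mono)
    qed
  next
    case 2
    have "((\<lambda>x. 0) has_real_derivative flat ([:0, 0, 1:] * (p - pderiv p)) x) (at x)"
      using 2 by (simp add: flat_def)
    then show ?thesis
    proof (rule DERIV_cong_ev[THEN iffD1, OF refl _ refl, rotated])
      show "\<forall>\<^sub>F x in nhds x. 0 = flat p x"
        using eventually_nhds_in_open[of "{..<0}" x] 2 by (auto simp: flat_def elim: eventually_mono)
    qed
  next
    case 3
    \<comment> \<open>The difference quotient at 0 is again a member of the family: dividing by h
      multiplies the polynomial in 1/h by its variable.\<close>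
    have "(\<lambda>h. (flat p (0 + h) - flat p 0) / h) = flat (pCons 0 p)"
      by (auto simp: flat_def fun_eq_iff field_simps)
    then have "(flat p has_real_derivative 0) (at 0)"
      unfolding DERIV_def using flat_tendsto_0[of "pCons 0 p"] by simp
    then show ?thesis using 3 by (simp add: flat_def)
  qed
qed

lemma smooth_flat: "smooth (flat p)"
proof -
  have "\<exists>q. (deriv ^^ n) (flat p) = flat q" for n
  proof (induction n)
    case (Suc n)
    then obtain q where "(deriv ^^ n) (flat p) = flat q" by blast
    then show ?case using deriv_eqI[OF flat_has_derivative, of q] by auto
  qed auto
  then show ?thesis
    unfolding smooth_def by (metis flat_has_derivative real_differentiable_def)
qed

definition bump :: "real \<Rightarrow> real" where
  "bump x = flat 1 (1 * x + 1) * flat 1 (-1 * x + 1)"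

lemma bump_nonneg: "0 \<le> bump x" by (simp add: bump_def flat_def)
lemma bump_pos: "\<bar>x\<bar> < 1 \<Longrightarrow> 0 < bump x" by (auto simp: bump_def flat_def)
lemma bump_eq_0: "1 \<le> \<bar>x\<bar> \<Longrightarrow> bump x = 0" by (auto simp: bump_def flat_def)

lemma smooth_bump: "smooth bump"
  unfolding bump_def[abs_def] by (intro smooth_mult smooth_affine smooth_flat)

lemma test_function_iff: "test_function f \<longleftrightarrow> smooth f \<and> (\<exists>M. \<forall>x. M < \<bar>x\<bar> \<longrightarrow> f x = 0)"
proof -
  have "compact (closure {x. f x \<noteq> 0}) \<longleftrightarrow> bounded {x. f x \<noteq> 0}"
    by (metis bounded_closure bounded_subset closure_subset closed_closure compact_eq_bounded_closed)
  also have "\<dots> \<longleftrightarrow> (\<exists>M. \<forall>x. M < \<bar>x\<bar> \<longrightarrow> f x = 0)"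
    unfolding bounded_iff by (auto simp: not_le) (meson not_le)+
  finally show ?thesis by (simp add: test_function_def smooth_def)
qed

lemma test_bump_affine:
  assumes "c \<noteq> 0" shows "test_function (\<lambda>x. bump (c * x + d))"
  unfolding test_function_iff
proof (intro conjI smooth_affine smooth_bump exI allI impI bump_eq_0)
  fix x assume x: "(1 + \<bar>d\<bar>) / \<bar>c\<bar> < \<bar>x\<bar>"
  then have "1 + \<bar>d\<bar> < \<bar>c * x\<bar>" using assms by (simp add: abs_mult field_simps)
  then show "1 \<le> \<bar>c * x + d\<bar>" by linarith
qed

lemma test_function_deriv:
  assumes "test_function f" shows "test_function (deriv f)"
proof -
  from assms obtain M where M: "\<And>x. M < \<bar>x\<bar> \<Longrightarrow> f x = 0" and sm: "smooth f"
    unfolding test_function_iff by blast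
  have "smooth (deriv f)"
    using sm unfolding smooth_def by (metis comp_apply funpow_Suc_right)
  moreover have "deriv f x = 0" if "M < \<bar>x\<bar>" for x
  proof -
    have "((\<lambda>x. 0) has_real_derivative 0) (at x)" by simp
    then have "(f has_real_derivative 0) (at x)"
    proof (rule DERIV_cong_ev[THEN iffD1, OF refl _ refl, rotated])
      have "open {x::real. M < \<bar>x\<bar>}" by (intro open_Collect_less continuous_intros)
      then show "\<forall>\<^sub>F x in nhds x. 0 = f x"
        using eventually_nhds_in_open[of "{x. M < \<bar>x\<bar>}" x] that by (auto simp: M elim: eventually_mono)
    qed
    then show ?thesis by (rule DERIV_imp_deriv)
  qed
  ultimately show ?thesis unfolding test_function_iff by blast
qed

lemma test_function_funpow_deriv: "test_function f \<Longrightarrow> test_function ((deriv ^^ n) f)"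
  by (induction n) (auto intro: test_function_deriv)

lemma smooth_has_deriv: "smooth f \<Longrightarrow> (f has_real_derivative deriv f x) (at x)"
  unfolding smooth_def by (metis funpow_0 has_deriv)

lemma smooth_continuous: "smooth f \<Longrightarrow> continuous_on UNIV f"
  using smooth_has_deriv DERIV_isCont by (simp add: continuous_on_eq_continuous_at) blast

lemma test_function_Cc: "test_function f \<Longrightarrow> Cc (\<lambda>x. of_real (f x))"
  using continuous_on_of_real[OF smooth_continuous, of f] unfolding test_function_iff Cc_def
  by (metis of_real_0)

lemma ft_deriv:
  assumes "test_function f"
  shows "ft (\<lambda>x. of_real (deriv f x)) \<xi> = \<i> * \<xi> * ft (\<lambda>x. of_real (f x)) \<xi>"
proof -
  from assms obtain M where M: "\<And>x. M < \<bar>x\<bar> \<Longrightarrow> f x = 0" and sm: "smooth f"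
    unfolding test_function_iff by blast
  note f = test_function_Cc[OF assms] and f' = test_function_Cc[OF test_function_deriv[OF assms]]
  have sm': "smooth (deriv f)" using test_function_deriv[OF assms] by (simp add: test_function_iff)
  have M': "deriv f x = 0" if "\<bar>M\<bar> + 1 < \<bar>x\<bar>" for x
  proof -
    have "((\<lambda>x. 0) has_real_derivative 0) (at x)" by simp
    then have "(f has_real_derivative 0) (at x)"
    proof (rule DERIV_cong_ev[THEN iffD1, OF refl _ refl, rotated])
      have "M < \<bar>x\<bar>" using that by linarith
      moreover have "open {x::real. M < \<bar>x\<bar>}" by (intro open_Collect_less continuous_intros)
      ultimately show "\<forall>\<^sub>F x in nhds x. 0 = f x"
        using eventually_nhds_in_open[of "{x. M < \<bar>x\<bar>}" x] by (auto simp: M elim: eventually_mono)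
    qed
    then show ?thesis by (rule DERIV_imp_deriv)
  qed
  \<comment> \<open>The endpoints need |x| strictly greater than M for f to vanish there, and M may
    be negative.\<close>
  let ?R = "\<bar>M\<bar> + 1"
  define F where "F y = complex_of_real (f y) * cis (- (\<xi> * y))" for y
  define G where "G y = of_real (deriv f y) * cis (- (\<xi> * y)) - \<i> * \<xi> * (of_real (f y) * cis (- (\<xi> * y)))" for y
  have "(\<integral>y. indicator {-?R..?R} y *\<^sub>R G y \<partial>lborel) = F ?R - F (-?R)"
  proof (rule integral_FTC_atLeastAtMost)
    have "(F has_vector_derivative G y) (at y)" for y
    proof -
      have "((\<lambda>y. complex_of_real (f y)) has_vector_derivative of_real (deriv f y)) (at y)"
        using smooth_has_deriv[OF sm, of y] has_vector_derivative_of_real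
        by (simp add: has_real_derivative_iff_has_vector_derivative)
      moreover have "((\<lambda>y. cis (- (\<xi> * y))) has_vector_derivative - (\<i> * \<xi> * cis (- (\<xi> * y)))) (at y)"
        unfolding has_vector_derivative_def
        by (auto intro!: derivative_eq_intros simp: scaleR_conv_of_real algebra_simps)
      ultimately have "(F has_vector_derivative of_real (f y) * - (\<i> * \<xi> * cis (- (\<xi> * y)))
          + of_real (deriv f y) * cis (- (\<xi> * y))) (at y)"
        unfolding F_def by (rule has_vector_derivative_mult)
      then show ?thesis by (simp add: G_def algebra_simps)
    qed
    then show "(F has_vector_derivative G y) (at y within {-?R..?R})" for y
      by (rule has_vector_derivative_at_within)
    show "continuous_on {-?R..?R} G" unfolding G_def
      by (intro continuous_intros continuous_on_subset[OF smooth_continuous[OF sm]]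
          continuous_on_subset[OF smooth_continuous[OF sm']]) auto
  qed auto
  also have "F ?R - F (-?R) = 0" using M[of ?R] M[of "-?R"] by (simp add: F_def)
  also have "(\<integral>y. indicator {-?R..?R} y *\<^sub>R G y \<partial>lborel) = (\<integral>y. G y \<partial>lborel)"
  proof (rule Bochner_Integration.integral_cong[OF refl])
    fix y
    show "indicator {-?R..?R} y *\<^sub>R G y = G y"
      using M[of y] M'[of y] by (cases "\<bar>y\<bar> \<le> ?R") (auto simp: G_def indicator_def)
  qed
  also have "\<dots> = (\<integral>y. of_real (deriv f y) * cis (- (\<xi> * y)) \<partial>lborel)
      - \<i> * \<xi> * (\<integral>y. of_real (f y) * cis (- (\<xi> * y)) \<partial>lborel)"
    unfolding G_def using integrable_cis_mult'[OF Cc_integrable[OF f]] integrable_cis_mult'[OF Cc_integrable[OF f']]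
    by simp
  finally show ?thesis by (simp add: ft_def)
qed

lemma ft_funpow_deriv:
  assumes "test_function f"
  shows "ft (\<lambda>x. of_real ((deriv ^^ n) f x)) \<xi> = (\<i> * \<xi>) ^ n * ft (\<lambda>x. of_real (f x)) \<xi>"
  by (induction n) (simp_all add: ft_deriv test_function_funpow_deriv assms)

text \<open>Shows why \<open>has_Dy\<close> carries the factor \<open>\<i> ^ N\<close>: since
  \<open>\<i> ^ N * cnj ((\<i> * \<xi>) ^ N)\<close> is \<xi>^N, the operator becomes multiplication
  by \<xi>^N. Test functions are real, so the pairing on the left is already the Hermitian
  one.\<close>

lemma test_function_Parseval:
  assumes f: "L2 lborel f" and \<phi>: "test_function \<phi>"
  shows "(\<integral>y. f y * of_real (\<phi> y) \<partial>lborel) = (\<integral>\<xi>. fourier f \<xi> * cnj (ft (\<lambda>x. of_real (\<phi> x)) \<xi>) \<partial>lborel)"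
    and "\<i> ^ N * (\<integral>y. f y * of_real ((deriv ^^ N) \<phi> y) \<partial>lborel)
      = (\<integral>\<xi>. fourier f \<xi> * (\<xi> ^ N * cnj (ft (\<lambda>x. of_real (\<phi> x)) \<xi>)) \<partial>lborel)"
proof -
  have *: "(\<integral>y. f y * of_real (\<phi> y) \<partial>lborel) = (\<integral>\<xi>. fourier f \<xi> * cnj (ft (\<lambda>x. of_real (\<phi> x)) \<xi>) \<partial>lborel)"
    if \<phi>: "test_function \<phi>" for \<phi>
  proof -
    note c = Cc_integrable[OF test_function_Cc[OF \<phi>]] Cc_L2[OF test_function_Cc[OF \<phi>]]
    have "(\<integral>y. f y * of_real (\<phi> y) \<partial>lborel) = (\<integral>\<xi>. fourier f \<xi> * cnj (fourier (\<lambda>x. of_real (\<phi> x)) \<xi>) \<partial>lborel)"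
      using Parseval[OF f c(2)] by simp
    also have "\<dots> = (\<integral>\<xi>. fourier f \<xi> * cnj (ft (\<lambda>x. of_real (\<phi> x)) \<xi>) \<partial>lborel)"
    proof (rule integral_cong_AE)
      show "AE \<xi> in lborel. fourier f \<xi> * cnj (fourier (\<lambda>x. of_real (\<phi> x)) \<xi>) =
          fourier f \<xi> * cnj (ft (\<lambda>x. of_real (\<phi> x)) \<xi>)"
        using fourier_eq_ft[OF c] by eventually_elim simp
    qed (use L2D(1)[OF fourier_L2[OF f]] L2D(1)[OF fourier_L2[OF c(2)]] L2D(1)[OF Plancherel_L1_L2(1)[OF c]] in simp_all)
    finally show ?thesis .
  qed
  from *[OF \<phi>] show "(\<integral>y. f y * of_real (\<phi> y) \<partial>lborel) =
      (\<integral>\<xi>. fourier f \<xi> * cnj (ft (\<lambda>x. of_real (\<phi> x)) \<xi>) \<partial>lborel)" .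
  have "\<i> ^ N * (\<integral>y. f y * of_real ((deriv ^^ N) \<phi> y) \<partial>lborel) =
      (\<integral>\<xi>. \<i> ^ N * (fourier f \<xi> * cnj ((\<i> * \<xi>) ^ N * ft (\<lambda>x. of_real (\<phi> x)) \<xi>)) \<partial>lborel)"
    by (simp only: *[OF test_function_funpow_deriv[OF \<phi>]] ft_funpow_deriv[OF \<phi>] integral_mult_right_zero)
  also have "\<dots> = (\<integral>\<xi>. fourier f \<xi> * (\<xi> ^ N * cnj (ft (\<lambda>x. of_real (\<phi> x)) \<xi>)) \<partial>lborel)"
  proof (rule Bochner_Integration.integral_cong[OF refl], goal_cases)
    case (1 \<xi>)
    have gen: "a * (F * cnj (A * B)) = F * ((a * cnj A) * cnj B)" for a F A B :: complex
      by (simp add: mult_ac)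
    have "\<i> ^ N * (- \<i>) ^ N = 1" by (simp flip: power_mult_distrib)
    then have "\<i> ^ N * cnj ((\<i> * \<xi>) ^ N) = of_real \<xi> ^ N"
      by (simp add: power_mult_distrib flip: mult.assoc)
    then show ?case by (simp only: gen of_real_power)
  qed
  finally show "\<i> ^ N * (\<integral>y. f y * of_real ((deriv ^^ N) \<phi> y) \<partial>lborel)
      = (\<integral>\<xi>. fourier f \<xi> * (\<xi> ^ N * cnj (ft (\<lambda>x. of_real (\<phi> x)) \<xi>)) \<partial>lborel)" .
qed

text \<open>The derivative is the inverse transform of the weighted transform. This direction
  provides the derivatives at positive times, whose existence is part of the final claim.\<close>

lemma has_Dy_of_fourier:
  assumes f: "L2 lborel f" and L: "L2 lborel (\<lambda>\<xi>. \<xi> ^ N * fourier f \<xi>)"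
  shows "\<exists>g. has_Dy N f g \<and> L2norm lborel g = L2norm lborel (\<lambda>\<xi>. \<xi> ^ N * fourier f \<xi>)"
proof -
  obtain g where g: "L2 lborel g" "L2norm lborel g = L2norm lborel (\<lambda>\<xi>. \<xi> ^ N * fourier f \<xi>)"
    "AE \<xi> in lborel. fourier g \<xi> = \<xi> ^ N * fourier f \<xi>"
    using fourier_inverse_ex[OF L] by blast
  have "(\<integral>y. g y * of_real (\<phi> y) \<partial>lborel) = \<i> ^ N * (\<integral>y. f y * of_real ((deriv ^^ N) \<phi> y) \<partial>lborel)"
    if \<phi>: "test_function \<phi>" for \<phi>
  proof -
    note c = Cc_integrable[OF test_function_Cc[OF \<phi>]] Cc_L2[OF test_function_Cc[OF \<phi>]]
    note [measurable] = L2D(1)[OF fourier_L2[OF f], simplified] L2D(1)[OF fourier_L2[OF g(1)], simplified]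
      L2D(1)[OF Plancherel_L1_L2(1)[OF c], simplified]
    show ?thesis
      unfolding test_function_Parseval(1)[OF g(1) \<phi>] test_function_Parseval(2)[OF f \<phi>]
    proof (rule integral_cong_AE)
      show "AE \<xi> in lborel. fourier g \<xi> * cnj (ft (\<lambda>x. of_real (\<phi> x)) \<xi>) =
          fourier f \<xi> * (\<xi> ^ N * cnj (ft (\<lambda>x. of_real (\<phi> x)) \<xi>))"
        using g(3) by eventually_elim (simp add: mult_ac)
    qed measurable
  qed
  then show ?thesis using f g by (auto simp: has_Dy_def)
qed

lemma ft_affine:
  assumes "c > 0"
  shows "ft (\<lambda>x. f (c * x + d)) \<xi> = cis (\<xi> * d / c) * ft f (\<xi> / c) / c"
proof -
  have "(\<integral>y. f y * cis (- (\<xi> / c * y)) \<partial>lborel) = \<bar>c\<bar> *\<^sub>R (\<integral>x. f (d + c * x) * cis (- (\<xi> / c * (d + c * x))) \<partial>lborel)"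
    by (rule lborel_integral_real_affine) (use assms in auto)
  also have "\<dots> = c * (\<integral>x. cis (- (\<xi> * d / c)) * (f (c * x + d) * cis (- (\<xi> * x))) \<partial>lborel)"
  proof -
    have "cis (- (\<xi> / c * (d + c * x))) = cis (- (\<xi> * d / c)) * cis (- (\<xi> * x))" for x
    proof -
      have "- (\<xi> / c * (d + c * x)) = - (\<xi> * d / c) + - (\<xi> * x)"
        using assms by (simp add: field_simps)
      then show ?thesis by (simp only: cis_mult)
    qed
    then show ?thesis using assms by (simp add: scaleR_conv_of_real add.commute mult_ac)
  qed
  finally have "ft f (\<xi> / c) = c * (cis (- (\<xi> * d / c)) * ft (\<lambda>x. f (c * x + d)) \<xi>)"
    by (simp add: ft_def)
  moreover have "cis (\<xi> * d / c) * cis (- (\<xi> * d / c)) = 1" by (simp add: cis_mult)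
  ultimately show ?thesis using assms by (simp add: field_simps)
qed

text \<open>Pairing with all translates of one test function \<open>\<phi>\<close> shows that the Fourier transform of
  \<open>(fourier g - \<xi>\<^sup>N fourier f) cnj (ft \<phi>)\<close> vanishes, hence so does this product; the
  transforms of the rescaled bump functions have no common zero.\<close>

lemma has_Dy_fourier:
  assumes "has_Dy N f g"
  shows "AE \<xi> in lborel. fourier g \<xi> = \<xi> ^ N * fourier f \<xi>"
proof -
  have f: "L2 lborel f" and g: "L2 lborel g"
    and eq: "\<And>\<phi>. test_function \<phi> \<Longrightarrow> (\<integral>y. g y * of_real (\<phi> y) \<partial>lborel) =
        \<i> ^ N * (\<integral>y. f y * of_real ((deriv ^^ N) \<phi> y) \<partial>lborel)"
    using assms by (auto simp: has_Dy_def)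
  note [measurable] = L2D(1)[OF fourier_L2[OF f], simplified] L2D(1)[OF fourier_L2[OF g], simplified]
  have zero: "AE \<xi> in lborel. (fourier g \<xi> - \<xi> ^ N * fourier f \<xi>) * cnj (ft (\<lambda>x. of_real (bump (c * x))) \<xi>) = 0"
    if c: "c > 0" for c
  proof -
    \<comment> \<open>As c x + a c = c (x + a), this is a translate by -a. Its transform gains the
      phase cis (a \<xi>), whose conjugate is the kernel of \<open>ft\<close> at the point
      a.\<close>
    define \<psi> where "\<psi> a x = complex_of_real (bump (c * x + a * c))" for a x
    have tf: "test_function (\<lambda>x. bump (c * x + a * c))" for a
      using test_bump_affine[of c "a * c"] c by simp
    have cc: "Cc (\<psi> a)" for a unfolding \<psi>_def[abs_def] by (rule test_function_Cc[OF tf])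
    note c1 = Cc_integrable[OF cc] and c2 = Cc_L2[OF cc]
    let ?\<Psi> = "ft (\<psi> 0)"
    have \<Psi>: "L2 lborel ?\<Psi>" by (rule Plancherel_L1_L2(1)[OF c1 c2])
    have \<Psi>N: "ft (\<lambda>x. of_real ((deriv ^^ N) (\<lambda>x. bump (c * x + 0 * c)) x)) \<xi> = (\<i> * \<xi>) ^ N * ?\<Psi> \<xi>" for \<xi>
      using ft_funpow_deriv[OF tf[of 0]] unfolding \<psi>_def[abs_def] .
    note cN = test_function_Cc[OF test_function_funpow_deriv[OF tf[of 0], of N]]
    note [measurable] = L2D(1)[OF \<Psi>, simplified]
    define B where "B = (\<integral>x. norm (\<psi> 0 x) \<partial>lborel) / sqrt (2 * pi)"
    define B' where "B' = (\<integral>x. norm (complex_of_real ((deriv ^^ N) (\<lambda>x. bump (c * x + 0 * c)) x)) \<partial>lborel) / sqrt (2 * pi)"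
    have B: "norm (?\<Psi> \<xi>) \<le> B" for \<xi> unfolding B_def by (rule norm_ft_le)
    have B': "norm (\<xi> ^ N * cnj (?\<Psi> \<xi>)) \<le> B'" for \<xi>
      using norm_ft_le[of "\<lambda>x. of_real ((deriv ^^ N) (\<lambda>x. bump (c * x + 0 * c)) x)" \<xi>]
      unfolding \<Psi>N B'_def by (simp add: norm_mult norm_power)
    have \<Psi>NL: "L2 lborel (\<lambda>\<xi>. \<xi> ^ N * cnj (?\<Psi> \<xi>))"
    proof (rule L2_bound[OF Plancherel_L1_L2(1)[OF Cc_integrable[OF cN] Cc_L2[OF cN]]])
      show "AE \<xi> in lborel. norm (\<xi> ^ N * cnj (?\<Psi> \<xi>)) \<le>
          norm (ft (\<lambda>x. of_real ((deriv ^^ N) (\<lambda>x. bump (c * x + 0 * c)) x)) \<xi>)"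
        unfolding \<Psi>N by (simp add: norm_mult norm_power)
    qed measurable
    \<comment> \<open>q is in L1, so that \<open>ft q\<close> makes sense, and in L2, so that
      Plancherel's theorem turns \<open>ft q = 0\<close> into q = 0. The second membership uses the
      uniform bounds B and B'.\<close>
    define q where "q \<xi> = fourier g \<xi> * cnj (?\<Psi> \<xi>) - fourier f \<xi> * (\<xi> ^ N * cnj (?\<Psi> \<xi>))" for \<xi>
    have i1: "integrable lborel (\<lambda>\<xi>. fourier g \<xi> * cnj (?\<Psi> \<xi>))"
      by (intro L2_mult_integrable fourier_L2 g L2_cnj \<Psi>)
    have i2: "integrable lborel (\<lambda>\<xi>. fourier f \<xi> * (\<xi> ^ N * cnj (?\<Psi> \<xi>)))"
      by (intro L2_mult_integrable fourier_L2 f \<Psi>NL)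
    have q1: "integrable lborel q" unfolding q_def[abs_def] using i1 i2 by auto
    have q2: "L2 lborel q" unfolding q_def[abs_def]
    proof (rule L2_diff)
      show "L2 lborel (\<lambda>\<xi>. fourier g \<xi> * cnj (?\<Psi> \<xi>))"
      proof (rule L2_bound[OF L2_cmult[OF fourier_L2[OF g], of "of_real B"]])
        show "AE x in lborel. cmod (fourier g x * cnj (?\<Psi> x)) \<le> cmod (complex_of_real B * fourier g x)"
        proof (rule AE_I2)
          fix x
          have "0 \<le> B" using B[of 0] norm_ge_zero by (rule order_trans[rotated])
          then show "cmod (fourier g x * cnj (?\<Psi> x)) \<le> cmod (complex_of_real B * fourier g x)"
            using mult_right_mono[OF B[of x], of "cmod (fourier g x)"] by (simp add: norm_mult mult.commute)
        qed
      qed measurable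
      show "L2 lborel (\<lambda>\<xi>. fourier f \<xi> * (\<xi> ^ N * cnj (?\<Psi> \<xi>)))"
      proof (rule L2_bound[OF L2_cmult[OF fourier_L2[OF f], of "of_real B'"]])
        show "AE x in lborel. cmod (fourier f x * (x ^ N * cnj (?\<Psi> x))) \<le> cmod (complex_of_real B' * fourier f x)"
        proof (rule AE_I2)
          fix x
          have "0 \<le> B'" using B'[of 0] norm_ge_zero by (rule order_trans[rotated])
          then show "cmod (fourier f x * (x ^ N * cnj (?\<Psi> x))) \<le> cmod (complex_of_real B' * fourier f x)"
            using mult_right_mono[OF B'[of x] norm_ge_zero[of "fourier f x"]]
            by (simp only: norm_mult norm_of_real abs_of_nonneg mult.commute[of "cmod (fourier f x)"])
        qed
      qed measurable
    qed
    have \<psi>a: "cnj (ft (\<psi> a) \<xi>) = cis (- (a * \<xi>)) * cnj (?\<Psi> \<xi>)" for a \<xi>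
      using ft_affine[OF c, of "\<lambda>x. of_real (bump x)" "a * c" \<xi>] ft_affine[OF c, of "\<lambda>x. of_real (bump x)" 0 \<xi>] c
      by (simp add: \<psi>_def[abs_def] cis_cnj mult_ac)
    have "ft q a = 0" for a
    proof -
      have "(\<integral>\<xi>. fourier g \<xi> * cnj (ft (\<psi> a) \<xi>) \<partial>lborel) = (\<integral>\<xi>. fourier f \<xi> * (\<xi> ^ N * cnj (ft (\<psi> a) \<xi>)) \<partial>lborel)"
        using eq[OF tf[of a]] unfolding test_function_Parseval(1)[OF g tf] test_function_Parseval(2)[OF f tf]
        by (simp add: \<psi>_def[abs_def])
      then have 0: "(\<integral>\<xi>. fourier g \<xi> * cnj (?\<Psi> \<xi>) * cis (- (a * \<xi>)) \<partial>lborel) =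
          (\<integral>\<xi>. fourier f \<xi> * (\<xi> ^ N * cnj (?\<Psi> \<xi>)) * cis (- (a * \<xi>)) \<partial>lborel)"
        by (simp only: \<psi>a[of a] mult_ac)
      have "(\<integral>\<xi>. q \<xi> * cis (- (a * \<xi>)) \<partial>lborel) = 0"
        unfolding q_def left_diff_distrib
        by (subst Bochner_Integration.integral_diff[OF integrable_cis_mult'[OF i1] integrable_cis_mult'[OF i2]])
          (use 0 in simp)
      then show ?thesis by (simp add: ft_def)
    qed
    then have "L2norm lborel q = 0"
      using Plancherel_L1_L2(2)[OF q1 q2] by (simp add: L2norm_def)
    from L2norm_eq_0_AE[OF q2 this] show ?thesis
      by eventually_elim (simp add: q_def \<psi>_def[abs_def] algebra_simps)
  qed
  \<comment> \<open>At 0 the transform of \<open>bump\<close> is a positive multiple of its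
    integral, so by continuity it is nonzero at \<xi>/n for large n. Countably many dilations
    suffice, which keeps the exceptional sets null.\<close>
  have nz: "\<exists>n. ft (\<lambda>x. of_real (bump (real (Suc n) * x))) \<xi> \<noteq> 0" for \<xi>
  proof -
    let ?b = "\<lambda>x. complex_of_real (bump x)"
    have tb: "test_function bump" using test_bump_affine[of 1 0] by simp
    note bi = Cc_integrable[OF test_function_Cc[OF tb]]
    have "(\<integral>y. bump y \<partial>lborel) \<noteq> 0"
    proof
      assume "(\<integral>y. bump y \<partial>lborel) = 0"
      moreover have ib: "integrable lborel bump" using bi by (simp add: complex_of_real_integrable_eq)
      ultimately have "AE y in lborel. bump y = 0"
        by (subst (asm) integral_nonneg_eq_0_iff_AE) (auto simp: bump_nonneg)
      then have "AE y in lborel. y \<notin> {-1/2..1/2::real}"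
      proof eventually_elim
        case (elim y)
        show ?case
        proof
          assume "y \<in> {-1/2..1/2}"
          then have "\<bar>y\<bar> < 1" by auto
          from bump_pos[OF this] elim show False by simp
        qed
      qed
      then have "emeasure lborel {-1/2..1/2::real} = 0"
        by (subst (asm) AE_iff_null_sets[symmetric]) auto
      then show False by simp
    qed
    then have ne: "ft ?b 0 \<noteq> 0" by (simp add: ft_def)
    have "(\<lambda>n. \<xi> * inverse (real (Suc n))) \<longlonglongrightarrow> \<xi> * 0"
      by (intro tendsto_intros LIMSEQ_inverse_real_of_nat)
    then have "(\<lambda>n. ft ?b (\<xi> * inverse (real (Suc n)))) \<longlonglongrightarrow> ft ?b 0"
      by (intro continuous_on_tendsto_compose[OF ft_continuous[OF bi]]) auto
    from tendsto_imp_eventually_ne[OF this ne] obtain n where "ft ?b (\<xi> / real (Suc n)) \<noteq> 0"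
      by (auto simp: eventually_sequentially divide_inverse)
    then show ?thesis using ft_affine[of "real (Suc n)" ?b 0 \<xi>] by (intro exI[of _ n]) (auto simp del: of_nat_Suc)
  qed
  have "AE \<xi> in lborel. \<forall>n. (fourier g \<xi> - \<xi> ^ N * fourier f \<xi>) * cnj (ft (\<lambda>x. of_real (bump (real (Suc n) * x))) \<xi>) = 0"
    unfolding AE_all_countable by (intro allI zero) simp
  then show ?thesis
  proof eventually_elim
    case (elim \<xi>)
    with nz[of \<xi>] show ?case by auto
  qed
qed

section \<open>Fourier modes in the periodic variable\<close>

text \<open>\<open>mode\<close> on one slice, through the gauge integral, for which the Leibniz rule
  and the fundamental theorem are applied. Both agree on continuous slices, by
  \<open>mode_eq_kint\<close>.\<close>

definition kint :: "int \<Rightarrow> (real \<Rightarrow> real) \<Rightarrow> complex" where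
  "kint k h = 1 / (2 * pi) * integral {0..2 * pi} (\<lambda>x. of_real (h x) * exp (- \<i> * of_int k * of_real x))"

lemma kint_integrable:
  assumes "continuous_on {0..2 * pi} h"
  shows "(\<lambda>x. of_real (h x) * exp (- \<i> * of_int k * of_real x)) integrable_on {0..2 * pi}"
  by (intro integrable_continuous_interval continuous_intros assms)

lemma mode_eq_kint:
  assumes "continuous_on {0..2 * pi} (\<lambda>x. f x y)"
  shows "mode k f y = kint k (\<lambda>x. f x y)"
proof -
  let ?g = "\<lambda>x. complex_of_real (f x y) * exp (- \<i> * of_int k * of_real x)"
  have c: "continuous_on {0..2 * pi} ?g" by (intro continuous_intros assms)
  have "(\<integral>x. ?g x \<partial>torus) = (LINT x:{0..2 * pi}|lborel. ?g x)"
    unfolding torus_def set_lebesgue_integral_def by (subst integral_restrict_space) auto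
  also have "\<dots> = integral {0..2 * pi} ?g"
    by (rule set_borel_integral_eq_integral(2)[OF borel_integrable_atLeastAtMost'[OF c]])
  finally show ?thesis by (simp add: mode_def kint_def)
qed

lemma kint_add:
  assumes "continuous_on {0..2 * pi} f" "continuous_on {0..2 * pi} g"
  shows "kint k (\<lambda>x. f x + g x) = kint k f + kint k g"
  using integral_add[OF kint_integrable[OF assms(1), of k] kint_integrable[OF assms(2), of k]]
  by (simp add: kint_def ring_distribs)

lemma kint_cmult: "kint k (\<lambda>x. c * f x) = of_real c * kint k f"
  unfolding kint_def by (simp add: mult.assoc)

lemma kint_diff:
  assumes "continuous_on {0..2 * pi} f" "continuous_on {0..2 * pi} g"
  shows "kint k (\<lambda>x. f x - g x) = kint k f - kint k g"
proof -
  have "continuous_on {0..2 * pi} (\<lambda>x. - 1 * g x)" by (intro continuous_intros assms)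
  from kint_add[OF assms(1) this, of k] show ?thesis using kint_cmult[of k "-1" g] by simp
qed

lemma has_vector_derivative_complex_of_real:
  "(f has_real_derivative D) F \<Longrightarrow> ((\<lambda>x. complex_of_real (f x)) has_vector_derivative of_real D) F"
  by (rule has_vector_derivative_of_real) (simp add: has_real_derivative_iff_has_vector_derivative)

text \<open>The parameter p stands for y, over the whole line, and for t, over t > 0; hence the open
  convex U.\<close>

lemma kint_vector_derivative:
  fixes G G' :: "real \<Rightarrow> real \<Rightarrow> real"
  assumes "\<And>p x. p \<in> U \<Longrightarrow> ((\<lambda>p. G p x) has_real_derivative G' p x) (at p)"
    and c: "\<And>p. p \<in> U \<Longrightarrow> continuous_on {0..2 * pi} (G p)"
    and c': "continuous_on (U \<times> {0..2 * pi}) (\<lambda>(p, x). G' p x)"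
    and U: "p0 \<in> U" "open U" "convex U"
  shows "((\<lambda>p. kint k (G p)) has_vector_derivative kint k (G' p0)) (at p0)"
proof -
  let ?e = "\<lambda>x::real. exp (- \<i> * of_int k * of_real x)"
  have "((\<lambda>p. integral (cbox 0 (2 * pi)) (\<lambda>x. of_real (G p x) * ?e x)) has_vector_derivative
      integral (cbox 0 (2 * pi)) (\<lambda>x. of_real (G' p0 x) * ?e x)) (at p0 within U)"
  proof (rule leibniz_rule_vector_derivative[OF _ _ _ U(1,3)])
    fix p x assume "p \<in> U"
    then have "((\<lambda>p. complex_of_real (G p x)) has_vector_derivative of_real (G' p x)) (at p)"
      by (intro has_vector_derivative_complex_of_real assms(1))
    then have "((\<lambda>p. complex_of_real (G p x) * ?e x) has_vector_derivative of_real (G' p x) * ?e x) (at p)"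
      by (rule has_vector_derivative_mult_left)
    then show "((\<lambda>p. of_real (G p x) * ?e x) has_vector_derivative of_real (G' p x) * ?e x) (at p within U)"
      by (rule has_vector_derivative_at_within)
  next
    show "(\<lambda>x. of_real (G p x) * ?e x) integrable_on cbox 0 (2 * pi)" if "p \<in> U" for p
      using kint_integrable[OF c[OF that]] by simp
    have "continuous_on (U \<times> {0..2 * pi}) (\<lambda>z. complex_of_real (case z of (p, x) \<Rightarrow> G' p x) * ?e (snd z))"
      by (intro continuous_intros c')
    then show "continuous_on (U \<times> cbox 0 (2 * pi)) (\<lambda>(p, x). of_real (G' p x) * ?e x)"
      by (simp add: split_beta)
  qed
  then have "((\<lambda>p. integral (cbox 0 (2 * pi)) (\<lambda>x. of_real (G p x) * ?e x)) has_vector_derivative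
      integral (cbox 0 (2 * pi)) (\<lambda>x. of_real (G' p0 x) * ?e x)) (at p0)"
    by (simp only: at_within_open[OF U(1,2)])
  then have "((\<lambda>p. (1 / (2 * pi)) * integral (cbox 0 (2 * pi)) (\<lambda>x. of_real (G p x) * ?e x)) has_vector_derivative
      (1 / (2 * pi)) * integral (cbox 0 (2 * pi)) (\<lambda>x. of_real (G' p0 x) * ?e x)) (at p0)"
    by (rule has_vector_derivative_mult_right)
  then show ?thesis unfolding kint_def by simp
qed

lemma kint_continuous:
  fixes G :: "'a::topological_space \<Rightarrow> real \<Rightarrow> real"
  assumes "continuous_on (U \<times> {0..2 * pi}) (\<lambda>(p, x). G p x)"
  shows "continuous_on U (\<lambda>p. kint k (G p))"
proof -
  let ?e = "\<lambda>x::real. exp (- \<i> * of_int k * of_real x)"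
  have "continuous_on (U \<times> {0..2 * pi}) (\<lambda>z. complex_of_real (case z of (p, x) \<Rightarrow> G p x) * ?e (snd z))"
    by (intro continuous_intros assms)
  then have "continuous_on (U \<times> cbox 0 (2 * pi)) (\<lambda>(p, x). complex_of_real (G p x) * ?e x)"
    by (simp add: split_beta)
  from integral_continuous_on_param[OF this] show ?thesis
    unfolding kint_def by (intro continuous_intros) simp
qed

text \<open>Integration by parts in x. The boundary terms cancel because h is periodic and because,
  k being an integer, so is the exponential.\<close>

lemma kint_deriv_periodic:
  assumes h: "\<And>x. (h has_real_derivative h' x) (at x)" and c: "continuous_on {0..2 * pi} h'"
    and per: "h (2 * pi) = h 0"
  shows "kint k h' = \<i> * of_int k * kint k h"
proof -
  let ?e = "\<lambda>x::real. exp (- \<i> * of_int k * of_real x)"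
  have hc: "continuous_on {0..2 * pi} h"
    using h by (meson DERIV_isCont continuous_at_imp_continuous_on)
  have "((\<lambda>x. of_real (h' x) * ?e x - \<i> * of_int k * (of_real (h x) * ?e x)) has_integral
      of_real (h (2 * pi)) * ?e (2 * pi) - of_real (h 0) * ?e 0) {0..2 * pi}"
  proof (rule fundamental_theorem_of_calculus)
    fix x :: real
    have 1: "((\<lambda>x. complex_of_real (h x)) has_vector_derivative of_real (h' x)) (at x)"
      by (intro has_vector_derivative_complex_of_real h)
    have 2: "(?e has_vector_derivative - (\<i> * of_int k * ?e x)) (at x)"
      by (rule has_vector_derivative_real_field) (auto intro!: derivative_eq_intros)
    have "((\<lambda>x. of_real (h x) * ?e x) has_vector_derivative
        of_real (h x) * - (\<i> * of_int k * ?e x) + of_real (h' x) * ?e x) (at x)"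
      by (rule has_vector_derivative_mult[OF 1 2])
    then have "((\<lambda>x. of_real (h x) * ?e x) has_vector_derivative
        of_real (h' x) * ?e x - \<i> * of_int k * (of_real (h x) * ?e x)) (at x)"
      by (simp add: algebra_simps)
    then show "((\<lambda>x. of_real (h x) * ?e x) has_vector_derivative
        of_real (h' x) * ?e x - \<i> * of_int k * (of_real (h x) * ?e x)) (at x within {0..2 * pi})"
      by (rule has_vector_derivative_at_within)
  qed simp
  moreover have "?e (2 * pi) = 1"
    using exp_integer_2pi[of "of_int (-k)"] by (simp add: mult_ac)
  ultimately have "((\<lambda>x. of_real (h' x) * ?e x - \<i> * of_int k * (of_real (h x) * ?e x)) has_integral 0) {0..2 * pi}"
    by (simp add: per)
  then have "integral {0..2 * pi} (\<lambda>x. of_real (h' x) * ?e x - \<i> * of_int k * (of_real (h x) * ?e x)) = 0"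
    by (rule integral_unique)
  moreover have "(\<lambda>x. \<i> * of_int k * (of_real (h x) * ?e x)) integrable_on {0..2 * pi}"
    by (intro integrable_continuous_interval continuous_intros hc)
  ultimately have "integral {0..2 * pi} (\<lambda>x. of_real (h' x) * ?e x) =
      \<i> * of_int k * integral {0..2 * pi} (\<lambda>x. of_real (h x) * ?e x)"
    using integral_diff[OF kint_integrable[OF c, of k]] by simp
  then show ?thesis by (simp add: kint_def)
qed

lemma C1_planeD:
  assumes "C1_plane f"
  shows "((\<lambda>x. f x y) has_real_derivative dx f x y) (at x)"
    and "((\<lambda>y. f x y) has_real_derivative dy f x y) (at y)"
    and "continuous_on UNIV (\<lambda>(x, y). dx f x y)" "continuous_on UNIV (\<lambda>(x, y). dy f x y)"
    and "continuous_on A (\<lambda>x. f x y)" "continuous_on A (\<lambda>x. dx f x y)" "continuous_on A (\<lambda>x. dy f x y)"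
proof -
  show d: "((\<lambda>x. f x y) has_real_derivative dx f x y) (at x)"
    and "((\<lambda>y. f x y) has_real_derivative dy f x y) (at y)" for x
    using assms unfolding C1_plane_def dx_def dy_def by (auto intro: has_deriv)
  show c: "continuous_on UNIV (\<lambda>(x, y). dx f x y)" "continuous_on UNIV (\<lambda>(x, y). dy f x y)"
    using assms unfolding C1_plane_def by auto
  show "continuous_on A (\<lambda>x. f x y)"
    using d by (meson DERIV_isCont continuous_at_imp_continuous_on)
  show "continuous_on A (\<lambda>x. dx f x y)" "continuous_on A (\<lambda>x. dy f x y)"
    using continuous_on_compose2[OF c(1) continuous_on_Pair[OF continuous_on_id continuous_on_const] subset_UNIV, of A y]
      continuous_on_compose2[OF c(2) continuous_on_Pair[OF continuous_on_id continuous_on_const] subset_UNIV, of A y]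
    by auto
qed

lemma mode_C1:
  assumes f: "C1_plane f"
  shows "mode k f y = kint k (\<lambda>x. f x y)" "mode k (dx f) y = kint k (\<lambda>x. dx f x y)"
    "mode k (dy f) y = kint k (\<lambda>x. dy f x y)"
    "(mode k f has_vector_derivative mode k (dy f) y) (at y)"
    "continuous_on UNIV (mode k (dy f))"
proof -
  show m: "mode k f y = kint k (\<lambda>x. f x y)" "mode k (dx f) y = kint k (\<lambda>x. dx f x y)"
    "mode k (dy f) y = kint k (\<lambda>x. dy f x y)" for y
    by (intro mode_eq_kint C1_planeD[OF f])+
  have c: "continuous_on (UNIV \<times> {0..2 * pi}) (\<lambda>(y, x). dy f x y)"
    using continuous_on_compose2[OF C1_planeD(4)[OF f] continuous_on_Pair[OF continuous_on_snd[OF continuous_on_id]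
        continuous_on_fst[OF continuous_on_id]] subset_UNIV, of "UNIV \<times> {0..2 * pi}"]
    by (simp add: split_beta)
  show "(mode k f has_vector_derivative mode k (dy f) y) (at y)"
    unfolding m[abs_def]
    by (rule kint_vector_derivative[where U=UNIV]) (use C1_planeD[OF f] c in auto)
  show "continuous_on UNIV (mode k (dy f))"
    unfolding m[abs_def] by (rule kint_continuous[OF c])
qed

lemma periodic_dx:
  assumes "periodic_x f" "C1_plane f" shows "periodic_x (dx f)"
  unfolding periodic_x_def
proof (intro allI)
  fix x y
  have "((\<lambda>x. f (x + 2 * pi) y) has_real_derivative dx f (x + 2 * pi) y) (at x)"
    using C1_planeD(1)[OF assms(2), of y "x + 2 * pi"] by (simp add: DERIV_shift)
  then have "((\<lambda>x. f x y) has_real_derivative dx f (x + 2 * pi) y) (at x)"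
    using assms(1) by (simp add: periodic_x_def)
  then show "dx f (x + 2 * pi) y = dx f x y" using C1_planeD(1)[OF assms(2)] by (rule DERIV_unique)
qed

lemma periodic_dy:
  assumes "periodic_x f" shows "periodic_x (dy f)"
proof -
  have "f (x + 2 * pi) = f x" for x using assms by (auto simp: periodic_x_def)
  then show ?thesis by (simp add: periodic_x_def dy_def)
qed

lemma mode_dx:
  assumes "periodic_x f" "C1_plane f"
  shows "mode k (dx f) y = \<i> * of_int k * mode k f y"
  unfolding mode_C1[OF assms(2)]
  by (rule kint_deriv_periodic[OF C1_planeD(1)[OF assms(2)] C1_planeD(6)[OF assms(2)]])
    (use assms(1) in \<open>auto simp: periodic_x_def dest: spec[of _ 0]\<close>)

lemma C2_planeD: "C2_plane f \<Longrightarrow> C1_plane f" "C2_plane f \<Longrightarrow> C1_plane (dx f)" "C2_plane f \<Longrightarrow> C1_plane (dy f)"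
  by (auto simp: C2_plane_def)

lemma laplacian_continuous: "C2_plane f \<Longrightarrow> continuous_on A (\<lambda>x. laplacian f x y)"
  unfolding laplacian_def by (intro continuous_intros C1_planeD C2_planeD)

lemma kint_laplacian:
  assumes "periodic_x f" "C2_plane f"
  shows "kint k (\<lambda>x. laplacian f x y) = - (of_int k)\<^sup>2 * mode k f y + mode k (dy (dy f)) y"
proof -
  note C = C2_planeD[OF assms(2)]
  have "kint k (\<lambda>x. laplacian f x y) = kint k (\<lambda>x. dx (dx f) x y) + kint k (\<lambda>x. dy (dy f) x y)"
    unfolding laplacian_def by (intro kint_add C1_planeD C)
  also have "kint k (\<lambda>x. dx (dx f) x y) = \<i> * of_int k * (\<i> * of_int k * mode k f y)"
    using mode_dx[OF periodic_dx[OF assms(1) C(1)] C(2)] mode_dx[OF assms(1) C(1)] mode_C1(2)[OF C(2)] by simp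
  also have "kint k (\<lambda>x. dy (dy f) x y) = mode k (dy (dy f)) y" using mode_C1(3)[OF C(3)] by simp
  finally show ?thesis by (simp add: power2_eq_square algebra_simps)
qed

section \<open>Modes of square-integrable functions on the periodic strip\<close>

lemma sigma_finite_torus: "sigma_finite_measure torus"
  unfolding torus_def by (intro sigma_finite_measure_restrict_space) (auto simp: sigma_finite_lborel)

lemma torus_measure: "space torus = {0..2 * pi}" "emeasure torus (space torus) = ennreal (2 * pi)"
  unfolding torus_def by (auto simp: space_restrict_space emeasure_restrict_space)

interpretation torus: finite_measure torus
  by (rule finite_measureI) (simp only: torus_measure(2) ennreal_neq_top infinity_ennreal_def not_False_eq_True)

interpretation torus_line: pair_sigma_finite torus "lborel :: real measure"
  unfolding pair_sigma_finite_def using sigma_finite_torus sigma_finite_lborel by auto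

lemma exp_torus_measurable [measurable]:
  "(\<lambda>x. exp (- \<i> * of_int k * of_real x)) \<in> borel_measurable torus"
  unfolding torus_def by (intro measurable_restrict_space1 borel_measurable_continuous_onI continuous_intros) simp

text \<open>Cauchy-Schwarz in x bounds the mode at y by the norm of the slice, and Fubini integrates
  the square in y. The sharper factor 1/sqrt(2 pi) is dropped.\<close>

lemma
  assumes f: "L2 Omega (\<lambda>(x, y). f x y)"
  shows mode_L2: "L2 lborel (mode k f)" "L2norm lborel (mode k f) \<le> L2norm Omega (\<lambda>(x, y). f x y)"
    and mode_AE_L2: "AE y in lborel. L2 torus (\<lambda>x. f x y)"
proof -
  have m[measurable]: "(\<lambda>(x, y). f x y) \<in> borel_measurable (torus \<Otimes>\<^sub>M lborel)"
    and i: "integrable (torus \<Otimes>\<^sub>M lborel) (\<lambda>(x, y). (f x y)\<^sup>2)"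
    using L2D[OF f] unfolding Omega_def by (auto simp: split_beta')
  have mswap[measurable]: "(\<lambda>(y, x). f x y) \<in> borel_measurable (lborel \<Otimes>\<^sub>M torus)"
    using measurable_compose[OF measurable_pair_swap' m] by (simp add: split_beta)
  have "mode k f \<in> borel_measurable lborel"
    unfolding mode_def[abs_def]
    by (intro borel_measurable_times borel_measurable_const torus.borel_measurable_lebesgue_integral) measurable
  have AEi: "AE y in lborel. integrable torus (\<lambda>x. (f x y)\<^sup>2)"
    using torus_line.AE_integrable_snd[OF i] by simp
  show AE2: "AE y in lborel. L2 torus (\<lambda>x. f x y)"
    using AEi by eventually_elim (auto simp: L2_def measurable_Pair2[OF mswap, simplified] intro!: measurable_compose[OF _ m])
  define g where "g y = sqrt (\<integral>x. (f x y)\<^sup>2 \<partial>torus)" for y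
  have g2: "(g y)\<^sup>2 = (\<integral>x. (f x y)\<^sup>2 \<partial>torus)" for y
    unfolding g_def by simp
  have g2i: "integrable lborel (\<lambda>y. (g y)\<^sup>2)"
    unfolding g2 using torus_line.integrable_snd[OF i] by simp
  have bound: "AE y in lborel. norm (mode k f y) \<le> g y"
    using AE2
  proof eventually_elim
    case (elim y)
    have one: "L2 torus (\<lambda>x. 1::real)" by (simp add: L2_def)
    have "norm (\<integral>x. complex_of_real (f x y) * exp (- \<i> * of_int k * of_real x) \<partial>torus)
        \<le> (\<integral>x. norm (f x y) * norm (1::real) \<partial>torus)"
      by (rule order_trans[OF integral_norm_bound]) (simp add: norm_mult)
    also have "\<dots> \<le> L2norm torus (\<lambda>x. f x y) * L2norm torus (\<lambda>x. 1::real)"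
      by (rule L2_Cauchy_Schwarz[OF elim one])
    also have "L2norm torus (\<lambda>x. f x y) = g y" by (simp add: L2norm_def g_def)
    also have "L2norm torus (\<lambda>x. 1::real) = sqrt (2 * pi)"
      using torus_measure by (simp add: L2norm_def measure_def)
    finally have *: "norm (\<integral>x. complex_of_real (f x y) * exp (- \<i> * of_int k * of_real x) \<partial>torus) \<le> g y * sqrt (2 * pi)" .
    have "1 \<le> sqrt (2 * pi)" using pi_gt3 by simp
    then have "sqrt (2 * pi) * 1 \<le> sqrt (2 * pi) * sqrt (2 * pi)" by (intro mult_left_mono) auto
    then have "sqrt (2 * pi) \<le> 2 * pi" by simp
    moreover have "0 \<le> g y" by (simp add: g_def)
    ultimately have "g y * sqrt (2 * pi) \<le> g y * (2 * pi)" by (intro mult_left_mono)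
    with * have "norm (\<integral>x. complex_of_real (f x y) * exp (- \<i> * of_int k * of_real x) \<partial>torus) \<le> g y * (2 * pi)"
      by linarith
    then show ?case by (simp add: mode_def norm_mult norm_divide divide_le_eq)
  qed
  note R = L2_of_norm_bound[OF g2i \<open>mode k f \<in> borel_measurable lborel\<close> bound]
  show "L2 lborel (mode k f)" by (rule R)
  have "(\<integral>y. (g y)\<^sup>2 \<partial>lborel) = (L2norm Omega (\<lambda>(x, y). f x y))\<^sup>2"
    unfolding g2 L2norm_power2 Omega_def using torus_line.integral_snd[OF i] by (simp add: split_beta')
  with R(2) show "L2norm lborel (mode k f) \<le> L2norm Omega (\<lambda>(x, y). f x y)"
    by (intro power2_le_imp_le[OF _ L2norm_nonneg]) simp
qed

text \<open>Additivity can fail where a slice is not integrable, the Bochner integral being 0 there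
  by default. By Fubini almost every slice is square-integrable; for the initial data nothing better
  is known.\<close>

lemma mode_diff_AE:
  assumes f: "L2 Omega (\<lambda>(x, y). f x y)" and g: "L2 Omega (\<lambda>(x, y). g x y)"
  shows "AE y in lborel. mode k (\<lambda>x y. f x y - g x y) y = mode k f y - mode k g y"
  using mode_AE_L2[OF f] mode_AE_L2[OF g]
proof eventually_elim
  case (elim y)
  have e: "L2 torus (\<lambda>x. exp (- \<i> * of_int k * of_real x))"
    using exp_torus_measurable[of k] by (simp add: L2_def)
  have i: "integrable torus (\<lambda>x. complex_of_real (h x) * exp (- \<i> * of_int k * of_real x))"
    if "L2 torus h" for h
    by (rule L2_mult_integrable[OF _ e]) (use that in \<open>auto simp: L2_def\<close>)
  show ?case using i[OF elim(1)] i[OF elim(2)]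
    by (simp add: mode_def left_diff_distrib right_diff_distrib)
qed

lemma mode_diff_L2norm:
  assumes f: "L2 Omega (\<lambda>(x, y). f x y)" and g: "L2 Omega (\<lambda>(x, y). g x y)"
  shows "L2norm lborel (\<lambda>y. mode k f y - mode k g y) \<le> L2norm Omega (\<lambda>(x, y). f x y - g x y)"
proof -
  have fg: "L2 Omega (\<lambda>(x, y). f x y - g x y)" using L2_diff[OF f g] by (simp add: split_beta')
  have "L2norm lborel (\<lambda>y. mode k f y - mode k g y) = L2norm lborel (mode k (\<lambda>x y. f x y - g x y))"
  proof (rule L2norm_AE_eq)
    show "(\<lambda>y. mode k f y - mode k g y) \<in> borel_measurable lborel"
      using L2D(1)[OF mode_L2(1)[OF f]] L2D(1)[OF mode_L2(1)[OF g]] by simp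
    show "L2 lborel (mode k (\<lambda>x y. f x y - g x y))" by (rule mode_L2[OF fg])
    show "AE x in lborel. mode k f x - mode k g x = mode k (\<lambda>x y. f x y - g x y) x"
      using mode_diff_AE[OF f g, of k] by eventually_elim simp
  qed
  also have "\<dots> \<le> L2norm Omega (\<lambda>(x, y). f x y - g x y)" by (rule mode_L2[OF fg])
  finally show ?thesis .
qed

text \<open>\<open>regular\<close> asserts joint continuity for the time derivative only. Its local
  bound makes U Lipschitz in t, uniformly for nearby y, and continuity in y at the fixed time does
  the rest.\<close>

lemma joint_continuity:
  fixes U Ut :: "real \<Rightarrow> real \<Rightarrow> complex"
  assumes d: "\<And>t y. t > 0 \<Longrightarrow> ((\<lambda>s. U s y) has_vector_derivative Ut t y) (at t)"
    and c: "continuous_on ({0<..} \<times> UNIV) (\<lambda>(t, y). Ut t y)"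
    and cy: "\<And>t. t > 0 \<Longrightarrow> continuous_on UNIV (U t)"
  shows "continuous_on ({0<..} \<times> UNIV) (\<lambda>(t, y). U t y)"
proof -
  have "isCont (\<lambda>(t, y). U t y) (t0, y0)" if t0: "t0 > 0" for t0 y0
  proof -
    let ?K = "{t0/2..2*t0} \<times> {y0-1..y0+1}"
    have "compact ((\<lambda>(t, y). Ut t y) ` ?K)"
      by (rule compact_continuous_image[OF continuous_on_subset[OF c]]) (use t0 in \<open>auto intro: compact_Times\<close>)
    then have "bounded ((\<lambda>(t, y). Ut t y) ` ?K)" by (rule compact_imp_bounded)
    then obtain B where B: "\<And>t y. t \<in> {t0/2..2*t0} \<Longrightarrow> y \<in> {y0-1..y0+1} \<Longrightarrow> norm (Ut t y) \<le> B"
      unfolding bounded_iff by force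
    have lip: "norm (U t y - U t0 y) \<le> B * norm (t - t0)" if "t \<in> {t0/2..2*t0}" "y \<in> {y0-1..y0+1}" for t y
    proof (rule differentiable_bound[of "{t0/2..2*t0}" "\<lambda>s. U s y" "\<lambda>s h. h *\<^sub>R Ut s y"])
      fix s assume s: "s \<in> {t0/2..2*t0}"
      have "((\<lambda>s. U s y) has_vector_derivative Ut s y) (at s within {t0/2..2*t0})"
        by (rule has_vector_derivative_at_within[OF d]) (use s t0 in auto)
      then show "((\<lambda>s. U s y) has_derivative (\<lambda>h. h *\<^sub>R Ut s y)) (at s within {t0/2..2*t0})"
        by (simp add: has_vector_derivative_def)
      show "onorm (\<lambda>h. h *\<^sub>R Ut s y) \<le> B"
        by (rule onorm_le) (use B[OF s that(2)] in \<open>simp add: mult.commute[of B] mult_left_mono\<close>)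
    qed (use that t0 in auto)
    have "((\<lambda>z. U (fst z) (snd z) - U t0 (snd z)) \<longlongrightarrow> 0) (at (t0, y0))"
    proof (rule Lim_null_comparison)
      have "open ({t0/2<..<2*t0} \<times> {y0-1<..<y0+1})" by (intro open_Times) auto
      then have "\<forall>\<^sub>F z in nhds (t0, y0). z \<in> {t0/2<..<2*t0} \<times> {y0-1<..<y0+1}"
        using t0 by (intro eventually_nhds_in_open) auto
      then show "\<forall>\<^sub>F z in at (t0, y0). norm (U (fst z) (snd z) - U t0 (snd z)) \<le> B * norm (fst z - t0)"
        unfolding eventually_at_filter by eventually_elim (use lip in force)
      have "((\<lambda>z. B * norm (fst z - t0)) \<longlongrightarrow> B * norm (fst (t0, y0) - t0)) (at (t0, y0))"
        by (intro tendsto_intros)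
      then show "((\<lambda>z. B * norm (fst z - t0)) \<longlongrightarrow> 0) (at (t0, y0))" by simp
    qed
    moreover have "((\<lambda>z. U t0 (snd z)) \<longlongrightarrow> U t0 (snd (t0, y0))) (at (t0, y0))"
      using cy[OF t0] by (intro isCont_tendsto_compose[where g="U t0"] tendsto_intros) (auto simp: continuous_on_eq_continuous_at)
    ultimately have "((\<lambda>z. (U (fst z) (snd z) - U t0 (snd z)) + U t0 (snd z)) \<longlongrightarrow> 0 + U t0 y0) (at (t0, y0))"
      by (intro tendsto_add) simp_all
    then show ?thesis by (simp add: isCont_def split_beta')
  qed
  then show ?thesis by (intro continuous_at_imp_continuous_on) auto
qed

text \<open>What a mode retains of \<open>regular\<close>. Square-integrability and L2 continuity
  concern U alone; the derivatives are continuous but uncontrolled at infinity, and this is what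
  forces the localization.\<close>

definition classical ::
  "(real \<Rightarrow> real \<Rightarrow> complex) \<Rightarrow> (real \<Rightarrow> real \<Rightarrow> complex) \<Rightarrow> (real \<Rightarrow> real \<Rightarrow> complex) \<Rightarrow> (real \<Rightarrow> real \<Rightarrow> complex) \<Rightarrow> bool"
  where
  "classical U Ut Uy Uyy \<longleftrightarrow>
    (\<forall>t\<ge>0. L2 lborel (U t)) \<and>
    (\<forall>t\<ge>0. ((\<lambda>s. L2norm lborel (\<lambda>y. U s y - U t y)) \<longlongrightarrow> 0) (at t within {0..})) \<and>
    (\<forall>t>0. \<forall>y. ((\<lambda>s. U s y) has_vector_derivative Ut t y) (at t)) \<and>
    (\<forall>t>0. \<forall>y. (U t has_vector_derivative Uy t y) (at y)) \<and>
    (\<forall>t>0. \<forall>y. (Uy t has_vector_derivative Uyy t y) (at y)) \<and>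
    (\<forall>t>0. continuous_on UNIV (Uyy t)) \<and>
    continuous_on ({0<..} \<times> UNIV) (\<lambda>(t, y). Ut t y) \<and>
    continuous_on ({0<..} \<times> UNIV) (\<lambda>(t, y). U t y)"

lemma dt_continuous_compose:
  assumes "regular u" "continuous_on S a" "continuous_on S b" "continuous_on S c" "\<And>z. z \<in> S \<Longrightarrow> a z > 0"
  shows "continuous_on S (\<lambda>z. dt u (a z) (b z) (c z))"
proof -
  have "continuous_on ({0<..} \<times> UNIV) (\<lambda>(t, x, y). dt u t x y)"
    using assms(1) by (auto simp: regular_def)
  moreover have "continuous_on S (\<lambda>z. (a z, b z, c z))" by (intro continuous_on_Pair assms)
  moreover have "(\<lambda>z. (a z, b z, c z)) ` S \<subseteq> {0<..} \<times> UNIV" using assms(5) by auto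
  ultimately have "continuous_on S (\<lambda>z. case (a z, b z, c z) of (t, x, y) \<Rightarrow> dt u t x y)"
    by (rule continuous_on_compose2)
  then show ?thesis by simp
qed

lemma dt_continuous: "regular u \<Longrightarrow> t > 0 \<Longrightarrow> continuous_on A (\<lambda>x. dt u t x y)"
  by (rule dt_continuous_compose) (auto intro: continuous_intros)

lemma classical_mode:
  assumes u: "regular u"
  shows "classical (\<lambda>t. mode k (u t)) (\<lambda>t. mode k (dt u t)) (\<lambda>t. mode k (dy (u t))) (\<lambda>t. mode k (dy (dy (u t))))"
proof -
  have C: "C1_plane (u t)" "C1_plane (dx (u t))" "C1_plane (dy (u t))" if "t > 0" for t
    using u that by (auto simp: regular_def C2_plane_def)
  have L: "L2 Omega (\<lambda>(x, y). u t x y)" if "t \<ge> 0" for t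
    using u that by (auto simp: regular_def L2_continuous_def)
  have lim: "((\<lambda>s. L2norm lborel (\<lambda>y. mode k (u s) y - mode k (u t) y)) \<longlongrightarrow> 0) (at t within {0..})"
    if "t \<ge> 0" for t
  proof (rule Lim_null_comparison)
    show "((\<lambda>s. L2norm Omega (\<lambda>(x, y). u s x y - u t x y)) \<longlongrightarrow> 0) (at t within {0..})"
      using u that by (auto simp: regular_def L2_continuous_def)
    show "\<forall>\<^sub>F s in at t within {0..}. norm (L2norm lborel (\<lambda>y. mode k (u s) y - mode k (u t) y))
        \<le> L2norm Omega (\<lambda>(x, y). u s x y - u t x y)"
      unfolding eventually_at_filter
      by (intro always_eventually allI impI) (use mode_diff_L2norm[OF L L] that in auto)
  qed
  have mdt: "mode k (dt u t) y = kint k (\<lambda>x. dt u t x y)" if "t > 0" for t y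
    by (intro mode_eq_kint dt_continuous u that)
  have cm: "continuous_on ({0<..} \<times> UNIV) (\<lambda>(t, y). mode k (dt u t) y)"
  proof -
    have "continuous_on ({0<..} \<times> UNIV) (\<lambda>z. kint k (\<lambda>x. dt u (fst z) x (snd z)))"
    proof (rule kint_continuous)
      show "continuous_on (({0<..} \<times> UNIV) \<times> {0..2 * pi}) (\<lambda>(z, x). dt u (fst z) x (snd z))"
        unfolding split_beta by (rule dt_continuous_compose[OF u]) (auto intro!: continuous_intros)
    qed
    then show ?thesis by (rule continuous_on_eq) (auto simp: mdt)
  qed
  have ddt: "((\<lambda>s. mode k (u s) y) has_vector_derivative mode k (dt u t) y) (at t)" if t: "t > 0" for t y
  proof -
    have "((\<lambda>s. kint k (\<lambda>x. u s x y)) has_vector_derivative kint k (\<lambda>x. dt u t x y)) (at t)"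
    proof (rule kint_vector_derivative[where U="{0<..}"])
      show "((\<lambda>p. u p x y) has_real_derivative dt u p x y) (at p)" if "p \<in> {0<..}" for p x
        using u that unfolding regular_def dt_def by (auto intro: has_deriv)
      show "continuous_on {0..2 * pi} (\<lambda>x. u p x y)" if "p \<in> {0<..}" for p
        using C1_planeD(5)[OF C(1)] that by auto
      show "continuous_on ({0<..} \<times> {0..2 * pi}) (\<lambda>(p, x). dt u p x y)"
        unfolding split_beta by (rule dt_continuous_compose[OF u]) (auto intro!: continuous_intros)
    qed (use t in auto)
    then have "((\<lambda>s. kint k (\<lambda>x. u s x y)) has_vector_derivative mode k (dt u t) y) (at t)"
      using t by (simp add: mdt)
    then show ?thesis
    proof (rule has_vector_derivative_transform_within_open[where S="{0<..}"])
      show "kint k (\<lambda>x. u s x y) = mode k (u s) y" if "s \<in> {0<..}" for s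
        using mode_C1(1)[OF C(1), of s] that by simp
    qed (use t in auto)
  qed
  have cy: "continuous_on UNIV (mode k (u t))" if "t > 0" for t
    using mode_C1(4)[OF C(1)[OF that]] by (meson has_vector_derivative_continuous continuous_at_imp_continuous_on)
  show ?thesis
    unfolding classical_def
    using mode_L2(1)[OF L] lim ddt mode_C1(4,5)[OF C(1)] mode_C1(4,5)[OF C(3)] cm
      joint_continuity[OF ddt cm cy] by auto
qed

text \<open>Since \<open>b\<close> is \<open>- perp_grad \<psi>\<close>, its first component is
  \<open>dy \<psi>\<close>, and the nonlocal term becomes \<open>2 * \<i> * K * \<psi>y\<close> with
  \<psi> solving an elliptic equation on the line. \<psi> is obtained for each t separately, without
  any regularity in t. For k = 0 the factor K removes this term.\<close>

lemma solution_mode: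
  fixes k :: int
  assumes sol: "solution \<nu> \<mu> \<eta> w j \<theta>" and t: "t > 0"
    and K: "K = complex_of_int k"
  shows "mode k (dt \<theta> t) y = - \<i> * K * y * mode k (\<theta> t) y + \<eta> * (mode k (dy (dy (\<theta> t))) y - K\<^sup>2 * mode k (\<theta> t) y)"
    and "mode k (dt w t) y = - \<i> * K * y * mode k (w t) y + \<nu> * (mode k (dy (dy (w t))) y - K\<^sup>2 * mode k (w t) y)
      + \<i> * K * mode k (j t) y + \<i> * K * mode k (\<theta> t) y"
    and "\<exists>\<psi> \<psi>y \<psi>yy. (k \<noteq> 0 \<longrightarrow> L2 lborel \<psi>) \<and> (\<forall>y. (\<psi> has_vector_derivative \<psi>y y) (at y)) \<and>
      (\<forall>y. (\<psi>y has_vector_derivative \<psi>yy y) (at y)) \<and> continuous_on UNIV \<psi>yy \<and>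
      (\<forall>y. K\<^sup>2 * \<psi> y - \<psi>yy y = mode k (j t) y) \<and>
      (\<forall>y. mode k (dt j t) y = - \<i> * K * y * mode k (j t) y + \<mu> * (mode k (dy (dy (j t))) y - K\<^sup>2 * mode k (j t) y)
      + \<i> * K * mode k (w t) y + 2 * \<i> * K * \<psi>y y)"
proof -
  have reg: "regular w" "regular j" "regular \<theta>" using sol by (auto simp: solution_def)
  have P: "periodic_x (w t)" "periodic_x (j t)" "periodic_x (\<theta> t)"
    and C2: "C2_plane (w t)" "C2_plane (j t)" "C2_plane (\<theta> t)"
    using reg t by (auto simp: regular_def)
  obtain b where b: "magnetic_field (j t) (b t)" and
    eqw: "\<And>x y. dt w t x y + y * dx (w t) x y - dx (j t) x y - \<nu> * laplacian (w t) x y - dx (\<theta> t) x y = 0" and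
    eqj: "\<And>x y. dt j t x y + y * dx (j t) x y - dx (w t) x y - \<mu> * laplacian (j t) x y - 2 * dx (\<lambda>x y. fst (b t x y)) x y = 0" and
    eqt: "\<And>x y. dt \<theta> t x y + y * dx (\<theta> t) x y - \<eta> * laplacian (\<theta> t) x y = 0"
    using sol t unfolding solution_def by blast
  have md: "kint k (\<lambda>x. dt u t x y) = mode k (dt u t) y" if "regular u" for u y
    by (intro mode_eq_kint[symmetric] dt_continuous that t)
  have mx: "kint k (\<lambda>x. dx f x y) = \<i> * K * mode k f y" if "periodic_x f" "C1_plane f" for f y
    using mode_dx[OF that] mode_C1(2)[OF that(2)] by (simp add: K)
  note C1 = C2_planeD(1)[OF C2(1)] C2_planeD(1)[OF C2(2)] C2_planeD(1)[OF C2(3)]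
  note cc = dt_continuous[OF reg(1) t] dt_continuous[OF reg(2) t] dt_continuous[OF reg(3) t]
    C1_planeD(6)[OF C1(1)] C1_planeD(6)[OF C1(2)] C1_planeD(6)[OF C1(3)]
    laplacian_continuous[OF C2(1)] laplacian_continuous[OF C2(2)] laplacian_continuous[OF C2(3)]
  have "kint k (\<lambda>x. dt \<theta> t x y + y * dx (\<theta> t) x y - \<eta> * laplacian (\<theta> t) x y) = 0" for y
    unfolding eqt by (simp add: kint_def)
  then have "mode k (dt \<theta> t) y + y * (\<i> * K * mode k (\<theta> t) y)
      - \<eta> * (- (of_int k)\<^sup>2 * mode k (\<theta> t) y + mode k (dy (dy (\<theta> t))) y) = 0"
    by (simp add: kint_diff kint_add cc continuous_on_add continuous_on_diff continuous_on_mult continuous_on_const kint_cmult md[OF reg(3)] mx[OF P(3) C1(3)] kint_laplacian[OF P(3) C2(3)])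
  then show "mode k (dt \<theta> t) y = - \<i> * K * y * mode k (\<theta> t) y + \<eta> * (mode k (dy (dy (\<theta> t))) y - K\<^sup>2 * mode k (\<theta> t) y)"
    by (simp add: K algebra_simps add_eq_0_iff)
  have "kint k (\<lambda>x. dt w t x y + y * dx (w t) x y - dx (j t) x y - \<nu> * laplacian (w t) x y - dx (\<theta> t) x y) = 0" for y
    unfolding eqw by (simp add: kint_def)
  then have "mode k (dt w t) y + y * (\<i> * K * mode k (w t) y) - \<i> * K * mode k (j t) y
      - \<nu> * (- (of_int k)\<^sup>2 * mode k (w t) y + mode k (dy (dy (w t))) y) - \<i> * K * mode k (\<theta> t) y = 0"
    by (simp add: kint_diff kint_add cc continuous_on_add continuous_on_diff continuous_on_mult continuous_on_const kint_cmult md[OF reg(1)] mx[OF P(1) C1(1)] mx[OF P(2) C1(2)] mx[OF P(3) C1(3)] kint_laplacian[OF P(1) C2(1)])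
  then show "mode k (dt w t) y = - \<i> * K * y * mode k (w t) y + \<nu> * (mode k (dy (dy (w t))) y - K\<^sup>2 * mode k (w t) y)
      + \<i> * K * mode k (j t) y + \<i> * K * mode k (\<theta> t) y"
    by (simp add: K algebra_simps add_eq_0_iff)
  obtain \<psi> where \<psi>: "periodic_x \<psi>" "C2_plane \<psi>" "\<And>x y. - laplacian \<psi> x y = j t x y"
    "k \<noteq> 0 \<Longrightarrow> L2 lborel (mode k \<psi>)" and b\<psi>: "\<And>x y. b t x y = - perp_grad \<psi> x y"
    using b unfolding magnetic_field_def inv_neg_laplacian_def by blast
  note C\<psi> = C2_planeD[OF \<psi>(2)]
  have bfst: "(\<lambda>x y. fst (b t x y)) = dy \<psi>" by (intro ext) (simp add: b\<psi> perp_grad_def)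
  have "kint k (\<lambda>x. dt j t x y + y * dx (j t) x y - dx (w t) x y - \<mu> * laplacian (j t) x y - 2 * dx (dy \<psi>) x y) = 0" for y
    using eqj unfolding bfst by (simp add: kint_def)
  then have "mode k (dt j t) y + y * (\<i> * K * mode k (j t) y) - \<i> * K * mode k (w t) y
      - \<mu> * (- (of_int k)\<^sup>2 * mode k (j t) y + mode k (dy (dy (j t))) y) - 2 * (\<i> * K * mode k (dy \<psi>) y) = 0" for y
    by (simp add: kint_diff kint_add cc C1_planeD(6)[OF C\<psi>(3)] continuous_on_add continuous_on_diff continuous_on_mult
        continuous_on_const kint_cmult md[OF reg(2)] mx[OF P(1) C1(1)] mx[OF P(2) C1(2)] mx[OF periodic_dy[OF \<psi>(1)] C\<psi>(3)]
        kint_laplacian[OF P(2) C2(2)])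
  then have E: "mode k (dt j t) y = - \<i> * K * y * mode k (j t) y + \<mu> * (mode k (dy (dy (j t))) y - K\<^sup>2 * mode k (j t) y)
      + \<i> * K * mode k (w t) y + 2 * \<i> * K * mode k (dy \<psi>) y" for y
    by (simp add: K algebra_simps add_eq_0_iff)
  have "kint k (\<lambda>x. laplacian \<psi> x y) = kint k (\<lambda>x. (-1) * j t x y)" for y
    using \<psi>(3) by (intro arg_cong[where f="kint k"] ext) (metis mult_minus1 minus_minus)
  then have "- (of_int k)\<^sup>2 * mode k \<psi> y + mode k (dy (dy \<psi>)) y = - mode k (j t) y" for y
    unfolding kint_cmult kint_laplacian[OF \<psi>(1,2)] using mode_C1(1)[OF C1(2)] by simp
  then have "K\<^sup>2 * mode k \<psi> y - mode k (dy (dy \<psi>)) y = mode k (j t) y" for y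
    by (simp add: K algebra_simps add_eq_0_iff)
  with E \<psi>(4) mode_C1(4,5)[OF C\<psi>(1)] mode_C1(4,5)[OF C\<psi>(3)]
  show "\<exists>\<psi> \<psi>y \<psi>yy. (k \<noteq> 0 \<longrightarrow> L2 lborel \<psi>) \<and> (\<forall>y. (\<psi> has_vector_derivative \<psi>y y) (at y)) \<and>
      (\<forall>y. (\<psi>y has_vector_derivative \<psi>yy y) (at y)) \<and> continuous_on UNIV \<psi>yy \<and>
      (\<forall>y. K\<^sup>2 * \<psi> y - \<psi>yy y = mode k (j t) y) \<and>
      (\<forall>y. mode k (dt j t) y = - \<i> * K * y * mode k (j t) y + \<mu> * (mode k (dy (dy (j t))) y - K\<^sup>2 * mode k (j t) y)
      + \<i> * K * mode k (w t) y + 2 * \<i> * K * \<psi>y y)"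
    by (intro exI[of _ "mode k \<psi>"] exI[of _ "mode k (dy \<psi>)"] exI[of _ "mode k (dy (dy \<psi>))"]) auto
qed

section \<open>Localized Fourier transforms\<close>

text \<open>Vanishes at -n and n together with its first derivative, so that two integrations by
  parts leave no boundary terms; as a polynomial it has explicit derivatives.\<close>

definition window :: "nat \<Rightarrow> real \<Rightarrow> real" where
  "window n y = (1 - (y / n)\<^sup>2) ^ 3"

definition cutoff :: "nat \<Rightarrow> (real \<Rightarrow> complex) \<Rightarrow> real \<Rightarrow> complex" where
  "cutoff n f y = indicator {-real n..real n} y *\<^sub>R (window n y *\<^sub>R f y)"

lemma window_bounds:
  assumes "\<bar>y\<bar> \<le> real n" shows "0 \<le> window n y" "window n y \<le> 1"
proof -
  have "\<bar>y / n\<bar> \<le> 1" using assms by (cases "n = 0") (auto simp: divide_le_eq)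
  then have "(y / n)\<^sup>2 \<le> 1" by (simp add: abs_square_le_1)
  then show "0 \<le> window n y" "window n y \<le> 1"
    unfolding window_def by (auto intro!: zero_le_power power_le_one)
qed

lemma norm_cutoff_le: "norm (cutoff n f y) \<le> norm (f y)"
  using window_bounds[of y n] by (auto simp: cutoff_def indicator_def abs_le_iff intro!: mult_left_le_one_le)

lemma cutoff_measurable [measurable]: "f \<in> borel_measurable borel \<Longrightarrow> cutoff n f \<in> borel_measurable borel"
  unfolding cutoff_def[abs_def] window_def by measurable

lemma cutoff_L2:
  assumes "L2 lborel f" shows "L2 lborel (cutoff n f)"
  using L2D(1)[OF assms] by (intro L2_bound[OF assms]) (auto simp: norm_cutoff_le)

lemma cutoff_integrable:
  assumes "L2 lborel f" shows "integrable lborel (cutoff n f)"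
proof (rule Bochner_Integration.integrable_bound[OF L2_integrable_on_bounded(1)[OF assms, of "-real n" "real n"]])
  show "AE y in lborel. norm (cutoff n f y) \<le> norm (indicator {-real n..real n} y *\<^sub>R f y)"
  proof (rule AE_I2)
    show "norm (cutoff n f y) \<le> norm (indicator {-real n..real n} y *\<^sub>R f y)" for y
      using norm_cutoff_le[of n f y] by (cases "y \<in> {-real n..real n}") (auto simp: cutoff_def)
  qed
qed (use L2D(1)[OF assms] in simp)

lemma cutoff_tendsto:
  assumes f: "L2 lborel f"
  shows "(\<lambda>n. L2norm lborel (\<lambda>y. cutoff n f y - f y)) \<longlonglongrightarrow> 0"
proof (rule L2_dominated_conv[OF f])
  show "cutoff n f \<in> borel_measurable lborel" for n using L2D(1)[OF cutoff_L2[OF f]] .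
  show "norm (cutoff n f y) \<le> norm (f y)" for n y by (rule norm_cutoff_le)
  fix y
  obtain m :: nat where m: "\<bar>y\<bar> \<le> real m" using real_arch_simple by blast
  have "(\<lambda>n. inverse (real n)) \<longlonglongrightarrow> 0" by (rule lim_inverse_n)
  then have "(\<lambda>n. (1 - (y * inverse (real n))\<^sup>2) ^ 3 *\<^sub>R f y) \<longlonglongrightarrow> (1 - (y * 0)\<^sup>2) ^ 3 *\<^sub>R f y"
    by (intro tendsto_intros)
  moreover have "\<forall>\<^sub>F n in sequentially. (1 - (y * inverse (real n))\<^sup>2) ^ 3 *\<^sub>R f y = cutoff n f y"
  proof (rule eventually_sequentiallyI[of m])
    fix n assume "m \<le> n"
    then have "\<bar>y\<bar> \<le> real n" using m by linarith
    then show "(1 - (y * inverse (real n))\<^sup>2) ^ 3 *\<^sub>R f y = cutoff n f y"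
      by (auto simp: cutoff_def window_def indicator_def divide_inverse)
  qed
  ultimately show "(\<lambda>n. cutoff n f y) \<longlonglongrightarrow> f y" by (simp add: Lim_transform_eventually)
qed

text \<open>L2 convergence gives pointwise convergence only along a subsequence. A finite set is
  treated at once because all data in one energy inequality must converge at the same frequency
  along the same subsequence.\<close>

lemma ft_cutoff_AE_subseq:
  assumes "finite I" "\<And>f. f \<in> I \<Longrightarrow> L2 lborel f"
  shows "\<exists>r::nat\<Rightarrow>nat. strict_mono r \<and> (AE \<xi> in lborel. \<forall>f\<in>I. (\<lambda>n. ft (cutoff (r n) f) \<xi>) \<longlonglongrightarrow> fourier f \<xi>)"
  using assms
proof (induction I rule: finite_induct)
  case empty
  show ?case by (intro exI[of _ id]) (auto simp: strict_mono_def)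
next
  case (insert f I)
  then obtain r where r: "strict_mono r" "AE \<xi> in lborel. \<forall>f\<in>I. (\<lambda>n. ft (cutoff (r n) f) \<xi>) \<longlonglongrightarrow> fourier f \<xi>"
    by auto
  have f: "L2 lborel f" using insert by simp
  note c = cutoff_integrable[OF f] cutoff_L2[OF f]
  have "(\<lambda>n. L2norm lborel (\<lambda>\<xi>. ft (cutoff n f) \<xi> - fourier f \<xi>)) \<longlonglongrightarrow> 0"
    by (simp add: fourier_dist[OF c f] cutoff_tendsto[OF f])
  then have lim: "(\<lambda>n. L2norm lborel (\<lambda>\<xi>. ft (cutoff (r n) f) \<xi> - fourier f \<xi>)) \<longlonglongrightarrow> 0"
    using LIMSEQ_subseq_LIMSEQ[OF _ r(1)] by (simp add: comp_def)
  have "L2 lborel (\<lambda>\<xi>. ft (cutoff (r n) f) \<xi> - fourier f \<xi>)" for n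
    by (intro L2_diff Plancherel_L1_L2 c fourier_L2 f)
  from L2_AE_subseq[OF this lim] obtain r' where r': "strict_mono r'"
    "AE \<xi> in lborel. (\<lambda>n. ft (cutoff (r (r' n)) f) \<xi> - fourier f \<xi>) \<longlonglongrightarrow> 0" by blast
  show ?case
  proof (intro exI[of _ "r \<circ> r'"] conjI strict_mono_o r r')
    show "AE \<xi> in lborel. \<forall>f\<in>insert f I. (\<lambda>n. ft (cutoff ((r \<circ> r') n) f) \<xi>) \<longlonglongrightarrow> fourier f \<xi>"
      using r(2) r'(2)
    proof eventually_elim
      case (elim \<xi>)
      have "(\<lambda>n. ft (cutoff (r (r' n)) g) \<xi>) \<longlonglongrightarrow> fourier g \<xi>" if "g \<in> I" for g
        using LIMSEQ_subseq_LIMSEQ[OF elim(1)[rule_format, OF that] r'(1)] by (simp add: comp_def)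
      moreover have "(\<lambda>n. ft (cutoff (r (r' n)) f) \<xi>) \<longlonglongrightarrow> fourier f \<xi>"
        using elim(2) by (rule LIM_zero_cancel)
      ultimately show ?case by simp
    qed
  qed
qed

lemma windowed_integral_bound:
  fixes f g :: "real \<Rightarrow> complex"
  assumes f: "L2 lborel f" and [measurable]: "g \<in> borel_measurable borel"
    and B: "\<And>y. \<bar>y\<bar> \<le> real n \<Longrightarrow> norm (g y) \<le> B"
  shows "norm (\<integral>y. indicator {-real n..real n} y *\<^sub>R (g y * f y) \<partial>lborel) \<le> B * (sqrt (2 * n) * L2norm lborel f)"
proof -
  note [measurable] = L2D(1)[OF f, simplified]
  have i: "integrable lborel (\<lambda>y. indicator {-real n..real n} y * norm (f y))"
    using integrable_norm[OF L2_integrable_on_bounded(1)[OF f, of "-real n" "real n"]] by simp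
  have B0: "0 \<le> B" using order_trans[OF norm_ge_zero B[of 0]] by simp
  have "norm (\<integral>y. indicator {-real n..real n} y *\<^sub>R (g y * f y) \<partial>lborel) \<le>
      (\<integral>y. norm (indicator {-real n..real n} y *\<^sub>R (g y * f y)) \<partial>lborel)"
    by (rule integral_norm_bound)
  also have "\<dots> \<le> (\<integral>y. B * (indicator {-real n..real n} y * norm (f y)) \<partial>lborel)"
  proof (rule integral_mono)
    show le: "norm (indicator {-real n..real n} y *\<^sub>R (g y * f y)) \<le> B * (indicator {-real n..real n} y * norm (f y))" for y
      using B[of y] by (auto simp: indicator_def norm_mult intro!: mult_right_mono)
    show "integrable lborel (\<lambda>y. B * (indicator {-real n..real n} y * norm (f y)))" using i by simp
    then show "integrable lborel (\<lambda>y. norm (indicator {-real n..real n} y *\<^sub>R (g y * f y)))"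
      by (rule Bochner_Integration.integrable_bound) (use le B0 in \<open>auto simp: abs_mult\<close>)
  qed
  also have "\<dots> = B * (\<integral>y. indicator {-real n..real n} y * norm (f y) \<partial>lborel)" by simp
  also have "\<dots> \<le> B * (sqrt (2 * n) * L2norm lborel f)"
    using L2_integrable_on_bounded(2)[OF f, of "-real n" "real n"] B0 by (intro mult_left_mono) auto
  finally show ?thesis .
qed

text \<open>Unlike Plancherel's theorem this holds at every frequency. It turns L2 continuity in
  time into continuity of the localized transform at a fixed frequency, down to t = 0.\<close>

lemma ft_cutoff_bound:
  assumes "L2 lborel f"
  shows "norm (ft (cutoff n f) \<zeta>) \<le> sqrt (2 * n) * L2norm lborel f"
proof -
  have "(\<integral>y. cutoff n f y * cis (- (\<zeta> * y)) \<partial>lborel) =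
      (\<integral>y. indicator {-real n..real n} y *\<^sub>R ((of_real (window n y) * cis (- (\<zeta> * y))) * f y) \<partial>lborel)"
    by (intro Bochner_Integration.integral_cong) (auto simp: cutoff_def scaleR_conv_of_real mult_ac)
  also have "norm \<dots> \<le> 1 * (sqrt (2 * n) * L2norm lborel f)"
  proof (rule windowed_integral_bound[OF assms])
    show "(\<lambda>y. of_real (window n y) * cis (- (\<zeta> * y))) \<in> borel_measurable borel"
      unfolding window_def by measurable
  qed (auto simp: norm_mult window_bounds)
  finally have "norm (\<integral>y. cutoff n f y * cis (- (\<zeta> * y)) \<partial>lborel) \<le> sqrt (2 * n) * L2norm lborel f" by simp
  moreover have "1 \<le> sqrt (2 * pi)" using pi_gt3 by simp
  ultimately have "norm (\<integral>y. cutoff n f y * cis (- (\<zeta> * y)) \<partial>lborel) / sqrt (2 * pi) \<le> sqrt (2 * n) * L2norm lborel f / 1"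
    by (intro frac_le) auto
  then show ?thesis by (simp add: ft_def norm_divide)
qed

lemma ft_cutoff_diff:
  assumes "L2 lborel f" "L2 lborel g"
  shows "ft (cutoff n (\<lambda>y. f y - g y)) \<zeta> = ft (cutoff n f) \<zeta> - ft (cutoff n g) \<zeta>"
proof -
  have "cutoff n (\<lambda>y. f y - g y) = (\<lambda>y. cutoff n f y - cutoff n g y)"
    by (auto simp: cutoff_def algebra_simps)
  then show ?thesis using ft_diff[OF cutoff_integrable[OF assms(1)] cutoff_integrable[OF assms(2)]] by simp
qed

lemma integration_by_parts_interval:
  fixes f g :: "real \<Rightarrow> complex"
  assumes "\<And>y. (f has_vector_derivative f' y) (at y)" "\<And>y. (g has_vector_derivative g' y) (at y)"
    and "continuous_on UNIV f'" "continuous_on UNIV g'" and "g a = 0" "g b = 0" "a \<le> b"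
  shows "(\<integral>y. indicator {a..b} y *\<^sub>R (g y * f' y) \<partial>lborel) = - (\<integral>y. indicator {a..b} y *\<^sub>R (g' y * f y) \<partial>lborel)"
proof -
  have fc: "continuous_on UNIV f" and gc: "continuous_on UNIV g"
    using assms(1,2) by (meson has_vector_derivative_continuous continuous_at_imp_continuous_on)+
  have i: "integrable lborel (\<lambda>y. indicator {a..b} y *\<^sub>R h y)" if "continuous_on UNIV h" for h :: "real \<Rightarrow> complex"
    using borel_integrable_compact[of "{a..b}" h] continuous_on_subset[OF that] by (simp add: indicator_scaleR_eq_if)
  have "(\<integral>y. indicator {a..b} y *\<^sub>R (g y * f' y + g' y * f y) \<partial>lborel) = g b * f b - g a * f a"
  proof (rule integral_FTC_atLeastAtMost[OF assms(7)])
    show "((\<lambda>y. g y * f y) has_vector_derivative g y * f' y + g' y * f y) (at y within {a..b})" for y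
      by (rule has_vector_derivative_at_within[OF has_vector_derivative_mult[OF assms(2,1)]])
    show "continuous_on {a..b} (\<lambda>y. g y * f' y + g' y * f y)"
      by (intro continuous_intros continuous_on_subset[OF fc] continuous_on_subset[OF gc]
          continuous_on_subset[OF assms(3)] continuous_on_subset[OF assms(4)]) auto
  qed
  moreover have "(\<integral>y. indicator {a..b} y *\<^sub>R (g y * f' y + g' y * f y) \<partial>lborel) =
      (\<integral>y. indicator {a..b} y *\<^sub>R (g y * f' y) \<partial>lborel) + (\<integral>y. indicator {a..b} y *\<^sub>R (g' y * f y) \<partial>lborel)"
    unfolding scaleR_add_right
    by (intro Bochner_Integration.integral_add i continuous_intros fc gc assms)
  ultimately show ?thesis using assms(5,6) by (simp add: add_eq_0_iff2)
qed

lemma ft_cutoff_eq: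
  "ft (cutoff n f) \<zeta> = (\<integral>y. indicator {-real n..real n} y *\<^sub>R ((of_real (window n y) * cis (- (\<zeta> * y))) * f y) \<partial>lborel) / sqrt (2 * pi)"
  unfolding ft_def by (intro arg_cong2[where f="(/)"] refl Bochner_Integration.integral_cong)
    (auto simp: cutoff_def scaleR_conv_of_real mult_ac)

definition window' :: "nat \<Rightarrow> real \<Rightarrow> real" where
  "window' n y = - 6 * (y / n) * (1 - (y / n)\<^sup>2)\<^sup>2 / n"

definition window'' :: "nat \<Rightarrow> real \<Rightarrow> real" where
  "window'' n y = (24 * (y / n)\<^sup>2 * (1 - (y / n)\<^sup>2) - 6 * (1 - (y / n)\<^sup>2)\<^sup>2) / (real n)\<^sup>2"

lemma window_deriv:
  assumes "n > 0"
  shows "(window n has_real_derivative window' n y) (at y)"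
    and "(window' n has_real_derivative window'' n y) (at y)"
proof -
  show "(window n has_real_derivative window' n y) (at y)"
    unfolding window_def[abs_def] window'_def
    using assms by (auto intro!: derivative_eq_intros simp: power2_eq_square)
  show "(window' n has_real_derivative window'' n y) (at y)"
    unfolding window'_def[abs_def] window''_def
    using assms by (auto intro!: derivative_eq_intros simp: power2_eq_square field_simps)
qed

text \<open>The constants are the coefficients 6 and 24 + 6, as |y/n| is at most 1. The second bound
  is weakened from n^-2 to 1/n so that both commutators have the same order.\<close>

lemma window'_bound:
  assumes "n > 0" "\<bar>y\<bar> \<le> real n"
  shows "\<bar>window' n y\<bar> \<le> 6 / n" "\<bar>window'' n y\<bar> \<le> 30 / n"
proof -
  let ?u = "y / n"
  have u: "\<bar>?u\<bar> \<le> 1" using assms by (simp add: divide_le_eq)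
  then have u2: "0 \<le> ?u\<^sup>2" "?u\<^sup>2 \<le> 1" by (auto simp: abs_square_le_1)
  have v: "0 \<le> 1 - ?u\<^sup>2" "1 - ?u\<^sup>2 \<le> 1" using u2 by auto
  have v2: "(1 - ?u\<^sup>2)\<^sup>2 \<le> 1" using v by (intro power_le_one)
  have "\<bar>window' n y\<bar> = 6 * (\<bar>?u\<bar> * (1 - ?u\<^sup>2)\<^sup>2) / n" by (simp add: window'_def abs_mult)
  also have "\<dots> \<le> 6 * (1 * 1) / n"
    using u v2 by (intro divide_right_mono mult_left_mono mult_mono) auto
  finally show "\<bar>window' n y\<bar> \<le> 6 / n" by simp
  have "\<bar>24 * ?u\<^sup>2 * (1 - ?u\<^sup>2) - 6 * (1 - ?u\<^sup>2)\<^sup>2\<bar> \<le> 30"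
  proof -
    have "0 \<le> ?u\<^sup>2 * (1 - ?u\<^sup>2)" "?u\<^sup>2 * (1 - ?u\<^sup>2) \<le> 1" using u2 v by (auto intro: mult_le_one)
    moreover have "0 \<le> (1 - ?u\<^sup>2)\<^sup>2" by simp
    ultimately show ?thesis using v2 by linarith
  qed
  then have "\<bar>window'' n y\<bar> \<le> 30 / (real n)\<^sup>2" by (simp add: window''_def divide_right_mono)
  also have "\<dots> \<le> 30 / n"
    using assms by (intro divide_left_mono) (auto simp: power2_eq_square)
  finally show "\<bar>window'' n y\<bar> \<le> 30 / n" .
qed

lemma sqrt_over_n: "n > 0 \<Longrightarrow> c / real n * (sqrt (2 * n) * a) / sqrt (2 * pi) \<le> c / sqrt n * a" if "c \<ge> 0" "a \<ge> 0"
proof -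
  assume n: "n > 0"
  have "c / real n * (sqrt (2 * n) * a) / sqrt (2 * pi) = (c / sqrt n * a) * (1 / sqrt pi)"
    using n by (simp add: real_sqrt_mult field_simps) 
  also have "\<dots> \<le> (c / sqrt n * a) * 1"
    using pi_gt3 that n by (intro mult_left_mono) (auto simp: divide_le_eq_1)
  finally show ?thesis by simp
qed

text \<open>All derivatives are moved onto window times phase. Where only the phase is
  differentiated, the multiplier \<i> \<zeta> or -\<zeta>^2 appears; the remainder contains a
  derivative of the window and is bounded through the norm of f alone. The 12 is twice the bound 6
  for \<open>window'\<close>, from the mixed term.\<close>

lemma
  fixes \<zeta> :: real and f f' f'' :: "real \<Rightarrow> complex"
  assumes n: "n > 0" and f: "L2 lborel f"
    and d1: "\<And>y. (f has_vector_derivative f' y) (at y)"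
    and c1: "continuous_on UNIV f'"
  shows ft_cutoff_deriv: "norm (ft (cutoff n f') \<zeta> - \<i> * \<zeta> * ft (cutoff n f) \<zeta>) \<le> 6 / sqrt n * L2norm lborel f"
    and ft_cutoff_deriv2: "\<lbrakk>\<And>y. (f' has_vector_derivative f'' y) (at y); continuous_on UNIV f''\<rbrakk> \<Longrightarrow>
      norm (ft (cutoff n f'') \<zeta> + \<zeta>\<^sup>2 * ft (cutoff n f) \<zeta>) \<le> (30 + 12 * \<bar>\<zeta>\<bar>) / sqrt n * L2norm lborel f"
proof -
  let ?I = "\<lambda>g f. \<integral>y. indicator {-real n..real n} y *\<^sub>R (g y * f y) \<partial>lborel"
  define E where "E y = cis (- (\<zeta> * y))" for y
  define g where "g y = of_real (window n y) * E y" for y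
  define g' where "g' y = (of_real (window' n y) - \<i> * \<zeta> * of_real (window n y)) * E y" for y
  define g'' where "g'' y = (of_real (window'' n y) - 2 * \<i> * \<zeta> * of_real (window' n y) - \<zeta>\<^sup>2 * of_real (window n y)) * E y" for y
  have Ed: "(E has_vector_derivative - (\<i> * \<zeta>) * E y) (at y)" for y
    unfolding has_vector_derivative_def E_def[abs_def]
    by (auto intro!: derivative_eq_intros simp: scaleR_conv_of_real algebra_simps)
  note wd = has_vector_derivative_complex_of_real[OF window_deriv(1)[OF n]]
    has_vector_derivative_complex_of_real[OF window_deriv(2)[OF n]]
  have gd: "(g has_vector_derivative g' y) (at y)" for y
  proof -
    have "(g has_vector_derivative of_real (window n y) * (- (\<i> * \<zeta>) * E y) + of_real (window' n y) * E y) (at y)"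
      unfolding g_def by (rule has_vector_derivative_mult[OF wd(1) Ed])
    then show ?thesis by (simp add: g'_def algebra_simps)
  qed
  have g'd: "(g' has_vector_derivative g'' y) (at y)" for y
  proof -
    have "(g' has_vector_derivative (of_real (window' n y) - \<i> * \<zeta> * of_real (window n y)) * (- (\<i> * \<zeta>) * E y)
        + (of_real (window'' n y) - \<i> * \<zeta> * of_real (window' n y)) * E y) (at y)"
      unfolding g'_def
      by (intro has_vector_derivative_mult has_vector_derivative_diff has_vector_derivative_mult_right wd Ed)
    moreover have "(of_real (window' n y) - \<i> * \<zeta> * of_real (window n y)) * (- (\<i> * \<zeta>) * E y)
        + (of_real (window'' n y) - \<i> * \<zeta> * of_real (window' n y)) * E y = g'' y"
      by (simp add: g''_def algebra_simps power2_eq_square)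
    ultimately show ?thesis by simp
  qed
  have Ec: "continuous_on UNIV E" unfolding E_def by (intro continuous_intros)
  have gc: "continuous_on UNIV g" "continuous_on UNIV g'"
    using gd g'd by (meson has_vector_derivative_continuous continuous_at_imp_continuous_on)+
  have g''c: "continuous_on UNIV g''"
    unfolding g''_def window''_def window'_def window_def by (intro continuous_intros Ec) (use n in auto)
  have E[measurable]: "E \<in> borel_measurable borel" by (intro borel_measurable_continuous_onI Ec)
  have w[measurable]: "window n \<in> borel_measurable borel" "window' n \<in> borel_measurable borel" "window'' n \<in> borel_measurable borel"
    unfolding window_def[abs_def] window'_def[abs_def] window''_def[abs_def] by measurable
  have [measurable]: "f \<in> borel_measurable borel" using L2D(1)[OF f] by simp
  have bd: "g (real n) = 0" "g (-real n) = 0" "g' (real n) = 0" "g' (-real n) = 0"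
    using n by (auto simp: g_def g'_def window_def window'_def)
  have fc: "continuous_on UNIV f"
    using d1 by (meson has_vector_derivative_continuous continuous_at_imp_continuous_on)
  have i: "integrable lborel (\<lambda>y. indicator {-real n..real n} y *\<^sub>R (h y * f y))" if "continuous_on UNIV h" for h :: "real \<Rightarrow> complex"
    using borel_integrable_compact[of "{-real n..real n}" "\<lambda>y. h y * f y"] continuous_on_subset[OF that] continuous_on_subset[OF fc]
    by (simp add: indicator_scaleR_eq_if continuous_on_mult)
  have ftc: "ft (cutoff n h) \<zeta> = ?I g h / sqrt (2 * pi)" for h
    by (simp add: ft_cutoff_eq g_def E_def)
  have s1: "?I g f' = - ?I g' f"
    by (rule integration_by_parts_interval[OF d1 gd c1 gc(2) bd(2,1)]) simp
  define h1 where "h1 y = of_real (window' n y) * E y" for y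
  have "?I g' f = ?I h1 f - \<i> * \<zeta> * ?I g f"
  proof -
    have "?I g' f = (\<integral>y. indicator {-real n..real n} y *\<^sub>R (h1 y * f y) - \<i> * \<zeta> * (indicator {-real n..real n} y *\<^sub>R (g y * f y)) \<partial>lborel)"
      by (intro Bochner_Integration.integral_cong) (auto simp: g'_def g_def h1_def algebra_simps scaleR_conv_of_real)
    also have "\<dots> = ?I h1 f - (\<integral>y. \<i> * \<zeta> * (indicator {-real n..real n} y *\<^sub>R (g y * f y)) \<partial>lborel)"
    proof (rule Bochner_Integration.integral_diff)
      show "integrable lborel (\<lambda>y. indicator {-real n..real n} y *\<^sub>R (h1 y * f y))"
        using n by (intro i) (auto simp: h1_def[abs_def] window'_def intro!: continuous_intros Ec)
      show "integrable lborel (\<lambda>y. \<i> * \<zeta> * (indicator {-real n..real n} y *\<^sub>R (g y * f y)))"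
        by (intro integrable_mult_right i gc)
    qed
    finally show ?thesis by (simp only: integral_mult_right_zero)
  qed
  with s1 have "ft (cutoff n f') \<zeta> - \<i> * \<zeta> * ft (cutoff n f) \<zeta> = - ?I h1 f / sqrt (2 * pi)"
    by (simp add: ftc diff_divide_distrib)
  moreover have "norm (?I h1 f) \<le> 6 / n * (sqrt (2 * n) * L2norm lborel f)"
  proof (rule windowed_integral_bound[OF f])
    show "h1 \<in> borel_measurable borel" unfolding h1_def[abs_def] by measurable
  qed (use window'_bound[OF n] in \<open>auto simp: h1_def E_def norm_mult\<close>)
  ultimately have "norm (ft (cutoff n f') \<zeta> - \<i> * \<zeta> * ft (cutoff n f) \<zeta>) \<le> 6 / n * (sqrt (2 * n) * L2norm lborel f) / sqrt (2 * pi)"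
    by (simp add: norm_divide divide_right_mono del: times_divide_eq_left)
  also have "\<dots> \<le> 6 / sqrt n * L2norm lborel f"
    using sqrt_over_n[of 6 "L2norm lborel f" n] n by simp
  finally show "norm (ft (cutoff n f') \<zeta> - \<i> * \<zeta> * ft (cutoff n f) \<zeta>) \<le> 6 / sqrt n * L2norm lborel f" .
  assume d2: "\<And>y. (f' has_vector_derivative f'' y) (at y)" and c2: "continuous_on UNIV f''"
  have s2: "?I g f'' = ?I g'' f"
  proof -
    have "?I g f'' = - ?I g' f'"
      by (rule integration_by_parts_interval[OF d2 gd c2 gc(2) bd(2,1)]) simp
    also have "?I g' f' = - ?I g'' f"
      by (rule integration_by_parts_interval[OF d1 g'd c1 g''c bd(4,3)]) simp
    finally show ?thesis by simp
  qed
  define h2 where "h2 y = (of_real (window'' n y) - 2 * \<i> * \<zeta> * of_real (window' n y)) * E y" for y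
  have h2c: "continuous_on UNIV h2"
    unfolding h2_def window''_def window'_def by (intro continuous_intros Ec) (use n in auto)
  have "?I g'' f = ?I h2 f - \<zeta>\<^sup>2 * ?I g f"
  proof -
    have "?I g'' f = (\<integral>y. indicator {-real n..real n} y *\<^sub>R (h2 y * f y) - \<zeta>\<^sup>2 * (indicator {-real n..real n} y *\<^sub>R (g y * f y)) \<partial>lborel)"
      by (intro Bochner_Integration.integral_cong) (auto simp: g''_def g_def h2_def algebra_simps scaleR_conv_of_real)
    also have "\<dots> = ?I h2 f - (\<integral>y. \<zeta>\<^sup>2 * (indicator {-real n..real n} y *\<^sub>R (g y * f y)) \<partial>lborel)"
      by (intro Bochner_Integration.integral_diff integrable_mult_right i gc h2c)
    finally show ?thesis by (simp only: integral_mult_right_zero)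
  qed
  with s2 have "ft (cutoff n f'') \<zeta> + \<zeta>\<^sup>2 * ft (cutoff n f) \<zeta> = ?I h2 f / sqrt (2 * pi)"
    by (simp add: ftc diff_divide_distrib)
  moreover have "norm (?I h2 f) \<le> (30 + 12 * \<bar>\<zeta>\<bar>) / n * (sqrt (2 * n) * L2norm lborel f)"
  proof (rule windowed_integral_bound[OF f])
    show "h2 \<in> borel_measurable borel" by (intro borel_measurable_continuous_onI h2c)
    fix y assume y: "\<bar>y\<bar> \<le> real n"
    have "norm (h2 y) \<le> norm (of_real (window'' n y) :: complex) + norm (2 * \<i> * \<zeta> * of_real (window' n y))"
      unfolding h2_def E_def norm_mult norm_cis mult_1_right by (rule norm_triangle_ineq4[of "of_real (window'' n y)" "2 * \<i> * \<zeta> * of_real (window' n y)", unfolded norm_mult])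
    also have "\<dots> = \<bar>window'' n y\<bar> + 2 * \<bar>\<zeta>\<bar> * \<bar>window' n y\<bar>" by (simp add: norm_mult)
    also have "\<dots> \<le> 30 / n + 2 * \<bar>\<zeta>\<bar> * (6 / n)"
      using window'_bound[OF n y] by (intro add_mono mult_left_mono) auto
    finally show "norm (h2 y) \<le> (30 + 12 * \<bar>\<zeta>\<bar>) / n" by (simp add: add_divide_distrib)
  qed
  ultimately have "norm (ft (cutoff n f'') \<zeta> + \<zeta>\<^sup>2 * ft (cutoff n f) \<zeta>) \<le>
      (30 + 12 * \<bar>\<zeta>\<bar>) / n * (sqrt (2 * n) * L2norm lborel f) / sqrt (2 * pi)"
    by (simp add: norm_divide divide_right_mono del: times_divide_eq_left)
  also have "\<dots> \<le> (30 + 12 * \<bar>\<zeta>\<bar>) / sqrt n * L2norm lborel f"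
    using sqrt_over_n[of "30 + 12 * \<bar>\<zeta>\<bar>" "L2norm lborel f" n] n by simp
  finally show "norm (ft (cutoff n f'') \<zeta> + \<zeta>\<^sup>2 * ft (cutoff n f) \<zeta>) \<le> (30 + 12 * \<bar>\<zeta>\<bar>) / sqrt n * L2norm lborel f" .
qed

section \<open>Evolution of the localized Fourier transforms\<close>

lemma
  assumes "classical U Ut Uy Uyy"
  shows classical_L2: "t \<ge> 0 \<Longrightarrow> L2 lborel (U t)"
    and classical_lim: "t \<ge> 0 \<Longrightarrow> ((\<lambda>s. L2norm lborel (\<lambda>y. U s y - U t y)) \<longlongrightarrow> 0) (at t within {0..})"
    and classical_dt: "t > 0 \<Longrightarrow> ((\<lambda>s. U s y) has_vector_derivative Ut t y) (at t)"
    and classical_dy: "t > 0 \<Longrightarrow> (U t has_vector_derivative Uy t y) (at y)"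
    and classical_dyy: "t > 0 \<Longrightarrow> (Uy t has_vector_derivative Uyy t y) (at y)"
    and classical_cyy: "t > 0 \<Longrightarrow> continuous_on UNIV (Uyy t)"
    and classical_ct: "continuous_on ({0<..} \<times> UNIV) (\<lambda>(t, y). Ut t y)"
    and classical_c: "continuous_on ({0<..} \<times> UNIV) (\<lambda>(t, y). U t y)"
  using assms unfolding classical_def by auto

lemma classical_cont:
  assumes "classical U Ut Uy Uyy" "t > 0"
  shows "continuous_on UNIV (U t)" "continuous_on UNIV (Uy t)"
  using classical_dy[OF assms] classical_dyy[OF assms]
  by (meson has_vector_derivative_continuous continuous_at_imp_continuous_on)+

lemma cutoff_integrable_continuous:
  assumes "continuous_on UNIV f" shows "integrable lborel (cutoff n f)"
proof -
  have "integrable lborel (\<lambda>y. indicator {-real n..real n} y *\<^sub>R (window n y *\<^sub>R f y))"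
    using borel_integrable_compact[of "{-real n..real n}" "\<lambda>y. window n y *\<^sub>R f y"]
      continuous_on_subset[OF assms]
    unfolding window_def divide_inverse
    by (simp add: indicator_scaleR_eq_if continuous_intros)
  then show ?thesis by (simp add: cutoff_def[abs_def])
qed

lemma ft_cutoff_add:
  assumes "continuous_on UNIV f" "continuous_on UNIV g"
  shows "ft (cutoff n (\<lambda>y. f y + g y)) \<zeta> = ft (cutoff n f) \<zeta> + ft (cutoff n g) \<zeta>"
proof -
  have "cutoff n (\<lambda>y. f y + g y) = (\<lambda>y. cutoff n f y + cutoff n g y)" by (auto simp: cutoff_def algebra_simps)
  then show ?thesis
    using integrable_cis_mult'[OF cutoff_integrable_continuous[OF assms(1)], of n \<zeta>]
      integrable_cis_mult'[OF cutoff_integrable_continuous[OF assms(2)], of n \<zeta>]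
    by (simp add: ft_def distrib_right add_divide_distrib)
qed

lemma ft_cutoff_cmult: "ft (cutoff n (\<lambda>y. c * f y)) \<zeta> = c * ft (cutoff n f) \<zeta>"
proof -
  have "cutoff n (\<lambda>y. c * f y) = (\<lambda>y. c * cutoff n f y)" by (auto simp: cutoff_def)
  then show ?thesis by (simp add: ft_def mult.assoc)
qed

lemma ft_cutoff_integral:
  assumes "continuous_on UNIV f"
  shows "ft (cutoff n f) \<zeta> = integral (cbox (-real n) (real n))
    (\<lambda>y. of_real (window n y) * cis (- (\<zeta> * y)) * f y) / sqrt (2 * pi)"
proof -
  have c: "continuous_on {-real n..real n} (\<lambda>y. of_real (window n y) * cis (- (\<zeta> * y)) * f y)"
    unfolding window_def divide_inverse by (intro continuous_intros continuous_on_subset[OF assms]) auto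
  show ?thesis
    unfolding ft_cutoff_eq
    using set_borel_integral_eq_integral(2)[OF borel_integrable_atLeastAtMost'[OF c]]
    by (simp add: set_lebesgue_integral_def)
qed

text \<open>Function and frequency both move with t: the first is handled by L2 continuity, the
  second by continuity of the transform of a fixed integrable function. Including t = 0 lets the
  energy inequalities start from the data.\<close>

lemma ft_cutoff_continuous_time:
  assumes cl: "classical U Ut Uy Uyy"
  shows "continuous_on {0..} (\<lambda>t. ft (cutoff n (U t)) (\<xi> - \<kappa> * t))"
  unfolding continuous_on_def
proof
  fix t :: real assume "t \<in> {0..}"
  then have t: "t \<ge> 0" by simp
  let ?F = "at t within {0..}"
  have "((\<lambda>s. ft (cutoff n (U s)) (\<xi> - \<kappa> * s) - ft (cutoff n (U t)) (\<xi> - \<kappa> * s)) \<longlongrightarrow> 0) ?F"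
  proof (rule Lim_null_comparison)
    show "((\<lambda>s. sqrt (2 * n) * L2norm lborel (\<lambda>y. U s y - U t y)) \<longlongrightarrow> 0) ?F"
      by (rule tendsto_mult_right_zero[OF classical_lim[OF cl t]])
    show "\<forall>\<^sub>F s in ?F. norm (ft (cutoff n (U s)) (\<xi> - \<kappa> * s) - ft (cutoff n (U t)) (\<xi> - \<kappa> * s))
        \<le> sqrt (2 * n) * L2norm lborel (\<lambda>y. U s y - U t y)"
      unfolding eventually_at_filter
    proof (intro always_eventually allI impI)
      fix s :: real assume "s \<in> {0..}"
      then have s: "s \<ge> 0" by simp
      note L = classical_L2[OF cl s] classical_L2[OF cl t]
      show "norm (ft (cutoff n (U s)) (\<xi> - \<kappa> * s) - ft (cutoff n (U t)) (\<xi> - \<kappa> * s))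
        \<le> sqrt (2 * n) * L2norm lborel (\<lambda>y. U s y - U t y)"
        using ft_cutoff_bound[OF L2_diff[OF L], of n "\<xi> - \<kappa> * s"] ft_cutoff_diff[OF L] by simp
    qed
  qed
  moreover have "((\<lambda>s. ft (cutoff n (U t)) (\<xi> - \<kappa> * s)) \<longlongrightarrow> ft (cutoff n (U t)) (\<xi> - \<kappa> * t)) ?F"
    by (rule continuous_on_tendsto_compose[OF ft_continuous[OF cutoff_integrable[OF classical_L2[OF cl t]]]])
      (auto intro!: tendsto_intros)
  ultimately have "((\<lambda>s. (ft (cutoff n (U s)) (\<xi> - \<kappa> * s) - ft (cutoff n (U t)) (\<xi> - \<kappa> * s)) + ft (cutoff n (U t)) (\<xi> - \<kappa> * s))
      \<longlongrightarrow> 0 + ft (cutoff n (U t)) (\<xi> - \<kappa> * t)) ?F"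
    by (rule tendsto_add)
  then show "((\<lambda>s. ft (cutoff n (U s)) (\<xi> - \<kappa> * s)) \<longlongrightarrow> ft (cutoff n (U t)) (\<xi> - \<kappa> * t)) ?F" by simp
qed

text \<open>Makes the commutator errors uniform over [0, T].\<close>

lemma classical_bounded:
  assumes cl: "classical U Ut Uy Uyy"
  shows "\<exists>B\<ge>0. \<forall>t\<in>{0..T}. L2norm lborel (U t) \<le> B"
proof -
  have "continuous_on {0..} (\<lambda>t. L2norm lborel (U t))"
    unfolding continuous_on_def
  proof
    fix t :: real assume "t \<in> {0..}"
    then have t: "t \<ge> 0" by simp
    show "((\<lambda>s. L2norm lborel (U s)) \<longlongrightarrow> L2norm lborel (U t)) (at t within {0..})"
    proof (rule LIM_zero_cancel, rule Lim_null_comparison[OF _ classical_lim[OF cl t]])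
      show "\<forall>\<^sub>F s in at t within {0..}. norm (L2norm lborel (U s) - L2norm lborel (U t)) \<le> L2norm lborel (\<lambda>y. U s y - U t y)"
        unfolding eventually_at_filter
        by (intro always_eventually allI impI) (use L2norm_triangle3[OF classical_L2[OF cl] classical_L2[OF cl t]] in auto)
    qed
  qed
  then have "compact ((\<lambda>t. L2norm lborel (U t)) ` {0..T})"
    by (intro compact_continuous_image) (auto intro: continuous_on_subset)
  then have "bounded ((\<lambda>t. L2norm lborel (U t)) ` {0..T})" by (rule compact_imp_bounded)
  then obtain B where "\<And>t. t \<in> {0..T} \<Longrightarrow> norm (L2norm lborel (U t)) \<le> B" unfolding bounded_iff by blast
  then show ?thesis by (intro exI[of _ "max 0 B"]) (fastforce simp: max_def)
qed

text \<open>Along the frequency \<xi> - \<kappa> t the derivative of the phase produces \<i>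
  \<kappa> y U, which cancels the transport term of the equation. The factor y is harmless because
  the window has bounded support.\<close>

lemma ft_cutoff_time_deriv:
  assumes cl: "classical U Ut Uy Uyy" and t: "t > 0"
  shows "((\<lambda>t. ft (cutoff n (U t)) (\<xi> - \<kappa> * t)) has_vector_derivative
    ft (cutoff n (\<lambda>y. Ut t y + \<i> * \<kappa> * y * U t y)) (\<xi> - \<kappa> * t)) (at t)"
proof -
  define G where "G t y = of_real (window n y) * cis (- ((\<xi> - \<kappa> * t) * y)) * U t y" for t y
  define G' where "G' t y = of_real (window n y) * cis (- ((\<xi> - \<kappa> * t) * y)) * (Ut t y + \<i> * \<kappa> * y * U t y)" for t y
  have Utc: "continuous_on UNIV (Ut s)" if "s > 0" for s
    using continuous_on_compose2[OF classical_ct[OF cl] continuous_on_Pair[OF continuous_on_const continuous_on_id], of s UNIV] that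
    by auto
  have "((\<lambda>t. integral (cbox (-real n) (real n)) (G t)) has_vector_derivative
      integral (cbox (-real n) (real n)) (G' t)) (at t within {0<..})"
  proof (rule leibniz_rule_vector_derivative)
    fix s y :: real assume "s \<in> {0<..}"
    then have s: "s > 0" by simp
    have 1: "((\<lambda>s. of_real (window n y) * cis (- ((\<xi> - \<kappa> * s) * y))) has_vector_derivative
        of_real (window n y) * (\<i> * \<kappa> * y * cis (- ((\<xi> - \<kappa> * s) * y)))) (at s)"
      unfolding has_vector_derivative_def
      by (auto intro!: derivative_eq_intros simp: scaleR_conv_of_real algebra_simps)
    have "(\<lambda>s. G s y) = (\<lambda>s. of_real (window n y) * cis (- ((\<xi> - \<kappa> * s) * y)) * U s y)"
      by (simp add: G_def)
    then have "((\<lambda>s. G s y) has_vector_derivative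
        of_real (window n y) * cis (- ((\<xi> - \<kappa> * s) * y)) * Ut s y +
        of_real (window n y) * (\<i> * \<kappa> * y * cis (- ((\<xi> - \<kappa> * s) * y))) * U s y) (at s)"
      using has_vector_derivative_mult[OF 1 classical_dt[OF cl s, of y]] by simp
    then have "((\<lambda>s. G s y) has_vector_derivative G' s y) (at s)"
      by (simp add: G'_def algebra_simps)
    then show "((\<lambda>s. G s y) has_vector_derivative G' s y) (at s within {0<..})"
      by (rule has_vector_derivative_at_within)
  next
    fix s :: real assume "s \<in> {0<..}"
    then have "continuous_on UNIV (U s)" using classical_cont[OF cl] by auto
    then show "G s integrable_on cbox (-real n) (real n)"
      unfolding G_def[abs_def] window_def divide_inverse
      by (intro integrable_continuous continuous_intros) (auto intro: continuous_on_subset)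
  next
    have c1: "continuous_on ({0<..} \<times> cbox (-real n) (real n)) (\<lambda>z. Ut (fst z) (snd z))"
      by (rule continuous_on_subset[OF classical_ct[OF cl, unfolded split_beta']]) auto
    have c2: "continuous_on ({0<..} \<times> cbox (-real n) (real n)) (\<lambda>z. U (fst z) (snd z))"
      by (rule continuous_on_subset[OF classical_c[OF cl, unfolded split_beta']]) auto
    show "continuous_on ({0<..} \<times> cbox (-real n) (real n)) (\<lambda>(s, y). G' s y)"
      unfolding G'_def split_beta' window_def divide_inverse
      by (intro continuous_intros c1 c2)
  qed (use t in auto)
  then have "((\<lambda>t. integral (cbox (-real n) (real n)) (G t)) has_vector_derivative
      integral (cbox (-real n) (real n)) (G' t)) (at t)"
    using t by (simp only: at_within_open[OF _ open_greaterThan] greaterThan_iff)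
  then have "((\<lambda>t. integral (cbox (-real n) (real n)) (G t) * (1 / sqrt (2 * pi))) has_vector_derivative
      integral (cbox (-real n) (real n)) (G' t) * (1 / sqrt (2 * pi))) (at t)"
    by (rule has_vector_derivative_mult_left)
  moreover have "integral (cbox (-real n) (real n)) (G' t) * (1 / sqrt (2 * pi)) =
      ft (cutoff n (\<lambda>y. Ut t y + \<i> * \<kappa> * y * U t y)) (\<xi> - \<kappa> * t)"
  proof -
    have "continuous_on UNIV (\<lambda>y. Ut t y + \<i> * \<kappa> * y * U t y)"
      by (intro continuous_intros Utc t classical_cont[OF cl t])
    from ft_cutoff_integral[OF this] show ?thesis by (simp add: G'_def[abs_def])
  qed
  ultimately have "((\<lambda>t. integral (cbox (-real n) (real n)) (G t) * (1 / sqrt (2 * pi))) has_vector_derivative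
      ft (cutoff n (\<lambda>y. Ut t y + \<i> * \<kappa> * y * U t y)) (\<xi> - \<kappa> * t)) (at t)" by simp
  then show ?thesis
  proof (rule has_vector_derivative_transform_within_open[where S="{0<..}"])
    show "integral (cbox (-real n) (real n)) (G s) * (1 / sqrt (2 * pi)) = ft (cutoff n (U s)) (\<xi> - \<kappa> * s)"
      if "s \<in> {0<..}" for s
      using ft_cutoff_integral[OF classical_cont(1)[OF cl], of s n "\<xi> - \<kappa> * s"] that by (simp add: G_def[abs_def])
  qed (use t in auto)
qed

lemma ft_cutoff_heat:
  assumes cl: "classical U Ut Uy Uyy" and t: "t > 0" and n: "n > 0"
  shows "norm (ft (cutoff n (\<lambda>y. Uyy t y - of_real \<kappa> ^ 2 * U t y)) \<zeta> + of_real (\<kappa>\<^sup>2 + \<zeta>\<^sup>2) * ft (cutoff n (U t)) \<zeta>)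
    \<le> (30 + 12 * \<bar>\<zeta>\<bar>) / sqrt n * L2norm lborel (U t)"
proof -
  have "ft (cutoff n (\<lambda>y. Uyy t y + - (of_real \<kappa> ^ 2) * U t y)) \<zeta> =
      ft (cutoff n (Uyy t)) \<zeta> + ft (cutoff n (\<lambda>y. - (of_real \<kappa> ^ 2) * U t y)) \<zeta>"
    by (intro ft_cutoff_add continuous_intros classical_cont[OF cl t] classical_cyy[OF cl t])
  then have "ft (cutoff n (\<lambda>y. Uyy t y - of_real \<kappa> ^ 2 * U t y)) \<zeta> + of_real (\<kappa>\<^sup>2 + \<zeta>\<^sup>2) * ft (cutoff n (U t)) \<zeta>
      = ft (cutoff n (Uyy t)) \<zeta> + of_real (\<zeta>\<^sup>2) * ft (cutoff n (U t)) \<zeta>"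
    unfolding ft_cutoff_cmult by (simp add: algebra_simps)
  then show ?thesis
    using ft_cutoff_deriv2[OF n classical_L2[OF cl] classical_dy[OF cl t] classical_cont(2)[OF cl t]
        classical_dyy[OF cl t] classical_cyy[OF cl t], of \<zeta>] t by simp
qed

section \<open>Energy inequalities at a fixed frequency\<close>

lemma gronwall:
  fixes \<Psi> \<Psi>' A a :: "real \<Rightarrow> real"
  assumes T: "0 \<le> T" and c: "continuous_on {0..T} \<Psi>"
    and d: "\<And>t. 0 < t \<Longrightarrow> t < T \<Longrightarrow> (\<Psi> has_real_derivative \<Psi>' t) (at t)"
    and A: "\<And>t. (A has_real_derivative a t) (at t)"
    and le: "\<And>t. 0 < t \<Longrightarrow> t < T \<Longrightarrow> \<Psi>' t \<le> - a t * \<Psi> t + r"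
    and r: "0 \<le> r" and AT: "\<And>t. 0 \<le> t \<Longrightarrow> t \<le> T \<Longrightarrow> A t \<le> A T"
  shows "\<Psi> T \<le> exp (- (A T - A 0)) * \<Psi> 0 + r * T"
proof -
  \<comment> \<open>Integrating factor exp(A). The source is charged at the largest weight
    \<open>exp (A T)\<close> and so enters as \<open>r * T\<close> without decay; this suffices
    because r will tend to 0 as the window widens.\<close>
  define f where "f t = exp (A t) * \<Psi> t - r * exp (A T) * t" for t
  have Ac: "continuous_on {0..T} A" using A by (meson DERIV_isCont continuous_at_imp_continuous_on)
  have "f T \<le> f 0"
  proof (rule DERIV_nonpos_imp_decreasing_open[OF T])
    fix t assume t: "0 < t" "t < T"
    have "(f has_real_derivative exp (A t) * a t * \<Psi> t + \<Psi>' t * exp (A t) - r * exp (A T)) (at t)"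
      unfolding f_def by (auto intro!: derivative_eq_intros d[OF t] A)
    moreover have "exp (A t) * a t * \<Psi> t + \<Psi>' t * exp (A t) - r * exp (A T) \<le> 0"
    proof -
      have "\<Psi>' t * exp (A t) \<le> (- a t * \<Psi> t + r) * exp (A t)"
        by (intro mult_right_mono le t) simp
      moreover have "r * exp (A t) \<le> r * exp (A T)" using AT[of t] t r by (intro mult_left_mono) auto
      ultimately show ?thesis by (simp add: algebra_simps)
    qed
    ultimately show "\<exists>y. DERIV f t :> y \<and> y \<le> 0" by blast
  qed (auto simp: f_def[abs_def] intro!: continuous_intros c Ac)
  then have "exp (A T) * \<Psi> T \<le> exp (A 0) * \<Psi> 0 + r * exp (A T) * T" by (simp add: f_def)
  then have "exp (- A T) * (exp (A T) * \<Psi> T) \<le> exp (- A T) * (exp (A 0) * \<Psi> 0 + r * exp (A T) * T)"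
    by (intro mult_left_mono) auto
  then show ?thesis by (simp add: algebra_simps exp_diff exp_minus field_simps)
qed

lemma norm_power2_deriv:
  fixes V :: "real \<Rightarrow> complex"
  assumes "(V has_vector_derivative V') (at t)"
  shows "((\<lambda>t. (norm (V t))\<^sup>2) has_real_derivative 2 * (V t \<bullet> V')) (at t)"
proof -
  have "((\<lambda>t. V t \<bullet> V t) has_derivative (\<lambda>h. V t \<bullet> (h *\<^sub>R V') + (h *\<^sub>R V') \<bullet> V t)) (at t)"
    using assms unfolding has_vector_derivative_def by (intro has_derivative_inner)
  then have "((\<lambda>t. V t \<bullet> V t) has_derivative (\<lambda>h. h * (2 * (V t \<bullet> V')))) (at t)"
    by (rule has_derivative_eq_rhs) (auto simp: inner_commute)
  then show ?thesis
    by (simp add: has_field_derivative_def power2_norm_eq_inner mult.commute[of "2 * _"] mult_commute_abs)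
qed

lemma inner_le_norms: "x \<bullet> y \<le> norm x * norm (y::complex)"
  using Cauchy_Schwarz_ineq2[of x y] by linarith

lemma young_weighted:
  fixes x y q :: real
  assumes "q > 0" shows "2 * (x * y) \<le> q * x\<^sup>2 + y\<^sup>2 / q"
proof -
  have "0 \<le> (q * x - y)\<^sup>2" by simp
  then have "2 * (x * y) * q \<le> q * (q * x\<^sup>2) + y\<^sup>2" by (simp add: power2_eq_square algebra_simps)
  also have "\<dots> = (q * x\<^sup>2 + y\<^sup>2 / q) * q" using assms by (simp add: field_simps)
  finally show ?thesis using assms by simp
qed

text \<open>Of the dissipation 2 \<eta> p one half absorbs the error by Young's inequality, and the
  other half remains as the decay rate of the square. The exponent is the exact integral of \<eta> p
  over [0, T] after completing the square. The uniform lower bound p0 controls the error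
  term.\<close>

lemma scalar_ODE_bound:
  fixes V e :: "real \<Rightarrow> complex" and \<kappa> \<xi> \<eta> p0 \<epsilon> T :: real
  assumes T: "0 \<le> T" and c: "continuous_on {0..T} V"
    and d: "\<And>t. 0 < t \<Longrightarrow> t < T \<Longrightarrow>
      (V has_vector_derivative - of_real (\<eta> * (\<kappa>\<^sup>2 + (\<xi> - \<kappa> * t)\<^sup>2)) * V t + e t) (at t)"
    and e: "\<And>t. 0 < t \<Longrightarrow> t < T \<Longrightarrow> norm (e t) \<le> \<epsilon>"
    and \<eta>: "\<eta> > 0" and p0: "p0 > 0" "\<And>t. p0 \<le> \<kappa>\<^sup>2 + (\<xi> - \<kappa> * t)\<^sup>2"
  shows "(norm (V T))\<^sup>2 \<le> exp (- (\<eta> * (\<kappa>\<^sup>2 * T + T * (\<xi> - \<kappa> * T / 2)\<^sup>2 + \<kappa>\<^sup>2 * T ^ 3 / 12))) * (norm (V 0))\<^sup>2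
    + \<epsilon>\<^sup>2 / (\<eta> * p0) * T"
proof -
  define p where "p t = \<kappa>\<^sup>2 + (\<xi> - \<kappa> * t)\<^sup>2" for t
  define A where "A t = \<eta> * (\<kappa>\<^sup>2 * t + \<xi>\<^sup>2 * t - \<kappa> * \<xi> * t\<^sup>2 + \<kappa>\<^sup>2 * t ^ 3 / 3)" for t
  have A: "(A has_real_derivative \<eta> * p t) (at t)" for t
    unfolding A_def p_def by (auto intro!: derivative_eq_intros simp: power2_eq_square field_simps)
  have p: "p0 \<le> p t" for t using p0 by (simp add: p_def)
  have "(norm (V T))\<^sup>2 \<le> exp (- (A T - A 0)) * (norm (V 0))\<^sup>2 + \<epsilon>\<^sup>2 / (\<eta> * p0) * T"
  proof (rule gronwall[OF T _ norm_power2_deriv[OF d] A])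
    show "continuous_on {0..T} (\<lambda>t. (norm (V t))\<^sup>2)" by (intro continuous_intros c)
    show "0 \<le> \<epsilon>\<^sup>2 / (\<eta> * p0)" using \<eta> p0 by simp
    show "A t \<le> A T" if "0 \<le> t" "t \<le> T" for t
    proof (rule DERIV_nonneg_imp_nondecreasing[OF that(2)])
      fix s
      have "0 \<le> \<eta> * p s" using \<eta> p0(1) p[of s] by simp
      then show "\<exists>y. DERIV A s :> y \<and> 0 \<le> y" using A[of s] by blast
    qed
    fix t assume t: "0 < t" "t < T"
    have pos: "\<eta> * p0 > 0" "\<eta> * p0 \<le> \<eta> * p t" using \<eta> p0 p[of t] by auto
    have "2 * (norm (V t) * \<epsilon>) \<le> \<eta> * p t * (norm (V t))\<^sup>2 + \<epsilon>\<^sup>2 / (\<eta> * p t)"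
      by (rule young_weighted) (use pos in linarith)
    also have "\<dots> \<le> \<eta> * p t * (norm (V t))\<^sup>2 + \<epsilon>\<^sup>2 / (\<eta> * p0)"
      using pos by (intro add_left_mono divide_left_mono) auto
    finally have 1: "2 * (norm (V t) * \<epsilon>) \<le> \<eta> * p t * (norm (V t))\<^sup>2 + \<epsilon>\<^sup>2 / (\<eta> * p0)" .
    have "V t \<bullet> e t \<le> norm (V t) * \<epsilon>"
      using inner_le_norms[of "V t" "e t"] mult_left_mono[OF e[OF t] norm_ge_zero[of "V t"]] by linarith
    moreover have E: "V t \<bullet> (- of_real (\<eta> * p t) * V t + e t) = - (\<eta> * p t) * (norm (V t))\<^sup>2 + V t \<bullet> e t"
    proof -
      have "- of_real (\<eta> * p t) * V t = (- (\<eta> * p t)) *\<^sub>R V t" by (simp add: scaleR_conv_of_real)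
      then show ?thesis by (simp only: inner_add_right inner_scaleR_right power2_norm_eq_inner)
    qed
    ultimately have "2 * (V t \<bullet> (- of_real (\<eta> * p t) * V t + e t)) \<le> - (\<eta> * p t) * (norm (V t))\<^sup>2 + \<epsilon>\<^sup>2 / (\<eta> * p0)"
      using 1 unfolding E mult_minus_left by linarith
    then show "2 * (V t \<bullet> (- of_real (\<eta> * (\<kappa>\<^sup>2 + (\<xi> - \<kappa> * t)\<^sup>2)) * V t + e t)) \<le> - (\<eta> * p t) * (norm (V t))\<^sup>2 + \<epsilon>\<^sup>2 / (\<eta> * p0)"
      by (simp only: p_def)
  qed
  moreover have "A T - A 0 = \<eta> * (\<kappa>\<^sup>2 * T + T * (\<xi> - \<kappa> * T / 2)\<^sup>2 + \<kappa>\<^sup>2 * T ^ 3 / 12)"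
    unfolding A_def by (simp add: power2_eq_square power3_eq_cube field_simps)
  ultimately show ?thesis by simp
qed

text \<open>Translation invariance of null sets, used because the transform at time T is evaluated
  at \<xi> - \<kappa> T.\<close>

lemma AE_shift:
  assumes "AE \<xi> in lborel. P \<xi>" shows "AE \<xi> in lborel. P (\<xi> - c :: real)"
proof -
  obtain N where N: "\<And>x. x \<in> space lborel - N \<Longrightarrow> P x" "N \<in> null_sets lborel"
    using AE_E3[OF assms] by blast
  have [measurable]: "N \<in> sets borel" using N(2) by auto
  have "AE \<xi> in lborel. \<xi> \<notin> N" by (rule AE_not_in[OF N(2)])
  then have "AE \<xi> in lborel. - c + 1 * \<xi> \<notin> N" by (intro AE_borel_affine) auto
  then show ?thesis by eventually_elim (use N(1) in auto)
qed

theorem scalar_decay: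
  fixes U Ut Uy Uyy :: "real \<Rightarrow> real \<Rightarrow> complex" and \<kappa> \<eta> T :: real
  assumes cl: "classical U Ut Uy Uyy" and \<eta>: "\<eta> > 0" and T: "T > 0"
    and eq: "\<And>t y. t > 0 \<Longrightarrow> Ut t y = - \<i> * \<kappa> * y * U t y + \<eta> * (Uyy t y - of_real \<kappa> ^ 2 * U t y)"
  shows "AE \<xi> in lborel. (norm (fourier (U T) (\<xi> - \<kappa> * T)))\<^sup>2
    \<le> exp (- (\<eta> * (\<kappa>\<^sup>2 * T + T * (\<xi> - \<kappa> * T / 2)\<^sup>2 + \<kappa>\<^sup>2 * T ^ 3 / 12))) * (norm (fourier (U 0) \<xi>))\<^sup>2"
proof -
  obtain B where B: "B \<ge> 0" "\<And>t. t \<in> {0..T} \<Longrightarrow> L2norm lborel (U t) \<le> B"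
    using classical_bounded[OF cl] by blast
  have "finite {U T, U 0}" "\<And>f. f \<in> {U T, U 0} \<Longrightarrow> L2 lborel f" using classical_L2[OF cl] T by auto
  from ft_cutoff_AE_subseq[OF this] obtain r where r: "strict_mono r"
    and AE0: "AE \<xi> in lborel. \<forall>f\<in>{U T, U 0}. (\<lambda>n. ft (cutoff (r n) f) \<xi>) \<longlonglongrightarrow> fourier f \<xi>" by blast
  \<comment> \<open>For \<kappa> = 0 the symbol p is the constant \<xi>^2, and a positive lower
    bound p0 exists only if \<xi> is not 0.\<close>
  have ne: "AE \<xi> in lborel. \<xi> \<noteq> (0::real)" by (rule AE_lborel_singleton)
  show ?thesis using AE0 AE_shift[OF AE0, of "\<kappa> * T"] ne
  proof eventually_elim
    case (elim \<xi>)
    define p0 where "p0 = (if \<kappa> = 0 then \<xi>\<^sup>2 else \<kappa>\<^sup>2)"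
    have p0: "p0 > 0" "\<And>t. p0 \<le> \<kappa>\<^sup>2 + (\<xi> - \<kappa> * t)\<^sup>2" using elim(3) by (auto simp: p0_def)
    let ?X = "exp (- (\<eta> * (\<kappa>\<^sup>2 * T + T * (\<xi> - \<kappa> * T / 2)\<^sup>2 + \<kappa>\<^sup>2 * T ^ 3 / 12)))"
    \<comment> \<open>Bounds the error, up to 1/sqrt n, over all of [0, T]. Its dependence on \<xi>
      and T is harmless, since the frequency is fixed while n tends to infinity.\<close>
    define M where "M = \<eta> * ((30 + 12 * (\<bar>\<xi>\<bar> + \<bar>\<kappa>\<bar> * T)) * B)"
    have bound: "(norm (ft (cutoff n (U T)) (\<xi> - \<kappa> * T)))\<^sup>2 \<le> ?X * (norm (ft (cutoff n (U 0)) \<xi>))\<^sup>2 + (M / sqrt n)\<^sup>2 / (\<eta> * p0) * T"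
      if n: "n > 0" for n
    proof -
      define V where "V t = ft (cutoff n (U t)) (\<xi> - \<kappa> * t)" for t
      define e where "e t = of_real \<eta> * (ft (cutoff n (\<lambda>y. Uyy t y - of_real \<kappa> ^ 2 * U t y)) (\<xi> - \<kappa> * t)
          + of_real (\<kappa>\<^sup>2 + (\<xi> - \<kappa> * t)\<^sup>2) * V t)" for t
      have "(norm (V T))\<^sup>2 \<le> ?X * (norm (V 0))\<^sup>2 + (M / sqrt n)\<^sup>2 / (\<eta> * p0) * T"
      proof (rule scalar_ODE_bound[OF _ _ _ _ \<eta> p0, of T V e])
        show "0 \<le> T" using T by simp
        show "continuous_on {0..T} V" unfolding V_def
          by (rule continuous_on_subset[OF ft_cutoff_continuous_time[OF cl]]) auto
        fix t assume t: "0 < t" "t < T"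
        have "(V has_vector_derivative ft (cutoff n (\<lambda>y. Ut t y + \<i> * \<kappa> * y * U t y)) (\<xi> - \<kappa> * t)) (at t)"
          unfolding V_def by (rule ft_cutoff_time_deriv[OF cl t(1)])
        also have "(\<lambda>y. Ut t y + \<i> * \<kappa> * y * U t y) = (\<lambda>y. \<eta> * (Uyy t y - of_real \<kappa> ^ 2 * U t y))"
          using eq[OF t(1)] by auto
        also have "ft (cutoff n \<dots>) (\<xi> - \<kappa> * t) = - of_real (\<eta> * (\<kappa>\<^sup>2 + (\<xi> - \<kappa> * t)\<^sup>2)) * V t + e t"
          unfolding ft_cutoff_cmult e_def by (simp add: algebra_simps)
        finally show "(V has_vector_derivative - of_real (\<eta> * (\<kappa>\<^sup>2 + (\<xi> - \<kappa> * t)\<^sup>2)) * V t + e t) (at t)" .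
        have "norm (e t) \<le> \<eta> * ((30 + 12 * \<bar>\<xi> - \<kappa> * t\<bar>) / sqrt n * L2norm lborel (U t))"
          unfolding e_def V_def norm_mult norm_of_real abs_of_pos[OF \<eta>]
          by (rule mult_left_mono[OF ft_cutoff_heat[OF cl t(1) n]]) (use \<eta> in simp)
        also have "\<dots> \<le> \<eta> * ((30 + 12 * (\<bar>\<xi>\<bar> + \<bar>\<kappa>\<bar> * T)) / sqrt n * B)"
        proof (intro mult_left_mono mult_mono divide_right_mono add_left_mono)
          have "\<bar>\<xi> - \<kappa> * t\<bar> \<le> \<bar>\<xi>\<bar> + \<bar>\<kappa>\<bar> * t" using abs_triangle_ineq4[of \<xi> "\<kappa> * t"] t by (simp add: abs_mult)
          also have "\<dots> \<le> \<bar>\<xi>\<bar> + \<bar>\<kappa>\<bar> * T" using t by (intro add_left_mono mult_left_mono) auto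
          finally show "\<bar>\<xi> - \<kappa> * t\<bar> \<le> \<bar>\<xi>\<bar> + \<bar>\<kappa>\<bar> * T" .
        qed (use B t \<eta> T in auto)
        finally show "norm (e t) \<le> M / sqrt n" by (simp add: M_def)
      qed
      then show ?thesis by (simp add: V_def)
    qed
    have rn: "r n > 0" if "n > 0" for n using strict_mono_imp_increasing[OF r, of n] that by linarith
    have inv: "(\<lambda>n. inverse (real (r n))) \<longlonglongrightarrow> 0"
      using LIMSEQ_subseq_LIMSEQ[OF lim_inverse_n r] by (simp add: comp_def)
    have "(norm (fourier (U T) (\<xi> - \<kappa> * T)))\<^sup>2 \<le> ?X * (norm (fourier (U 0) \<xi>))\<^sup>2 + M\<^sup>2 * 0 / (\<eta> * p0) * T"
    proof (rule LIMSEQ_le)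
      show "(\<lambda>n. (norm (ft (cutoff (r n) (U T)) (\<xi> - \<kappa> * T)))\<^sup>2) \<longlonglongrightarrow> (norm (fourier (U T) (\<xi> - \<kappa> * T)))\<^sup>2"
        using elim(2) by (intro tendsto_intros) auto
      show "(\<lambda>n. ?X * (norm (ft (cutoff (r n) (U 0)) \<xi>))\<^sup>2 + M\<^sup>2 * inverse (real (r n)) / (\<eta> * p0) * T)
          \<longlonglongrightarrow> ?X * (norm (fourier (U 0) \<xi>))\<^sup>2 + M\<^sup>2 * 0 / (\<eta> * p0) * T"
        by (intro tendsto_intros inv) (use elim(1) \<eta> p0 in auto)
      show "\<exists>N. \<forall>n\<ge>N. (norm (ft (cutoff (r n) (U T)) (\<xi> - \<kappa> * T)))\<^sup>2 \<le>
          ?X * (norm (ft (cutoff (r n) (U 0)) \<xi>))\<^sup>2 + M\<^sup>2 * inverse (real (r n)) / (\<eta> * p0) * T"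
      proof (intro exI[of _ 1] allI impI)
        fix n :: nat assume "1 \<le> n"
        then have "r n > 0" using rn by simp
        moreover have "(M / sqrt (r n))\<^sup>2 = M\<^sup>2 * inverse (real (r n))"
          by (subst divide_inverse[symmetric]) (simp add: power_divide)
        ultimately show "(norm (ft (cutoff (r n) (U T)) (\<xi> - \<kappa> * T)))\<^sup>2 \<le>
          ?X * (norm (ft (cutoff (r n) (U 0)) \<xi>))\<^sup>2 + M\<^sup>2 * inverse (real (r n)) / (\<eta> * p0) * T"
          using bound[of "r n"] by (simp only:)
      qed
    qed
    then show ?case by simp
  qed
qed

section \<open>The coupled system\<close>

text \<open>Squaring removes the kink at 0, so that the weight in \<open>system_ODE_bound\<close> is
  differentiable also where the growth sets in.\<close>

lemma pos_part_square_deriv: "((\<lambda>x. (max 0 x)\<^sup>2) has_real_derivative 2 * max 0 x) (at x)" for x :: real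
proof -
  consider "x > 0" | "x < 0" | "x = 0" by linarith
  then show ?thesis
  proof cases
    case 1
    have "((\<lambda>x. x\<^sup>2) has_real_derivative 2 * max 0 x) (at x)"
      using 1 by (auto intro!: derivative_eq_intros)
    then show ?thesis
    proof (rule has_field_derivative_transform_within_open[where S="{0<..}"])
      show "y\<^sup>2 = (max 0 y)\<^sup>2" if "y \<in> {0<..}" for y :: real using that by simp
    qed (use 1 in auto)
  next
    case 2
    have "((\<lambda>x. 0) has_real_derivative 2 * max 0 x) (at x)" using 2 by simp
    then show ?thesis
    proof (rule has_field_derivative_transform_within_open[where S="{..<0}"])
      show "0 = (max 0 y)\<^sup>2" if "y \<in> {..<0}" for y :: real using that by simp
    qed (use 2 in auto)
  next
    case 3
    have "((\<lambda>h::real. ((max 0 (0 + h))\<^sup>2 - (max 0 0)\<^sup>2) / h) \<longlongrightarrow> 0) (at 0)"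
    proof (rule Lim_null_comparison)
      show "\<forall>\<^sub>F h in at (0::real). norm (((max 0 (0 + h))\<^sup>2 - (max 0 0)\<^sup>2) / h) \<le> \<bar>h\<bar>"
        unfolding eventually_at_filter
        by (intro always_eventually allI impI) (auto simp: max_def power2_eq_square)
      show "((\<lambda>h::real. \<bar>h\<bar>) \<longlongrightarrow> 0) (at 0)" by (rule tendsto_rabs_zero) (rule tendsto_ident_at)
    qed
    then show ?thesis using 3 by (simp add: DERIV_def)
  qed
qed

lemma inner_cross_cancel: "W \<bullet> (\<i> * of_real \<kappa> * J) + J \<bullet> (\<i> * of_real \<kappa> * W) = 0"
  by (simp add: inner_complex_def algebra_simps)

lemma inner_of_real_mult: "V \<bullet> (of_real c * V) = c * (norm V)\<^sup>2" for V :: complex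
proof -
  have "of_real c * V = c *\<^sub>R V" by (simp add: scaleR_conv_of_real)
  then show ?thesis by (simp only: inner_scaleR_right power2_norm_eq_inner)
qed

text \<open>The factor \<open>-2 \<kappa> (\<xi> - \<kappa> t) / p = p' / p\<close> in the equation for \<open>J\<close> exceeds the dissipation only
  for \<open>0 < t - \<xi> / \<kappa> < O(1 / \<nu>)\<close>. The weight \<open>h\<^sup>2\<close>, with \<open>h = (1 + \<delta> s) / (1 + s)\<close>,
  \<open>s = ((t - \<xi> / \<kappa>)\<^sub>+)\<^sup>2\<close> and \<open>\<delta> = \<nu>\<^sup>2 / 4\<close>, decreases just fast enough to absorb this growth and
  stays between \<open>\<nu>\<^sup>4 / 16\<close> and \<open>1\<close>.\<close>

lemma system_ODE_bound:
  fixes W J Th e1 e2 e3 :: "real \<Rightarrow> complex" and \<kappa> \<xi> \<nu> \<eta> \<epsilon> T :: real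
  defines "p \<equiv> \<lambda>t. \<kappa>\<^sup>2 + (\<xi> - \<kappa> * t)\<^sup>2"
  assumes T: "0 \<le> T" and c: "continuous_on {0..T} W" "continuous_on {0..T} J" "continuous_on {0..T} Th"
    and dW: "\<And>t. 0 < t \<Longrightarrow> t < T \<Longrightarrow> (W has_vector_derivative
        of_real (- (\<nu> * p t)) * W t + \<i> * of_real \<kappa> * J t + \<i> * of_real \<kappa> * Th t + e1 t) (at t)"
    and dJ: "\<And>t. 0 < t \<Longrightarrow> t < T \<Longrightarrow> (J has_vector_derivative
        of_real (- (\<nu> * p t)) * J t + \<i> * of_real \<kappa> * W t + of_real (- 2 * \<kappa> * (\<xi> - \<kappa> * t) / p t) * J t + e2 t) (at t)"
    and dTh: "\<And>t. 0 < t \<Longrightarrow> t < T \<Longrightarrow> (Th has_vector_derivative of_real (- (\<eta> * p t)) * Th t + e3 t) (at t)"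
    and e: "\<And>t. 0 < t \<Longrightarrow> t < T \<Longrightarrow> norm (e1 t) \<le> \<epsilon>" "\<And>t. 0 < t \<Longrightarrow> t < T \<Longrightarrow> norm (e2 t) \<le> \<epsilon>"
      "\<And>t. 0 < t \<Longrightarrow> t < T \<Longrightarrow> norm (e3 t) \<le> \<epsilon>"
    and \<kappa>: "1 \<le> \<kappa>\<^sup>2" and \<nu>: "0 < \<nu>" "\<nu> \<le> 1" "\<nu> \<le> \<eta>"
  shows "(norm (W T))\<^sup>2 + (norm (J T))\<^sup>2 \<le> 16 / \<nu> ^ 4 * (exp (- (\<nu> * \<kappa>\<^sup>2 / 4 * T)) *
    ((norm (W 0))\<^sup>2 + (norm (J 0))\<^sup>2 + 4 / \<nu>\<^sup>2 * (norm (Th 0))\<^sup>2) + (8 / \<nu> + 8 / \<nu> ^ 3) * \<epsilon>\<^sup>2 * T)"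
proof -
  have \<kappa>0: "\<kappa> \<noteq> 0" using \<kappa> by auto
  have pk: "\<kappa>\<^sup>2 \<le> p t" for t by (simp add: p_def)
  define \<delta> where "\<delta> = \<nu>\<^sup>2 / 4"
  have "\<nu>\<^sup>2 \<le> 1" using \<nu> by (intro power_le_one) auto
  then have \<delta>: "0 < \<delta>" "\<delta> \<le> 1" using \<nu> by (auto simp: \<delta>_def)
  define x where "x t = max 0 (t - \<xi> / \<kappa>)" for t
  define s where "s t = (x t)\<^sup>2" for t
  have x0: "0 \<le> x t" for t by (simp add: x_def)
  have s0: "0 \<le> s t" for t by (simp add: s_def)
  have ds: "(s has_real_derivative 2 * x t) (at t)" for t
  proof -
    have "((\<lambda>t. (max 0 (t - \<xi> / \<kappa>))\<^sup>2) has_real_derivative 2 * max 0 (t - \<xi> / \<kappa>) * 1) (at t)"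
      by (rule DERIV_chain2[OF pos_part_square_deriv]) (auto intro!: derivative_eq_intros)
    then show ?thesis by (simp add: s_def[abs_def] x_def)
  qed
  define h where "h t = (1 + \<delta> * s t) / (1 + s t)" for t
  \<comment> \<open>-D is the logarithmic derivative of h. Its first term matches the growth p'/p
    for t beyond \<xi>/\<kappa>; the second is the deficit left to viscosity.\<close>
  define D where "D t = 2 * x t / (1 + s t) - \<delta> * (2 * x t) / (1 + \<delta> * s t)" for t
  have nz: "1 + s t > 0" "1 + \<delta> * s t > 0" for t
    using s0[of t] mult_nonneg_nonneg[of \<delta> "s t"] \<delta> by linarith+
  have h0: "0 < h t" for t using nz[of t] by (simp add: h_def)
  have h1: "h t \<le> 1" for t
    using nz[of t] mult_right_mono[OF \<delta>(2) s0[of t]] by (simp add: h_def divide_le_eq_1)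
  have h\<delta>: "\<delta> \<le> h t" for t
  proof -
    have "\<delta> * (1 + s t) \<le> 1 + \<delta> * s t" using \<delta> by (simp add: algebra_simps)
    then show ?thesis using nz[of t] by (simp add: h_def le_divide_eq)
  qed
  have dh: "((\<lambda>t. (h t)\<^sup>2) has_real_derivative - 2 * D t * (h t)\<^sup>2) (at t)" for t
  proof -
    have "(h has_real_derivative ((\<delta> * (2 * x t)) * (1 + s t) - (1 + \<delta> * s t) * (2 * x t)) / ((1 + s t) * (1 + s t))) (at t)"
      unfolding h_def using nz[of t]
      by (intro DERIV_divide) (auto intro!: derivative_eq_intros ds)
    moreover have "((\<delta> * (2 * x t)) * (1 + s t) - (1 + \<delta> * s t) * (2 * x t)) / ((1 + s t) * (1 + s t)) = - D t * h t"
      using nz[of t] unfolding D_def h_def by (simp add: divide_simps)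
    ultimately have "(h has_real_derivative - D t * h t) (at t)" by simp
    then have "((\<lambda>t. (h t)\<^sup>2) has_real_derivative 2 * h t * (- D t * h t)) (at t)"
      by (auto intro!: derivative_eq_intros)
    then show ?thesis by (simp add: power2_eq_square algebra_simps)
  qed
  have growth: "- 2 * \<kappa> * (\<xi> - \<kappa> * t) / p t \<le> D t + \<nu> / 2" for t
  proof -
    let ?\<tau> = "t - \<xi> / \<kappa>"
    have "p t = \<kappa>\<^sup>2 * (1 + ?\<tau>\<^sup>2)" unfolding p_def using \<kappa>0 by (simp add: power2_eq_square field_simps)
    moreover have "- 2 * \<kappa> * (\<xi> - \<kappa> * t) = \<kappa>\<^sup>2 * (2 * ?\<tau>)" using \<kappa>0 by (simp add: power2_eq_square field_simps)
    ultimately have "- 2 * \<kappa> * (\<xi> - \<kappa> * t) / p t = 2 * ?\<tau> / (1 + ?\<tau>\<^sup>2)" using \<kappa>0 by simp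
    also have "\<dots> \<le> 2 * x t / (1 + s t)"
    proof (cases "?\<tau> \<ge> 0")
      case True
      then show ?thesis by (simp add: x_def s_def)
    next
      case False
      then have "2 * ?\<tau> / (1 + ?\<tau>\<^sup>2) \<le> 0" by (intro divide_nonpos_nonneg) auto
      also have "0 \<le> 2 * x t / (1 + s t)" using x0[of t] nz[of t] by simp
      finally show ?thesis .
    qed
    also have "\<dots> = D t + \<delta> * (2 * x t) / (1 + \<delta> * s t)" by (simp add: D_def)
    also have "\<delta> * (2 * x t) / (1 + \<delta> * s t) \<le> \<nu> / 2"
    proof -
      \<comment> \<open>This square is the origin of \<delta> = \<nu>^2/4: it gives \<nu> x \<le> 1
        + \<delta> x^2, hence a deficit of at most \<nu>/2.\<close>
      have "0 \<le> (1 - \<nu> * x t / 2)\<^sup>2" by simp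
      then have "\<nu> * x t \<le> 1 + \<delta> * s t" by (simp add: \<delta>_def s_def power2_eq_square algebra_simps)
      then have "\<nu> / 2 * (\<nu> * x t) \<le> \<nu> / 2 * (1 + \<delta> * s t)" using \<nu> by (intro mult_left_mono) auto
      then have "\<delta> * (2 * x t) \<le> \<nu> / 2 * (1 + \<delta> * s t)" by (simp add: \<delta>_def power2_eq_square algebra_simps)
      then show ?thesis using nz[of t] by (simp add: divide_le_eq)
    qed
    finally show ?thesis by simp
  qed
  define N where "N t = (norm (W t))\<^sup>2 + (norm (J t))\<^sup>2" for t
  \<comment> \<open>With the coefficient 4/\<nu>^2 the dissipation of \<theta> contributes -6
    \<kappa>^2/\<nu> times \<theta>^2. This pays for the forcing, which costs 2/\<nu>, and for the
    decay rate \<nu> \<kappa>^2/4 of this term, which costs \<kappa>^2/\<nu>.\<close>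
  define \<Psi> where "\<Psi> t = (h t)\<^sup>2 * N t + 4 / \<nu>\<^sup>2 * (norm (Th t))\<^sup>2" for t
  define W' where "W' t = of_real (- (\<nu> * p t)) * W t + \<i> * of_real \<kappa> * J t + \<i> * of_real \<kappa> * Th t + e1 t" for t
  define J' where "J' t = of_real (- (\<nu> * p t)) * J t + \<i> * of_real \<kappa> * W t + of_real (- 2 * \<kappa> * (\<xi> - \<kappa> * t) / p t) * J t + e2 t" for t
  define Th' where "Th' t = of_real (- (\<eta> * p t)) * Th t + e3 t" for t
  define \<Psi>' where "\<Psi>' t = (- 2 * D t * (h t)\<^sup>2) * N t + (2 * (W t \<bullet> W' t) + 2 * (J t \<bullet> J' t)) * (h t)\<^sup>2 + 4 / \<nu>\<^sup>2 * (2 * (Th t \<bullet> Th' t))" for t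
  define r where "r = (8 / \<nu> + 8 / \<nu> ^ 3) * \<epsilon>\<^sup>2"
  have "\<Psi> T \<le> exp (- (\<nu> * \<kappa>\<^sup>2 / 4 * T - \<nu> * \<kappa>\<^sup>2 / 4 * 0)) * \<Psi> 0 + r * T"
  proof (rule gronwall[OF T, where a="\<lambda>t. \<nu> * \<kappa>\<^sup>2 / 4" and A="\<lambda>t. \<nu> * \<kappa>\<^sup>2 / 4 * t" and \<Psi>'=\<Psi>'])
    have hc: "continuous_on {0..T} (\<lambda>t. (h t)\<^sup>2)"
      using dh by (meson DERIV_isCont continuous_at_imp_continuous_on)
    show "continuous_on {0..T} \<Psi>" unfolding \<Psi>_def N_def by (intro continuous_intros hc c)
    show "0 \<le> r" unfolding r_def using \<nu> by (intro mult_nonneg_nonneg add_nonneg_nonneg) auto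
    show "((\<lambda>t. \<nu> * \<kappa>\<^sup>2 / 4 * t) has_real_derivative \<nu> * \<kappa>\<^sup>2 / 4) (at t)" for t
      by (auto intro!: derivative_eq_intros)
    show "\<nu> * \<kappa>\<^sup>2 / 4 * t \<le> \<nu> * \<kappa>\<^sup>2 / 4 * T" if "0 \<le> t" "t \<le> T" for t
      using that \<nu> by (intro mult_left_mono) auto
    fix t assume t: "0 < t" "t < T"
    have "(N has_real_derivative 2 * (W t \<bullet> W' t) + 2 * (J t \<bullet> J' t)) (at t)"
      unfolding N_def W'_def J'_def by (intro DERIV_add norm_power2_deriv dW dJ t)
    then show "(\<Psi> has_real_derivative \<Psi>' t) (at t)"
      unfolding \<Psi>_def \<Psi>'_def Th'_def
      by (intro DERIV_add DERIV_mult dh DERIV_cmult norm_power2_deriv dTh t)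
    define w where "w = norm (W t)" define j where "j = norm (J t)" define \<theta> where "\<theta> = norm (Th t)"
    have nn: "0 \<le> w" "0 \<le> j" "0 \<le> \<theta>" by (auto simp: w_def j_def \<theta>_def)
    have Nt: "N t = w\<^sup>2 + j\<^sup>2" by (simp add: N_def w_def j_def)
    have \<epsilon>: "0 \<le> \<epsilon>" using order_trans[OF norm_ge_zero e(1)[OF t]] .
    have inn: "W t \<bullet> (\<i> * of_real \<kappa> * Th t) \<le> w * (\<bar>\<kappa>\<bar> * \<theta>)" "W t \<bullet> e1 t \<le> w * \<epsilon>" "J t \<bullet> e2 t \<le> j * \<epsilon>" "Th t \<bullet> e3 t \<le> \<theta> * \<epsilon>"
      using inner_le_norms[of "W t" "\<i> * of_real \<kappa> * Th t"]
        order_trans[OF inner_le_norms[of "W t" "e1 t"] mult_left_mono[OF e(1)[OF t] norm_ge_zero]]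
        order_trans[OF inner_le_norms[of "J t" "e2 t"] mult_left_mono[OF e(2)[OF t] norm_ge_zero]]
        order_trans[OF inner_le_norms[of "Th t" "e3 t"] mult_left_mono[OF e(3)[OF t] norm_ge_zero]]
      by (auto simp: norm_mult w_def j_def \<theta>_def)
    have y1: "2 * (w * (\<bar>\<kappa>\<bar> * \<theta>)) \<le> \<nu> * \<kappa>\<^sup>2 / 2 * w\<^sup>2 + 2 / \<nu> * \<theta>\<^sup>2"
    proof -
      have "2 * (w * (\<bar>\<kappa>\<bar> * \<theta>)) \<le> (\<nu> * \<kappa>\<^sup>2 / 2) * w\<^sup>2 + (\<bar>\<kappa>\<bar> * \<theta>)\<^sup>2 / (\<nu> * \<kappa>\<^sup>2 / 2)"
        using \<nu> \<kappa>0 by (intro young_weighted) auto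
      also have "(\<bar>\<kappa>\<bar> * \<theta>)\<^sup>2 / (\<nu> * \<kappa>\<^sup>2 / 2) = 2 / \<nu> * \<theta>\<^sup>2" using \<kappa>0 \<nu> by (simp add: power_mult_distrib)
      finally show ?thesis .
    qed
    have y2: "2 * (u * \<epsilon>) \<le> \<nu> / 4 * u\<^sup>2 + 4 / \<nu> * \<epsilon>\<^sup>2" for u
      using young_weighted[of "\<nu> / 4" u \<epsilon>] \<nu> by simp
    have y3: "2 * (\<theta> * \<epsilon>) \<le> \<nu> / 2 * \<theta>\<^sup>2 + 2 / \<nu> * \<epsilon>\<^sup>2"
      using young_weighted[of "\<nu> / 2" \<theta> \<epsilon>] \<nu> by simp
    define g where "g = - 2 * \<kappa> * (\<xi> - \<kappa> * t) / p t"
    have WJ: "W t \<bullet> W' t + J t \<bullet> J' t = - (\<nu> * p t) * N t + W t \<bullet> (\<i> * of_real \<kappa> * Th t) + W t \<bullet> e1 t + g * j\<^sup>2 + J t \<bullet> e2 t"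
      using inner_cross_cancel[of "W t" \<kappa> "J t"]
      unfolding W'_def J'_def g_def[symmetric] inner_add_right inner_of_real_mult Nt w_def j_def
      by (simp add: algebra_simps)
    have \<nu>\<kappa>: "\<nu> \<le> \<nu> * \<kappa>\<^sup>2" "\<nu> * \<kappa>\<^sup>2 \<le> \<nu> * p t" "\<nu> * \<kappa>\<^sup>2 \<le> \<eta> * p t"
      using \<nu> \<kappa> pk[of t] by (auto intro!: mult_left_mono mult_mono)
    \<comment> \<open>Budget in units of \<nu> \<kappa>^2 N, with \<kappa>^2 \<ge> 1: dissipation 2,
      minus 1 for the deficit of the weight, minus 1/2 for the forcing by \<theta>, minus 1/4 for
      the errors, leaves 1/4.\<close>
    have main: "- 2 * D t * N t + 2 * (W t \<bullet> W' t + J t \<bullet> J' t) \<le> - (\<nu> * \<kappa>\<^sup>2 / 4) * N t + 2 / \<nu> * \<theta>\<^sup>2 + 8 / \<nu> * \<epsilon>\<^sup>2"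
    proof -
      have dg: "0 \<le> D t + \<nu> / 2"
      proof -
        have "D t + \<delta> * (2 * x t) / (1 + \<delta> * s t) \<ge> 0" using x0[of t] nz[of t] by (simp add: D_def)
        moreover have "0 \<le> D t"
        proof -
          have "\<delta> * (2 * x t) * (1 + s t) \<le> 2 * x t * (1 + \<delta> * s t)"
            using mult_right_mono[OF \<delta>(2), of "2 * x t"] x0[of t] by (simp add: algebra_simps)
          then have "\<delta> * (2 * x t) / (1 + \<delta> * s t) \<le> 2 * x t / (1 + s t)"
            using nz[of t] by (simp add: divide_le_eq le_divide_eq mult_ac)
          then show ?thesis by (simp add: D_def)
        qed
        ultimately show ?thesis using \<nu> by linarith
      qed
      have "g * j\<^sup>2 \<le> (D t + \<nu> / 2) * j\<^sup>2" using growth[of t] by (intro mult_right_mono) (auto simp: g_def)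
      also have "\<dots> \<le> (D t + \<nu> / 2) * N t" using dg by (intro mult_left_mono) (auto simp: Nt)
      finally have g: "2 * (g * j\<^sup>2) \<le> 2 * D t * N t + \<nu> * N t" by (simp add: algebra_simps)
      have N0: "0 \<le> N t" by (simp add: Nt)
      have a1: "\<nu> * \<kappa>\<^sup>2 * N t \<le> \<nu> * p t * N t" "\<nu> * N t \<le> \<nu> * \<kappa>\<^sup>2 * N t" "\<nu> * \<kappa>\<^sup>2 / 2 * w\<^sup>2 \<le> \<nu> * \<kappa>\<^sup>2 / 2 * N t"
        using mult_right_mono[OF \<nu>\<kappa>(2) N0] mult_right_mono[OF \<nu>\<kappa>(1) N0] \<nu>
        by (auto intro!: mult_left_mono simp: Nt)
      have a2: "\<nu> / 4 * w\<^sup>2 + \<nu> / 4 * j\<^sup>2 = \<nu> * N t / 4" by (simp add: Nt field_simps)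
      have a3: "4 / \<nu> * \<epsilon>\<^sup>2 + 4 / \<nu> * \<epsilon>\<^sup>2 = 8 / \<nu> * \<epsilon>\<^sup>2" by (simp add: field_simps)
      have "2 * (W t \<bullet> W' t + J t \<bullet> J' t) = - 2 * (\<nu> * p t * N t) + 2 * (W t \<bullet> (\<i> * of_real \<kappa> * Th t)) + 2 * (W t \<bullet> e1 t) + 2 * (g * j\<^sup>2) + 2 * (J t \<bullet> e2 t)"
        unfolding WJ by (simp add: algebra_simps)
      then show ?thesis
        using g a1 a2 a3 inn y1 y2[of w] y2[of j] by (simp add: algebra_simps)
    qed
    have main': "- 2 * D t * N t + 2 * (W t \<bullet> W' t + J t \<bullet> J' t) \<le> - (\<nu> * \<kappa>\<^sup>2 / 4) * N t + (2 / \<nu> * \<theta>\<^sup>2 + 8 / \<nu> * \<epsilon>\<^sup>2)"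
      using main by linarith
    have thb: "4 / \<nu>\<^sup>2 * (2 * (Th t \<bullet> Th' t)) \<le> - (6 * \<kappa>\<^sup>2 / \<nu>) * \<theta>\<^sup>2 + 8 / \<nu> ^ 3 * \<epsilon>\<^sup>2"
    proof -
      have "2 * (Th t \<bullet> Th' t) = - 2 * (\<eta> * p t * \<theta>\<^sup>2) + 2 * (Th t \<bullet> e3 t)"
        unfolding Th'_def inner_add_right inner_of_real_mult \<theta>_def by (simp add: algebra_simps)
      moreover have "\<nu> * \<kappa>\<^sup>2 * \<theta>\<^sup>2 \<le> \<eta> * p t * \<theta>\<^sup>2" "\<nu> * \<theta>\<^sup>2 \<le> \<nu> * \<kappa>\<^sup>2 * \<theta>\<^sup>2" using \<nu>\<kappa> by (auto intro!: mult_right_mono)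
      ultimately have "2 * (Th t \<bullet> Th' t) \<le> - (3 / 2) * (\<nu> * \<kappa>\<^sup>2 * \<theta>\<^sup>2) + 2 / \<nu> * \<epsilon>\<^sup>2"
        using inn(4) y3 by (simp add: algebra_simps)
      then have "4 / \<nu>\<^sup>2 * (2 * (Th t \<bullet> Th' t)) \<le> 4 / \<nu>\<^sup>2 * (- (3 / 2) * (\<nu> * \<kappa>\<^sup>2 * \<theta>\<^sup>2) + 2 / \<nu> * \<epsilon>\<^sup>2)"
        using \<nu> by (intro mult_left_mono) auto
      also have "\<dots> = - (6 * \<kappa>\<^sup>2 / \<nu>) * \<theta>\<^sup>2 + 8 / \<nu> ^ 3 * \<epsilon>\<^sup>2"
        using \<nu> by (simp add: power2_eq_square power3_eq_cube field_simps)
      finally show ?thesis .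
    qed
    have hh: "(h t)\<^sup>2 \<le> 1" using h0[of t] h1[of t] by (intro power_le_one) auto
    have "\<Psi>' t = (h t)\<^sup>2 * (- 2 * D t * N t + 2 * (W t \<bullet> W' t + J t \<bullet> J' t)) + 4 / \<nu>\<^sup>2 * (2 * (Th t \<bullet> Th' t))"
      by (simp add: \<Psi>'_def algebra_simps)
    also have "\<dots> \<le> (h t)\<^sup>2 * (- (\<nu> * \<kappa>\<^sup>2 / 4) * N t + (2 / \<nu> * \<theta>\<^sup>2 + 8 / \<nu> * \<epsilon>\<^sup>2)) + (- (6 * \<kappa>\<^sup>2 / \<nu>) * \<theta>\<^sup>2 + 8 / \<nu> ^ 3 * \<epsilon>\<^sup>2)"
      by (rule add_mono[OF mult_left_mono[OF main' zero_le_power2] thb])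
    also have "\<dots> \<le> - (\<nu> * \<kappa>\<^sup>2 / 4) * ((h t)\<^sup>2 * N t) + (2 / \<nu> * \<theta>\<^sup>2 + 8 / \<nu> * \<epsilon>\<^sup>2) + (- (6 * \<kappa>\<^sup>2 / \<nu>) * \<theta>\<^sup>2 + 8 / \<nu> ^ 3 * \<epsilon>\<^sup>2)"
    proof -
      have "(h t)\<^sup>2 * (2 / \<nu> * \<theta>\<^sup>2 + 8 / \<nu> * \<epsilon>\<^sup>2) \<le> 1 * (2 / \<nu> * \<theta>\<^sup>2 + 8 / \<nu> * \<epsilon>\<^sup>2)"
        using hh \<nu> by (intro mult_right_mono) auto
      then show ?thesis by (simp add: algebra_simps)
    qed
    also have "\<dots> \<le> - (\<nu> * \<kappa>\<^sup>2 / 4) * \<Psi> t + r"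
    proof -
      have "\<theta>\<^sup>2 / \<nu> \<le> \<kappa>\<^sup>2 * (\<theta>\<^sup>2 / \<nu>)" using mult_right_mono[OF \<kappa>, of "\<theta>\<^sup>2 / \<nu>"] \<nu> by simp
      moreover have "2 / \<nu> * \<theta>\<^sup>2 = 2 * (\<theta>\<^sup>2 / \<nu>)" "6 * \<kappa>\<^sup>2 / \<nu> * \<theta>\<^sup>2 = 6 * (\<kappa>\<^sup>2 * (\<theta>\<^sup>2 / \<nu>))" by simp_all
      moreover have "\<nu> * \<kappa>\<^sup>2 / 4 * \<Psi> t = \<nu> * \<kappa>\<^sup>2 / 4 * ((h t)\<^sup>2 * N t) + \<kappa>\<^sup>2 * (\<theta>\<^sup>2 / \<nu>)"
        unfolding \<Psi>_def \<theta>_def[symmetric] using \<nu> by (simp add: power2_eq_square field_simps)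
      moreover have "0 \<le> \<theta>\<^sup>2 / \<nu>" using \<nu> by simp
      ultimately show ?thesis unfolding r_def mult_minus_left distrib_right by linarith
    qed
    finally show "\<Psi>' t \<le> - (\<nu> * \<kappa>\<^sup>2 / 4) * \<Psi> t + r" .
  qed
  then have G: "\<Psi> T \<le> exp (- (\<nu> * \<kappa>\<^sup>2 / 4 * T)) * \<Psi> 0 + r * T" by simp
  have "\<Psi> 0 \<le> N 0 + 4 / \<nu>\<^sup>2 * (norm (Th 0))\<^sup>2"
  proof -
    have "(h 0)\<^sup>2 \<le> 1" using h0[of 0] h1[of 0] by (intro power_le_one) auto
    then have "(h 0)\<^sup>2 * N 0 \<le> 1 * N 0" by (intro mult_right_mono) (auto simp: N_def)
    then show ?thesis by (simp add: \<Psi>_def)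
  qed
  then have G2: "\<Psi> T \<le> exp (- (\<nu> * \<kappa>\<^sup>2 / 4 * T)) * (N 0 + 4 / \<nu>\<^sup>2 * (norm (Th 0))\<^sup>2) + r * T"
    using G by (smt (verit) exp_ge_zero mult_left_mono)
  have "\<delta>\<^sup>2 * N T \<le> (h T)\<^sup>2 * N T"
    using h\<delta>[of T] \<delta> by (intro mult_right_mono power_mono) (auto simp: N_def)
  also have "\<dots> \<le> \<Psi> T" by (simp add: \<Psi>_def)
  finally have "\<nu> ^ 4 / 16 * N T \<le> \<Psi> T" by (simp add: \<delta>_def power_divide flip: power_mult)
  \<comment> \<open>Undoing the weight costs the inverse square of its lower bound \<delta>, that is
    16/\<nu>^4 for the energy and 4/\<nu>^2 for the norm.\<close>
  then have "N T \<le> 16 / \<nu> ^ 4 * \<Psi> T" using \<nu> by (simp add: field_simps)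
  also have "\<dots> \<le> 16 / \<nu> ^ 4 * (exp (- (\<nu> * \<kappa>\<^sup>2 / 4 * T)) * (N 0 + 4 / \<nu>\<^sup>2 * (norm (Th 0))\<^sup>2) + r * T)"
    using G2 \<nu> by (intro mult_left_mono) auto
  finally show ?thesis unfolding N_def r_def .
qed

lemma subseq_inverse_tendsto:
  assumes "strict_mono r"
  shows "(\<lambda>n. inverse (real (r n))) \<longlonglongrightarrow> 0"
  using LIMSEQ_subseq_LIMSEQ[OF lim_inverse_n assms] by (simp add: comp_def)

lemma subseq_pos: "strict_mono (r :: nat \<Rightarrow> nat) \<Longrightarrow> 1 \<le> n \<Longrightarrow> 0 < r n"
  using strict_mono_imp_increasing[of r n] by linarith

text \<open>The first claim is the elliptic equation on the Fourier side up to a commutator. Letting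
  n tend to infinity at fixed \<xi> makes it exact, so the transform of J dominates that of \<psi>
  once \<kappa>^2 \<ge> 1. The resulting norm bound is what makes the errors from \<psi> uniform in
  time, since \<psi> is chosen anew at each t.\<close>

lemma
  fixes \<psi> \<psi>y \<psi>yy :: "real \<Rightarrow> complex" and \<kappa> :: real
  assumes \<psi>: "L2 lborel \<psi>" "\<And>y. (\<psi> has_vector_derivative \<psi>y y) (at y)"
      "\<And>y. (\<psi>y has_vector_derivative \<psi>yy y) (at y)" "continuous_on UNIV \<psi>yy"
    and J: "\<And>y. of_real \<kappa> ^ 2 * \<psi> y - \<psi>yy y = J y"
  shows elliptic_ft_cutoff: "n > 0 \<Longrightarrow> norm (ft (cutoff n J) \<zeta> - of_real (\<kappa>\<^sup>2 + \<zeta>\<^sup>2) * ft (cutoff n \<psi>) \<zeta>)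
      \<le> (30 + 12 * \<bar>\<zeta>\<bar>) / sqrt n * L2norm lborel \<psi>"
    and elliptic_L2norm: "L2 lborel J \<Longrightarrow> 1 \<le> \<kappa>\<^sup>2 \<Longrightarrow> L2norm lborel \<psi> \<le> L2norm lborel J"
proof -
  have \<psi>c: "continuous_on UNIV \<psi>" "continuous_on UNIV \<psi>y"
    using \<psi>(2,3) by (meson has_vector_derivative_continuous continuous_at_imp_continuous_on)+
  have key: "norm (ft (cutoff n J) \<zeta> - of_real (\<kappa>\<^sup>2 + \<zeta>\<^sup>2) * ft (cutoff n \<psi>) \<zeta>)
      \<le> (30 + 12 * \<bar>\<zeta>\<bar>) / sqrt n * L2norm lborel \<psi>" if n: "n > 0" for n \<zeta>
  proof -
    have "J = (\<lambda>y. (- 1) * \<psi>yy y + of_real \<kappa> ^ 2 * \<psi> y)" using J by (auto simp: algebra_simps)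
    then have "ft (cutoff n J) \<zeta> = ft (cutoff n (\<lambda>y. (- 1) * \<psi>yy y)) \<zeta> + ft (cutoff n (\<lambda>y. of_real \<kappa> ^ 2 * \<psi> y)) \<zeta>"
      by (simp only:) (intro ft_cutoff_add continuous_intros \<psi>c \<psi>)
    then have "ft (cutoff n J) \<zeta> - of_real (\<kappa>\<^sup>2 + \<zeta>\<^sup>2) * ft (cutoff n \<psi>) \<zeta> = - (ft (cutoff n \<psi>yy) \<zeta> + of_real (\<zeta>\<^sup>2) * ft (cutoff n \<psi>) \<zeta>)"
      unfolding ft_cutoff_cmult by (simp add: algebra_simps)
    then show ?thesis
      using ft_cutoff_deriv2[OF n \<psi>(1,2) \<psi>c(2) \<psi>(3,4), of \<zeta>] by (simp only: norm_minus_cancel of_real_power)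
  qed
  then show "n > 0 \<Longrightarrow> norm (ft (cutoff n J) \<zeta> - of_real (\<kappa>\<^sup>2 + \<zeta>\<^sup>2) * ft (cutoff n \<psi>) \<zeta>)
      \<le> (30 + 12 * \<bar>\<zeta>\<bar>) / sqrt n * L2norm lborel \<psi>" .
  assume JL: "L2 lborel J" and \<kappa>: "1 \<le> \<kappa>\<^sup>2"
  have "finite {\<psi>, J}" "\<And>f. f \<in> {\<psi>, J} \<Longrightarrow> L2 lborel f" using \<psi>(1) JL by auto
  from ft_cutoff_AE_subseq[OF this] obtain r where r: "strict_mono r"
    and AE0: "AE \<xi> in lborel. \<forall>f\<in>{\<psi>, J}. (\<lambda>n. ft (cutoff (r n) f) \<xi>) \<longlonglongrightarrow> fourier f \<xi>" by blast
  have "AE \<xi> in lborel. norm (fourier \<psi> \<xi>) \<le> norm (fourier J \<xi>)"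
    using AE0
  proof eventually_elim
    case (elim \<xi>)
    let ?B = "(30 + 12 * \<bar>\<xi>\<bar>) * L2norm lborel \<psi>"
    have "norm (fourier J \<xi> - of_real (\<kappa>\<^sup>2 + \<xi>\<^sup>2) * fourier \<psi> \<xi>) \<le> sqrt 0 * ?B"
    proof (rule LIMSEQ_le)
      show "(\<lambda>n. norm (ft (cutoff (r n) J) \<xi> - of_real (\<kappa>\<^sup>2 + \<xi>\<^sup>2) * ft (cutoff (r n) \<psi>) \<xi>)) \<longlonglongrightarrow>
          norm (fourier J \<xi> - of_real (\<kappa>\<^sup>2 + \<xi>\<^sup>2) * fourier \<psi> \<xi>)"
        using elim by (intro tendsto_intros) auto
      show "(\<lambda>n. sqrt (inverse (real (r n))) * ?B) \<longlonglongrightarrow> sqrt 0 * ?B"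
        by (intro tendsto_intros subseq_inverse_tendsto r)
      show "\<exists>N. \<forall>n\<ge>N. norm (ft (cutoff (r n) J) \<xi> - of_real (\<kappa>\<^sup>2 + \<xi>\<^sup>2) * ft (cutoff (r n) \<psi>) \<xi>) \<le> sqrt (inverse (real (r n))) * ?B"
      proof (intro exI[of _ 1] allI impI)
        fix n :: nat assume "1 \<le> n"
        from key[OF subseq_pos[OF r this], of \<xi>]
        show "norm (ft (cutoff (r n) J) \<xi> - of_real (\<kappa>\<^sup>2 + \<xi>\<^sup>2) * ft (cutoff (r n) \<psi>) \<xi>) \<le> sqrt (inverse (real (r n))) * ?B"
          by (simp only: real_sqrt_inverse divide_inverse mult_ac)
      qed
    qed
    then have "fourier J \<xi> = of_real (\<kappa>\<^sup>2 + \<xi>\<^sup>2) * fourier \<psi> \<xi>" by simp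
    then have "norm (fourier J \<xi>) = (\<kappa>\<^sup>2 + \<xi>\<^sup>2) * norm (fourier \<psi> \<xi>)" by (simp only: norm_mult norm_of_real) simp
    moreover have "1 * norm (fourier \<psi> \<xi>) \<le> (\<kappa>\<^sup>2 + \<xi>\<^sup>2) * norm (fourier \<psi> \<xi>)"
      using \<kappa> by (intro mult_right_mono) (auto intro: add_increasing2)
    ultimately show ?case by simp
  qed
  then have "L2norm lborel (fourier \<psi>) \<le> L2norm lborel (fourier J)"
    by (intro L2norm_mono fourier_L2 JL L2D(1)[OF fourier_L2[OF \<psi>(1)]])
  then show "L2norm lborel \<psi> \<le> L2norm lborel J" using Plancherel[OF \<psi>(1)] Plancherel[OF JL] by simp
qed

theorem system_decay:
  fixes W Wt Wy Wyy J Jt Jy Jyy Th Tt Ty Tyy :: "real \<Rightarrow> real \<Rightarrow> complex" and \<kappa> \<nu> \<eta> T :: real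
  assumes cl: "classical W Wt Wy Wyy" "classical J Jt Jy Jyy" "classical Th Tt Ty Tyy"
    and \<kappa>: "1 \<le> \<kappa>\<^sup>2" and \<nu>: "0 < \<nu>" "\<nu> \<le> 1" "\<nu> \<le> \<eta>" and T: "T > 0"
    and eqW: "\<And>t y. t > 0 \<Longrightarrow> Wt t y = - \<i> * of_real \<kappa> * of_real y * W t y + of_real \<nu> * (Wyy t y - of_real \<kappa> ^ 2 * W t y)
      + \<i> * of_real \<kappa> * J t y + \<i> * of_real \<kappa> * Th t y"
    and eqJ: "\<And>t. t > 0 \<Longrightarrow> \<exists>\<psi> \<psi>y \<psi>yy. L2 lborel \<psi> \<and> (\<forall>y. (\<psi> has_vector_derivative \<psi>y y) (at y)) \<and>
      (\<forall>y. (\<psi>y has_vector_derivative \<psi>yy y) (at y)) \<and> continuous_on UNIV \<psi>yy \<and>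
      (\<forall>y. of_real \<kappa> ^ 2 * \<psi> y - \<psi>yy y = J t y) \<and>
      (\<forall>y. Jt t y = - \<i> * of_real \<kappa> * of_real y * J t y + of_real \<nu> * (Jyy t y - of_real \<kappa> ^ 2 * J t y)
      + \<i> * of_real \<kappa> * W t y + 2 * \<i> * of_real \<kappa> * \<psi>y y)"
    and eqTh: "\<And>t y. t > 0 \<Longrightarrow> Tt t y = - \<i> * of_real \<kappa> * of_real y * Th t y + of_real \<eta> * (Tyy t y - of_real \<kappa> ^ 2 * Th t y)"
  shows "AE \<xi> in lborel. (norm (fourier (W T) (\<xi> - \<kappa> * T)))\<^sup>2 + (norm (fourier (J T) (\<xi> - \<kappa> * T)))\<^sup>2
    \<le> 16 / \<nu> ^ 4 * exp (- (\<nu> * \<kappa>\<^sup>2 / 4 * T)) *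
      ((norm (fourier (W 0) \<xi>))\<^sup>2 + (norm (fourier (J 0) \<xi>))\<^sup>2 + (2 / \<nu>)\<^sup>2 * (norm (fourier (Th 0) \<xi>))\<^sup>2)"
proof -
  obtain B1 where B1: "B1 \<ge> 0" "\<And>t. t \<in> {0..T} \<Longrightarrow> L2norm lborel (W t) \<le> B1" using classical_bounded[OF cl(1)] by blast
  obtain B2 where B2: "B2 \<ge> 0" "\<And>t. t \<in> {0..T} \<Longrightarrow> L2norm lborel (J t) \<le> B2" using classical_bounded[OF cl(2)] by blast
  obtain B3 where B3: "B3 \<ge> 0" "\<And>t. t \<in> {0..T} \<Longrightarrow> L2norm lborel (Th t) \<le> B3" using classical_bounded[OF cl(3)] by blast
  define B where "B = B1 + B2 + B3"
  have B: "B \<ge> 0" "\<And>t. t \<in> {0..T} \<Longrightarrow> L2norm lborel (W t) \<le> B" "\<And>t. t \<in> {0..T} \<Longrightarrow> L2norm lborel (J t) \<le> B"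
    "\<And>t. t \<in> {0..T} \<Longrightarrow> L2norm lborel (Th t) \<le> B"
    using B1 B2 B3 by (force simp: B_def)+
  let ?I = "{W T, J T, W 0, J 0, Th 0}"
  have "finite ?I" "\<And>f. f \<in> ?I \<Longrightarrow> L2 lborel f" using classical_L2[OF cl(1)] classical_L2[OF cl(2)] classical_L2[OF cl(3)] T by auto
  from ft_cutoff_AE_subseq[OF this] obtain r where r: "strict_mono r"
    and AE0: "AE \<xi> in lborel. \<forall>f\<in>?I. (\<lambda>n. ft (cutoff (r n) f) \<xi>) \<longlonglongrightarrow> fourier f \<xi>" by blast
  show ?thesis using AE0 AE_shift[OF AE0, of "\<kappa> * T"]
  proof eventually_elim
    case (elim \<xi>)
    define Z where "Z = 30 + 12 * (\<bar>\<xi>\<bar> + \<bar>\<kappa>\<bar> * T)"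
    have Z0: "Z \<ge> 0" using T by (simp add: Z_def)
    \<comment> \<open>Here \<open>2 * Z\<close> covers the heat error of W or J, as \<nu> \<le> 1,
      and the elliptic error; \<open>\<eta> * Z\<close> covers the heat error of Th; 12 |\<kappa>|
      is the factor 2 |\<kappa>| of the nonlocal term times the constant 6 of
      \<open>ft_cutoff_deriv\<close>.\<close>
    define M where "M = ((2 + \<eta>) * Z + 12 * \<bar>\<kappa>\<bar>) * B"
    have Zt: "30 + 12 * \<bar>\<xi> - \<kappa> * t\<bar> \<le> Z" if "0 < t" "t < T" for t
    proof -
      have "\<bar>\<xi> - \<kappa> * t\<bar> \<le> \<bar>\<xi>\<bar> + \<bar>\<kappa>\<bar> * t" using abs_triangle_ineq4[of \<xi> "\<kappa> * t"] that by (simp add: abs_mult)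
      also have "\<dots> \<le> \<bar>\<xi>\<bar> + \<bar>\<kappa>\<bar> * T" using that by (intro add_left_mono mult_left_mono) auto
      finally show ?thesis by (simp add: Z_def)
    qed
    have heat: "norm (of_real a * (ft (cutoff n (\<lambda>y. Uyy t y - of_real \<kappa> ^ 2 * U t y)) (\<xi> - \<kappa> * t)
          + of_real (\<kappa>\<^sup>2 + (\<xi> - \<kappa> * t)\<^sup>2) * ft (cutoff n (U t)) (\<xi> - \<kappa> * t))) \<le> a * (Z / sqrt n * B)"
      if "classical U Ut Uy Uyy" "L2norm lborel (U t) \<le> B" "0 < t" "t < T" "n > 0" "a > 0" for U Ut Uy Uyy t n a
    proof -
      have "(30 + 12 * \<bar>\<xi> - \<kappa> * t\<bar>) / sqrt n * L2norm lborel (U t) \<le> Z / sqrt n * B"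
        using Zt[OF that(3,4)] that(2) B(1) Z0 by (intro mult_mono divide_right_mono) auto
      with ft_cutoff_heat[OF that(1,3,5), of \<kappa> "\<xi> - \<kappa> * t"]
      have "norm (ft (cutoff n (\<lambda>y. Uyy t y - of_real \<kappa> ^ 2 * U t y)) (\<xi> - \<kappa> * t)
          + of_real (\<kappa>\<^sup>2 + (\<xi> - \<kappa> * t)\<^sup>2) * ft (cutoff n (U t)) (\<xi> - \<kappa> * t)) \<le> Z / sqrt n * B" by linarith
      then show ?thesis unfolding norm_mult norm_of_real abs_of_pos[OF that(6)] using that(6) by (intro mult_left_mono) auto
    qed
    have bound: "(norm (ft (cutoff n (W T)) (\<xi> - \<kappa> * T)))\<^sup>2 + (norm (ft (cutoff n (J T)) (\<xi> - \<kappa> * T)))\<^sup>2 \<le>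
        16 / \<nu> ^ 4 * (exp (- (\<nu> * \<kappa>\<^sup>2 / 4 * T)) *
        ((norm (ft (cutoff n (W 0)) \<xi>))\<^sup>2 + (norm (ft (cutoff n (J 0)) \<xi>))\<^sup>2 + 4 / \<nu>\<^sup>2 * (norm (ft (cutoff n (Th 0)) \<xi>))\<^sup>2)
        + (8 / \<nu> + 8 / \<nu> ^ 3) * (M / sqrt n)\<^sup>2 * T)"
      if n: "n > 0" for n
    proof -
      define w where "w t = ft (cutoff n (W t)) (\<xi> - \<kappa> * t)" for t
      define j where "j t = ft (cutoff n (J t)) (\<xi> - \<kappa> * t)" for t
      define \<theta> where "\<theta> t = ft (cutoff n (Th t)) (\<xi> - \<kappa> * t)" for t
      define p where "p t = \<kappa>\<^sup>2 + (\<xi> - \<kappa> * t)\<^sup>2" for t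
      have pp: "p t > 0" for t unfolding p_def by (rule add_pos_nonneg) (use \<kappa> in auto)
      define H where "H Uyy U t = ft (cutoff n (\<lambda>y. Uyy t y - of_real \<kappa> ^ 2 * U t y)) (\<xi> - \<kappa> * t)
          + of_real (p t) * ft (cutoff n (U t)) (\<xi> - \<kappa> * t)" for Uyy U :: "real \<Rightarrow> real \<Rightarrow> complex" and t
      define g where "g t = - 2 * \<kappa> * (\<xi> - \<kappa> * t) / p t" for t
      define e1 where "e1 t = of_real \<nu> * H Wyy W t" for t
      define e3 where "e3 t = of_real \<eta> * H Tyy Th t" for t
      define Jd where "Jd t = ft (cutoff n (\<lambda>y. Jt t y + \<i> * \<kappa> * y * J t y)) (\<xi> - \<kappa> * t)" for t
      \<comment> \<open>Taken as the remainder, so that the equation for j holds by construction and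
        only a bound is left to prove.\<close>
      define e2 where "e2 t = Jd t - (of_real (- (\<nu> * p t)) * j t + \<i> * of_real \<kappa> * w t + of_real (g t) * j t)" for t
      have rt: "0 \<le> B / sqrt n" using B by simp
      have MZ: "\<nu> * (Z / sqrt n * B) \<le> M / sqrt n" "\<eta> * (Z / sqrt n * B) \<le> M / sqrt n"
        "\<nu> * (Z / sqrt n * B) + (2 * \<bar>\<kappa>\<bar> * (6 / sqrt n * B) + Z / sqrt n * B) \<le> M / sqrt n"
      proof -
        have z: "\<nu> * Z \<le> Z" using \<nu> Z0 by (simp add: mult_left_le_one_le)
        have e: "0 \<le> \<eta> * Z" using \<nu> Z0 by simp
        have k: "0 \<le> \<bar>\<kappa>\<bar>" by simp
        have "\<nu> * Z \<le> (2 + \<eta>) * Z + 12 * \<bar>\<kappa>\<bar>" "\<eta> * Z \<le> (2 + \<eta>) * Z + 12 * \<bar>\<kappa>\<bar>"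
          "\<nu> * Z + 12 * \<bar>\<kappa>\<bar> + Z \<le> (2 + \<eta>) * Z + 12 * \<bar>\<kappa>\<bar>"
          using z e k Z0 by (simp_all add: algebra_simps)
        from this[THEN mult_right_mono, OF rt] show "\<nu> * (Z / sqrt n * B) \<le> M / sqrt n" "\<eta> * (Z / sqrt n * B) \<le> M / sqrt n"
          "\<nu> * (Z / sqrt n * B) + (2 * \<bar>\<kappa>\<bar> * (6 / sqrt n * B) + Z / sqrt n * B) \<le> M / sqrt n"
          by (simp_all add: M_def algebra_simps add_divide_distrib)
      qed
      have "(norm (w T))\<^sup>2 + (norm (j T))\<^sup>2 \<le> 16 / \<nu> ^ 4 * (exp (- (\<nu> * \<kappa>\<^sup>2 / 4 * T)) *
        ((norm (w 0))\<^sup>2 + (norm (j 0))\<^sup>2 + 4 / \<nu>\<^sup>2 * (norm (\<theta> 0))\<^sup>2) + (8 / \<nu> + 8 / \<nu> ^ 3) * (M / sqrt n)\<^sup>2 * T)"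
      proof (rule system_ODE_bound[OF _ _ _ _ _ _ _ _ _ _ \<kappa> \<nu>, where ?e1.0=e1 and ?e2.0=e2 and ?e3.0=e3 and \<xi>=\<xi>])
        show "0 \<le> T" using T by simp
        show "continuous_on {0..T} w" "continuous_on {0..T} j" "continuous_on {0..T} \<theta>"
          unfolding w_def j_def \<theta>_def
          by (rule continuous_on_subset[OF ft_cutoff_continuous_time[OF cl(1)]]
              continuous_on_subset[OF ft_cutoff_continuous_time[OF cl(2)]]
              continuous_on_subset[OF ft_cutoff_continuous_time[OF cl(3)]]; auto)+
        fix t assume t: "0 < t" "t < T"
        note cs = classical_cont(1)[OF cl(1) t(1)] classical_cont(1)[OF cl(2) t(1)] classical_cont(1)[OF cl(3) t(1)]
          classical_cyy[OF cl(1) t(1)] classical_cyy[OF cl(2) t(1)] classical_cyy[OF cl(3) t(1)]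
        have tT: "t \<in> {0..T}" using t by simp
        have "(w has_vector_derivative ft (cutoff n (\<lambda>y. Wt t y + \<i> * \<kappa> * y * W t y)) (\<xi> - \<kappa> * t)) (at t)"
          unfolding w_def by (rule ft_cutoff_time_deriv[OF cl(1) t(1)])
        also have "(\<lambda>y. Wt t y + \<i> * \<kappa> * y * W t y) = (\<lambda>y. (of_real \<nu> * (Wyy t y - of_real \<kappa> ^ 2 * W t y) + (\<i> * of_real \<kappa>) * J t y)
            + (\<i> * of_real \<kappa>) * Th t y)"
          using eqW[OF t(1)] by auto
        also have "ft (cutoff n \<dots>) (\<xi> - \<kappa> * t) = of_real \<nu> * ft (cutoff n (\<lambda>y. Wyy t y - of_real \<kappa> ^ 2 * W t y)) (\<xi> - \<kappa> * t)
            + (\<i> * of_real \<kappa>) * j t + (\<i> * of_real \<kappa>) * \<theta> t"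
          by (subst ft_cutoff_add, (intro continuous_intros cs)+, subst ft_cutoff_add, (intro continuous_intros cs)+)
            (simp only: ft_cutoff_cmult j_def \<theta>_def)
        also have "\<dots> = of_real (- (\<nu> * (\<kappa>\<^sup>2 + (\<xi> - \<kappa> * t)\<^sup>2))) * w t + \<i> * of_real \<kappa> * j t + \<i> * of_real \<kappa> * \<theta> t + e1 t"
          by (simp add: e1_def H_def w_def p_def algebra_simps)
        finally show "(w has_vector_derivative of_real (- (\<nu> * (\<kappa>\<^sup>2 + (\<xi> - \<kappa> * t)\<^sup>2))) * w t + \<i> * of_real \<kappa> * j t + \<i> * of_real \<kappa> * \<theta> t + e1 t) (at t)" .
        have "(\<theta> has_vector_derivative ft (cutoff n (\<lambda>y. Tt t y + \<i> * \<kappa> * y * Th t y)) (\<xi> - \<kappa> * t)) (at t)"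
          unfolding \<theta>_def by (rule ft_cutoff_time_deriv[OF cl(3) t(1)])
        also have "(\<lambda>y. Tt t y + \<i> * \<kappa> * y * Th t y) = (\<lambda>y. of_real \<eta> * (Tyy t y - of_real \<kappa> ^ 2 * Th t y))"
          using eqTh[OF t(1)] by auto
        also have "ft (cutoff n \<dots>) (\<xi> - \<kappa> * t) = of_real (- (\<eta> * (\<kappa>\<^sup>2 + (\<xi> - \<kappa> * t)\<^sup>2))) * \<theta> t + e3 t"
          unfolding ft_cutoff_cmult e3_def H_def \<theta>_def p_def by (simp add: algebra_simps)
        finally show "(\<theta> has_vector_derivative of_real (- (\<eta> * (\<kappa>\<^sup>2 + (\<xi> - \<kappa> * t)\<^sup>2))) * \<theta> t + e3 t) (at t)" .
        have "(j has_vector_derivative Jd t) (at t)"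
          unfolding j_def Jd_def by (rule ft_cutoff_time_deriv[OF cl(2) t(1)])
        then show "(j has_vector_derivative of_real (- (\<nu> * (\<kappa>\<^sup>2 + (\<xi> - \<kappa> * t)\<^sup>2))) * j t + \<i> * of_real \<kappa> * w t +
            of_real (- 2 * \<kappa> * (\<xi> - \<kappa> * t) / (\<kappa>\<^sup>2 + (\<xi> - \<kappa> * t)\<^sup>2)) * j t + e2 t) (at t)"
          by (simp only: e2_def g_def p_def) simp
        show "norm (e1 t) \<le> M / sqrt n"
          using heat[OF cl(1) B(2)[OF tT] t n, of \<nu>] \<nu> MZ(1) unfolding e1_def H_def p_def by linarith
        show "norm (e3 t) \<le> M / sqrt n"
          using heat[OF cl(3) B(4)[OF tT] t n, of \<eta>] \<nu> MZ(2) unfolding e3_def H_def p_def by linarith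
        obtain \<psi> \<psi>y \<psi>yy where \<psi>: "L2 lborel \<psi>" "\<And>y. (\<psi> has_vector_derivative \<psi>y y) (at y)"
          "\<And>y. (\<psi>y has_vector_derivative \<psi>yy y) (at y)" "continuous_on UNIV \<psi>yy"
          "\<And>y. of_real \<kappa> ^ 2 * \<psi> y - \<psi>yy y = J t y"
          and eqj: "\<And>y. Jt t y = - \<i> * of_real \<kappa> * of_real y * J t y + of_real \<nu> * (Jyy t y - of_real \<kappa> ^ 2 * J t y)
            + \<i> * of_real \<kappa> * W t y + 2 * \<i> * of_real \<kappa> * \<psi>y y"
          using eqJ[OF t(1)] by blast
        have \<psi>yc: "continuous_on UNIV \<psi>y"
          using \<psi>(3) by (meson has_vector_derivative_continuous continuous_at_imp_continuous_on)
        have J2: "L2 lborel (J t)" using classical_L2[OF cl(2)] t by simp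
        have \<psi>B: "L2norm lborel \<psi> \<le> B"
          using elliptic_L2norm[OF \<psi> J2 \<kappa>] B(3)[OF tT] by linarith
        define \<zeta> where "\<zeta> = \<xi> - \<kappa> * t"
        define a where "a = ft (cutoff n \<psi>) \<zeta>"
        \<comment> \<open>Two commutators replace the nonlocal term: \<open>ea\<close> for the
          transform of \<open>\<psi>y\<close> being \<i> \<zeta> a, and \<open>eb\<close> for j
          being p a. Up to them 2 \<i> \<kappa> \<psi>y becomes -2 \<kappa> \<zeta> j / p, which is
          \<open>g t * j t\<close>.\<close>
        define ea where "ea = ft (cutoff n \<psi>y) \<zeta> - \<i> * \<zeta> * a"
        define eb where "eb = j t - of_real (p t) * a"
        have "norm ea \<le> 6 / sqrt n * L2norm lborel \<psi>"
          unfolding ea_def a_def by (rule ft_cutoff_deriv[OF n \<psi>(1,2) \<psi>yc])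
        also have "\<dots> \<le> 6 / sqrt n * B" using \<psi>B by (intro mult_left_mono) auto
        finally have ea: "norm ea \<le> 6 / sqrt n * B" .
        have "norm eb \<le> (30 + 12 * \<bar>\<zeta>\<bar>) / sqrt n * L2norm lborel \<psi>"
          using elliptic_ft_cutoff[OF \<psi> n, of \<zeta>] by (simp only: eb_def a_def j_def \<zeta>_def p_def)
        also have "\<dots> \<le> Z / sqrt n * B"
          using Zt[OF t] \<psi>B B(1) Z0 by (intro mult_mono divide_right_mono) (auto simp: \<zeta>_def)
        finally have eb: "norm eb \<le> Z / sqrt n * B" .
        have "(\<lambda>y. Jt t y + \<i> * \<kappa> * y * J t y) = (\<lambda>y. (of_real \<nu> * (Jyy t y - of_real \<kappa> ^ 2 * J t y) + (\<i> * of_real \<kappa>) * W t y)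
            + (2 * \<i> * of_real \<kappa>) * \<psi>y y)"
          using eqj by auto
        then have "Jd t = ft (cutoff n (\<lambda>y. (of_real \<nu> * (Jyy t y - of_real \<kappa> ^ 2 * J t y) + (\<i> * of_real \<kappa>) * W t y)
            + (2 * \<i> * of_real \<kappa>) * \<psi>y y)) (\<xi> - \<kappa> * t)" by (simp only: Jd_def)
        also have "\<dots> = of_real \<nu> * ft (cutoff n (\<lambda>y. Jyy t y - of_real \<kappa> ^ 2 * J t y)) (\<xi> - \<kappa> * t)
            + (\<i> * of_real \<kappa>) * w t + (2 * \<i> * of_real \<kappa>) * ft (cutoff n \<psi>y) \<zeta>"
          by (subst ft_cutoff_add, (intro continuous_intros cs \<psi>yc)+, subst ft_cutoff_add, (intro continuous_intros cs)+)
            (simp only: ft_cutoff_cmult w_def \<zeta>_def)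
        also have "of_real \<nu> * ft (cutoff n (\<lambda>y. Jyy t y - of_real \<kappa> ^ 2 * J t y)) (\<xi> - \<kappa> * t) = of_real \<nu> * H Jyy J t + of_real (- (\<nu> * p t)) * j t"
          by (simp add: H_def j_def algebra_simps)
        also have "ft (cutoff n \<psi>y) \<zeta> = ea + \<i> * \<zeta> * a" by (simp add: ea_def)
        finally have "e2 t = of_real \<nu> * H Jyy J t + (2 * \<i> * of_real \<kappa>) * ea + ((2 * \<i> * of_real \<kappa>) * (\<i> * \<zeta> * a) - of_real (g t) * j t)"
          unfolding e2_def by (simp add: algebra_simps)
        also have "(2 * \<i> * of_real \<kappa>) * (\<i> * \<zeta> * a) - of_real (g t) * j t = - of_real (g t) * eb"
        proof -
          have gp: "g t * p t = - 2 * \<kappa> * \<zeta>" using pp[of t] by (simp add: g_def \<zeta>_def)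
          have "of_real (g t) * (of_real (p t) * a) = of_real (g t * p t) * a" by (simp add: mult.assoc)
          also have "\<dots> = (2 * \<i> * of_real \<kappa>) * (\<i> * \<zeta> * a)" unfolding gp by (simp add: algebra_simps)
          finally show ?thesis unfolding eb_def by (simp add: algebra_simps)
        qed
        finally have e2: "e2 t = of_real \<nu> * H Jyy J t + ((2 * \<i> * of_real \<kappa>) * ea + - of_real (g t) * eb)" by simp
        have g1: "\<bar>g t\<bar> \<le> 1"
        proof -
          have "2 * (\<bar>\<kappa>\<bar> * \<bar>\<xi> - \<kappa> * t\<bar>) \<le> p t"
            using sum_squares_bound[of "\<bar>\<kappa>\<bar>" "\<bar>\<xi> - \<kappa> * t\<bar>"] by (simp add: p_def)
          then show ?thesis using pp[of t] by (simp add: g_def abs_mult divide_le_eq)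
        qed
        have "norm (e2 t) \<le> norm (of_real \<nu> * H Jyy J t) + (norm ((2 * \<i> * of_real \<kappa>) * ea) + norm (- of_real (g t) * eb))"
          unfolding e2 by (intro order_trans[OF norm_triangle_ineq] add_left_mono norm_triangle_ineq)
        also have "\<dots> \<le> \<nu> * (Z / sqrt n * B) + (2 * \<bar>\<kappa>\<bar> * (6 / sqrt n * B) + Z / sqrt n * B)"
        proof (intro add_mono)
          show "norm (of_real \<nu> * H Jyy J t) \<le> \<nu> * (Z / sqrt n * B)"
            using heat[OF cl(2) B(3)[OF tT] t n, of \<nu>] \<nu> unfolding H_def p_def by simp
          show "norm ((2 * \<i> * of_real \<kappa>) * ea) \<le> 2 * \<bar>\<kappa>\<bar> * (6 / sqrt n * B)"
            using mult_left_mono[OF ea, of "2 * \<bar>\<kappa>\<bar>"] by (simp add: norm_mult)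
          show "norm (- of_real (g t) * eb) \<le> Z / sqrt n * B"
            using mult_mono[OF g1 eb] by (simp add: norm_mult)
        qed
        finally show "norm (e2 t) \<le> M / sqrt n" using MZ(3) by linarith
      qed
      then show ?thesis by (simp add: w_def j_def \<theta>_def)
    qed
    have "(norm (fourier (W T) (\<xi> - \<kappa> * T)))\<^sup>2 + (norm (fourier (J T) (\<xi> - \<kappa> * T)))\<^sup>2 \<le>
        16 / \<nu> ^ 4 * (exp (- (\<nu> * \<kappa>\<^sup>2 / 4 * T)) *
        ((norm (fourier (W 0) \<xi>))\<^sup>2 + (norm (fourier (J 0) \<xi>))\<^sup>2 + 4 / \<nu>\<^sup>2 * (norm (fourier (Th 0) \<xi>))\<^sup>2)
        + (8 / \<nu> + 8 / \<nu> ^ 3) * (M\<^sup>2 * 0) * T)"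
    proof (rule LIMSEQ_le)
      show "(\<lambda>n. (norm (ft (cutoff (r n) (W T)) (\<xi> - \<kappa> * T)))\<^sup>2 + (norm (ft (cutoff (r n) (J T)) (\<xi> - \<kappa> * T)))\<^sup>2) \<longlonglongrightarrow>
          (norm (fourier (W T) (\<xi> - \<kappa> * T)))\<^sup>2 + (norm (fourier (J T) (\<xi> - \<kappa> * T)))\<^sup>2"
        using elim(2) by (intro tendsto_intros) auto
      show "(\<lambda>n. 16 / \<nu> ^ 4 * (exp (- (\<nu> * \<kappa>\<^sup>2 / 4 * T)) *
        ((norm (ft (cutoff (r n) (W 0)) \<xi>))\<^sup>2 + (norm (ft (cutoff (r n) (J 0)) \<xi>))\<^sup>2 + 4 / \<nu>\<^sup>2 * (norm (ft (cutoff (r n) (Th 0)) \<xi>))\<^sup>2)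
        + (8 / \<nu> + 8 / \<nu> ^ 3) * (M\<^sup>2 * inverse (real (r n))) * T)) \<longlonglongrightarrow>
        16 / \<nu> ^ 4 * (exp (- (\<nu> * \<kappa>\<^sup>2 / 4 * T)) *
        ((norm (fourier (W 0) \<xi>))\<^sup>2 + (norm (fourier (J 0) \<xi>))\<^sup>2 + 4 / \<nu>\<^sup>2 * (norm (fourier (Th 0) \<xi>))\<^sup>2)
        + (8 / \<nu> + 8 / \<nu> ^ 3) * (M\<^sup>2 * 0) * T)"
        using elim(1) by (intro tendsto_add tendsto_mult tendsto_const tendsto_power tendsto_norm subseq_inverse_tendsto r) auto
      show "\<exists>N. \<forall>n\<ge>N. (norm (ft (cutoff (r n) (W T)) (\<xi> - \<kappa> * T)))\<^sup>2 + (norm (ft (cutoff (r n) (J T)) (\<xi> - \<kappa> * T)))\<^sup>2 \<le>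
        16 / \<nu> ^ 4 * (exp (- (\<nu> * \<kappa>\<^sup>2 / 4 * T)) *
        ((norm (ft (cutoff (r n) (W 0)) \<xi>))\<^sup>2 + (norm (ft (cutoff (r n) (J 0)) \<xi>))\<^sup>2 + 4 / \<nu>\<^sup>2 * (norm (ft (cutoff (r n) (Th 0)) \<xi>))\<^sup>2)
        + (8 / \<nu> + 8 / \<nu> ^ 3) * (M\<^sup>2 * inverse (real (r n))) * T)"
      proof (intro exI[of _ 1] allI impI)
        fix n :: nat assume n: "1 \<le> n"
        have "(M / sqrt (r n))\<^sup>2 = M\<^sup>2 * inverse (real (r n))"
          by (subst divide_inverse[symmetric]) (simp add: power_divide)
        with bound[OF subseq_pos[OF r n]]
        show "(norm (ft (cutoff (r n) (W T)) (\<xi> - \<kappa> * T)))\<^sup>2 + (norm (ft (cutoff (r n) (J T)) (\<xi> - \<kappa> * T)))\<^sup>2 \<le>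
          16 / \<nu> ^ 4 * (exp (- (\<nu> * \<kappa>\<^sup>2 / 4 * T)) *
          ((norm (ft (cutoff (r n) (W 0)) \<xi>))\<^sup>2 + (norm (ft (cutoff (r n) (J 0)) \<xi>))\<^sup>2 + 4 / \<nu>\<^sup>2 * (norm (ft (cutoff (r n) (Th 0)) \<xi>))\<^sup>2)
          + (8 / \<nu> + 8 / \<nu> ^ 3) * (M\<^sup>2 * inverse (real (r n))) * T)"
          by (simp only:)
      qed
    qed
    then show ?case by (simp add: power_divide)
  qed
qed

section \<open>Moments of the Fourier transform and the final estimates\<close>

lemma fourier_moment:
  assumes "has_Dy N f g"
  shows "integrable lborel (\<lambda>\<xi>. (\<xi> ^ N)\<^sup>2 * (norm (fourier f \<xi>))\<^sup>2)"
    and "(\<integral>\<xi>. (\<xi> ^ N)\<^sup>2 * (norm (fourier f \<xi>))\<^sup>2 \<partial>lborel) = (L2norm lborel g)\<^sup>2"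
proof -
  have f: "L2 lborel f" and g: "L2 lborel g" using assms by (auto simp: has_Dy_def)
  note [measurable] = L2D(1)[OF fourier_L2[OF f], simplified] L2D(1)[OF fourier_L2[OF g], simplified]
  have eq: "AE \<xi> in lborel. (norm (fourier g \<xi>))\<^sup>2 = (\<xi> ^ N)\<^sup>2 * (norm (fourier f \<xi>))\<^sup>2"
    using has_Dy_fourier[OF assms] by eventually_elim (simp add: norm_mult norm_power power_mult_distrib power_even_abs flip: power_mult)
  show "integrable lborel (\<lambda>\<xi>. (\<xi> ^ N)\<^sup>2 * (norm (fourier f \<xi>))\<^sup>2)"
    using L2D(2)[OF fourier_L2[OF g]] by (subst integrable_cong_AE[OF _ _ eq, symmetric]) auto
  have "(\<integral>\<xi>. (\<xi> ^ N)\<^sup>2 * (norm (fourier f \<xi>))\<^sup>2 \<partial>lborel) = (\<integral>\<xi>. (norm (fourier g \<xi>))\<^sup>2 \<partial>lborel)"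
    by (rule integral_cong_AE[symmetric]) (use eq in auto)
  also have "\<dots> = (L2norm lborel g)\<^sup>2"
    using Plancherel[OF g] by (simp flip: L2norm_power2)
  finally show "(\<integral>\<xi>. (\<xi> ^ N)\<^sup>2 * (norm (fourier f \<xi>))\<^sup>2 \<partial>lborel) = (L2norm lborel g)\<^sup>2" .
qed

lemma has_Dy_of_moment:
  assumes f: "L2 lborel f" and i: "integrable lborel (\<lambda>\<xi>. (\<xi> ^ N)\<^sup>2 * (norm (fourier f \<xi>))\<^sup>2)"
  shows "\<exists>g. has_Dy N f g \<and> (L2norm lborel g)\<^sup>2 = (\<integral>\<xi>. (\<xi> ^ N)\<^sup>2 * (norm (fourier f \<xi>))\<^sup>2 \<partial>lborel)"
proof -
  note [measurable] = L2D(1)[OF fourier_L2[OF f], simplified]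
  have e: "(norm (complex_of_real \<xi> ^ N * fourier f \<xi>))\<^sup>2 = (\<xi> ^ N)\<^sup>2 * (norm (fourier f \<xi>))\<^sup>2" for \<xi> :: real
    by (simp add: norm_mult norm_power power_mult_distrib power_even_abs flip: power_mult)
  have "L2 lborel (\<lambda>\<xi>. of_real \<xi> ^ N * fourier f \<xi>)" unfolding L2_def e using i by simp
  then obtain g where g: "has_Dy N f g" "L2norm lborel g = L2norm lborel (\<lambda>\<xi>. of_real \<xi> ^ N * fourier f \<xi>)"
    using has_Dy_of_fourier[OF f] by blast
  have "(L2norm lborel g)\<^sup>2 = (\<integral>\<xi>. (\<xi> ^ N)\<^sup>2 * (norm (fourier f \<xi>))\<^sup>2 \<partial>lborel)"
    unfolding g(2) L2norm_power2 e ..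
  with g(1) show ?thesis by blast
qed

lemma has_Dy_0: "L2 lborel f \<Longrightarrow> has_Dy 0 f f"
  by (simp add: has_Dy_def)

text \<open>Lets the estimates without derivatives be the case N = 0 of those with derivatives. A
  weak derivative of order 0 is only almost everywhere equal to the function, so norms are compared
  through their transforms.\<close>

lemma has_Dy_0_L2norm:
  assumes "has_Dy 0 f g" shows "L2norm lborel g = L2norm lborel f"
proof -
  have "(L2norm lborel g)\<^sup>2 = (L2norm lborel f)\<^sup>2"
    using fourier_moment(2)[OF assms] fourier_moment(2)[OF has_Dy_0[of f]] assms by (auto simp: has_Dy_def)
  then show ?thesis by (simp add: power2_eq_iff_nonneg)
qed

text \<open>Translating back by c spreads the weight over \<xi> and c, so the shift costs |c|^N
  times unweighted mass. Integrability is a conclusion in its own right: it is what produces the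
  weak derivative at the later time.\<close>

lemma shifted_moment_bound:
  fixes F G :: "real \<Rightarrow> real"
  assumes [measurable]: "F \<in> borel_measurable borel" and F0: "\<And>\<xi>. 0 \<le> F \<xi>" and G0: "\<And>\<xi>. 0 \<le> G \<xi>"
    and le: "AE \<xi> in lborel. F (\<xi> - c) \<le> E * G \<xi>" and E: "0 \<le> E"
    and i0: "integrable lborel G" and iN: "integrable lborel (\<lambda>\<xi>. (\<xi> ^ N)\<^sup>2 * G \<xi>)"
  shows "integrable lborel (\<lambda>\<xi>. (\<xi> ^ N)\<^sup>2 * F \<xi>)"
    and "(\<integral>\<xi>. (\<xi> ^ N)\<^sup>2 * F \<xi> \<partial>lborel) \<le> E * (2 ^ N)\<^sup>2 * ((\<integral>\<xi>. (\<xi> ^ N)\<^sup>2 * G \<xi> \<partial>lborel) + (c ^ N)\<^sup>2 * (\<integral>\<xi>. G \<xi> \<partial>lborel))"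
proof -
  let ?H = "\<lambda>\<xi>. E * (2 ^ N)\<^sup>2 * ((\<xi> ^ N)\<^sup>2 * G \<xi> + (c ^ N)\<^sup>2 * G \<xi>)"
  have H: "integrable lborel ?H" using i0 iN by auto
  have pw: "((\<xi> - c) ^ N)\<^sup>2 \<le> (2 ^ N)\<^sup>2 * ((\<xi> ^ N)\<^sup>2 + (c ^ N)\<^sup>2)" for \<xi>
  proof -
    define m where "m = max \<bar>\<xi>\<bar> \<bar>c\<bar>"
    have "\<bar>\<xi> - c\<bar> \<le> 2 * m" by (auto simp: m_def max_def)
    then have "\<bar>\<xi> - c\<bar> ^ N \<le> (2 * m) ^ N" by (rule power_mono) simp
    then have "(\<bar>\<xi> - c\<bar> ^ N)\<^sup>2 \<le> ((2 * m) ^ N)\<^sup>2" by (rule power_mono) simp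
    also have "\<dots> = (2 ^ N)\<^sup>2 * (m ^ N)\<^sup>2" by (simp add: power_mult_distrib)
    also have "(m ^ N)\<^sup>2 \<le> (\<bar>\<xi>\<bar> ^ N)\<^sup>2 + (\<bar>c\<bar> ^ N)\<^sup>2" by (auto simp: m_def max_def)
    finally show ?thesis by (simp add: power_abs[symmetric])
  qed
  have le2: "AE \<xi> in lborel. ((\<xi> - c) ^ N)\<^sup>2 * F (\<xi> - c) \<le> ?H \<xi>"
    using le
  proof eventually_elim
    case (elim \<xi>)
    have "((\<xi> - c) ^ N)\<^sup>2 * F (\<xi> - c) \<le> ((2 ^ N)\<^sup>2 * ((\<xi> ^ N)\<^sup>2 + (c ^ N)\<^sup>2)) * (E * G \<xi>)"
      using elim pw[of \<xi>] F0 by (intro mult_mono) auto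
    then show ?case by (simp add: algebra_simps)
  qed
  have i: "integrable lborel (\<lambda>\<xi>. ((\<xi> - c) ^ N)\<^sup>2 * F (\<xi> - c))"
  proof (rule Bochner_Integration.integrable_bound[OF H])
    show "AE \<xi> in lborel. norm (((\<xi> - c) ^ N)\<^sup>2 * F (\<xi> - c)) \<le> norm (?H \<xi>)"
      using le2
    proof eventually_elim
      case (elim \<xi>)
      have "0 \<le> ((\<xi> - c) ^ N)\<^sup>2 * F (\<xi> - c)" using F0 by simp
      then show ?case using elim unfolding real_norm_def by linarith
    qed
  qed measurable
  then show "integrable lborel (\<lambda>\<xi>. (\<xi> ^ N)\<^sup>2 * F \<xi>)"
    using lborel_integrable_real_affine_iff[of 1 "\<lambda>\<xi>. (\<xi> ^ N)\<^sup>2 * F \<xi>" "-c"] by simp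
  have "(\<integral>\<xi>. (\<xi> ^ N)\<^sup>2 * F \<xi> \<partial>lborel) = (\<integral>\<xi>. ((\<xi> - c) ^ N)\<^sup>2 * F (\<xi> - c) \<partial>lborel)"
    using lborel_integral_real_affine[of 1 "\<lambda>\<xi>. (\<xi> ^ N)\<^sup>2 * F \<xi>" "-c"] by simp
  also have "\<dots> \<le> (\<integral>\<xi>. ?H \<xi> \<partial>lborel)" by (rule integral_mono_AE[OF i H le2])
  also have "\<dots> = E * (2 ^ N)\<^sup>2 * ((\<integral>\<xi>. (\<xi> ^ N)\<^sup>2 * G \<xi> \<partial>lborel) + (c ^ N)\<^sup>2 * (\<integral>\<xi>. G \<xi> \<partial>lborel))"
    using i0 iN by simp
  finally show "(\<integral>\<xi>. (\<xi> ^ N)\<^sup>2 * F \<xi> \<partial>lborel) \<le> E * (2 ^ N)\<^sup>2 * ((\<integral>\<xi>. (\<xi> ^ N)\<^sup>2 * G \<xi> \<partial>lborel) + (c ^ N)\<^sup>2 * (\<integral>\<xi>. G \<xi> \<partial>lborel))" .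
qed

lemma L2norm_pair_power2: "(L2norm_pair M f g)\<^sup>2 = (L2norm M f)\<^sup>2 + (L2norm M g)\<^sup>2"
  by (simp add: L2norm_pair_def)

lemma L2norm_pair_nonneg [simp]: "0 \<le> L2norm_pair M f g"
  by (simp add: L2norm_pair_def)

text \<open>Passes from pointwise bounds on transforms to norms of derivatives. The parameters c, E,
  b cover three uses: the coupled modes, the temperature with both components equal and b = 0, and
  the mode k = 0 with c = 0 and E = 1.\<close>

theorem pair_decay:
  fixes b c E :: real
  assumes L: "L2 lborel W" "L2 lborel J"
    and D: "has_Dy N W0 DW0" "has_Dy N J0 DJ0" "has_Dy N Th0 DTh0"
    and le: "AE \<xi> in lborel. (norm (fourier W (\<xi> - c)))\<^sup>2 + (norm (fourier J (\<xi> - c)))\<^sup>2 \<le>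
      E * ((norm (fourier W0 \<xi>))\<^sup>2 + (norm (fourier J0 \<xi>))\<^sup>2 + b\<^sup>2 * (norm (fourier Th0 \<xi>))\<^sup>2)"
    and E: "0 \<le> E" and b: "0 \<le> b"
  shows "\<exists>DW DJ. has_Dy N W DW \<and> has_Dy N J DJ \<and> L2norm_pair lborel DW DJ \<le>
    sqrt E * 2 ^ N * (L2norm_pair lborel DW0 DJ0 + b * L2norm lborel DTh0
      + \<bar>c\<bar> ^ N * (L2norm_pair lborel W0 J0 + b * L2norm lborel Th0))"
proof -
  have L0: "L2 lborel W0" "L2 lborel J0" "L2 lborel Th0" using D by (auto simp: has_Dy_def)
  note [measurable] = L2D(1)[OF fourier_L2[OF L(1)], simplified] L2D(1)[OF fourier_L2[OF L(2)], simplified]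
  define F where "F \<xi> = (norm (fourier W \<xi>))\<^sup>2 + (norm (fourier J \<xi>))\<^sup>2" for \<xi>
  define G where "G \<xi> = (norm (fourier W0 \<xi>))\<^sup>2 + (norm (fourier J0 \<xi>))\<^sup>2 + b\<^sup>2 * (norm (fourier Th0 \<xi>))\<^sup>2" for \<xi>
  have Gm: "integrable lborel (\<lambda>\<xi>. (\<xi> ^ n)\<^sup>2 * G \<xi>) \<and> (\<integral>\<xi>. (\<xi> ^ n)\<^sup>2 * G \<xi> \<partial>lborel) =
      (L2norm_pair lborel d1 d2)\<^sup>2 + b\<^sup>2 * (L2norm lborel d3)\<^sup>2"
    if "has_Dy n W0 d1" "has_Dy n J0 d2" "has_Dy n Th0 d3" for n d1 d2 d3
  proof -
    note m = fourier_moment[OF that(1)] fourier_moment[OF that(2)] fourier_moment[OF that(3)]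
    have "(\<lambda>\<xi>. (\<xi> ^ n)\<^sup>2 * G \<xi>) = (\<lambda>\<xi>. (\<xi> ^ n)\<^sup>2 * (norm (fourier W0 \<xi>))\<^sup>2 + (\<xi> ^ n)\<^sup>2 * (norm (fourier J0 \<xi>))\<^sup>2
        + b\<^sup>2 * ((\<xi> ^ n)\<^sup>2 * (norm (fourier Th0 \<xi>))\<^sup>2))"
      by (auto simp: G_def algebra_simps)
    then show ?thesis using m by (simp add: L2norm_pair_power2)
  qed
  note GN = Gm[OF D]
  have G1: "integrable lborel G" "(\<integral>\<xi>. G \<xi> \<partial>lborel) = (L2norm_pair lborel W0 J0)\<^sup>2 + b\<^sup>2 * (L2norm lborel Th0)\<^sup>2"
    using Gm[OF has_Dy_0[OF L0(1)] has_Dy_0[OF L0(2)] has_Dy_0[OF L0(3)]] by simp_all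
  have Fmeas: "F \<in> borel_measurable borel" unfolding F_def[abs_def] by measurable
  have F0: "0 \<le> F \<xi>" and G0: "0 \<le> G \<xi>" for \<xi> by (auto simp: F_def G_def)
  have le': "AE \<xi> in lborel. F (\<xi> - c) \<le> E * G \<xi>" using le by (simp add: F_def G_def)
  note S = shifted_moment_bound[OF Fmeas F0 G0 le' E G1(1) conjunct1[OF GN]]
  have iW: "integrable lborel (\<lambda>\<xi>. (\<xi> ^ N)\<^sup>2 * (norm (fourier W \<xi>))\<^sup>2)"
    and iJ: "integrable lborel (\<lambda>\<xi>. (\<xi> ^ N)\<^sup>2 * (norm (fourier J \<xi>))\<^sup>2)"
    by (rule Bochner_Integration.integrable_bound[OF S(1)]; (auto simp: F_def abs_mult intro!: mult_left_mono)?; measurable)+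
  obtain DW where DW: "has_Dy N W DW" "(L2norm lborel DW)\<^sup>2 = (\<integral>\<xi>. (\<xi> ^ N)\<^sup>2 * (norm (fourier W \<xi>))\<^sup>2 \<partial>lborel)"
    using has_Dy_of_moment[OF L(1) iW] by blast
  obtain DJ where DJ: "has_Dy N J DJ" "(L2norm lborel DJ)\<^sup>2 = (\<integral>\<xi>. (\<xi> ^ N)\<^sup>2 * (norm (fourier J \<xi>))\<^sup>2 \<partial>lborel)"
    using has_Dy_of_moment[OF L(2) iJ] by blast
  let ?P = "L2norm_pair lborel DW0 DJ0" let ?R = "L2norm_pair lborel W0 J0"
  let ?T = "b * L2norm lborel DTh0" let ?S = "b * L2norm lborel Th0"
  have "(L2norm_pair lborel DW DJ)\<^sup>2 = (\<integral>\<xi>. (\<xi> ^ N)\<^sup>2 * F \<xi> \<partial>lborel)"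
    using iW iJ by (simp add: L2norm_pair_power2 DW DJ F_def distrib_left)
  also have "\<dots> \<le> E * (2 ^ N)\<^sup>2 * ((?P\<^sup>2 + ?T\<^sup>2) + (c ^ N)\<^sup>2 * (?R\<^sup>2 + ?S\<^sup>2))"
    using S(2) GN G1(2) by (simp add: power_mult_distrib)
  also have "\<dots> \<le> E * (2 ^ N)\<^sup>2 * (?P + ?T + \<bar>c\<bar> ^ N * (?R + ?S))\<^sup>2"
  proof (intro mult_left_mono)
    have sq: "x\<^sup>2 + y\<^sup>2 \<le> (x + y)\<^sup>2" if "0 \<le> x" "0 \<le> y" for x y :: real using that by (simp add: power2_sum)
    have T0: "0 \<le> ?T" "0 \<le> ?S" using b by auto
    have "(c ^ N)\<^sup>2 * (?R\<^sup>2 + ?S\<^sup>2) \<le> (c ^ N)\<^sup>2 * (?R + ?S)\<^sup>2"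
      using sq[OF _ T0(2)] by (intro mult_left_mono) auto
    also have "\<dots> = (\<bar>c\<bar> ^ N * (?R + ?S))\<^sup>2" by (simp add: power_mult_distrib power_abs[symmetric])
    finally have "(?P\<^sup>2 + ?T\<^sup>2) + (c ^ N)\<^sup>2 * (?R\<^sup>2 + ?S\<^sup>2) \<le> (?P + ?T)\<^sup>2 + (\<bar>c\<bar> ^ N * (?R + ?S))\<^sup>2"
      using sq[OF _ T0(1)] by (intro add_mono) auto
    also have "\<dots> \<le> (?P + ?T + \<bar>c\<bar> ^ N * (?R + ?S))\<^sup>2" using T0 by (intro sq) auto
    finally show "(?P\<^sup>2 + ?T\<^sup>2) + (c ^ N)\<^sup>2 * (?R\<^sup>2 + ?S\<^sup>2) \<le> (?P + ?T + \<bar>c\<bar> ^ N * (?R + ?S))\<^sup>2" .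
  qed (use E in simp)
  also have "\<dots> = (sqrt E * 2 ^ N * (?P + ?T + \<bar>c\<bar> ^ N * (?R + ?S)))\<^sup>2"
    using E by (simp add: power_mult_distrib)
  finally have "L2norm_pair lborel DW DJ \<le> sqrt E * 2 ^ N * (?P + ?T + \<bar>c\<bar> ^ N * (?R + ?S))"
    by (rule power2_le_imp_le) (use E b in \<open>auto intro!: mult_nonneg_nonneg add_nonneg_nonneg\<close>)
  with DW(1) DJ(1) show ?thesis by blast
qed

section \<open>Decay rates and amplitudes\<close>

lemma power_le_fact_exp:
  assumes "0 \<le> (s::real)" shows "s ^ N \<le> fact N * exp s"
proof -
  have "(\<Sum>n\<in>{N}. s ^ n /\<^sub>R fact n) \<le> (\<Sum>n. s ^ n /\<^sub>R fact n)"
    by (rule sum_le_suminf[OF summable_exp_generic]) (use assms in auto)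
  then have "s ^ N /\<^sub>R fact N \<le> exp s" unfolding exp_def by simp
  then have "fact N * (s ^ N /\<^sub>R fact N) \<le> fact N * exp s" by (intro mult_left_mono) auto
  also have "fact N * (s ^ N /\<^sub>R fact N) = s ^ N"
    by (simp only: real_scaleR_def mult.assoc[symmetric] right_inverse[OF fact_nonzero] mult_1_left)
  finally show ?thesis .
qed

text \<open>The variable s is chosen so that s^3 = \<eta> \<kappa>^2 t^3; cubic decay beats
  exponential decay in s up to a constant. The second claim spends exp(-s/2) on the powers of
  \<kappa> t.\<close>

lemma scalar_amplitude:
  fixes \<eta> \<kappa> t :: real
  assumes \<eta>: "0 < \<eta>" and t: "0 \<le> t"
  defines "s \<equiv> \<eta> powr (1/3) * \<bar>\<kappa>\<bar> powr (2/3) * t"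
  shows "sqrt (exp (- (\<eta> * (\<kappa>\<^sup>2 * t ^ 3 / 12)))) \<le> exp 3 * exp (- s)"
    and "N > 0 \<Longrightarrow> \<bar>\<kappa> * t\<bar> ^ N * exp (- s / 2) \<le> 2 ^ N * fact N * (\<eta> powr (-1) * \<bar>\<kappa>\<bar>) powr (real N / 3)"
proof -
  have s0: "0 \<le> s" using t by (simp add: s_def)
  have "(\<eta> powr (1/3)) ^ 3 = \<eta>" using \<eta> by (simp add: powr_power)
  moreover have "(\<bar>\<kappa>\<bar> powr (2/3)) ^ 3 = \<kappa>\<^sup>2"
  proof (cases "\<kappa> = 0")
    case False
    then have "(\<bar>\<kappa>\<bar> powr (2/3)) ^ 3 = \<bar>\<kappa>\<bar> powr (real 2)" by (simp add: powr_power)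
    also have "\<dots> = \<bar>\<kappa>\<bar> ^ 2" using False by (intro powr_realpow) simp
    finally show ?thesis by simp
  qed simp
  ultimately have s3: "s ^ 3 = \<eta> * \<kappa>\<^sup>2 * t ^ 3" by (simp add: s_def power_mult_distrib)
  \<comment> \<open>Equals s^3 - 27 s + 54: the cube lies above its tangent at s = 3.\<close>
  have "0 \<le> (s - 3)\<^sup>2 * (s + 6)" using s0 by simp
  then have "27 * s \<le> s ^ 3 + 54" by (simp add: power2_eq_square power3_eq_cube algebra_simps)
  then have "- (s ^ 3 / 24) \<le> 3 - s" using s0 by simp
  have "sqrt (exp (- (\<eta> * (\<kappa>\<^sup>2 * t ^ 3 / 12)))) = exp (- (s ^ 3 / 24))"
  proof (rule real_sqrt_unique)
    show "(exp (- (s ^ 3 / 24)))\<^sup>2 = exp (- (\<eta> * (\<kappa>\<^sup>2 * t ^ 3 / 12)))"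
      unfolding s3 by (simp flip: exp_double)
  qed simp
  also have "\<dots> \<le> exp (3 - s)" by (simp add: \<open>- (s ^ 3 / 24) \<le> 3 - s\<close>)
  finally show "sqrt (exp (- (\<eta> * (\<kappa>\<^sup>2 * t ^ 3 / 12)))) \<le> exp 3 * exp (- s)"
    by (simp only: diff_conv_add_uminus exp_add)
  assume N: "N > 0"
  show "\<bar>\<kappa> * t\<bar> ^ N * exp (- s / 2) \<le> 2 ^ N * fact N * (\<eta> powr (-1) * \<bar>\<kappa>\<bar>) powr (real N / 3)"
  proof (cases "\<kappa> = 0")
    \<comment> \<open>Here N > 0 matters: \<open>0 ^ 0\<close> is 1, whereas \<open>0 powr 0\<close>
      is 0.\<close>
    case True
    then show ?thesis using N by (simp add: power_0_left)
  next
    case False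
    \<comment> \<open>Chosen so that s q = |\<kappa> t|; the power q^N is then exactly the prefactor
      in the claim, and s^N is absorbed by the exponential.\<close>
    define q where "q = (\<eta> powr (-1) * \<bar>\<kappa>\<bar>) powr (1/3)"
    have qN: "q ^ N = (\<eta> powr (-1) * \<bar>\<kappa>\<bar>) powr (real N / 3)"
      unfolding q_def using False \<eta> by (simp add: powr_power)
    have p1: "\<eta> powr (1/3) * \<eta> powr (-1/3) = 1" using \<eta> by (simp flip: powr_add)
    have p2: "\<bar>\<kappa>\<bar> powr (2/3) * \<bar>\<kappa>\<bar> powr (1/3) = \<bar>\<kappa>\<bar>" using False by (simp flip: powr_add)
    have p3: "q = \<eta> powr (-1/3) * \<bar>\<kappa>\<bar> powr (1/3)" 
    proof -
      have "q = (\<eta> powr (-1)) powr (1/3) * \<bar>\<kappa>\<bar> powr (1/3)"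
        unfolding q_def by (rule powr_mult)
      also have "(\<eta> powr (-1)) powr (1/3) = \<eta> powr (-1/3)" unfolding powr_powr by simp
      finally show ?thesis .
    qed
    have "s * q = (\<eta> powr (1/3) * \<eta> powr (-1/3)) * (\<bar>\<kappa>\<bar> powr (2/3) * \<bar>\<kappa>\<bar> powr (1/3)) * t"
      unfolding s_def p3 by (simp only: mult_ac)
    then have sq: "s * q = \<bar>\<kappa> * t\<bar>" unfolding p1 p2 using t by (simp add: abs_mult)
    have "\<bar>\<kappa> * t\<bar> ^ N * exp (- s / 2) = 2 ^ N * ((s / 2) ^ N * exp (- s / 2)) * q ^ N"
      unfolding sq[symmetric] by (simp add: power_mult_distrib power_divide)
    also have "(s / 2) ^ N * exp (- s / 2) \<le> fact N"
      using mult_right_mono[OF power_le_fact_exp[of "s / 2" N], of "exp (- s / 2)"] s0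
      by (simp add: mult.assoc flip: exp_add)
    finally show ?thesis unfolding qN by (simp add: mult_left_mono mult_right_mono)
  qed
qed

text \<open>Occurs twice in the estimate with derivatives, once for the differentiated data and once
  for the plain data.\<close>

definition data_bound :: "real \<Rightarrow> real \<Rightarrow> real \<Rightarrow> real \<Rightarrow> real" where
  "data_bound \<nu> \<kappa> A B = \<nu> powr (-2) * A + \<nu> powr (-6) * (\<nu> powr (-1) * \<bar>\<kappa>\<bar>) powr (1/3) * B"

text \<open>The square root of the energy factor is 4/\<nu>^2 times \<open>x * x\<close>, where x
  decays at the rate \<nu> \<kappa>^2/16. One factor x gives the stated exponential, the other
  absorbs |\<kappa> t|^N.\<close>

lemma system_amplitude:
  fixes \<nu> \<kappa> t P T P0 T0 :: real and N :: nat
  assumes \<nu>: "0 < \<nu>" "\<nu> \<le> 1" and \<kappa>: "1 \<le> \<bar>\<kappa>\<bar>" and t: "0 \<le> t"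
    and nn: "0 \<le> P" "0 \<le> T" "0 \<le> P0" "0 \<le> T0"
  shows "sqrt (16 / \<nu> ^ 4 * exp (- (\<nu> * \<kappa>\<^sup>2 / 4 * t))) * 2 ^ N * (P + (2 / \<nu>) * T + \<bar>\<kappa> * t\<bar> ^ N * (P0 + (2 / \<nu>) * T0))
    \<le> 8 * 2 ^ N * (1 + 16 ^ N * fact N) * exp (- (1/16) * \<nu> powr (13/3) * \<bar>\<kappa>\<bar> powr (2/3) * t) *
      (data_bound \<nu> \<kappa> P T + \<nu> powr (-6 * real N) * (\<nu> powr (-1) * \<bar>\<kappa>\<bar>) powr (real N / 3) * data_bound \<nu> \<kappa> P0 T0)"
proof -
  define x where "x = exp (- (\<nu> * \<kappa>\<^sup>2 * t / 16))"
  define y where "y = exp (- (1/16) * \<nu> powr (13/3) * \<bar>\<kappa>\<bar> powr (2/3) * t)"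
  define q where "q = (\<nu> powr (-1) * \<bar>\<kappa>\<bar>) powr (1/3)"
  define Q where "Q = \<nu> powr (-6 * real N) * (\<nu> powr (-1) * \<bar>\<kappa>\<bar>) powr (real N / 3)"
  have \<kappa>2: "1 \<le> \<kappa>\<^sup>2" using \<kappa> by (simp add: abs_le_square_iff[of 1 \<kappa>, simplified])
  have base: "1 \<le> \<nu> powr (-1) * \<bar>\<kappa>\<bar>"
  proof -
    have "1 * 1 \<le> \<nu> powr (-1) * \<bar>\<kappa>\<bar>"
      using \<nu> \<kappa> by (intro mult_mono) (auto simp: powr_minus one_le_inverse)
    then show ?thesis by simp
  qed
  have q1: "1 \<le> q" unfolding q_def using base by (intro ge_one_powr_ge_zero) auto
  have Q1: "\<nu> powr (- real N) \<le> Q"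
  proof -
    have "\<nu> powr (- real N) * 1 \<le> \<nu> powr (-6 * real N) * (\<nu> powr (-1) * \<bar>\<kappa>\<bar>) powr (real N / 3)"
      using \<nu> base by (intro mult_mono powr_mono' ge_one_powr_ge_zero) auto
    then show ?thesis by (simp add: Q_def)
  qed
  have Q0: "0 \<le> Q" by (simp add: Q_def)
  have x01: "0 \<le> x" "x \<le> 1" using \<nu> t by (auto simp: x_def)
  have xy: "x \<le> y"
  proof -
    have "\<nu> powr (13/3) \<le> \<nu> powr 1" using \<nu> by (intro powr_mono') auto
    moreover have "\<bar>\<kappa>\<bar> powr (2/3) \<le> \<bar>\<kappa>\<bar> powr (real 2)" using \<kappa> by (intro powr_mono) auto
    moreover have "\<bar>\<kappa>\<bar> powr (real 2) = \<kappa>\<^sup>2" using \<kappa> by (subst powr_realpow) auto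
    ultimately have "\<nu> powr (13/3) * \<bar>\<kappa>\<bar> powr (2/3) \<le> \<nu> * \<kappa>\<^sup>2" using \<nu> by (intro mult_mono) auto
    from mult_right_mono[OF this t] show ?thesis by (simp add: x_def y_def)
  qed
  have kx: "\<bar>\<kappa> * t\<bar> ^ N * x \<le> 16 ^ N * fact N * Q"
  proof -
    \<comment> \<open>As |\<kappa>| \<ge> 1, the product |\<kappa>| t is at most 16 u/\<nu>. Hence
      the constant 16^N, and the power \<nu>^-N that \<open>Q1\<close> compares with Q.\<close>
    define u where "u = \<nu> * \<kappa>\<^sup>2 * t / 16"
    have u0: "0 \<le> u" using \<nu> t by (simp add: u_def)
    have "\<bar>\<kappa> * t\<bar> \<le> 16 * u / \<nu>"
    proof -
      have "\<bar>\<kappa>\<bar> * 1 \<le> \<bar>\<kappa>\<bar> * \<bar>\<kappa>\<bar>" using \<kappa> by (intro mult_left_mono) auto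
      then have "\<bar>\<kappa>\<bar> * t \<le> \<kappa>\<^sup>2 * t" using t by (intro mult_right_mono) (auto simp: power2_eq_square)
      then show ?thesis using \<nu> t by (simp add: u_def abs_mult)
    qed
    then have "\<bar>\<kappa> * t\<bar> ^ N * x \<le> (16 * u / \<nu>) ^ N * exp (- u)"
      unfolding x_def u_def by (intro mult_mono power_mono) auto
    also have "\<dots> = 16 ^ N * (u ^ N * exp (- u)) * (1 / \<nu>) ^ N" by (simp add: power_mult_distrib power_divide)
    also have "\<dots> \<le> 16 ^ N * fact N * (1 / \<nu>) ^ N"
      using mult_right_mono[OF power_le_fact_exp[OF u0, of N], of "exp (- u)"] \<nu>
      by (intro mult_right_mono mult_left_mono) (auto simp: mult.assoc simp flip: exp_add)
    also have "(1 / \<nu>) ^ N = \<nu> powr (- real N)" using \<nu> by (simp add: powr_minus powr_realpow power_one_over inverse_eq_divide)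
    also have "16 ^ N * fact N * \<nu> powr (- real N) \<le> 16 ^ N * fact N * Q" using Q1 by (intro mult_left_mono) auto
    finally show ?thesis .
  qed
  have sq: "sqrt (16 / \<nu> ^ 4 * exp (- (\<nu> * \<kappa>\<^sup>2 / 4 * t))) = 4 / \<nu>\<^sup>2 * (x * x)"
  proof (rule real_sqrt_unique)
    have "(x * x)\<^sup>2 = exp (- (\<nu> * \<kappa>\<^sup>2 / 4 * t))"
      unfolding x_def power2_eq_square by (simp flip: exp_add)
    then show "(4 / \<nu>\<^sup>2 * (x * x))\<^sup>2 = 16 / \<nu> ^ 4 * exp (- (\<nu> * \<kappa>\<^sup>2 / 4 * t))"
      unfolding power_mult_distrib by (simp add: power_divide flip: power_mult)
  qed simp
  have n2: "\<nu> powr (-2) = 1 / \<nu>\<^sup>2" using \<nu> by (simp add: powr_minus_divide)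
  \<comment> \<open>The amplitude obtained for \<theta> is of order \<nu>^-3, which q \<ge> 1 and
    \<nu> \<le> 1 weaken to the stated form.\<close>
  have n6: "1 / \<nu>\<^sup>2 * (2 / \<nu>) \<le> 2 * (\<nu> powr (-6) * q)"
  proof -
    have "\<nu> powr (-3) * 1 \<le> \<nu> powr (-6) * q" using \<nu> q1 by (intro mult_mono powr_mono') auto
    moreover have "\<nu> powr (-3) = 1 / \<nu> ^ 3" using \<nu> by (simp add: powr_minus_divide)
    moreover have "1 / \<nu>\<^sup>2 * (2 / \<nu>) = 2 * (1 / \<nu> ^ 3)" by (simp add: power2_eq_square power3_eq_cube)
    ultimately show ?thesis by linarith
  qed
  define X where "X = \<nu> powr (-2) * P + \<nu> powr (-6) * q * T"
  define X0 where "X0 = \<nu> powr (-2) * P0 + \<nu> powr (-6) * q * T0"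
  have XX: "0 \<le> X" "0 \<le> X0" using nn q1 by (auto simp: X_def X0_def)
  have b: "1 / \<nu>\<^sup>2 * (R + 2 / \<nu> * S) \<le> 2 * (\<nu> powr (-2) * R + \<nu> powr (-6) * q * S)" if "0 \<le> R" "0 \<le> S" for R S
  proof -
    have "1 / \<nu>\<^sup>2 * (R + 2 / \<nu> * S) = 1 / \<nu>\<^sup>2 * R + (1 / \<nu>\<^sup>2 * (2 / \<nu>)) * S" by (simp add: algebra_simps)
    also have "\<dots> \<le> 2 * (1 / \<nu>\<^sup>2 * R) + (2 * (\<nu> powr (-6) * q)) * S"
    proof (rule add_mono)
      have "0 \<le> 1 / \<nu>\<^sup>2 * R" using that by simp
      then show "1 / \<nu>\<^sup>2 * R \<le> 2 * (1 / \<nu>\<^sup>2 * R)" by linarith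
    qed (rule mult_right_mono[OF n6 that(2)])
    finally show ?thesis unfolding n2 by (simp add: algebra_simps)
  qed
  have "sqrt (16 / \<nu> ^ 4 * exp (- (\<nu> * \<kappa>\<^sup>2 / 4 * t))) * 2 ^ N * (P + (2 / \<nu>) * T + \<bar>\<kappa> * t\<bar> ^ N * (P0 + (2 / \<nu>) * T0))
      = 4 * 2 ^ N * x * (x * (1 / \<nu>\<^sup>2 * (P + 2 / \<nu> * T)) + (\<bar>\<kappa> * t\<bar> ^ N * x) * (1 / \<nu>\<^sup>2 * (P0 + 2 / \<nu> * T0)))"
    unfolding sq by (simp add: algebra_simps)
  also have "\<dots> \<le> 4 * 2 ^ N * y * (1 * (2 * X) + (16 ^ N * fact N * Q) * (2 * X0))"
  proof (rule mult_mono)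
    have A: "0 \<le> 1 / \<nu>\<^sup>2 * (P + 2 / \<nu> * T)" "0 \<le> 1 / \<nu>\<^sup>2 * (P0 + 2 / \<nu> * T0)"
      using nn \<nu> by (auto intro!: mult_nonneg_nonneg add_nonneg_nonneg divide_nonneg_nonneg)
    have K: "0 \<le> \<bar>\<kappa> * t\<bar> ^ N * x" "0 \<le> 16 ^ N * fact N * Q" using x01 Q0 by auto
    show "4 * 2 ^ N * x \<le> 4 * 2 ^ N * y" using xy by simp
    show "x * (1 / \<nu>\<^sup>2 * (P + 2 / \<nu> * T)) + (\<bar>\<kappa> * t\<bar> ^ N * x) * (1 / \<nu>\<^sup>2 * (P0 + 2 / \<nu> * T0))
        \<le> 1 * (2 * X) + (16 ^ N * fact N * Q) * (2 * X0)"
      by (rule add_mono[OF mult_mono[OF x01(2) b[OF nn(1,2), folded X_def] zero_le_one A(1)]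
            mult_mono[OF kx b[OF nn(3,4), folded X0_def] K(2) A(2)]])
    show "0 \<le> 4 * 2 ^ N * y" by (simp add: y_def)
    show "0 \<le> x * (1 / \<nu>\<^sup>2 * (P + 2 / \<nu> * T)) + (\<bar>\<kappa> * t\<bar> ^ N * x) * (1 / \<nu>\<^sup>2 * (P0 + 2 / \<nu> * T0))"
      by (rule add_nonneg_nonneg[OF mult_nonneg_nonneg[OF x01(1) A(1)] mult_nonneg_nonneg[OF K(1) A(2)]])
  qed
  also have "\<dots> \<le> 4 * 2 ^ N * y * (2 * (1 + 16 ^ N * fact N) * (X + Q * X0))"
  proof (rule mult_left_mono)
    have "0 \<le> 16 ^ N * fact N * X" "0 \<le> Q * X0" using XX Q0 by auto
    then show "1 * (2 * X) + (16 ^ N * fact N * Q) * (2 * X0) \<le> 2 * (1 + 16 ^ N * fact N) * (X + Q * X0)"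
      by (simp add: algebra_simps)
  qed (simp add: y_def)
  also have "\<dots> = 8 * 2 ^ N * (1 + 16 ^ N * fact N) * y * (X + Q * X0)" by (simp add: algebra_simps)
  finally show ?thesis unfolding X_def X0_def Q_def q_def y_def data_bound_def .
qed

section \<open>Estimates for solutions of the system\<close>

lemma solution_theta_decay:
  assumes sol: "solution \<nu> \<mu> \<eta> w j \<theta>" and \<eta>: "0 < \<eta>" and t: "0 < t"
    and D: "has_Dy N (mode k (\<theta> 0)) D\<theta>0"
  shows "\<exists>D\<theta>. has_Dy N (mode k (\<theta> t)) D\<theta> \<and> L2norm lborel D\<theta> \<le>
    2 * exp 3 * 2 ^ N * exp (- (\<eta> powr (1/3) * \<bar>real_of_int k\<bar> powr (2/3) * t)) *
      (L2norm lborel D\<theta>0 + \<bar>real_of_int k * t\<bar> ^ N * L2norm lborel (mode k (\<theta> 0)))"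
proof -
  let ?\<kappa> = "real_of_int k"
  let ?E = "exp (- (\<eta> * (?\<kappa>\<^sup>2 * t ^ 3 / 12)))"
  have reg: "regular \<theta>" using sol by (simp add: solution_def)
  note cl = classical_mode[OF reg, of k]
  have eq: "mode k (dt \<theta> s) y = - \<i> * of_real ?\<kappa> * of_real y * mode k (\<theta> s) y
      + of_real \<eta> * (mode k (dy (dy (\<theta> s))) y - of_real ?\<kappa> ^ 2 * mode k (\<theta> s) y)" if "s > 0" for s y
    using solution_mode(1)[OF sol that, where k=k and K="of_real ?\<kappa>"] by simp
  have L: "L2 lborel (mode k (\<theta> t))" using classical_L2[OF cl, of t] t by simp
  have sd: "AE \<xi> in lborel. (norm (fourier (mode k (\<theta> t)) (\<xi> - ?\<kappa> * t)))\<^sup>2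
      \<le> exp (- (\<eta> * (?\<kappa>\<^sup>2 * t + t * (\<xi> - ?\<kappa> * t / 2)\<^sup>2 + ?\<kappa>\<^sup>2 * t ^ 3 / 12))) * (norm (fourier (mode k (\<theta> 0)) \<xi>))\<^sup>2"
    by (rule scalar_decay[OF cl \<eta> t eq])
  \<comment> \<open>\<open>pair_decay\<close> is used with the temperature as both components and b
    = 0; comparing its pair norm with the plain norm costs the factor 2. Only the cubic part of the
    exponent is kept.\<close>
  have le: "AE \<xi> in lborel. (norm (fourier (mode k (\<theta> t)) (\<xi> - ?\<kappa> * t)))\<^sup>2 + (norm (fourier (mode k (\<theta> t)) (\<xi> - ?\<kappa> * t)))\<^sup>2 \<le>
    ?E * ((norm (fourier (mode k (\<theta> 0)) \<xi>))\<^sup>2 + (norm (fourier (mode k (\<theta> 0)) \<xi>))\<^sup>2 + 0\<^sup>2 * (norm (fourier (mode k (\<theta> 0)) \<xi>))\<^sup>2)"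
    using sd
  proof eventually_elim
    case (elim \<xi>)
    have "?\<kappa>\<^sup>2 * t ^ 3 / 12 \<le> ?\<kappa>\<^sup>2 * t + t * (\<xi> - ?\<kappa> * t / 2)\<^sup>2 + ?\<kappa>\<^sup>2 * t ^ 3 / 12" using t by simp
    then have "exp (- (\<eta> * (?\<kappa>\<^sup>2 * t + t * (\<xi> - ?\<kappa> * t / 2)\<^sup>2 + ?\<kappa>\<^sup>2 * t ^ 3 / 12))) \<le> ?E"
      using \<eta> by (simp only: exp_le_cancel_iff neg_le_iff_le) (intro mult_left_mono; simp)
    from order_trans[OF elim mult_right_mono[OF this zero_le_power2]]
    have "(norm (fourier (mode k (\<theta> t)) (\<xi> - ?\<kappa> * t)))\<^sup>2 \<le> ?E * (norm (fourier (mode k (\<theta> 0)) \<xi>))\<^sup>2"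
      .
    then show ?case by (simp add: algebra_simps)
  qed
  have E0: "0 \<le> ?E" by simp
  obtain D1 D2 where D1: "has_Dy N (mode k (\<theta> t)) D1" and le2: "L2norm_pair lborel D1 D2 \<le>
      sqrt ?E * 2 ^ N * (L2norm_pair lborel D\<theta>0 D\<theta>0 + 0 * L2norm lborel D\<theta>0
      + \<bar>?\<kappa> * t\<bar> ^ N * (L2norm_pair lborel (mode k (\<theta> 0)) (mode k (\<theta> 0)) + 0 * L2norm lborel (mode k (\<theta> 0))))"
    using pair_decay[OF L L D D D le E0 order_refl] by blast
  have pair2: "L2norm_pair lborel f f \<le> 2 * L2norm lborel f" for f :: "real \<Rightarrow> complex"
    by (rule power2_le_imp_le) (auto simp: L2norm_pair_power2 power_mult_distrib)
  have "L2norm lborel D1 \<le> L2norm_pair lborel D1 D2"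
    by (rule power2_le_imp_le) (auto simp: L2norm_pair_power2)
  also note le2
  also have "sqrt ?E * 2 ^ N * (L2norm_pair lborel D\<theta>0 D\<theta>0 + 0 * L2norm lborel D\<theta>0
      + \<bar>?\<kappa> * t\<bar> ^ N * (L2norm_pair lborel (mode k (\<theta> 0)) (mode k (\<theta> 0)) + 0 * L2norm lborel (mode k (\<theta> 0))))
    \<le> (exp 3 * exp (- (\<eta> powr (1/3) * \<bar>?\<kappa>\<bar> powr (2/3) * t))) * 2 ^ N * (2 * L2norm lborel D\<theta>0 + 0
      + \<bar>?\<kappa> * t\<bar> ^ N * (2 * L2norm lborel (mode k (\<theta> 0)) + 0))"
    using scalar_amplitude(1)[OF \<eta>, of t ?\<kappa>] t pair2
    by (intro mult_mono add_mono) (auto intro!: add_nonneg_nonneg mult_nonneg_nonneg)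
  also have "\<dots> = 2 * exp 3 * 2 ^ N * exp (- (\<eta> powr (1/3) * \<bar>?\<kappa>\<bar> powr (2/3) * t)) *
      (L2norm lborel D\<theta>0 + \<bar>?\<kappa> * t\<bar> ^ N * L2norm lborel (mode k (\<theta> 0)))"
    by (simp add: algebra_simps)
  finally show ?thesis using D1 by blast
qed

text \<open>At k = 0 the coupling, the forcing and the nonlocal term all carry the factor k, so
  \<open>scalar_decay\<close> applies to \<open>w\<close> and \<open>j\<close> separately. Its
  exponential is bounded by 1, and the \<open>0 ^ N\<close> is the shift |k t|^N.\<close>

lemma solution_wj_decay:
  assumes sol: "solution \<nu> \<nu> \<eta> w j \<theta>" and \<nu>: "0 < \<nu>" "\<nu> \<le> \<eta>" "\<eta> \<le> 1" and t: "0 < t"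
    and D: "has_Dy N (mode k (w 0)) Dw0" "has_Dy N (mode k (j 0)) Dj0" "has_Dy N (mode k (\<theta> 0)) D\<theta>0"
  shows "k \<noteq> 0 \<Longrightarrow> \<exists>Dw Dj. has_Dy N (mode k (w t)) Dw \<and> has_Dy N (mode k (j t)) Dj \<and>
      L2norm_pair lborel Dw Dj \<le> 8 * 2 ^ N * (1 + 16 ^ N * fact N) *
        exp (- (1/16) * \<nu> powr (13/3) * \<bar>real_of_int k\<bar> powr (2/3) * t) *
        (data_bound \<nu> k (L2norm_pair lborel Dw0 Dj0) (L2norm lborel D\<theta>0)
         + \<nu> powr (-6 * real N) * (\<nu> powr (-1) * \<bar>real_of_int k\<bar>) powr (real N / 3) *
         data_bound \<nu> k (L2norm_pair lborel (mode k (w 0)) (mode k (j 0))) (L2norm lborel (mode k (\<theta> 0))))"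
    and "k = 0 \<Longrightarrow> \<exists>Dw Dj. has_Dy N (mode k (w t)) Dw \<and> has_Dy N (mode k (j t)) Dj \<and>
      L2norm_pair lborel Dw Dj \<le> 2 ^ N * (L2norm_pair lborel Dw0 Dj0 + 0 ^ N * L2norm_pair lborel (mode k (w 0)) (mode k (j 0)))"
proof -
  let ?\<kappa> = "real_of_int k"
  have reg: "regular w" "regular j" "regular \<theta>" using sol by (simp_all add: solution_def)
  note cl = classical_mode[OF reg(1), of k] classical_mode[OF reg(2), of k] classical_mode[OF reg(3), of k]
  have L: "L2 lborel (mode k (w t))" "L2 lborel (mode k (j t))"
    using classical_L2[OF cl(1), of t] classical_L2[OF cl(2), of t] t by simp_all
  have K: "complex_of_real ?\<kappa> = of_int k" by simp
  note eqs = solution_mode[OF sol _ K]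
  {
    assume k: "k \<noteq> 0"
    then have k1: "1 \<le> \<bar>?\<kappa>\<bar>" by linarith
    then have k2: "1 \<le> ?\<kappa>\<^sup>2" by (simp add: abs_le_square_iff[of 1 ?\<kappa>, simplified])
    have \<nu>1: "\<nu> \<le> 1" using \<nu> by simp
    let ?E = "16 / \<nu> ^ 4 * exp (- (\<nu> * ?\<kappa>\<^sup>2 / 4 * t))"
    have "AE \<xi> in lborel. (norm (fourier (mode k (w t)) (\<xi> - ?\<kappa> * t)))\<^sup>2 + (norm (fourier (mode k (j t)) (\<xi> - ?\<kappa> * t)))\<^sup>2
      \<le> ?E * ((norm (fourier (mode k (w 0)) \<xi>))\<^sup>2 + (norm (fourier (mode k (j 0)) \<xi>))\<^sup>2 + (2 / \<nu>)\<^sup>2 * (norm (fourier (mode k (\<theta> 0)) \<xi>))\<^sup>2)"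
      by (rule system_decay[OF cl k2 \<nu>(1) \<nu>1 \<nu>(2) t]) (use eqs(1,2) eqs(3) k in \<open>blast+\<close>)
    from pair_decay[OF L D this] have "\<exists>Dw Dj. has_Dy N (mode k (w t)) Dw \<and> has_Dy N (mode k (j t)) Dj \<and>
      L2norm_pair lborel Dw Dj \<le> sqrt ?E * 2 ^ N * (L2norm_pair lborel Dw0 Dj0 + (2 / \<nu>) * L2norm lborel D\<theta>0
      + \<bar>?\<kappa> * t\<bar> ^ N * (L2norm_pair lborel (mode k (w 0)) (mode k (j 0)) + (2 / \<nu>) * L2norm lborel (mode k (\<theta> 0))))"
      using \<nu> by simp
    then show "\<exists>Dw Dj. has_Dy N (mode k (w t)) Dw \<and> has_Dy N (mode k (j t)) Dj \<and>
      L2norm_pair lborel Dw Dj \<le> 8 * 2 ^ N * (1 + 16 ^ N * fact N) *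
        exp (- (1/16) * \<nu> powr (13/3) * \<bar>real_of_int k\<bar> powr (2/3) * t) *
        (data_bound \<nu> k (L2norm_pair lborel Dw0 Dj0) (L2norm lborel D\<theta>0)
         + \<nu> powr (-6 * real N) * (\<nu> powr (-1) * \<bar>real_of_int k\<bar>) powr (real N / 3) *
         data_bound \<nu> k (L2norm_pair lborel (mode k (w 0)) (mode k (j 0))) (L2norm lborel (mode k (\<theta> 0))))"
      using order_trans[OF _ system_amplitude[OF \<nu>(1) \<nu>1 k1 less_imp_le[OF t] L2norm_pair_nonneg L2norm_nonneg L2norm_pair_nonneg L2norm_nonneg]]
      by blast
  next
    assume k: "k = 0"
    have eqw: "mode k (dt w s) y = - \<i> * of_real 0 * of_real y * mode k (w s) y
      + of_real \<nu> * (mode k (dy (dy (w s))) y - of_real 0 ^ 2 * mode k (w s) y)" if "s > 0" for s y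
      using eqs(2)[OF that, of y] k by simp
    have eqj: "mode k (dt j s) y = - \<i> * of_real 0 * of_real y * mode k (j s) y
      + of_real \<nu> * (mode k (dy (dy (j s))) y - of_real 0 ^ 2 * mode k (j s) y)" if "s > 0" for s y
      using eqs(3)[OF that] k by auto
    have sdw: "AE \<xi> in lborel. (norm (fourier (mode k (w t)) (\<xi> - 0 * t)))\<^sup>2
        \<le> exp (- (\<nu> * (0\<^sup>2 * t + t * (\<xi> - 0 * t / 2)\<^sup>2 + 0\<^sup>2 * t ^ 3 / 12))) * (norm (fourier (mode k (w 0)) \<xi>))\<^sup>2"
      by (rule scalar_decay[OF cl(1) \<nu>(1) t eqw])
    have sdj: "AE \<xi> in lborel. (norm (fourier (mode k (j t)) (\<xi> - 0 * t)))\<^sup>2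
        \<le> exp (- (\<nu> * (0\<^sup>2 * t + t * (\<xi> - 0 * t / 2)\<^sup>2 + 0\<^sup>2 * t ^ 3 / 12))) * (norm (fourier (mode k (j 0)) \<xi>))\<^sup>2"
      by (rule scalar_decay[OF cl(2) \<nu>(1) t eqj])
    have le: "AE \<xi> in lborel. (norm (fourier (mode k (w t)) (\<xi> - 0)))\<^sup>2 + (norm (fourier (mode k (j t)) (\<xi> - 0)))\<^sup>2
      \<le> 1 * ((norm (fourier (mode k (w 0)) \<xi>))\<^sup>2 + (norm (fourier (mode k (j 0)) \<xi>))\<^sup>2 + 0\<^sup>2 * (norm (fourier (mode k (\<theta> 0)) \<xi>))\<^sup>2)"
      using sdw sdj
    proof eventually_elim
      case (elim \<xi>)
      have "exp (- (\<nu> * (t * \<xi>\<^sup>2))) \<le> 1" using \<nu> t by simp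
      then have "exp (- (\<nu> * (t * \<xi>\<^sup>2))) * (norm (f::complex))\<^sup>2 \<le> (norm f)\<^sup>2" for f by (simp add: mult_left_le_one_le)
      with elim show ?case by (simp add: add_mono order_trans)
    qed
    from pair_decay[OF L D le] show "\<exists>Dw Dj. has_Dy N (mode k (w t)) Dw \<and> has_Dy N (mode k (j t)) Dj \<and>
      L2norm_pair lborel Dw Dj \<le> 2 ^ N * (L2norm_pair lborel Dw0 Dj0 + 0 ^ N * L2norm_pair lborel (mode k (w 0)) (mode k (j 0)))"
      by simp
  }
qed

lemma theta_estimate:
  assumes sol: "solution \<nu> \<mu> \<eta> w j \<theta>" and \<eta>: "0 < \<eta>" and t: "0 < t"
  shows "L2norm lborel (mode k (\<theta> t)) \<le> 4 * exp 3 * L2norm lborel (mode k (\<theta> 0))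
      * exp (- (1/16) * \<eta> powr (1/3) * \<bar>real_of_int k\<bar> powr (2/3) * t)"
    and "\<lbrakk>N > 0; has_Dy N (mode k (\<theta> 0)) D\<theta>0\<rbrakk> \<Longrightarrow> \<exists>D\<theta>. has_Dy N (mode k (\<theta> t)) D\<theta> \<and>
      L2norm lborel D\<theta> \<le> 2 * exp 3 * 2 ^ N * (1 + 2 ^ N * fact N)
        * exp (- (1/16) * \<eta> powr (1/3) * \<bar>real_of_int k\<bar> powr (2/3) * t)
        * (L2norm lborel D\<theta>0 + (\<eta> powr (-1) * \<bar>real_of_int k\<bar>) powr (real N / 3) * L2norm lborel (mode k (\<theta> 0)))"
proof -
  let ?s = "\<eta> powr (1/3) * \<bar>real_of_int k\<bar> powr (2/3) * t"
  let ?y = "exp (- (1/16) * \<eta> powr (1/3) * \<bar>real_of_int k\<bar> powr (2/3) * t)"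
  have s0: "0 \<le> ?s" using t by simp
  \<comment> \<open>Rates 1 and 1/2 are available here; 1/16 is what the pair estimate allows and is
    used throughout so that a single c serves.\<close>
  have y: "exp (- ?s) \<le> ?y" "exp (- ?s / 2) \<le> ?y" 
  proof -
    have e: "- (1/16) * \<eta> powr (1/3) * \<bar>real_of_int k\<bar> powr (2/3) * t = - (?s / 16)" by simp
    show "exp (- ?s) \<le> ?y" "exp (- ?s / 2) \<le> ?y" unfolding e exp_le_cancel_iff using s0 by linarith+
  qed
  have reg: "regular \<theta>" using sol by (simp add: solution_def)
  have L0: "L2 lborel (mode k (\<theta> 0))" using classical_L2[OF classical_mode[OF reg, of k], of 0] by simp
  obtain D where D: "has_Dy 0 (mode k (\<theta> t)) D" and Dle: "L2norm lborel D \<le>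
      2 * exp 3 * 2 ^ 0 * exp (- ?s) * (L2norm lborel (mode k (\<theta> 0)) + \<bar>real_of_int k * t\<bar> ^ 0 * L2norm lborel (mode k (\<theta> 0)))"
    using solution_theta_decay[OF sol \<eta> t has_Dy_0[OF L0]] by blast
  have "L2norm lborel (mode k (\<theta> t)) \<le> 4 * exp 3 * L2norm lborel (mode k (\<theta> 0)) * exp (- ?s)"
    using Dle has_Dy_0_L2norm[OF D] by (simp add: algebra_simps)
  also have "\<dots> \<le> 4 * exp 3 * L2norm lborel (mode k (\<theta> 0)) * ?y" using y(1) by (intro mult_left_mono) auto
  finally show "L2norm lborel (mode k (\<theta> t)) \<le> 4 * exp 3 * L2norm lborel (mode k (\<theta> 0)) * ?y" .
  assume N: "N > 0" and D0: "has_Dy N (mode k (\<theta> 0)) D\<theta>0"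
  let ?Q = "(\<eta> powr (-1) * \<bar>real_of_int k\<bar>) powr (real N / 3)"
  let ?A = "L2norm lborel D\<theta>0" and ?B = "L2norm lborel (mode k (\<theta> 0))"
  obtain D where D: "has_Dy N (mode k (\<theta> t)) D" and Dle: "L2norm lborel D \<le>
      2 * exp 3 * 2 ^ N * exp (- ?s) * (?A + \<bar>real_of_int k * t\<bar> ^ N * ?B)"
    using solution_theta_decay[OF sol \<eta> t D0] by blast
  have e2: "exp (- ?s) = exp (- ?s / 2) * exp (- ?s / 2)" by (simp flip: exp_add)
  have "exp (- ?s) * (?A + \<bar>real_of_int k * t\<bar> ^ N * ?B) =
      exp (- ?s / 2) * (exp (- ?s / 2) * ?A + (\<bar>real_of_int k * t\<bar> ^ N * exp (- ?s / 2)) * ?B)"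
    unfolding e2 by (simp add: algebra_simps)
  also have "\<dots> \<le> ?y * ((1 + 2 ^ N * fact N) * (?A + ?Q * ?B))"
  proof (rule mult_mono[OF y(2)])
    have "exp (- ?s / 2) * ?A \<le> 1 * ?A" using s0 by (intro mult_right_mono) auto
    moreover have "(\<bar>real_of_int k * t\<bar> ^ N * exp (- ?s / 2)) * ?B \<le> (2 ^ N * fact N * ?Q) * ?B"
      using scalar_amplitude(2)[OF \<eta> _ N, of t "real_of_int k"] t by (intro mult_right_mono) auto
    moreover have "0 \<le> 2 ^ N * fact N * ?A + ?Q * ?B" by auto
    moreover have "(1 + 2 ^ N * fact N) * (?A + ?Q * ?B) = 1 * ?A + (2 ^ N * fact N * ?Q) * ?B + (2 ^ N * fact N * ?A + ?Q * ?B)"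
      by (simp add: algebra_simps)
    ultimately show "exp (- ?s / 2) * ?A + (\<bar>real_of_int k * t\<bar> ^ N * exp (- ?s / 2)) * ?B \<le> (1 + 2 ^ N * fact N) * (?A + ?Q * ?B)"
      by linarith
  qed auto
  finally have "2 * exp 3 * 2 ^ N * (exp (- ?s) * (?A + \<bar>real_of_int k * t\<bar> ^ N * ?B)) \<le>
      2 * exp 3 * 2 ^ N * (?y * ((1 + 2 ^ N * fact N) * (?A + ?Q * ?B)))"
    by (intro mult_left_mono) auto
  with Dle have "L2norm lborel D \<le> 2 * exp 3 * 2 ^ N * (1 + 2 ^ N * fact N) * ?y * (?A + ?Q * ?B)"
    by (simp only: mult_ac)
  with D show "\<exists>D\<theta>. has_Dy N (mode k (\<theta> t)) D\<theta> \<and>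
      L2norm lborel D\<theta> \<le> 2 * exp 3 * 2 ^ N * (1 + 2 ^ N * fact N) * ?y * (?A + ?Q * ?B)" by blast
qed

lemma wj_estimate:
  assumes sol: "solution \<nu> \<nu> \<eta> w j \<theta>" and \<nu>: "0 < \<nu>" "\<nu> \<le> \<eta>" "\<eta> \<le> 1" and t: "0 < t"
  shows "L2norm_pair lborel (mode k (w t)) (mode k (j t)) \<le> 32 * data_bound \<nu> k (L2norm_pair lborel (mode k (w 0)) (mode k (j 0))) (L2norm lborel (mode k (\<theta> 0)))
      * exp (- (1/16) * \<nu> powr (13/3) * \<bar>real_of_int k\<bar> powr (2/3) * t)"
    and "\<lbrakk>N > 0; has_Dy N (mode k (w 0)) Dw0; has_Dy N (mode k (j 0)) Dj0; has_Dy N (mode k (\<theta> 0)) D\<theta>0\<rbrakk> \<Longrightarrow>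
      \<exists>Dw Dj. has_Dy N (mode k (w t)) Dw \<and> has_Dy N (mode k (j t)) Dj \<and>
      L2norm_pair lborel Dw Dj \<le> 8 * 2 ^ N * (1 + 16 ^ N * fact N) *
        exp (- (1/16) * \<nu> powr (13/3) * \<bar>real_of_int k\<bar> powr (2/3) * t) *
        (data_bound \<nu> k (L2norm_pair lborel Dw0 Dj0) (L2norm lborel D\<theta>0)
         + \<nu> powr (-6 * real N) * (\<nu> powr (-1) * \<bar>real_of_int k\<bar>) powr (real N / 3) *
         data_bound \<nu> k (L2norm_pair lborel (mode k (w 0)) (mode k (j 0))) (L2norm lborel (mode k (\<theta> 0))))"
proof -
  have reg: "regular w" "regular j" "regular \<theta>" using sol by (simp_all add: solution_def)
  have L0: "L2 lborel (mode k (w 0))" "L2 lborel (mode k (j 0))" "L2 lborel (mode k (\<theta> 0))"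
    using classical_L2[OF classical_mode[OF reg(1), of k], of 0] classical_L2[OF classical_mode[OF reg(2), of k], of 0]
      classical_L2[OF classical_mode[OF reg(3), of k], of 0] by simp_all
  note D0 = has_Dy_0[OF L0(1)] has_Dy_0[OF L0(2)] has_Dy_0[OF L0(3)]
  \<comment> \<open>Inserts the power \<nu>^-2 in the case k = 0, whose bound contains no power of
    \<nu>.\<close>
  have n2: "1 \<le> \<nu> powr (-2)"
  proof -
    have "\<nu> powr 0 \<le> \<nu> powr (-2)" using \<nu> by (intro powr_mono') auto
    then show ?thesis using \<nu> by simp
  qed
  let ?P = "L2norm_pair lborel (mode k (w 0)) (mode k (j 0))"
  let ?y = "exp (- (1/16) * \<nu> powr (13/3) * \<bar>real_of_int k\<bar> powr (2/3) * t)"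
  let ?X = "data_bound \<nu> k ?P (L2norm lborel (mode k (\<theta> 0)))"
  have Pn2: "p \<le> \<nu> powr (-2) * p" if "0 \<le> p" for p using mult_right_mono[OF n2 that] by simp
  have pair0: "L2norm_pair lborel Dw Dj = L2norm_pair lborel (mode k (w t)) (mode k (j t))"
    if "has_Dy 0 (mode k (w t)) Dw" "has_Dy 0 (mode k (j t)) Dj" for Dw Dj
    using has_Dy_0_L2norm[OF that(1)] has_Dy_0_L2norm[OF that(2)] by (simp add: L2norm_pair_def)
  show "L2norm_pair lborel (mode k (w t)) (mode k (j t)) \<le> 32 * ?X * ?y"
  proof (cases "k = 0")
    \<comment> \<open>For k = 0 the exponential is 1 and the \<theta> part of
      \<open>data_bound\<close> is 0, as \<open>0 powr (1/3)\<close> is 0.\<close>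
    case True
    obtain Dw Dj where D: "has_Dy 0 (mode k (w t)) Dw" "has_Dy 0 (mode k (j t)) Dj"
      and le: "L2norm_pair lborel Dw Dj \<le> 2 ^ 0 * (?P + 0 ^ 0 * ?P)"
      using solution_wj_decay(2)[OF sol \<nu> t D0 True] by blast
    have "L2norm_pair lborel (mode k (w t)) (mode k (j t)) \<le> 2 * ?P" using le pair0[OF D] by simp
    also have "\<dots> \<le> 32 * (\<nu> powr (-2) * ?P)" using Pn2[of ?P] L2norm_pair_nonneg[of lborel "mode k (w 0)" "mode k (j 0)"] by linarith
    finally show ?thesis using True by (simp add: data_bound_def)
  next
    case False
    obtain Dw Dj where D: "has_Dy 0 (mode k (w t)) Dw" "has_Dy 0 (mode k (j t)) Dj"
      and le: "L2norm_pair lborel Dw Dj \<le> 8 * 2 ^ 0 * (1 + 16 ^ 0 * fact 0) * ?y *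
        (?X + \<nu> powr (-6 * real 0) * (\<nu> powr (-1) * \<bar>real_of_int k\<bar>) powr (real 0 / 3) * ?X)"
      using solution_wj_decay(1)[OF sol \<nu> t D0 False] by blast
    show ?thesis using le pair0[OF D] False \<nu> by (simp add: algebra_simps)
  qed
  assume N: "N > 0" and D: "has_Dy N (mode k (w 0)) Dw0" "has_Dy N (mode k (j 0)) Dj0" "has_Dy N (mode k (\<theta> 0)) D\<theta>0"
  let ?C = "8 * 2 ^ N * (1 + 16 ^ N * fact N) :: real"
  let ?Z = "data_bound \<nu> k (L2norm_pair lborel Dw0 Dj0) (L2norm lborel D\<theta>0)
         + \<nu> powr (-6 * real N) * (\<nu> powr (-1) * \<bar>real_of_int k\<bar>) powr (real N / 3) * ?X"
  show "\<exists>Dw Dj. has_Dy N (mode k (w t)) Dw \<and> has_Dy N (mode k (j t)) Dj \<and> L2norm_pair lborel Dw Dj \<le> ?C * ?y * ?Z"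
  proof (cases "k = 0")
    case True
    obtain Dw Dj where DD: "has_Dy N (mode k (w t)) Dw" "has_Dy N (mode k (j t)) Dj"
      and le: "L2norm_pair lborel Dw Dj \<le> 2 ^ N * (L2norm_pair lborel Dw0 Dj0 + 0 ^ N * ?P)"
      using solution_wj_decay(2)[OF sol \<nu> t D True] by blast
    \<comment> \<open>Since N > 0, the term with \<open>0 ^ N\<close> disappears; on the right-hand
      side \<open>0 powr (real N / 3)\<close> is 0 as well.\<close>
    have "L2norm_pair lborel Dw Dj \<le> 2 ^ N * L2norm_pair lborel Dw0 Dj0" using le N by (simp add: power_0_left)
    also have "\<dots> \<le> ?C * (\<nu> powr (-2) * L2norm_pair lborel Dw0 Dj0)"
    proof (rule mult_mono)
      have "(2::real) ^ N * 1 \<le> 2 ^ N * (8 * (1 + 16 ^ N * fact N))"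
        by (intro mult_left_mono) (auto simp: add_increasing2)
      then show "(2::real) ^ N \<le> ?C" by (simp add: mult_ac)
    qed (use Pn2 in auto)
    also have "\<dots> = ?C * ?y * ?Z" using True N by (simp add: data_bound_def)
    finally show ?thesis using DD by blast
  next
    case False
    show ?thesis by (rule solution_wj_decay(1)[OF sol \<nu> t D False])
  qed
qed

theorem theorem1p1:
  "(\<exists>c C :: real. c > 0 \<and> C > 0 \<and>
     (\<forall>\<nu> \<mu> \<eta> w j \<theta>.
        0 < \<nu> \<and> \<nu> = \<mu> \<and> \<mu> \<le> \<eta> \<and> \<eta> \<le> 1 \<and> solution \<nu> \<mu> \<eta> w j \<theta> \<longrightarrow>
        (\<forall>(k::int) t. t > 0 \<longrightarrow>
           L2norm lborel (mode k (\<theta> t))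
             \<le> C * L2norm lborel (mode k (\<theta> 0))
                 * exp (- c * \<eta> powr (1/3) * \<bar>real_of_int k\<bar> powr (2/3) * t) \<and>
           L2norm_pair lborel (mode k (w t)) (mode k (j t))
             \<le> C * (\<nu> powr (-2) * L2norm_pair lborel (mode k (w 0)) (mode k (j 0))
                    + \<nu> powr (-6) * (\<nu> powr (-1) * \<bar>real_of_int k\<bar>) powr (1/3)
                        * L2norm lborel (mode k (\<theta> 0)))
                 * exp (- c * \<nu> powr (13/3) * \<bar>real_of_int k\<bar> powr (2/3) * t)))) \<and>
   (\<forall>N::nat. N > 0 \<longrightarrow>
     (\<exists>c C :: real. c > 0 \<and> C > 0 \<and>
       (\<forall>\<nu> \<mu> \<eta> w j \<theta>.
          0 < \<nu> \<and> \<nu> = \<mu> \<and> \<mu> \<le> \<eta> \<and> \<eta> \<le> 1 \<and> solution \<nu> \<mu> \<eta> w j \<theta> \<longrightarrow>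
          (\<forall>(k::int) t. t > 0 \<longrightarrow>
             (\<forall>D\<theta>0. has_Dy N (mode k (\<theta> 0)) D\<theta>0 \<longrightarrow>
                (\<exists>D\<theta>. has_Dy N (mode k (\<theta> t)) D\<theta> \<and>
                   L2norm lborel D\<theta>
                     \<le> C * exp (- c * \<eta> powr (1/3) * \<bar>real_of_int k\<bar> powr (2/3) * t)
                         * (L2norm lborel D\<theta>0
                            + (\<eta> powr (-1) * \<bar>real_of_int k\<bar>) powr (real N / 3)
                                * L2norm lborel (mode k (\<theta> 0))))) \<and>
             (\<forall>Dw0 Dj0 D\<theta>0.
                has_Dy N (mode k (w 0)) Dw0 \<and> has_Dy N (mode k (j 0)) Dj0 \<and>
                has_Dy N (mode k (\<theta> 0)) D\<theta>0 \<longrightarrow>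
                (\<exists>Dw Dj. has_Dy N (mode k (w t)) Dw \<and> has_Dy N (mode k (j t)) Dj \<and>
                   L2norm_pair lborel Dw Dj
                     \<le> C * exp (- c * \<nu> powr (13/3) * \<bar>real_of_int k\<bar> powr (2/3) * t)
                         * (\<nu> powr (-2) * L2norm_pair lborel Dw0 Dj0
                            + \<nu> powr (-6) * (\<nu> powr (-1) * \<bar>real_of_int k\<bar>) powr (1/3)
                                * L2norm lborel D\<theta>0
                            + \<nu> powr (-6 * real N)
                                * (\<nu> powr (-1) * \<bar>real_of_int k\<bar>) powr (real N / 3)
                                * (\<nu> powr (-2)
                                     * L2norm_pair lborel (mode k (w 0)) (mode k (j 0))
                                   + \<nu> powr (-6) * (\<nu> powr (-1) * \<bar>real_of_int k\<bar>) powr (1/3)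
                                       * L2norm lborel (mode k (\<theta> 0))))))))))"
proof (intro conjI allI impI, goal_cases)
  case 1
  show ?case
  \<comment> \<open>One C serves both inequalities: the sum of the constants of
    \<open>theta_estimate\<close> and \<open>wj_estimate\<close>.\<close>
  proof (rule exI[of _ "1/16"], rule exI[of _ "4 * exp 3 + 32"], intro conjI allI impI, goal_cases)
    case 2
    show ?case by (simp add: add_pos_pos)
  next
    case (3 \<nu> \<mu> \<eta> w j \<theta> k t)
    then have "solution \<nu> \<nu> \<eta> w j \<theta>" "0 < \<eta>" by auto
    from theta_estimate(1)[OF this 3(2)] show ?case
      by (rule order_trans, intro mult_right_mono) auto
  next
    case (4 \<nu> \<mu> \<eta> w j \<theta> k t)
    then have "solution \<nu> \<nu> \<eta> w j \<theta>" "0 < \<nu>" "\<nu> \<le> \<eta>" "\<eta> \<le> 1" by auto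
    from wj_estimate(1)[OF this 4(2), of k] show ?case
      unfolding data_bound_def
      by (rule order_trans, intro mult_right_mono) (auto intro!: add_nonneg_nonneg)
  qed simp
next
  case (2 N)
  let ?C1 = "2 * exp 3 * 2 ^ N * (1 + 2 ^ N * fact N) :: real"
  let ?C2 = "8 * 2 ^ N * (1 + 16 ^ N * fact N) :: real"
  have C: "0 < ?C1" "0 < ?C2" by (auto intro!: mult_pos_pos add_pos_nonneg)
  \<comment> \<open>Both estimates are again raised to the sum of their constants; nonnegativity of
    the exponential and of the data makes this monotone.\<close>
  have enlarge: "c * e * z \<le> (?C1 + ?C2) * e * z" if "c \<le> ?C1 + ?C2" "0 \<le> e" "0 \<le> z" for c e z
    using that by (intro mult_right_mono)
  show ?case
  proof (rule exI[of _ "1/16"], rule exI[of _ "?C1 + ?C2"], intro conjI allI impI, goal_cases)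
    case 2
    show ?case using C by linarith
  next
    case (3 \<nu> \<mu> \<eta> w j \<theta> k t D\<theta>0)
    then have "solution \<nu> \<nu> \<eta> w j \<theta>" "0 < \<eta>" by auto
    from theta_estimate(2)[OF this 3(2) \<open>N > 0\<close> 3(3)]
    obtain D\<theta> where D\<theta>: "has_Dy N (mode k (\<theta> t)) D\<theta>" "L2norm lborel D\<theta> \<le> ?C1
      * exp (- (1/16) * \<eta> powr (1/3) * \<bar>real_of_int k\<bar> powr (2/3) * t)
      * (L2norm lborel D\<theta>0 + (\<eta> powr (-1) * \<bar>real_of_int k\<bar>) powr (real N / 3) * L2norm lborel (mode k (\<theta> 0)))"
      by blast
    show ?case
      by (intro exI conjI, rule D\<theta>(1), rule order_trans[OF D\<theta>(2) enlarge])
        (use C in \<open>auto intro!: add_nonneg_nonneg\<close>)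
  next
    case (4 \<nu> \<mu> \<eta> w j \<theta> k t Dw0 Dj0 D\<theta>0)
    then have "solution \<nu> \<nu> \<eta> w j \<theta>" "0 < \<nu>" "\<nu> \<le> \<eta>" "\<eta> \<le> 1" by auto
    note E = wj_estimate(2)[OF this 4(2) \<open>N > 0\<close>, unfolded data_bound_def]
    have "\<exists>Dw Dj. has_Dy N (mode k (w t)) Dw \<and> has_Dy N (mode k (j t)) Dj \<and> L2norm_pair lborel Dw Dj \<le> ?C2 * e * z
        \<Longrightarrow> 0 \<le> e \<Longrightarrow> 0 \<le> z \<Longrightarrow>
        \<exists>Dw Dj. has_Dy N (mode k (w t)) Dw \<and> has_Dy N (mode k (j t)) Dj \<and> L2norm_pair lborel Dw Dj \<le> (?C1 + ?C2) * e * z" for e z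
      using order_trans[OF _ enlarge[of ?C2 e z]] C by (meson less_imp_le le_add_same_cancel2)
    from this[OF E] 4(3) show ?case
      by (auto intro!: add_nonneg_nonneg mult_nonneg_nonneg)
  qed simp
qed

end
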